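(* Let $K>0$ be an upper bound for $\tilde\phi$. Consider the following algorithm. 1. Simulate a Poisson point process with unit density on $[0,T]\times[0,K]$, giving a random number $N$ of points $(t_1,z_1),\dots,(t_N,z_N)$, indexed so that $t_1<\dots<t_N$. 2. Given these points, simulate a skeleton $(\omega_{t_1},\dots,\omega_{t_N},\omega_T)$ from the law with density $$h_\theta(y)\prod_{i=0}^{N-1}q^{\theta}(t_{i+1}-t_i,\;T-t_i,\;y_i,\;y,\;y_{i+1})\quad\text{with respect to } dy_1\cdots dy_N\,dy,\qquad t_0=0,\ y_0=x,$$ where $y_i$ corresponds to $\omega_{t_i}$ and $y$ to $\omega_T$ (if $N=0$ the density is $h_\theta(y)$). 3. If $\tilde\phi(\omega_{t_i})\le z_i$ for all $i\in\{1,\dots,N\}$, accept the skeleton; otherwise return to step 1 with fresh independent randomness. Then the final instance $\omega_T$ of the accepted skeleton is an exact sample of $X_T$ under $\mathbb{P}$, i.e. its law is the law of $X_T$, where $X$ is the solution of $dX_t=dW_t+\bar b(X_t)\,dt$, $X_0=x$, with $W$ a Brownian motion under $\mathbb{P}$.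
   Context: Fix $0<T<\infty$ and $x\in\mathbb{R}$. Assumptions on $\bar b$: $\bar{b}:\mathbb{R}\to\mathbb{R}$ is bounded, differentiable with bounded first derivative on $(0,\infty)$ and on $(-\infty,0)$, possibly discontinuous at $0$; the limits $\bar b(0+)$ and $\bar b(0-)$ exist and are finite; the value $\bar b(0)$ is arbitrary. Set $\theta=\frac{\bar b(0+)-\bar b(0-)}{2}$, $B(y)=\int_0^y\bar b(z)\,dz$, $\phi(y)=\frac{\bar b^2(y)+\bar b'(y)}{2}$ for $y\ne0$, and $\tilde\phi(y)=\phi(y)-\inf_{z\neq 0}\phi(z)$ for $y\neq0$; the value at $0$ is immaterial and we set $\tilde\phi(0)=0$. Let $p^{0,0}(t,a,b)=\frac{1}{\sqrt{2\pi t}}e^{-(b-a)^2/(2t)}$ be the Brownian transition density, and for $0<t<T'$ let $$q^{0,0}(t,T',a,b,y)=\frac{p^{0,0}(t,a,y)\,p^{0,0}(T'-t,y,b)}{p^{0,0}(T',a,b)}$$ be the density in $y$, at time $t$, of the Brownian bridge from $a$ to $b$ over $[0,T']$. Let $N^c(u)=\frac1{\sqrt{2\pi}}\int_u^\infty e^{-z^2/2}\,dz$ and, for $t>0$ and $a,b\in\mathbb{R}$, $$v^\theta(t,a,b)=\big(1-e^{-2ab/t}\big)\mathbf{1}_{ab>0}+e^{-\frac{2ab}{t}\mathbf{1}_{ab>0}}\Big[1-\theta\sqrt{2\pi t}\,\exp\Big\{\tfrac{(|a|+|b|+t\theta)^2}{2t}\Big\}N^c\Big(\tfrac{\theta t+|a|+|b|}{\sqrt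 t}\Big)\Big].$$ Then $h_\theta$ is the probability density on $\mathbb{R}$ proportional to $$y\mapsto \exp\big(B(y)-B(x)\big)\,v^\theta(T,x,y)\,p^{0,0}(T,x,y),$$ and, for $0<t<T'$ and $a,b\in\mathbb{R}$, $y\mapsto q^\theta(t,T',a,b,y)$ is the probability density on $\mathbb{R}$ proportional to $$y\mapsto v^\theta(t,a,y)\,v^\theta(T'-t,y,b)\,q^{0,0}(t,T',a,b,y).$$ *)

theory Defs
  imports "HOL-Probability.Probability"
begin

section \<open>The drift and the functions derived from it\<close>

definition admissible_drift :: "(real \<Rightarrow> real) \<Rightarrow> bool" where
  "admissible_drift b \<longleftrightarrow>
     bounded (range b) \<and>
     (\<forall>y. y \<noteq> 0 \<longrightarrow> b differentiable (at y)) \<and>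
     bounded (deriv b ` {0<..}) \<and> bounded (deriv b ` {..<0}) \<and>
     (\<exists>l. (b \<longlongrightarrow> l) (at_right 0)) \<and>
     (\<exists>l. (b \<longlongrightarrow> l) (at_left 0))"

definition half_jump :: "(real \<Rightarrow> real) \<Rightarrow> real" where
  "half_jump b = (Lim (at_right 0) b - Lim (at_left 0) b) / 2"

text \<open>The interval integral is signed, so this is also the intended value for negative \<open>y\<close>.\<close>
definition drift_primitive :: "(real \<Rightarrow> real) \<Rightarrow> real \<Rightarrow> real" where
  "drift_primitive b y = (LBINT u=0..ereal y. b u)"

definition phi :: "(real \<Rightarrow> real) \<Rightarrow> real \<Rightarrow> real" where
  "phi b y = ((b y)\<^sup>2 + deriv b y) / 2"

definition phi_tilde :: "(real \<Rightarrow> real) \<Rightarrow> real \<Rightarrow> real" where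
  "phi_tilde b y = (if y = 0 then 0 else phi b y - (INF u\<in>-{0}. phi b u))"


section \<open>Transition and bridge densities\<close>

text \<open>The second parameter of \<^const>\<open>normal_density\<close> is the standard deviation.\<close>
definition p00 :: "real \<Rightarrow> real \<Rightarrow> real \<Rightarrow> real" where
  "p00 t a c = normal_density a (sqrt t) c"

definition q00 :: "real \<Rightarrow> real \<Rightarrow> real \<Rightarrow> real \<Rightarrow> real \<Rightarrow> real" where
  "q00 t T' a c y = p00 t a y * p00 (T' - t) y c / p00 T' a c"

definition normal_tail :: "real \<Rightarrow> real" where
  "normal_tail u = (LINT s:{u..}|lborel. std_normal_density s)"

definition v_theta :: "real \<Rightarrow> real \<Rightarrow> real \<Rightarrow> real \<Rightarrow> real" where
  "v_theta \<theta> t a c =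
     (1 - exp (- 2 * a * c / t)) * of_bool (a * c > 0) +
     exp (- (2 * a * c / t) * of_bool (a * c > 0)) *
       (1 - \<theta> * sqrt (2 * pi * t) * exp ((\<bar>a\<bar> + \<bar>c\<bar> + t * \<theta>)\<^sup>2 / (2 * t)) *
              normal_tail ((\<theta> * t + \<bar>a\<bar> + \<bar>c\<bar>) / sqrt t))"

definition normalised :: "(real \<Rightarrow> real) \<Rightarrow> real \<Rightarrow> real" where
  "normalised g y = g y / (\<integral>u. g u \<partial>lborel)"

definition h_theta :: "(real \<Rightarrow> real) \<Rightarrow> real \<Rightarrow> real \<Rightarrow> real \<Rightarrow> real" where
  "h_theta b x T =
     normalised (\<lambda>y. exp (drift_primitive b y - drift_primitive b x) *
                     v_theta (half_jump b) T x y * p00 T x y)"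

definition q_theta :: "real \<Rightarrow> real \<Rightarrow> real \<Rightarrow> real \<Rightarrow> real \<Rightarrow> real \<Rightarrow> real" where
  "q_theta \<theta> t T' a c =
     normalised (\<lambda>y. v_theta \<theta> t a y * v_theta \<theta> (T' - t) y c * q00 t T' a c y)"


section \<open>The skeleton law\<close>

text \<open>
  Times and positions are indexed by \<open>1..n\<close>; the updates at index \<open>0\<close> put in \<open>t\<^sub>0 = 0\<close> and
  \<open>y\<^sub>0 = x\<close>. The last argument is the position at time \<open>T\<close>.
\<close>
definition skeleton_density ::
  "(real \<Rightarrow> real) \<Rightarrow> real \<Rightarrow> real \<Rightarrow> nat \<Rightarrow> (nat \<Rightarrow> real) \<Rightarrow> (nat \<Rightarrow> real) \<Rightarrow> real \<Rightarrow> real" where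
  "skeleton_density b x T n ts ys y =
     (let s = ts(0 := 0); w = ys(0 := x) in
        h_theta b x T y *
        (\<Prod>i<n. q_theta (half_jump b) (s (Suc i) - s i) (T - s i) (w i) y (w (Suc i))))"

definition skeleton_law ::
  "(real \<Rightarrow> real) \<Rightarrow> real \<Rightarrow> real \<Rightarrow> nat \<Rightarrow> (nat \<Rightarrow> real) \<Rightarrow> ((nat \<Rightarrow> real) \<times> real) measure" where
  "skeleton_law b x T n ts =
     density ((\<Pi>\<^sub>M i\<in>{1..n}. lborel) \<Otimes>\<^sub>M lborel)
       (\<lambda>(ys, y). ennreal (skeleton_density b x T n ts ys y))"


section \<open>Poisson point processes\<close>

text \<open>
  Point processes with a finite diffuse intensity \<open>\<mu>\<close>, so that a configuration is a finite set.
  The Poisson weights are written out, since \<^const>\<open>poisson_pmf\<close> excludes the rate \<open>0\<close> that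
  arises for null sets.
\<close>
definition poisson_point_process :: "'a measure \<Rightarrow> 'b measure \<Rightarrow> ('a \<Rightarrow> 'b set) \<Rightarrow> bool" where
  "poisson_point_process M \<mu> \<eta> \<longleftrightarrow>
     prob_space M \<and>
     (\<forall>\<omega>\<in>space M. finite (\<eta> \<omega>) \<and> \<eta> \<omega> \<subseteq> space \<mu>) \<and>
     (\<forall>A\<in>sets \<mu>.
        (\<lambda>\<omega>. card (\<eta> \<omega> \<inter> A)) \<in> measurable M (count_space UNIV) \<and>
        (\<forall>k. measure M {\<omega> \<in> space M. card (\<eta> \<omega> \<inter> A) = k} =
               measure \<mu> A ^ k / fact k * exp (- measure \<mu> A))) \<and>
     (\<forall>A :: nat \<Rightarrow> 'b set. range A \<subseteq> sets \<mu> \<and> disjoint_family A \<longrightarrow>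
        prob_space.indep_vars M (\<lambda>_. count_space UNIV) (\<lambda>j \<omega>. card (\<eta> \<omega> \<inter> A j)) UNIV)"


section \<open>The algorithm\<close>

text \<open>
  One round produces the number \<open>N\<close> of points, the points \<open>(t i, z i)\<close> and the skeleton values
  \<open>Y i\<close> for \<open>1 \<le> i \<le> N\<close>, and the final value \<open>E\<close> at time \<open>T\<close>. The variables \<open>t i\<close>, \<open>z i\<close>, \<open>Y i\<close>
  with \<open>i\<close> outside \<open>{1..N}\<close> have no meaning and are masked by \<open>0\<close> below.
\<close>
definition round_data ::
  "('a \<Rightarrow> nat) \<Rightarrow> (nat \<Rightarrow> 'a \<Rightarrow> real) \<Rightarrow> (nat \<Rightarrow> 'a \<Rightarrow> real) \<Rightarrow> (nat \<Rightarrow> 'a \<Rightarrow> real) \<Rightarrow> ('a \<Rightarrow> real) \<Rightarrow>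
   'a \<Rightarrow> nat \<times> (nat \<Rightarrow> real \<times> real \<times> real) \<times> real" where
  "round_data N t z Y E \<omega> =
     (N \<omega>, (\<lambda>i. if i \<in> {1..N \<omega>} then (t i \<omega>, z i \<omega>, Y i \<omega>) else 0), E \<omega>)"

definition round_space :: "(nat \<times> (nat \<Rightarrow> real \<times> real \<times> real) \<times> real) measure" where
  "round_space = count_space UNIV \<Otimes>\<^sub>M ((\<Pi>\<^sub>M i\<in>UNIV. borel) \<Otimes>\<^sub>M borel)"

text \<open>
  The last clause says that \<open>skeleton_law\<close> is the conditional law of the skeleton given the points.
\<close>
definition sampling_round ::
  "'a measure \<Rightarrow> (real \<Rightarrow> real) \<Rightarrow> real \<Rightarrow> real \<Rightarrow> real \<Rightarrow>
   ('a \<Rightarrow> nat) \<Rightarrow> (nat \<Rightarrow> 'a \<Rightarrow> real) \<Rightarrow> (nat \<Rightarrow> 'a \<Rightarrow> real) \<Rightarrow> (nat \<Rightarrow> 'a \<Rightarrow> real) \<Rightarrow> ('a \<Rightarrow> real) \<Rightarrow> bool" where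
  "sampling_round M b x T K N t z Y E \<longleftrightarrow>
     round_data N t z Y E \<in> measurable M round_space \<and>
     poisson_point_process M (restrict_space lborel ({0..T} \<times> {0..K}))
       (\<lambda>\<omega>. (\<lambda>i. (t i \<omega>, z i \<omega>)) ` {1..N \<omega>}) \<and>
     (AE \<omega> in M. strict_mono_on {1..N \<omega>} (\<lambda>i. t i \<omega>)) \<and>
     (\<forall>n. \<forall>A \<in> sets (\<Pi>\<^sub>M i\<in>{1..n}. borel). \<forall>C \<in> sets ((\<Pi>\<^sub>M i\<in>{1..n}. borel) \<Otimes>\<^sub>M borel).
        emeasure M {\<omega> \<in> space M. N \<omega> = n \<and> (\<lambda>i\<in>{1..n}. (t i \<omega>, z i \<omega>)) \<in> A \<and>
                                 ((\<lambda>i\<in>{1..n}. Y i \<omega>), E \<omega>) \<in> C} =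
        (\<integral>\<^sup>+\<omega>. emeasure (skeleton_law b x T n (\<lambda>i. t i \<omega>)) C *
              indicator {\<omega> \<in> space M. N \<omega> = n \<and> (\<lambda>i\<in>{1..n}. (t i \<omega>, z i \<omega>)) \<in> A} \<omega> \<partial>M))"

text \<open>
  The rounds are numbered \<open>k = 0, 1, \<dots>\<close> and continued as an independent sequence beyond the
  first acceptance, which does not affect the output.
\<close>
definition rejection_rounds ::
  "'a measure \<Rightarrow> (real \<Rightarrow> real) \<Rightarrow> real \<Rightarrow> real \<Rightarrow> real \<Rightarrow>
   (nat \<Rightarrow> 'a \<Rightarrow> nat) \<Rightarrow> (nat \<Rightarrow> nat \<Rightarrow> 'a \<Rightarrow> real) \<Rightarrow> (nat \<Rightarrow> nat \<Rightarrow> 'a \<Rightarrow> real) \<Rightarrow>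
   (nat \<Rightarrow> nat \<Rightarrow> 'a \<Rightarrow> real) \<Rightarrow> (nat \<Rightarrow> 'a \<Rightarrow> real) \<Rightarrow> bool" where
  "rejection_rounds M b x T K N t z Y E \<longleftrightarrow>
     prob_space M \<and>
     (\<forall>k. sampling_round M b x T K (N k) (t k) (z k) (Y k) (E k)) \<and>
     prob_space.indep_vars M (\<lambda>_. round_space) (\<lambda>k. round_data (N k) (t k) (z k) (Y k) (E k)) UNIV"

definition accepted ::
  "(real \<Rightarrow> real) \<Rightarrow> (nat \<Rightarrow> 'a \<Rightarrow> nat) \<Rightarrow> (nat \<Rightarrow> nat \<Rightarrow> 'a \<Rightarrow> real) \<Rightarrow> (nat \<Rightarrow> nat \<Rightarrow> 'a \<Rightarrow> real) \<Rightarrow>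
   'a \<Rightarrow> nat \<Rightarrow> bool" where
  "accepted b N z Y \<omega> k \<longleftrightarrow> (\<forall>i\<in>{1..N k \<omega>}. phi_tilde b (Y k i \<omega>) \<le> z k i \<omega>)"

definition algorithm_output ::
  "(real \<Rightarrow> real) \<Rightarrow> (nat \<Rightarrow> 'a \<Rightarrow> nat) \<Rightarrow> (nat \<Rightarrow> nat \<Rightarrow> 'a \<Rightarrow> real) \<Rightarrow> (nat \<Rightarrow> nat \<Rightarrow> 'a \<Rightarrow> real) \<Rightarrow>
   (nat \<Rightarrow> 'a \<Rightarrow> real) \<Rightarrow> 'a \<Rightarrow> real" where
  "algorithm_output b N z Y E \<omega> = E (LEAST k. accepted b N z Y \<omega> k) \<omega>"


section \<open>Brownian motion and the stochastic differential equation\<close>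

definition brownian_motion ::
  "'a measure \<Rightarrow> (real \<Rightarrow> 'a measure) \<Rightarrow> real \<Rightarrow> (real \<Rightarrow> 'a \<Rightarrow> real) \<Rightarrow> bool" where
  "brownian_motion P F T W \<longleftrightarrow>
     prob_space P \<and> filtration (space P) F \<and>
     (\<forall>t\<in>{0..T}. subalgebra P (F t) \<and> W t \<in> borel_measurable (F t)) \<and>
     (AE \<omega> in P. W 0 \<omega> = 0) \<and>
     (AE \<omega> in P. continuous_on {0..T} (\<lambda>t. W t \<omega>)) \<and>
     (\<forall>s t. 0 \<le> s \<and> s < t \<and> t \<le> T \<longrightarrow>
        distributed P lborel (\<lambda>\<omega>. W t \<omega> - W s \<omega>) (normal_density 0 (sqrt (t - s))) \<and>
        prob_space.indep_set P
          (sets (vimage_algebra (space P) (\<lambda>\<omega>. W t \<omega> - W s \<omega>) borel)) (sets (F s)))"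

text \<open>
  The noise is additive, so \<open>dX = dW + b(X) dt\<close> in integrated form involves no stochastic integral.
  The filtration may be larger than the one generated by \<open>W\<close>.
\<close>
definition sde_solution ::
  "'a measure \<Rightarrow> (real \<Rightarrow> 'a measure) \<Rightarrow> real \<Rightarrow> (real \<Rightarrow> real) \<Rightarrow> real \<Rightarrow>
   (real \<Rightarrow> 'a \<Rightarrow> real) \<Rightarrow> (real \<Rightarrow> 'a \<Rightarrow> real) \<Rightarrow> bool" where
  "sde_solution P F T b x W X \<longleftrightarrow>
     brownian_motion P F T W \<and>
     (\<forall>t\<in>{0..T}. X t \<in> borel_measurable (F t)) \<and>
     (AE \<omega> in P. continuous_on {0..T} (\<lambda>t. X t \<omega>)) \<and>
     (AE \<omega> in P. \<forall>t\<in>{0..T}. X t \<omega> = x + W t \<omega> + (LINT s:{0..t}|lborel. b (X s \<omega>)))"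

end

(* Put p_s(a, y) = v^theta(s, a, y) p^{0,0}(s, a, y), the kernel of Brownian motion with a delta potential of strength
   theta at 0; it satisfies the Chapman--Kolmogorov equation. The function exp(-B(y)) p_s(y, d) is continuously
   differentiable at 0, because the kink of B cancels that of the kernel, so a Dynkin identity without local time applies
   to exp(-B(X_s)) p_{t-s}(X_s, d). It shows that the law of X_t weighted by exp(c t + B(x) - B) solves the Duhamel
   equation with potential V = K - phi_tilde, where c = K + inf phi. Iterating the equation gives
   law(X_T) = sum_n exp(B(y) - B(x) - c T) R_n(T, y) dy.
   On the other side, Chapman--Kolmogorov yields all normalising constants, the bridge factors telescope, and the
   skeleton density becomes exp(B(y) - B(x)) times a product of kernels p. Integrating out the marks z_i over
   [phi_tilde(y_i), K] produces the factors V(y_i), so on {N = n} and acceptance the end point has density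
   exp(B(y) - B(x)) R_n(T, y) up to a constant that does not depend on n. Independence of the rounds then gives a
   geometric series. *)
theory Submission
  imports Defs
begin

text \<open>The solution is known only through \<open>X = x + W + (time integral of b(X))\<close>,
  and \<open>b\<close> jumps. Since the noise is additive, no stochastic integral is needed for
  Dynkin's formula: a Taylor expansion over a short step, combined with independence of the Brownian
  increment, leaves an error of order h^(3/2), and a function with increments that small is
  constant. The test functions have a second derivative that jumps at 0; smoothing them works
  because the expected time spent at 0 is zero. All kernel identities come from one representation:
  the correction to the Gaussian density is -\<theta> times the integral of \<open>exp (- (\<theta>
  * l)) * gauss t (\<bar>a\<bar> + \<bar>c\<bar> + l)\<close> over \<open>l \<ge> 0\<close>, where
  \<open>l\<close> plays the role of the local time at 0. Since \<open>B\<close> may grow linearly,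
  the weighted laws are handled as finite measures only after damping by
  \<open>exp (- (M * \<bar>y\<bar>))\<close>; integrals against the kernel still determine them. The
  Poisson hypothesis speaks of counts in sets, while the skeleton needs the points in order of time.
  Boxes whose time ranges follow one another translate between the two.\<close>

definition gauss :: "real \<Rightarrow> real \<Rightarrow> real" where
  "gauss t m = exp (- (m\<^sup>2 / (2 * t))) / sqrt (2 * pi * t)"

text \<open>Closed form of the integral of \<open>exp (- (\<theta> * l)) * gauss t (l + m)\<close>
  over \<open>l \<ge> 0\<close> (\<open>nn_integral_tail\<close>), a Gaussian tail tilted by
  \<theta>. Times -\<theta>, at \<open>m = \<bar>a\<bar> + \<bar>c\<bar>\<close>, it is the
  correction that turns the Gaussian density into \<open>ker\<close>
  (\<open>ker_eq\<close>).\<close>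

definition tail :: "real \<Rightarrow> real \<Rightarrow> real \<Rightarrow> real" where
  "tail \<theta> t m = exp (\<theta> * m + \<theta>\<^sup>2 * t / 2) * normal_tail ((m + \<theta> * t) / sqrt t)"

definition ker :: "real \<Rightarrow> real \<Rightarrow> real \<Rightarrow> real \<Rightarrow> real" where
  "ker \<theta> t a c = v_theta \<theta> t a c * p00 t a c"

section \<open>The Gaussian density, its convolution and its derivatives\<close>

lemma normal_density_gauss: "0 < t \<Longrightarrow> normal_density a (sqrt t) c = gauss t (c - a)"
  by (simp add: normal_density_def gauss_def)

lemma p00_gauss: "0 < t \<Longrightarrow> p00 t a c = gauss t (c - a)"
  by (simp add: p00_def normal_density_gauss)

lemma gauss_pos: "0 < t \<Longrightarrow> 0 < gauss t m"
  by (simp add: gauss_def)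

lemma gauss_nonneg [simp]: "0 < t \<Longrightarrow> 0 \<le> gauss t m"
  using gauss_pos[of t m] by simp

lemma gauss_minus [simp]: "gauss t (- m) = gauss t m"
  by (simp add: gauss_def)

lemma gauss_abs [simp]: "gauss t \<bar>m\<bar> = gauss t m"
  by (simp add: gauss_def)

lemma gauss_diff_commute: "gauss t (a - c) = gauss t (c - a)"
  using gauss_minus[of t "a - c"] by simp

lemma borel_measurable_gauss [measurable]:
  assumes [measurable]: "f \<in> borel_measurable M" "g \<in> borel_measurable M"
  shows "(\<lambda>x. gauss (f x) (g x)) \<in> borel_measurable M"
  unfolding gauss_def by measurable

lemma integrable_gauss: "0 < t \<Longrightarrow> integrable lborel (\<lambda>y. gauss t (y - a))"
  using integrable_normal_density[of "sqrt t" a]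
  by (subst Bochner_Integration.integrable_cong[where g="normal_density a (sqrt t)"]) (auto simp: normal_density_gauss)

lemma integral_gauss: "0 < t \<Longrightarrow> (\<integral>y. gauss t (y - a) \<partial>lborel) = 1"
  using integral_normal_density[of "sqrt t" a] by (simp add: normal_density_gauss)

lemma gauss_mono: "0 < t \<Longrightarrow> \<bar>m'\<bar> \<le> \<bar>m\<bar> \<Longrightarrow> gauss t m \<le> gauss t m'"
  by (auto simp: gauss_def intro!: divide_right_mono abs_le_square_iff[THEN iffD1])

lemma gauss_convolution:
  assumes "0 < s" "0 < t"
  shows "(\<integral>\<^sup>+y. ennreal (gauss s (y - a)) * ennreal (gauss t (c - y)) \<partial>lborel) = ennreal (gauss (s + t) (c - a))"
proof -
  have "(\<integral>\<^sup>+y. ennreal (gauss s (y - a)) * ennreal (gauss t (c - y)) \<partial>lborel)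
     = (\<integral>\<^sup>+y. ennreal (gauss s y) * ennreal (gauss t ((c - a) - y)) \<partial>lborel)"
    by (subst nn_integral_real_affine[where c=1 and t=a]) (auto simp: algebra_simps)
  also have "\<dots> = (\<integral>\<^sup>+y. ennreal (normal_density 0 (sqrt t) ((c - a) - y) * normal_density 0 (sqrt s) y) \<partial>lborel)"
    using assms by (intro nn_integral_cong) (simp add: normal_density_gauss ennreal_mult mult.commute)
  also have "\<dots> = ennreal (normal_density 0 (sqrt ((sqrt t)\<^sup>2 + (sqrt s)\<^sup>2)) (c - a))"
    using conv_normal_density_zero_mean[of "sqrt t" "sqrt s"] assms by (simp add: fun_eq_iff)
  also have "\<dots> = ennreal (gauss (s + t) (c - a))"
    using assms by (simp add: normal_density_gauss add.commute)
  finally show ?thesis .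
qed

lemma gauss_integrable_mult:
  assumes "0 < s" "0 < t"
  shows "integrable lborel (\<lambda>y. gauss s (y - a) * gauss t (c - y))"
    and "(\<integral>y. gauss s (y - a) * gauss t (c - y) \<partial>lborel) = gauss (s + t) (c - a)"
proof -
  have "(\<integral>\<^sup>+y. ennreal (gauss s (y - a) * gauss t (c - y)) \<partial>lborel) = ennreal (gauss (s + t) (c - a))"
    using gauss_convolution[OF assms, of a c] assms by (simp add: ennreal_mult)
  then have "has_bochner_integral lborel (\<lambda>y. gauss s (y - a) * gauss t (c - y)) (gauss (s + t) (c - a))"
    using assms by (intro has_bochner_integral_nn_integral) auto
  then show "integrable lborel (\<lambda>y. gauss s (y - a) * gauss t (c - y))"
    and "(\<integral>y. gauss s (y - a) * gauss t (c - y) \<partial>lborel) = gauss (s + t) (c - a)"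
    by (auto simp: has_bochner_integral_iff)
qed

lemma DERIV_gauss_space [derivative_intros]:
  "0 < t \<Longrightarrow> (f has_real_derivative f') (at x within S) \<Longrightarrow>
   ((\<lambda>x. gauss t (f x)) has_real_derivative - (f x / t) * gauss t (f x) * f') (at x within S)"
  unfolding gauss_def by (auto intro!: derivative_eq_intros simp: field_simps)

lemma DERIV_gauss_time:
  assumes "0 < t"
  shows "((\<lambda>t. gauss t m) has_real_derivative ((m\<^sup>2 / t\<^sup>2 - 1 / t) / 2 * gauss t m)) (at t)"
proof -
  \<comment> \<open>\<open>E\<close>, \<open>r\<close> and \<open>p\<close> stand for the
    exponential, \<open>sqrt (2 * pi * t)\<close> and \<open>pi\<close>. The left side has the shape
    that the derivative rules produce, and \<open>r * r = 2 * p * t\<close> is all that is used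
    about the root.\<close>
  have alg: "(E * m\<^sup>2 * r / (2 * (t * t)) - E * (inverse r * p)) / (2 * p * t) = (m\<^sup>2 / t\<^sup>2 - 1 / t) * E / (2 * r)"
    if "r > 0" "p > 0" "r * r = 2 * p * t" for E r p :: real
  proof -
    have 1: "r / (2 * p * t) = 1 / r" using that assms by (simp add: field_simps)
    have 2: "inverse r * p / (2 * p * t) = 1 / (2 * t * r)" using that assms by (simp add: field_simps)
    have "(E * m\<^sup>2 * r / (2 * (t * t)) - E * (inverse r * p)) / (2 * p * t)
       = E * m\<^sup>2 / (2 * (t * t)) * (r / (2 * p * t)) - E * (inverse r * p / (2 * p * t))"
      by (simp add: diff_divide_distrib)
    also have "\<dots> = (m\<^sup>2 / t\<^sup>2 - 1 / t) * E / (2 * r)"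
      unfolding 1 2 using that assms by (simp add: field_simps power2_eq_square)
    finally show ?thesis .
  qed
  show ?thesis
    unfolding gauss_def using assms
    apply (auto intro!: derivative_eq_intros)
    subgoal by (simp add: mult_less_0_iff)
    subgoal by (rule alg) auto
    done
qed

subsection \<open>The normal tail\<close>

lemma set_integrable_normal_tail: "set_integrable lborel {u..} std_normal_density"
  unfolding set_integrable_def by (rule integrable_mult_indicator) auto

lemma normal_tail_nonneg: "0 \<le> normal_tail u"
  unfolding normal_tail_def set_lebesgue_integral_def by (intro integral_nonneg_AE) auto

lemma normal_tail_le_1: "normal_tail u \<le> 1"
proof -
  have "normal_tail u \<le> (\<integral>s. std_normal_density s \<partial>lborel)"
    unfolding normal_tail_def set_lebesgue_integral_def
    by (intro integral_mono set_integrable_normal_tail[unfolded set_integrable_def]) (auto simp: indicator_def)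
  then show ?thesis by simp
qed

text \<open>Exponential Markov inequality with parameter 1: on \<open>s \<ge> u\<close> the factor
  \<open>exp (s - u)\<close> is at least 1, and tilting the standard normal density by it gives a
  multiple of the normal density with mean 1. The bound is crude, but it suffices for the limit at
  infinity.\<close>

lemma normal_tail_le_exp: "normal_tail u \<le> exp (1 / 2 - u)"
proof -
  have e: "exp (s - u) * std_normal_density s = exp (1 / 2 - u) * normal_density 1 1 s" for s
  proof -
    have "s - u + - (s\<^sup>2 / 2) = 1 / 2 - u + - ((s - 1)\<^sup>2 / 2)" by (simp add: power2_eq_square field_simps)
    then have "exp (s - u) * exp (- (s\<^sup>2 / 2)) = exp (1 / 2 - u) * exp (- ((s - 1)\<^sup>2 / 2))"
      by (simp only: exp_add[symmetric])
    then show ?thesis by (simp add: normal_density_def)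
  qed
  have i: "integrable lborel (\<lambda>s. exp (s - u) * std_normal_density s)"
    unfolding e by (intro integrable_mult_right integrable_normal_density) simp
  have le: "std_normal_density s \<le> exp (s - u) * std_normal_density s" if "u \<le> s" for s
    using mult_right_mono[of 1 "exp (s - u)" "std_normal_density s"] that by simp
  have "normal_tail u \<le> (\<integral>s. exp (s - u) * std_normal_density s \<partial>lborel)"
    unfolding normal_tail_def set_lebesgue_integral_def
    by (intro integral_mono set_integrable_normal_tail[unfolded set_integrable_def] i)
       (auto simp: indicator_def le)
  also have "\<dots> = exp (1 / 2 - u)"
    unfolding e by simp
  finally show ?thesis .
qed

text \<open>Near \<open>u\<close> the tail is a constant minus an integral over a compact interval.
  The interval starts at \<open>u - 1\<close> so that \<open>u\<close> is interior and the
  fundamental theorem yields a two-sided derivative.\<close>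

lemma DERIV_normal_tail:
  "(normal_tail has_real_derivative - std_normal_density u) (at u)"
proof -
  have eq: "normal_tail v = normal_tail (u - 1) - integral {u - 1..v} std_normal_density" if "u - 1 \<le> v" for v
  proof -
    have i: "set_integrable lborel S std_normal_density" if "S \<in> sets lborel" for S
      unfolding set_integrable_def using that by (intro integrable_mult_indicator) auto
    have "normal_tail (u - 1) = (LINT s:{u-1..<v} \<union> {v..}|lborel. std_normal_density s)"
      unfolding normal_tail_def using that by (intro arg_cong2[where f="set_lebesgue_integral lborel"]) auto
    also have "\<dots> = (LINT s:{u-1..<v}|lborel. std_normal_density s) + normal_tail v"
      unfolding normal_tail_def by (intro set_integral_Un i) auto
    also have "(LINT s:{u-1..<v}|lborel. std_normal_density s) = (LINT s:{u-1..v}|lborel. std_normal_density s)"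
      unfolding set_lebesgue_integral_def
      by (intro integral_cong_AE) (auto intro!: eventually_mono[OF AE_lborel_singleton[of v]] simp: indicator_def)
    also have "\<dots> = integral {u - 1..v} std_normal_density"
      by (intro set_borel_integral_eq_integral i) auto
    finally show ?thesis by simp
  qed
  have c: "continuous_on S std_normal_density" for S
    unfolding std_normal_density_def by (intro continuous_intros) auto
  have "((\<lambda>v. integral {u - 1..v} std_normal_density) has_real_derivative std_normal_density u) (at u within {u-1..u+1})"
    by (intro integral_has_real_derivative c) auto
  then have "((\<lambda>v. integral {u - 1..v} std_normal_density) has_real_derivative std_normal_density u) (at u)"
    by (simp add: at_within_Icc_at)
  then have "((\<lambda>v. normal_tail (u - 1) - integral {u - 1..v} std_normal_density) has_real_derivative - std_normal_density u) (at u)"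
    by (auto intro!: derivative_eq_intros)
  moreover have "eventually (\<lambda>v. normal_tail (u - 1) - integral {u - 1..v} std_normal_density = normal_tail v) (nhds u)"
    by (rule eventually_mono[OF eventually_nhds_in_open[of "{u - 1<..}" u]]) (auto simp: eq[symmetric])
  ultimately show ?thesis
    by (subst (asm) DERIV_cong_ev) auto
qed

lemma DERIV_normal_tail_chain [derivative_intros]:
  "(f has_real_derivative f') (at x within S) \<Longrightarrow>
   ((\<lambda>x. normal_tail (f x)) has_real_derivative - std_normal_density (f x) * f') (at x within S)"
  by (rule DERIV_chain2[OF DERIV_normal_tail])

lemma borel_measurable_normal_tail [measurable]: "normal_tail \<in> borel_measurable borel"
  by (intro borel_measurable_continuous_onI continuous_at_imp_continuous_on ballI DERIV_isCont[OF DERIV_normal_tail])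

lemma tendsto_normal_tail_at_top: "(normal_tail \<longlongrightarrow> 0) at_top"
proof (rule tendsto_sandwich[OF _ _ tendsto_const])
  have "((\<lambda>u::real. exp (1 / 2) * exp (- u)) \<longlongrightarrow> exp (1 / 2) * 0) at_top"
    by (intro tendsto_mult tendsto_const filterlim_compose[OF exp_at_bot] filterlim_uminus_at_bot_at_top)
  then show "((\<lambda>u::real. exp (1 / 2 - u)) \<longlongrightarrow> 0) at_top"
    by (simp flip: exp_add)
qed (auto simp: normal_tail_nonneg normal_tail_le_exp)

subsection \<open>The tilted tail\<close>

lemma tail_nonneg: "0 \<le> tail \<theta> t m"
  by (simp add: tail_def normal_tail_nonneg)

lemma borel_measurable_tail [measurable]:
  assumes [measurable]: "f \<in> borel_measurable M" "g \<in> borel_measurable M"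
  shows "(\<lambda>x. tail \<theta> (f x) (g x)) \<in> borel_measurable M"
  unfolding tail_def by measurable

text \<open>Completing the square: the tilt in \<open>tail\<close> turns the normal density that
  arises from differentiating \<open>normal_tail\<close> back into \<open>gauss t m\<close>. Hence
  the space and time derivatives of \<open>tail\<close> are combinations of \<open>tail\<close> and
  \<open>gauss\<close> alone.\<close>

lemma exp_std_normal_gauss:
  assumes "0 < t"
  shows "exp (\<theta> * m + \<theta>\<^sup>2 * t / 2) * std_normal_density ((m + \<theta> * t) / sqrt t) = sqrt t * gauss t m"
proof -
  have "exp (\<theta> * m + \<theta>\<^sup>2 * t / 2) * exp (- ((m + \<theta> * t) / sqrt t)\<^sup>2 / 2) = exp (- (m\<^sup>2 / (2 * t)))"
  proof -
    have "\<theta> * m + \<theta>\<^sup>2 * t / 2 + - ((m + \<theta> * t) / sqrt t)\<^sup>2 / 2 = - (m\<^sup>2 / (2 * t))"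
      using assms by (simp add: power_divide) (simp add: power2_eq_square field_simps)
    then show ?thesis by (simp only: exp_add[symmetric])
  qed
  then show ?thesis
    using assms by (simp add: std_normal_density_def gauss_def real_sqrt_mult field_simps)
qed

lemma DERIV_tail_space [derivative_intros]:
  assumes "0 < t" "(f has_real_derivative f') (at x within S)"
  shows "((\<lambda>x. tail \<theta> t (f x)) has_real_derivative (\<theta> * tail \<theta> t (f x) - gauss t (f x)) * f') (at x within S)"
proof -
  define m where "m = f x"
  have d: "((\<lambda>m. (m + \<theta> * t) / sqrt t) has_real_derivative 1 / sqrt t) (at m)"
    using DERIV_cmult_right[where c="inverse (sqrt t)", OF DERIV_add[OF DERIV_ident DERIV_const[where k="\<theta> * t"]], of m UNIV]
    by (simp add: divide_inverse)
  have e: "((\<lambda>m. exp (\<theta> * m + \<theta>\<^sup>2 * t / 2)) has_real_derivative \<theta> * exp (\<theta> * m + \<theta>\<^sup>2 * t / 2)) (at m)"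
    by (auto intro!: derivative_eq_intros)
  have "((\<lambda>m. tail \<theta> t m) has_real_derivative
     (\<theta> * tail \<theta> t m - (exp (\<theta> * m + \<theta>\<^sup>2 * t / 2) * std_normal_density ((m + \<theta> * t) / sqrt t)) / sqrt t)) (at m)"
    using DERIV_mult[OF e DERIV_normal_tail_chain[OF d]] by (simp add: tail_def algebra_simps)
  then have "((\<lambda>m. tail \<theta> t m) has_real_derivative (\<theta> * tail \<theta> t m - gauss t m)) (at m)"
    using assms(1) unfolding exp_std_normal_gauss[OF assms(1)] by simp
  from DERIV_chain2[OF this[unfolded m_def] assms(2)] show ?thesis .
qed

lemma DERIV_tail_time:
  assumes "0 < t"
  shows "((\<lambda>t. tail \<theta> t m) has_real_derivative (\<theta>\<^sup>2 * tail \<theta> t m - \<theta> * gauss t m + m / t * gauss t m) / 2) (at t)"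
proof -
  have d: "((\<lambda>t. (m + \<theta> * t) / sqrt t) has_real_derivative (\<theta> / 2 - m / (2 * t)) / sqrt t) (at t)"
  proof -
    have e: "sqrt t * sqrt t = t" using assms by simp
    show ?thesis
      using assms
      apply (auto intro!: derivative_eq_intros)
      apply (simp add: divide_simps e)

      done
  qed
  have "((\<lambda>t. tail \<theta> t m) has_real_derivative
     (\<theta>\<^sup>2 / 2 * tail \<theta> t m - (exp (\<theta> * m + \<theta>\<^sup>2 * t / 2) * std_normal_density ((m + \<theta> * t) / sqrt t)) * ((\<theta> / 2 - m / (2 * t)) / sqrt t))) (at t)"
  proof -
    have e: "((\<lambda>t. exp (\<theta> * m + \<theta>\<^sup>2 * t / 2)) has_real_derivative \<theta>\<^sup>2 / 2 * exp (\<theta> * m + \<theta>\<^sup>2 * t / 2)) (at t)"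
      by (auto intro!: derivative_eq_intros)
    show ?thesis
      unfolding tail_def
      by (rule DERIV_cong[OF DERIV_mult[OF e DERIV_normal_tail_chain[OF d]]]) (simp add: algebra_simps diff_divide_distrib add_divide_distrib)
  qed
  also have "(\<theta>\<^sup>2 / 2 * tail \<theta> t m - (exp (\<theta> * m + \<theta>\<^sup>2 * t / 2) * std_normal_density ((m + \<theta> * t) / sqrt t)) * ((\<theta> / 2 - m / (2 * t)) / sqrt t))
     = (\<theta>\<^sup>2 * tail \<theta> t m - \<theta> * gauss t m + m / t * gauss t m) / 2"
    unfolding exp_std_normal_gauss[OF assms] using assms by (simp add: field_simps)
  finally show ?thesis .
qed

text \<open>The exponential factor cancels exactly the part of the tilt that depends on
  \<open>l\<close>. What remains is a constant times \<open>normal_tail\<close> at an argument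
  tending to infinity, so the sign of \<theta> does not matter.\<close>

lemma tendsto_exp_tail:
  assumes "0 < t"
  shows "((\<lambda>l. exp (- (\<theta> * l)) * tail \<theta> t (l + m)) \<longlongrightarrow> 0) at_top"
proof -
  have l: "LIM l at_top. (l + m + \<theta> * t) / sqrt t :> at_top"
  proof -
    have "LIM l at_top. (m + \<theta> * t) + l :> at_top"
      by (intro filterlim_tendsto_add_at_top[OF tendsto_const] filterlim_ident)
    then have "LIM l at_top. inverse (sqrt t) * ((m + \<theta> * t) + l) :> at_top"
      using assms by (intro filterlim_tendsto_pos_mult_at_top[OF tendsto_const]) auto
    then show ?thesis by (simp add: divide_inverse ac_simps)
  qed
  have "((\<lambda>l. exp (\<theta> * m + \<theta>\<^sup>2 * t / 2) * normal_tail ((l + m + \<theta> * t) / sqrt t)) \<longlongrightarrow> exp (\<theta> * m + \<theta>\<^sup>2 * t / 2) * 0) at_top"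
    by (intro tendsto_intros filterlim_compose[OF tendsto_normal_tail_at_top l])
  moreover have "exp (- (\<theta> * l)) * tail \<theta> t (l + m) = exp (\<theta> * m + \<theta>\<^sup>2 * t / 2) * normal_tail ((l + m + \<theta> * t) / sqrt t)" for l
  proof -
    have "- (\<theta> * l) + (\<theta> * (l + m) + \<theta>\<^sup>2 * t / 2) = \<theta> * m + \<theta>\<^sup>2 * t / 2" by (simp add: algebra_simps)
    then have "exp (- (\<theta> * l)) * exp (\<theta> * (l + m) + \<theta>\<^sup>2 * t / 2) = exp (\<theta> * m + \<theta>\<^sup>2 * t / 2)"
      by (simp only: exp_add[symmetric])
    then show ?thesis by (simp add: tail_def mult.assoc[symmetric] add.assoc)
  qed
  ultimately show ?thesis by simp
qed

text \<open>By the equation \<open>tail' = \<theta> * tail - gauss\<close> in space,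
  \<open>- exp (- (\<theta> * l)) * tail \<theta> t (l + m)\<close> is an antiderivative of the
  integrand, and it vanishes at infinity. This representation is what makes the bounds and the
  Chapman--Kolmogorov equation accessible.\<close>

lemma nn_integral_tail:
  assumes "0 < t"
  shows "(\<integral>\<^sup>+l. ennreal (exp (- (\<theta> * l)) * gauss t (l + m)) * indicator {0..} l \<partial>lborel) = ennreal (tail \<theta> t m)"
proof -
  have "(\<integral>\<^sup>+l\<in>{0..}. ennreal (exp (- (\<theta> * l)) * gauss t (l + m)) \<partial>lborel)
      = ennreal (0 - (- (exp (- (\<theta> * 0)) * tail \<theta> t (0 + m))))"
  proof (rule nn_integral_FTC_atLeast)
    show "((\<lambda>l. - (exp (- (\<theta> * l)) * tail \<theta> t (l + m))) has_real_derivative exp (- (\<theta> * l)) * gauss t (l + m)) (at l)" for l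
      using assms by (auto intro!: derivative_eq_intros simp: algebra_simps)
    show "((\<lambda>l. - (exp (- (\<theta> * l)) * tail \<theta> t (l + m))) \<longlongrightarrow> 0) at_top"
      using tendsto_minus[OF tendsto_exp_tail[OF assms]] by simp
  qed (use assms in auto)
  then show ?thesis by simp
qed

lemma gauss_split_le: "0 < t \<Longrightarrow> 0 \<le> l \<Longrightarrow> 0 \<le> m \<Longrightarrow> gauss t (l + m) \<le> exp (- (m\<^sup>2 / (2 * t))) * gauss t l"
proof -
  assume a: "0 < t" "0 \<le> l" "0 \<le> m"
  have "- ((l + m)\<^sup>2 / (2 * t)) \<le> - (m\<^sup>2 / (2 * t)) + - (l\<^sup>2 / (2 * t))"
    using a by (simp add: power2_eq_square field_simps)
  then have "exp (- ((l + m)\<^sup>2 / (2 * t))) \<le> exp (- (m\<^sup>2 / (2 * t))) * exp (- (l\<^sup>2 / (2 * t)))"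
    by (simp add: exp_add[symmetric])
  then show ?thesis
    using a by (simp add: gauss_def divide_right_mono)
qed

text \<open>In the integral representation, \<open>(l + m)^2 \<ge> l^2 + m^2\<close> lets the
  Gaussian factor in \<open>m\<close> be pulled out, and \<open>tail \<theta> t 0\<close> remains.
  The closed form does not show this decay when \<theta> is positive, because its prefactor
  \<open>exp (\<theta> * m)\<close> then grows.\<close>

lemma tail_le_exp:
  assumes "0 < t" "0 \<le> m"
  shows "tail \<theta> t m \<le> exp (\<theta>\<^sup>2 * t / 2) * exp (- (m\<^sup>2 / (2 * t)))"
proof -
  have "ennreal (tail \<theta> t m) = (\<integral>\<^sup>+l. ennreal (exp (- (\<theta> * l)) * gauss t (l + m)) * indicator {0..} l \<partial>lborel)"
    using nn_integral_tail[OF assms(1)] by simp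
  also have "\<dots> \<le> (\<integral>\<^sup>+l. ennreal (exp (- (m\<^sup>2 / (2 * t)))) * (ennreal (exp (- (\<theta> * l)) * gauss t (l + 0)) * indicator {0..} l) \<partial>lborel)"
  proof (intro nn_integral_mono)
    fix l :: real
    have "exp (- (\<theta> * l)) * gauss t (l + m) \<le> exp (- (m\<^sup>2 / (2 * t))) * (exp (- (\<theta> * l)) * gauss t (l + 0))" if "0 \<le> l"
      using gauss_split_le[OF assms(1) that assms(2)] by (simp add: mult.left_commute)
    then show "ennreal (exp (- (\<theta> * l)) * gauss t (l + m)) * indicator {0..} l
        \<le> ennreal (exp (- (m\<^sup>2 / (2 * t)))) * (ennreal (exp (- (\<theta> * l)) * gauss t (l + 0)) * indicator {0..} l)"
      using assms by (auto simp: indicator_def ennreal_mult[symmetric] intro!: ennreal_leI)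
  qed
  also have "\<dots> = ennreal (exp (- (m\<^sup>2 / (2 * t)))) * ennreal (tail \<theta> t 0)"
    using nn_integral_tail[OF assms(1), of \<theta> 0] by (subst nn_integral_cmult) auto
  also have "\<dots> = ennreal (exp (- (m\<^sup>2 / (2 * t))) * tail \<theta> t 0)"
    by (simp add: ennreal_mult tail_nonneg)
  finally have "tail \<theta> t m \<le> exp (- (m\<^sup>2 / (2 * t))) * tail \<theta> t 0"
    by (simp add: tail_nonneg)
  also have "tail \<theta> t 0 \<le> exp (\<theta>\<^sup>2 * t / 2) * 1"
    unfolding tail_def by (intro mult_mono normal_tail_le_1 normal_tail_nonneg) auto
  finally show ?thesis by (simp add: mult.commute)
qed

lemma tail_le_gauss:
  assumes "0 < t" "0 \<le> m"
  shows "tail \<theta> t m \<le> exp (\<theta>\<^sup>2 * t / 2) * sqrt (2 * pi * t) * gauss t m"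
  using tail_le_exp[OF assms, of \<theta>] assms by (simp add: gauss_def)

lemma tendsto_tail:
  assumes "0 < t"
  shows "(tail \<theta> t \<longlongrightarrow> 0) at_top"
proof (rule tendsto_sandwich[OF _ _ tendsto_const])
  have "LIM m at_top. inverse (2 * t) * m\<^sup>2 :> at_top"
    using assms by (intro filterlim_tendsto_pos_mult_at_top[OF tendsto_const] filterlim_pow_at_top filterlim_ident) auto
  then have "LIM m at_top. - (m\<^sup>2 / (2 * t)) :> at_bot"
    by (simp only: filterlim_uminus_at_bot minus_minus divide_inverse mult.commute)
  then have "((\<lambda>m. exp (- (m\<^sup>2 / (2 * t)))) \<longlongrightarrow> 0) at_top"
    by (rule filterlim_compose[OF exp_at_bot])
  then show "((\<lambda>m. exp (\<theta>\<^sup>2 * t / 2) * exp (- (m\<^sup>2 / (2 * t)))) \<longlongrightarrow> 0) at_top"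
    by (rule tendsto_mult_right_zero)
  show "eventually (\<lambda>m. tail \<theta> t m \<le> exp (\<theta>\<^sup>2 * t / 2) * exp (- (m\<^sup>2 / (2 * t)))) at_top"
    using eventually_ge_at_top[of 0] by eventually_elim (rule tail_le_exp[OF assms])
qed (auto simp: tail_nonneg)

subsection \<open>The kernel\<close>

text \<open>If \<open>a * c > 0\<close>, the reflection identity \<open>exp (- (2 * a * c / t)) *
  gauss t (c - a) = gauss t (\<bar>a\<bar> + \<bar>c\<bar>)\<close> absorbs the exponential factors
  of \<open>v_theta\<close>; otherwise
  \<open>\<bar>c - a\<bar> = \<bar>a\<bar> + \<bar>c\<bar>\<close> holds outright. Either way the
  bracket in \<open>v_theta\<close> contributes \<open>\<theta> * tail\<close>, and the case
  distinction disappears.\<close>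

lemma ker_eq:
  assumes t: "0 < t"
  shows "ker \<theta> t a c = gauss t (c - a) - \<theta> * tail \<theta> t (\<bar>a\<bar> + \<bar>c\<bar>)"
proof -
  define m where "m = \<bar>a\<bar> + \<bar>c\<bar>"
  have 1: "gauss t m * (\<theta> * sqrt (2 * pi * t) * exp ((m + t * \<theta>)\<^sup>2 / (2 * t)) * normal_tail ((\<theta> * t + m) / sqrt t))
     = \<theta> * tail \<theta> t m"
  proof -
    have "- (m\<^sup>2 / (2 * t)) + (m + t * \<theta>)\<^sup>2 / (2 * t) = \<theta> * m + \<theta>\<^sup>2 * t / 2"
      using t by (simp add: power2_eq_square field_simps)
    then have "exp (- (m\<^sup>2 / (2 * t))) * exp ((m + t * \<theta>)\<^sup>2 / (2 * t)) = exp (\<theta> * m + \<theta>\<^sup>2 * t / 2)"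
      by (simp only: exp_add[symmetric])
    then show ?thesis
      using t by (simp add: gauss_def tail_def add.commute[of "\<theta> * t"] mult.assoc[symmetric])
  qed
  show ?thesis
  proof (cases "a * c > 0")
    case True
    then have m2: "m\<^sup>2 = (a + c)\<^sup>2"
      unfolding m_def by (cases "a > 0") (auto simp: zero_less_mult_iff power2_eq_square algebra_simps)
    have "- (2 * a * c / t) + - ((c - a)\<^sup>2 / (2 * t)) = - (m\<^sup>2 / (2 * t))"
      unfolding m2 using t by (simp add: power2_eq_square field_simps)
    then have "exp (- (2 * a * c / t)) * exp (- ((c - a)\<^sup>2 / (2 * t))) = exp (- (m\<^sup>2 / (2 * t)))"
      by (simp only: exp_add[symmetric])
    then have 2: "exp (- (2 * a * c / t)) * gauss t (c - a) = gauss t m"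
      by (simp add: gauss_def)
    have "ker \<theta> t a c = gauss t (c - a) - exp (- (2 * a * c / t)) * gauss t (c - a) +
       exp (- (2 * a * c / t)) * gauss t (c - a) * (1 - \<theta> * sqrt (2 * pi * t) * exp ((m + t * \<theta>)\<^sup>2 / (2 * t)) * normal_tail ((\<theta> * t + m) / sqrt t))"
      using True t unfolding ker_def v_theta_def p00_gauss[OF t] m_def by (simp add: algebra_simps)
    also have "\<dots> = gauss t (c - a) - gauss t m * (\<theta> * sqrt (2 * pi * t) * exp ((m + t * \<theta>)\<^sup>2 / (2 * t)) * normal_tail ((\<theta> * t + m) / sqrt t))"
      unfolding 2 by (simp add: algebra_simps)
    also have "\<dots> = gauss t (c - a) - \<theta> * tail \<theta> t m"
      unfolding 1 ..
    finally show ?thesis by (simp add: m_def)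
  next
    case False
    then have "\<bar>c - a\<bar> = m" unfolding m_def
      by (auto simp: not_less mult_le_0_iff abs_if)
    then have "gauss t (c - a) = gauss t m" by (metis gauss_abs)
    then have "ker \<theta> t a c = gauss t (c - a) - gauss t m * (\<theta> * sqrt (2 * pi * t) * exp ((m + t * \<theta>)\<^sup>2 / (2 * t)) * normal_tail ((\<theta> * t + m) / sqrt t))"
      using False t unfolding ker_def v_theta_def p00_gauss[OF t] m_def by (simp add: algebra_simps)
    then show ?thesis unfolding 1 by (simp add: m_def)
  qed
qed

lemma borel_measurable_ker [measurable]:
  assumes [measurable]: "f \<in> borel_measurable M" "g \<in> borel_measurable M" "h \<in> borel_measurable M"
  shows "(\<lambda>x. ker \<theta> (f x) (g x) (h x)) \<in> borel_measurable M"
  unfolding ker_def v_theta_def p00_def normal_density_def of_bool_def by measurable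

text \<open>The difference multiplied by \<open>exp (- (\<theta> * l))\<close> has derivative
  \<open>- (l / t) * exp (- (\<theta> * l)) * gauss t l\<close>, because the \<open>tail\<close>
  terms cancel. So \<open>k\<close> decreases strictly on the positive half line to the limit 0 and
  must be positive. This gives positivity of the kernel, hence honest probability densities in the
  algorithm.\<close>

lemma tail_less_gauss:
  assumes t: "0 < t" and m: "0 \<le> m"
  shows "\<theta> * tail \<theta> t m < gauss t m"
proof -
  define k where "k l = exp (- (\<theta> * l)) * (gauss t l - \<theta> * tail \<theta> t l)" for l
  have d: "(k has_real_derivative - (l / t) * exp (- (\<theta> * l)) * gauss t l) (at l)" for l
    unfolding k_def using t by (auto intro!: derivative_eq_intros simp: algebra_simps)
  have dec: "k l' < k l" if "0 \<le> l" "l < l'" for l l'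
  proof (rule DERIV_neg_imp_decreasing_open[OF that(2)])
    show "\<exists>y. (k has_real_derivative y) (at r) \<and> y < 0" if "l < r" "r < l'" for r
    proof (intro exI conjI)
      show "- (r / t) * exp (- (\<theta> * r)) * gauss t r < 0"
        using t \<open>0 \<le> l\<close> \<open>l < r\<close> by (simp add: gauss_pos)
    qed (rule d)
    show "continuous_on {l..l'} k"
      by (intro continuous_at_imp_continuous_on ballI DERIV_isCont[OF d])
  qed
  have "(k \<longlongrightarrow> 0) at_top"
  proof -
    have t1: "((\<lambda>l. exp (- (\<theta> * l)) * tail \<theta> t l) \<longlongrightarrow> 0) at_top"
      using tendsto_exp_tail[OF t, of \<theta> 0] by simp
    have "((\<lambda>l. exp (- (\<theta> * l)) * gauss t l) \<longlongrightarrow> 0) at_top"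
    proof (rule tendsto_sandwich[OF _ _ tendsto_const])
      \<comment> \<open>Young's inequality trades the linear growth of the exponent for the Gaussian
        one. The extra 1 in \<open>1 + \<bar>\<theta>\<bar>\<close> leaves the factor
        \<open>exp (- l)\<close>, which tends to 0.\<close>
      have e: "exp (- (\<theta> * l)) * gauss t l \<le> exp ((1 + \<bar>\<theta>\<bar>)\<^sup>2 * t / 2) / sqrt (2 * pi * t) * exp (- l)" if "0 \<le> l" for l
      proof -
        have "- (\<theta> * l) \<le> \<bar>\<theta>\<bar> * l" using that by (simp add: mult_right_mono abs_if)
        moreover have "(1 + \<bar>\<theta>\<bar>) * l \<le> (1 + \<bar>\<theta>\<bar>)\<^sup>2 * t / 2 + l\<^sup>2 / (2 * t)"
        proof -
          have "0 \<le> ((1 + \<bar>\<theta>\<bar>) * t - l)\<^sup>2 / (2 * t)" using t by simp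
          also have "\<dots> = (1 + \<bar>\<theta>\<bar>)\<^sup>2 * t / 2 + l\<^sup>2 / (2 * t) - (1 + \<bar>\<theta>\<bar>) * l"
            using t by (simp add: power2_eq_square field_simps)
          finally show ?thesis by simp
        qed
        ultimately have "- (\<theta> * l) + - (l\<^sup>2 / (2 * t)) \<le> (1 + \<bar>\<theta>\<bar>)\<^sup>2 * t / 2 + - l"
          by (simp add: algebra_simps)
        then have "exp (- (\<theta> * l)) * exp (- (l\<^sup>2 / (2 * t))) \<le> exp ((1 + \<bar>\<theta>\<bar>)\<^sup>2 * t / 2) * exp (- l)"
          by (simp only: exp_add[symmetric] exp_le_cancel_iff)
        then show ?thesis using t by (simp add: gauss_def divide_right_mono)
      qed
      show "eventually (\<lambda>l. exp (- (\<theta> * l)) * gauss t l \<le> exp ((1 + \<bar>\<theta>\<bar>)\<^sup>2 * t / 2) / sqrt (2 * pi * t) * exp (- l)) at_top"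
        using eventually_ge_at_top[of 0] by eventually_elim (rule e)
      show "((\<lambda>l. exp ((1 + \<bar>\<theta>\<bar>)\<^sup>2 * t / 2) / sqrt (2 * pi * t) * exp (- l)) \<longlongrightarrow> 0) at_top"
        by (intro tendsto_mult_right_zero filterlim_compose[OF exp_at_bot] filterlim_uminus_at_bot_at_top)
    qed (use t in auto)
    from tendsto_diff[OF this tendsto_mult_right_zero[OF t1, of \<theta>]] show ?thesis
      by (simp add: k_def[abs_def] algebra_simps)
  qed
  \<comment> \<open>The limit gives only a weak inequality; taking it at \<open>m + 1\<close> and
    descending to \<open>m\<close> restores strictness.\<close>
  then have "0 \<le> k (m + 1)"
    by (rule tendsto_upperbound) (auto intro!: eventually_mono[OF eventually_gt_at_top[of "m+1"]] less_imp_le[OF dec] add_nonneg_nonneg m)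
  also have "k (m + 1) < k m" using m by (intro dec) auto
  finally show ?thesis by (simp add: k_def zero_less_mult_iff)
qed

lemma ker_pos:
  assumes "0 < t" shows "0 < ker \<theta> t a c"
proof -
  have "\<theta> * tail \<theta> t (\<bar>a\<bar> + \<bar>c\<bar>) < gauss t (\<bar>a\<bar> + \<bar>c\<bar>)"
    by (intro tail_less_gauss assms) auto
  also have "\<dots> \<le> gauss t (c - a)"
    by (intro gauss_mono assms) auto
  finally show ?thesis by (simp add: ker_eq[OF assms])
qed

lemma ker_nonneg [simp]: "0 < t \<Longrightarrow> 0 \<le> ker \<theta> t a c"
  using ker_pos[of t \<theta> a c] by simp

lemma ker_le_gauss:
  assumes "0 < t"
  shows "ker \<theta> t a c \<le> (1 + \<bar>\<theta>\<bar> * (exp (\<theta>\<^sup>2 * t / 2) * sqrt (2 * pi * t))) * gauss t (c - a)"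
proof -
  have "tail \<theta> t (\<bar>a\<bar> + \<bar>c\<bar>) \<le> exp (\<theta>\<^sup>2 * t / 2) * sqrt (2 * pi * t) * gauss t (\<bar>a\<bar> + \<bar>c\<bar>)"
    by (intro tail_le_gauss assms) auto
  also have "\<dots> \<le> exp (\<theta>\<^sup>2 * t / 2) * sqrt (2 * pi * t) * gauss t (c - a)"
    using assms by (intro mult_left_mono gauss_mono) auto
  finally have "\<bar>\<theta>\<bar> * tail \<theta> t (\<bar>a\<bar> + \<bar>c\<bar>) \<le> \<bar>\<theta>\<bar> * (exp (\<theta>\<^sup>2 * t / 2) * sqrt (2 * pi * t) * gauss t (c - a))"
    by (rule mult_left_mono) auto
  moreover have "- \<theta> * tail \<theta> t (\<bar>a\<bar> + \<bar>c\<bar>) \<le> \<bar>\<theta>\<bar> * tail \<theta> t (\<bar>a\<bar> + \<bar>c\<bar>)"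
    by (intro mult_right_mono tail_nonneg) auto
  ultimately show ?thesis by (simp add: ker_eq[OF assms] algebra_simps)
qed

subsection \<open>Chapman--Kolmogorov\<close>

lemma nn_integral_Ioi_eq_Ici:
  fixes a :: real
  shows "(\<integral>\<^sup>+y. f y * indicator {a<..} y \<partial>lborel) = (\<integral>\<^sup>+y. f y * indicator {a..} y \<partial>lborel)"
  by (intro nn_integral_cong_AE eventually_mono[OF AE_lborel_singleton[of a]]) (auto simp: indicator_def)

lemma borel_measurable_indicator_Ici [measurable]:
  fixes f g :: "'a \<Rightarrow> real"
  assumes [measurable]: "f \<in> borel_measurable M" "g \<in> borel_measurable M"
  shows "(\<lambda>x. indicator {f x..} (g x) :: ennreal) \<in> borel_measurable M"
    and "(\<lambda>x. indicator {f x<..} (g x) :: ennreal) \<in> borel_measurable M"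
proof -
  have "(\<lambda>x. indicator {f x..} (g x) :: ennreal) = (\<lambda>x. if f x \<le> g x then 1 else 0)"
    "(\<lambda>x. indicator {f x<..} (g x) :: ennreal) = (\<lambda>x. if f x < g x then 1 else 0)"
    by (auto simp: indicator_def)
  then show "(\<lambda>x. indicator {f x..} (g x) :: ennreal) \<in> borel_measurable M"
    and "(\<lambda>x. indicator {f x<..} (g x) :: ennreal) \<in> borel_measurable M"
    by simp_all
qed

text \<open>Start from the representation of
  \<open>tail \<theta> (s + t) (\<alpha> + \<gamma>)\<close> and split the Gaussian at time
  \<open>s\<close> by convolution. The result is a double integral of \<open>Q l y\<close> over
  \<open>l \<ge> 0\<close> and real \<open>y\<close>, which is cut into three regions:
  \<open>y \<ge> 0\<close>, then \<open>y < 0\<close> with \<open>l \<ge> - y\<close>, then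
  \<open>y < 0\<close> with \<open>l < - y\<close>. They yield the first term, the product of tails
  and the second term.\<close>

lemma nn_integral_gauss_tail:
  assumes s: "0 < s" and t: "0 < t"
  shows "(\<integral>\<^sup>+y. ennreal (gauss s (y - \<alpha>) * tail \<theta> t (y + \<gamma>)) * indicator {0..} y \<partial>lborel)
       + (\<integral>\<^sup>+y. ennreal (tail \<theta> s (\<alpha> + y) * gauss t (y - \<gamma>)) * indicator {0..} y \<partial>lborel)
       + ennreal (tail \<theta> s \<alpha> * tail \<theta> t \<gamma>) = ennreal (tail \<theta> (s + t) (\<alpha> + \<gamma>))"
proof -
  define e where "e l = ennreal (exp (- (\<theta> * l)))" for l
  define g where "g r m = ennreal (gauss r m)" for r m
  have [measurable]: "e \<in> borel_measurable borel" "(\<lambda>x. g r (f x)) \<in> borel_measurable M"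
    if "f \<in> borel_measurable M" for r f M using that unfolding e_def g_def by auto
  have tail: "(\<integral>\<^sup>+l. e l * g r (l + m) * indicator {0..} l \<partial>lborel) = ennreal (tail \<theta> r m)" if "0 < r" for r m
    using nn_integral_tail[OF that, of \<theta> m] that by (simp add: e_def g_def ennreal_mult)
  have e_add: "e (x + y) = e x * e y" for x y
    by (simp add: e_def ennreal_mult[symmetric] exp_add[symmetric] algebra_simps)
  have g_minus: "g r (x - y) = g r (y - x)" for r x y
    by (simp add: g_def gauss_diff_commute)
  define Q where "Q l y = e l * g s (y - \<alpha>) * g t (l + \<gamma> + y) * indicator {0..} l" for l y
  have [measurable]: "case_prod Q \<in> borel_measurable (lborel \<Otimes>\<^sub>M lborel)" "\<And>l. Q l \<in> borel_measurable borel"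
    unfolding Q_def by measurable
  have "ennreal (tail \<theta> (s + t) (\<alpha> + \<gamma>)) = (\<integral>\<^sup>+l. e l * g (s + t) (l + (\<alpha> + \<gamma>)) * indicator {0..} l \<partial>lborel)"
    using s t by (simp add: tail)
  also have "\<dots> = (\<integral>\<^sup>+l. \<integral>\<^sup>+y. Q l y \<partial>lborel \<partial>lborel)"
  proof (rule nn_integral_cong)
    fix l :: real
    have "(\<integral>\<^sup>+y. g s (y - \<alpha>) * g t (l + \<gamma> + y) \<partial>lborel) = g (s + t) (l + (\<alpha> + \<gamma>))"
    proof -
      \<comment> \<open>\<open>gauss t (l + \<gamma> + y)\<close> is read as the density of a move
        from \<open>y\<close> to the end point \<open>- (l + \<gamma>)\<close>, so that the
        convolution formula applies.\<close>
      have "- (l + \<gamma>) - y = - (l + \<gamma> + y)" "- (l + \<gamma>) - \<alpha> = - (l + (\<alpha> + \<gamma>))" for y by auto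
      then show ?thesis
        using gauss_convolution[OF s t, of \<alpha> "- (l + \<gamma>)"] by (simp only: g_def gauss_minus)
    qed
    moreover have "(\<integral>\<^sup>+y. Q l y \<partial>lborel) = (\<integral>\<^sup>+y. (e l * indicator {0..} l) * (g s (y - \<alpha>) * g t (l + \<gamma> + y)) \<partial>lborel)"
      by (intro nn_integral_cong) (simp add: Q_def ac_simps)
    ultimately show "e l * g (s + t) (l + (\<alpha> + \<gamma>)) * indicator {0..} l = (\<integral>\<^sup>+y. Q l y \<partial>lborel)"
      by (simp add: nn_integral_cmult ac_simps)
  qed
  also have "\<dots> = (\<integral>\<^sup>+l. (\<integral>\<^sup>+y. Q l y * indicator {0..} y \<partial>lborel) + (\<integral>\<^sup>+y. Q l y * indicator {..<0} y \<partial>lborel) \<partial>lborel)"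
    by (intro nn_integral_cong, subst nn_integral_add[symmetric]) (auto intro!: nn_integral_cong simp: indicator_def)
  also have "\<dots> = (\<integral>\<^sup>+l. \<integral>\<^sup>+y. Q l y * indicator {0..} y \<partial>lborel \<partial>lborel) + (\<integral>\<^sup>+l. \<integral>\<^sup>+y. Q l y * indicator {..<0} y \<partial>lborel \<partial>lborel)"
    by (intro nn_integral_add) auto
  also have "(\<integral>\<^sup>+l. \<integral>\<^sup>+y. Q l y * indicator {0..} y \<partial>lborel \<partial>lborel) = (\<integral>\<^sup>+y. \<integral>\<^sup>+l. Q l y * indicator {0..} y \<partial>lborel \<partial>lborel)"
    by (rule lborel_pair.Fubini') auto
  also have "\<dots> = (\<integral>\<^sup>+y. ennreal (gauss s (y - \<alpha>) * tail \<theta> t (y + \<gamma>)) * indicator {0..} y \<partial>lborel)"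
  proof (rule nn_integral_cong)
    fix y :: real
    have "(\<integral>\<^sup>+l. Q l y * indicator {0..} y \<partial>lborel) = (\<integral>\<^sup>+l. (e l * g t (l + (y + \<gamma>)) * indicator {0..} l) * (g s (y - \<alpha>) * indicator {0..} y) \<partial>lborel)"
      by (intro nn_integral_cong) (simp add: Q_def ac_simps)
    also have "\<dots> = ennreal (tail \<theta> t (y + \<gamma>)) * (g s (y - \<alpha>) * indicator {0..} y)"
      using t by (subst nn_integral_multc) (auto simp: tail)
    finally show "(\<integral>\<^sup>+l. Q l y * indicator {0..} y \<partial>lborel) = ennreal (gauss s (y - \<alpha>) * tail \<theta> t (y + \<gamma>)) * indicator {0..} y"
      using s by (simp add: g_def ennreal_mult tail_nonneg ac_simps)
  qed
  also have "(\<integral>\<^sup>+l. \<integral>\<^sup>+y. Q l y * indicator {..<0} y \<partial>lborel \<partial>lborel) = (\<integral>\<^sup>+l. \<integral>\<^sup>+y. Q l (- y) * indicator {0<..} y \<partial>lborel \<partial>lborel)"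
    by (rule nn_integral_cong, subst nn_integral_real_affine[where c="-1" and t=0])
      (auto intro!: nn_integral_cong simp: indicator_def)
  \<comment> \<open>After \<open>y\<close> has been replaced by \<open>- y\<close>, the quadrant is
    cut along \<open>l = y\<close>. For \<open>l \<ge> y\<close> the shift \<open>l = y + l'\<close>
    separates the variables and gives the product of two tails. For \<open>l < y\<close> the shift
    \<open>y = l + r\<close> makes the integral over \<open>l\<close> a tail with argument
    \<open>\<alpha> + r\<close>.\<close>
  also have "\<dots> = (\<integral>\<^sup>+l. \<integral>\<^sup>+y. Q l (- y) * indicator {0<..} y * indicator {y..} l \<partial>lborel + (\<integral>\<^sup>+y. Q l (- y) * indicator {0<..} y * indicator {l<..} y \<partial>lborel) \<partial>lborel)"
    by (intro nn_integral_cong, subst nn_integral_add[symmetric]) (auto intro!: nn_integral_cong simp: indicator_def)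
  also have "\<dots> = (\<integral>\<^sup>+l. \<integral>\<^sup>+y. Q l (- y) * indicator {0<..} y * indicator {y..} l \<partial>lborel \<partial>lborel)
      + (\<integral>\<^sup>+l. \<integral>\<^sup>+y. Q l (- y) * indicator {0<..} y * indicator {l<..} y \<partial>lborel \<partial>lborel)"
    by (intro nn_integral_add) auto
  also have "(\<integral>\<^sup>+l. \<integral>\<^sup>+y. Q l (- y) * indicator {0<..} y * indicator {y..} l \<partial>lborel \<partial>lborel)
     = (\<integral>\<^sup>+y. \<integral>\<^sup>+l. Q l (- y) * indicator {0<..} y * indicator {y..} l \<partial>lborel \<partial>lborel)"
    by (rule lborel_pair.Fubini') auto
  also have "\<dots> = (\<integral>\<^sup>+y. (e y * g s (y + \<alpha>) * indicator {0<..} y) * ennreal (tail \<theta> t \<gamma>) \<partial>lborel)"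
  proof (rule nn_integral_cong)
    fix y :: real
    have "(\<integral>\<^sup>+l. Q l (- y) * indicator {0<..} y * indicator {y..} l \<partial>lborel)
        = (\<integral>\<^sup>+l. Q (y + l) (- y) * indicator {0<..} y * indicator {y..} (y + l) \<partial>lborel)"
      by (subst nn_integral_real_affine[where c=1 and t=y]) auto
    also have "\<dots> = (\<integral>\<^sup>+l. (e y * g s (y + \<alpha>) * indicator {0<..} y) * (e l * g t (l + \<gamma>) * indicator {0..} l) \<partial>lborel)"
      using g_minus[of s "-y" \<alpha>] by (intro nn_integral_cong) (auto simp: Q_def e_add ac_simps indicator_def)
    also have "\<dots> = (e y * g s (y + \<alpha>) * indicator {0<..} y) * ennreal (tail \<theta> t \<gamma>)"
      using t by (subst nn_integral_cmult) (auto simp: tail)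
    finally show "(\<integral>\<^sup>+l. Q l (- y) * indicator {0<..} y * indicator {y..} l \<partial>lborel) = \<dots>" .
  qed
  also have "\<dots> = (\<integral>\<^sup>+y. (e y * g s (y + \<alpha>) * indicator {0<..} y) \<partial>lborel) * ennreal (tail \<theta> t \<gamma>)"
    by (rule nn_integral_multc) auto
  also have "(\<integral>\<^sup>+y. (e y * g s (y + \<alpha>) * indicator {0<..} y) \<partial>lborel) = ennreal (tail \<theta> s \<alpha>)"
    using s by (simp add: nn_integral_Ioi_eq_Ici tail)
  also have "(\<integral>\<^sup>+l. \<integral>\<^sup>+y. Q l (- y) * indicator {0<..} y * indicator {l<..} y \<partial>lborel \<partial>lborel)
     = (\<integral>\<^sup>+l. \<integral>\<^sup>+r. (e l * g s (l + (\<alpha> + r)) * indicator {0..} l) * (g t (r - \<gamma>) * indicator {0<..} r) \<partial>lborel \<partial>lborel)"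
  proof (rule nn_integral_cong)
    fix l :: real
    have "(\<integral>\<^sup>+y. Q l (- y) * indicator {0<..} y * indicator {l<..} y \<partial>lborel)
       = (\<integral>\<^sup>+r. Q l (- (l + r)) * indicator {0<..} (l + r) * indicator {l<..} (l + r) \<partial>lborel)"
      by (subst nn_integral_real_affine[where c=1 and t=l]) auto
    also have "\<dots> = (\<integral>\<^sup>+r. (e l * g s (l + (\<alpha> + r)) * indicator {0..} l) * (g t (r - \<gamma>) * indicator {0<..} r) \<partial>lborel)"
    proof (rule nn_integral_cong)
      fix r :: real
      show "Q l (- (l + r)) * indicator {0<..} (l + r) * indicator {l<..} (l + r)
         = (e l * g s (l + (\<alpha> + r)) * indicator {0..} l) * (g t (r - \<gamma>) * indicator {0<..} r)"
      proof -
        have "- (l + r) - \<alpha> = - (l + (\<alpha> + r))" by simp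
        then have "g s (- (l + r) - \<alpha>) = g s (l + (\<alpha> + r))"
          by (simp only: g_def gauss_minus)
        then show ?thesis
          using g_minus[of t \<gamma> r] by (auto simp: Q_def ac_simps indicator_def)
      qed
    qed
    finally show "(\<integral>\<^sup>+y. Q l (- y) * indicator {0<..} y * indicator {l<..} y \<partial>lborel)
       = (\<integral>\<^sup>+r. (e l * g s (l + (\<alpha> + r)) * indicator {0..} l) * (g t (r - \<gamma>) * indicator {0<..} r) \<partial>lborel)" .
  qed
  also have "\<dots> = (\<integral>\<^sup>+r. \<integral>\<^sup>+l. (e l * g s (l + (\<alpha> + r)) * indicator {0..} l) * (g t (r - \<gamma>) * indicator {0<..} r) \<partial>lborel \<partial>lborel)"
    by (rule lborel_pair.Fubini') auto
  also have "\<dots> = (\<integral>\<^sup>+r. (ennreal (tail \<theta> s (\<alpha> + r)) * g t (r - \<gamma>)) * indicator {0<..} r \<partial>lborel)"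
    using s by (subst nn_integral_multc) (auto simp: tail[of s "\<alpha> + _"] mult.assoc[of "ennreal (tail _ _ _)"])
  also have "\<dots> = (\<integral>\<^sup>+r. ennreal (tail \<theta> s (\<alpha> + r) * gauss t (r - \<gamma>)) * indicator {0..} r \<partial>lborel)"
    using t by (simp add: nn_integral_Ioi_eq_Ici g_def ennreal_mult tail_nonneg)
  finally show ?thesis
    by (simp add: ennreal_mult tail_nonneg ac_simps)
qed


lemma integral_reflect_Ici:
  fixes f :: "real \<Rightarrow> real"
  assumes "integrable lborel f"
  shows "(\<integral>y. f y \<partial>lborel) = (\<integral>y. (f y + f (- y)) * indicator {0..} y \<partial>lborel)"
proof -
  have [measurable]: "f \<in> borel_measurable borel"
    using borel_measurable_integrable[OF assms] by simp
  have i: "integrable lborel (\<lambda>y. f y * indicator S y)" if "S \<in> sets borel" for S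
    using integrable_mult_indicator[OF _ assms, of S] that by (simp add: mult.commute)
  have m: "integrable lborel (\<lambda>y. f (- y))"
    using lborel_integrable_real_affine[OF assms, of "-1" 0] by simp
  have im: "integrable lborel (\<lambda>y. f (- y) * indicator {0..} y)"
    using integrable_mult_indicator[OF _ m, of "{0..}"] by (simp add: mult.commute)
  have "(\<integral>y. f y \<partial>lborel) = (\<integral>y. f y * indicator {0..} y + f y * indicator {..<0} y \<partial>lborel)"
    by (intro Bochner_Integration.integral_cong) (auto simp: indicator_def)
  also have "\<dots> = (\<integral>y. f y * indicator {0..} y \<partial>lborel) + (\<integral>y. f y * indicator {..<0} y \<partial>lborel)"
    by (intro Bochner_Integration.integral_add i) auto
  also have "(\<integral>y. f y * indicator {..<0} y \<partial>lborel) = (\<integral>y. f (- y) * indicator {..<0} (- y) \<partial>lborel)"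
    by (subst lborel_integral_real_affine[where c="-1" and t=0]) auto
  also have "\<dots> = (\<integral>y. f (- y) * indicator {0..} y \<partial>lborel)"
    by (intro integral_cong_AE eventually_mono[OF AE_lborel_singleton[of 0]]) (auto simp: indicator_def)
  also have "(\<integral>y. f y * indicator {0..} y \<partial>lborel) + \<dots> = (\<integral>y. (f y + f (- y)) * indicator {0..} y \<partial>lborel)"
    by (subst Bochner_Integration.integral_add[symmetric]) (auto intro!: i im simp: distrib_right)
  finally show ?thesis .
qed

lemma integrable_tail_abs:
  assumes "0 < t" "0 \<le> \<gamma>"
  shows "integrable lborel (\<lambda>y. tail \<theta> t (\<bar>y\<bar> + \<gamma>))"
proof (rule Bochner_Integration.integrable_bound)
  show "integrable lborel (\<lambda>y. exp (\<theta>\<^sup>2 * t / 2) * sqrt (2 * pi * t) * gauss t (y - 0))"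
    using assms by (intro integrable_mult_right integrable_gauss)
  have "tail \<theta> t (\<bar>y\<bar> + \<gamma>) \<le> exp (\<theta>\<^sup>2 * t / 2) * sqrt (2 * pi * t) * gauss t y" for y
  proof -
    have "tail \<theta> t (\<bar>y\<bar> + \<gamma>) \<le> exp (\<theta>\<^sup>2 * t / 2) * sqrt (2 * pi * t) * gauss t (\<bar>y\<bar> + \<gamma>)"
      using assms by (intro tail_le_gauss) auto
    also have "\<dots> \<le> exp (\<theta>\<^sup>2 * t / 2) * sqrt (2 * pi * t) * gauss t y"
      using assms by (intro mult_left_mono gauss_mono) auto
    finally show ?thesis .
  qed
  then show "AE y in lborel. norm (tail \<theta> t (\<bar>y\<bar> + \<gamma>)) \<le> norm (exp (\<theta>\<^sup>2 * t / 2) * sqrt (2 * pi * t) * gauss t (y - 0))"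
    using assms by (simp add: tail_nonneg)
qed auto

lemma tail_le_const: "0 < t \<Longrightarrow> 0 \<le> m \<Longrightarrow> tail \<theta> t m \<le> exp (\<theta>\<^sup>2 * t / 2)"
  by (rule order_trans[OF tail_le_exp]) (auto intro!: mult_left_le)

lemma integrable_mult_tail:
  assumes f: "integrable lborel f" and "0 < t" "0 \<le> \<gamma>"
  shows "integrable lborel (\<lambda>y. f y * tail \<theta> t (\<bar>y\<bar> + \<gamma>))"
proof (rule Bochner_Integration.integrable_bound)
  show "integrable lborel (\<lambda>y. f y * exp (\<theta>\<^sup>2 * t / 2))"
    using f by simp
  show "AE y in lborel. norm (f y * tail \<theta> t (\<bar>y\<bar> + \<gamma>)) \<le> norm (f y * exp (\<theta>\<^sup>2 * t / 2))"
    using assms by (auto simp: abs_mult tail_nonneg intro!: mult_left_mono tail_le_const)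
  show "(\<lambda>y. f y * tail \<theta> t (\<bar>y\<bar> + \<gamma>)) \<in> borel_measurable lborel"
    using borel_measurable_integrable[OF f] by measurable
qed

text \<open>Up to the factor -\<theta>, \<open>F\<close> collects the terms of
  \<open>ker \<theta> s a y * ker \<theta> t y c\<close> that contain a tail. Adding the values at
  \<open>y\<close> and \<open>- y\<close> produces \<open>U1 + U2\<close>, covered by
  \<open>nn_integral_gauss_tail\<close>, and \<open>V\<close>, which is the exact derivative of
  minus the product of two tails. The integral of \<open>V\<close> over the half line is therefore
  \<open>tail \<theta> s \<alpha> * tail \<theta> t \<gamma>\<close>, precisely the term by which
  \<open>U1 + U2\<close> falls short.\<close>

lemma integral_gauss_tail:
  fixes a c \<theta> :: real
  assumes s: "0 < s" and t: "0 < t"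
  defines "F \<equiv> \<lambda>y. gauss s (y - a) * tail \<theta> t (\<bar>y\<bar> + \<bar>c\<bar>) + gauss t (c - y) * tail \<theta> s (\<bar>y\<bar> + \<bar>a\<bar>)
                    - \<theta> * (tail \<theta> s (\<bar>y\<bar> + \<bar>a\<bar>) * tail \<theta> t (\<bar>y\<bar> + \<bar>c\<bar>))"
  shows "integrable lborel F" and "(\<integral>y. F y \<partial>lborel) = tail \<theta> (s + t) (\<bar>a\<bar> + \<bar>c\<bar>)"
proof -
  define \<alpha> \<gamma> where "\<alpha> = \<bar>a\<bar>" and "\<gamma> = \<bar>c\<bar>"
  have [simp]: "0 \<le> \<alpha>" "0 \<le> \<gamma>" by (auto simp: \<alpha>_def \<gamma>_def)
  have gt: "integrable lborel (\<lambda>y. gauss t (c - y))"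
    using integrable_gauss[OF t, of c] by (simp add: gauss_diff_commute)
  show F: "integrable lborel F"
    unfolding F_def using s t
    by (intro Bochner_Integration.integrable_add Bochner_Integration.integrable_diff integrable_mult_right integrable_mult_tail integrable_gauss gt integrable_tail_abs) auto
  define U1 U2 where "U1 y = gauss s (y - \<alpha>) * tail \<theta> t (y + \<gamma>)" and "U2 y = tail \<theta> s (\<alpha> + y) * gauss t (y - \<gamma>)" for y
  define V where "V y = gauss s (y + \<alpha>) * tail \<theta> t (y + \<gamma>) + tail \<theta> s (\<alpha> + y) * gauss t (y + \<gamma>)
     - 2 * \<theta> * (tail \<theta> s (\<alpha> + y) * tail \<theta> t (y + \<gamma>))" for y
  have [measurable]: "U1 \<in> borel_measurable borel" "U2 \<in> borel_measurable borel" "V \<in> borel_measurable borel"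
    unfolding U1_def U2_def V_def by auto
  have U_nonneg: "0 \<le> U1 y" "0 \<le> U2 y" for y
    using s t by (auto simp: U1_def U2_def tail_nonneg)
  have eq: "F y + F (- y) = U1 y + U2 y + V y" if "0 \<le> y" for y
  proof -
    have 1: "gauss s (y - a) + gauss s (- y - a) = gauss s (y - \<alpha>) + gauss s (y + \<alpha>)"
      using gauss_minus[of s "y + a"] gauss_minus[of s "y - a"] by (cases "a \<ge> 0") (auto simp: \<alpha>_def)
    have 2: "gauss t (c - y) + gauss t (c + y) = gauss t (y - \<gamma>) + gauss t (y + \<gamma>)"
      using gauss_minus[of t "y - c"] gauss_minus[of t "y + c"] by (cases "c \<ge> 0") (auto simp: \<gamma>_def add.commute)
    have "F y + F (- y) = (gauss s (y - a) + gauss s (- y - a)) * tail \<theta> t (y + \<gamma>)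
       + (gauss t (c - y) + gauss t (c + y)) * tail \<theta> s (y + \<alpha>) - 2 * (\<theta> * (tail \<theta> s (y + \<alpha>) * tail \<theta> t (y + \<gamma>)))"
      using that by (simp add: F_def \<alpha>_def[symmetric] \<gamma>_def[symmetric] algebra_simps)
    then show ?thesis unfolding 1 2 by (simp add: U1_def U2_def V_def algebra_simps)
  qed
  have nn: "(\<integral>\<^sup>+y. ennreal ((U1 y + U2 y) * indicator {0..} y) \<partial>lborel) + ennreal (tail \<theta> s \<alpha> * tail \<theta> t \<gamma>) = ennreal (tail \<theta> (s + t) (\<alpha> + \<gamma>))"
  proof -
    have "(\<integral>\<^sup>+y. ennreal ((U1 y + U2 y) * indicator {0..} y) \<partial>lborel)
        = (\<integral>\<^sup>+y. ennreal (U1 y) * indicator {0..} y + ennreal (U2 y) * indicator {0..} y \<partial>lborel)"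
      using U_nonneg by (intro nn_integral_cong) (auto simp: indicator_def)
    also have "\<dots> = (\<integral>\<^sup>+y. ennreal (U1 y) * indicator {0..} y \<partial>lborel) + (\<integral>\<^sup>+y. ennreal (U2 y) * indicator {0..} y \<partial>lborel)"
      by (rule nn_integral_add) auto
    finally show ?thesis
      using nn_integral_gauss_tail[OF s t, of \<alpha> \<theta> \<gamma>] by (simp add: U1_def U2_def)
  qed
  define R where "R = tail \<theta> (s + t) (\<alpha> + \<gamma>) - tail \<theta> s \<alpha> * tail \<theta> t \<gamma>"
  \<comment> \<open>In \<open>ennreal\<close> the product can be moved to the other side only once
    it is known not to exceed the total; the same inequality shows that \<open>R\<close> is
    nonnegative.\<close>
  have le: "ennreal (tail \<theta> s \<alpha> * tail \<theta> t \<gamma>) \<le> ennreal (tail \<theta> (s + t) (\<alpha> + \<gamma>))"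
    unfolding nn[symmetric] by simp
  then have R0: "0 \<le> R"
    by (simp add: R_def tail_nonneg)
  have "(\<integral>\<^sup>+y. ennreal ((U1 y + U2 y) * indicator {0..} y) \<partial>lborel) = ennreal R"
  proof -
    have "(\<integral>\<^sup>+y. ennreal ((U1 y + U2 y) * indicator {0..} y) \<partial>lborel) + ennreal (tail \<theta> s \<alpha> * tail \<theta> t \<gamma>)
       = ennreal R + ennreal (tail \<theta> s \<alpha> * tail \<theta> t \<gamma>)"
      unfolding nn using R0 by (subst ennreal_plus[symmetric]) (auto simp: R_def tail_nonneg)
    then show ?thesis by (simp add: add.commute[of _ "ennreal (tail \<theta> s \<alpha> * _)"] ennreal_add_left_cancel)
  qed
  then have U: "has_bochner_integral lborel (\<lambda>y. (U1 y + U2 y) * indicator {0..} y) R"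
    using U_nonneg R0 by (intro has_bochner_integral_nn_integral) auto
  \<comment> \<open>\<open>V\<close> has no definite sign, so its integrability is read off from
    that of the symmetrised \<open>F\<close> and of \<open>U1 + U2\<close>.\<close>
  have Vi: "integrable lborel (\<lambda>y. V y * indicator {0..} y)"
  proof -
    have "integrable lborel (\<lambda>y. (F y + F (- y)) * indicator {0..} y)"
    proof -
      have "integrable lborel (\<lambda>y. F y + F (- y))"
        using lborel_integrable_real_affine[OF F, of "-1" 0] F by simp
      from integrable_mult_indicator[OF _ this, of "{0..}"] show ?thesis by (simp add: mult.commute)
    qed
    then have "integrable lborel (\<lambda>y. (F y + F (- y)) * indicator {0..} y - (U1 y + U2 y) * indicator {0..} y)"
      using U by (auto simp: has_bochner_integral_iff)
    also have "(\<lambda>y. (F y + F (- y)) * indicator {0..} y - (U1 y + U2 y) * indicator {0..} y) = (\<lambda>y. V y * indicator {0..} y)"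
      using eq by (auto simp: indicator_def fun_eq_iff)
    finally show ?thesis .
  qed
  have V: "(\<integral>y. V y * indicator {0..} y \<partial>lborel) = tail \<theta> s \<alpha> * tail \<theta> t \<gamma>"
  proof -
    define W where "W y = - (tail \<theta> s (\<alpha> + y) * tail \<theta> t (y + \<gamma>))" for y
    have dW: "(W has_real_derivative V y) (at y)" for y
      unfolding W_def V_def using s t
      by (auto intro!: derivative_eq_intros simp: algebra_simps)
    have set: "set_integrable lborel {0<..} V"
      unfolding set_integrable_def
      by (rule Bochner_Integration.integrable_bound[OF Vi]) (auto simp: indicator_def)
    have cV: "isCont V y" for y
      unfolding V_def using s t
      by (intro continuous_intros DERIV_isCont[OF DERIV_gauss_space] DERIV_isCont[OF DERIV_tail_space])
         (auto intro!: derivative_eq_intros)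
    have "(LBINT y=ereal 0..\<infinity>. V y) = 0 - W 0"
    proof (rule interval_integral_FTC_integrable)
      show "(W has_vector_derivative V y) (at y)" for y
        using dW by (simp add: has_real_derivative_iff_has_vector_derivative)
      show "set_integrable lborel (einterval (ereal 0) \<infinity>) V" using set by simp
      have "((\<lambda>y. - (tail \<theta> s (\<alpha> + y) * tail \<theta> t (\<gamma> + y))) \<longlongrightarrow> - (0 * 0)) at_top"
        using s t by (intro tendsto_intros filterlim_compose[OF tendsto_tail]
          filterlim_tendsto_add_at_top[OF tendsto_const] filterlim_ident)
      then show "((W \<circ> real_of_ereal) \<longlongrightarrow> 0) (at_left \<infinity>)"
        by (simp add: ereal_tendsto_simps W_def[abs_def] add.commute)
      show "((W \<circ> real_of_ereal) \<longlongrightarrow> W 0) (at_right (ereal 0))"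
        using DERIV_isCont[OF dW[of 0]]
        by (simp add: ereal_tendsto_simps isCont_def filterlim_at_split)
    qed (use cV in auto)
    also have "(LBINT y=ereal 0..\<infinity>. V y) = (LBINT y:{0<..}. V y)"
      by (rule interval_integral_to_infinity_eq)
    also have "\<dots> = (\<integral>y. V y * indicator {0..} y \<partial>lborel)"
      unfolding set_lebesgue_integral_def
      by (intro integral_cong_AE eventually_mono[OF AE_lborel_singleton[of 0]]) (auto simp: indicator_def)
    finally show ?thesis by (simp add: W_def)
  qed
  have "(\<integral>y. F y \<partial>lborel) = (\<integral>y. (F y + F (- y)) * indicator {0..} y \<partial>lborel)"
    by (rule integral_reflect_Ici[OF F])
  also have "\<dots> = (\<integral>y. (U1 y + U2 y) * indicator {0..} y + V y * indicator {0..} y \<partial>lborel)"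
    using eq by (intro Bochner_Integration.integral_cong) (auto simp: indicator_def)
  also have "\<dots> = R + tail \<theta> s \<alpha> * tail \<theta> t \<gamma>"
    using U V Vi by (subst Bochner_Integration.integral_add) (auto simp: has_bochner_integral_iff)
  finally show "(\<integral>y. F y \<partial>lborel) = tail \<theta> (s + t) (\<bar>a\<bar> + \<bar>c\<bar>)"
    by (simp add: R_def \<alpha>_def \<gamma>_def)
qed

theorem ker_chapman_kolmogorov:
  assumes s: "0 < s" and t: "0 < t"
  shows "has_bochner_integral lborel (\<lambda>y. ker \<theta> s a y * ker \<theta> t y c) (ker \<theta> (s + t) a c)"
proof -
  define F where "F y = gauss s (y - a) * tail \<theta> t (\<bar>y\<bar> + \<bar>c\<bar>) + gauss t (c - y) * tail \<theta> s (\<bar>y\<bar> + \<bar>a\<bar>)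
                    - \<theta> * (tail \<theta> s (\<bar>y\<bar> + \<bar>a\<bar>) * tail \<theta> t (\<bar>y\<bar> + \<bar>c\<bar>))" for y
  note F = integral_gauss_tail[OF s t, of a \<theta> c, folded F_def[abs_def]]
  have "has_bochner_integral lborel (\<lambda>y. gauss s (y - a) * gauss t (c - y) - \<theta> * F y)
      (gauss (s + t) (c - a) - \<theta> * tail \<theta> (s + t) (\<bar>a\<bar> + \<bar>c\<bar>))"
    using F gauss_integrable_mult[OF s t, of a c]
    by (intro has_bochner_integral_diff has_bochner_integral_mult_right) (auto simp: has_bochner_integral_iff)
  also have "(\<lambda>y. gauss s (y - a) * gauss t (c - y) - \<theta> * F y) = (\<lambda>y. ker \<theta> s a y * ker \<theta> t y c)"
    using s t by (simp add: fun_eq_iff ker_eq F_def algebra_simps)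
  finally show ?thesis using s t by (simp add: ker_eq)
qed

lemma nn_integral_ker:
  assumes s: "0 < s" and t: "0 < t"
  shows "(\<integral>\<^sup>+y. ennreal (ker \<theta> s a y) * ennreal (ker \<theta> t y c) \<partial>lborel) = ennreal (ker \<theta> (s + t) a c)"
proof -
  note ck = ker_chapman_kolmogorov[OF s t, of \<theta> a c]
  have "(\<integral>\<^sup>+y. ennreal (ker \<theta> s a y * ker \<theta> t y c) \<partial>lborel) = ennreal (ker \<theta> (s + t) a c)"
    using ck s t by (subst nn_integral_eq_integral) (auto simp: has_bochner_integral_iff)
  then show ?thesis using s t by (simp add: ennreal_mult)
qed

section \<open>Elementary bounds: Taylor remainders, second differences, integrals over short
  intervals\<close>

lemma deriv_bound_0:
  fixes \<phi> \<phi>' :: "real \<Rightarrow> real"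
  assumes "\<And>e. \<bar>e\<bar> \<le> \<bar>d\<bar> \<Longrightarrow> (\<phi> has_real_derivative \<phi>' e) (at e)"
    and "\<And>e. \<bar>e\<bar> \<le> \<bar>d\<bar> \<Longrightarrow> \<bar>\<phi>' e\<bar> \<le> C"
  shows "\<bar>\<phi> d - \<phi> 0\<bar> \<le> C * \<bar>d\<bar>"
proof -
  have "norm (\<phi> d - \<phi> 0) \<le> C * norm (d - 0)"
    by (rule field_differentiable_bound[where S="{-\<bar>d\<bar>..\<bar>d\<bar>}" and f'=\<phi>'])
      (auto intro!: has_field_derivative_at_within assms)
  then show ?thesis by simp
qed

text \<open>The mean value inequality applied twice to the Lipschitz bound on \<open>f2\<close>. The
  factor 1/6 is given up, as only the cubic order of the error will matter.\<close>

lemma taylor2_bound: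
  fixes f f1 f2 :: "real \<Rightarrow> real"
  assumes f: "\<And>y. (f has_real_derivative f1 y) (at y)"
    and f1: "\<And>y. (f1 has_real_derivative f2 y) (at y)"
    and L: "\<And>u v. \<bar>f2 u - f2 v\<bar> \<le> L * \<bar>u - v\<bar>"
  shows "\<bar>f (y + d) - f y - f1 y * d - f2 y * d\<^sup>2 / 2\<bar> \<le> L * \<bar>d\<bar> ^ 3"
proof -
  have L0: "0 \<le> L" using L[of 0 1] by simp
  have 1: "\<bar>f1 (y + e) - f1 y - f2 y * e\<bar> \<le> L * \<bar>e\<bar> * \<bar>e\<bar>" for e
  proof -
    have "\<bar>(f1 (y + e) - f1 y - f2 y * e) - (f1 (y + 0) - f1 y - f2 y * 0)\<bar> \<le> L * \<bar>e\<bar> * \<bar>e\<bar>"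
    proof (rule deriv_bound_0[where \<phi>'="\<lambda>e. f2 (y + e) - f2 y"])
      show "((\<lambda>e. f1 (y + e) - f1 y - f2 y * e) has_real_derivative f2 (y + e) - f2 y) (at e)" for e
        by (auto intro!: derivative_eq_intros DERIV_chain2[OF f1])
      fix e' assume "\<bar>e'\<bar> \<le> \<bar>e\<bar>"
      have "\<bar>f2 (y + e') - f2 y\<bar> \<le> L * \<bar>e'\<bar>" using L[of "y + e'" y] by simp
      also have "\<dots> \<le> L * \<bar>e\<bar>" using \<open>\<bar>e'\<bar> \<le> \<bar>e\<bar>\<close> L0 by (rule mult_left_mono)
      finally show "\<bar>f2 (y + e') - f2 y\<bar> \<le> L * \<bar>e\<bar>" .
    qed
    then show ?thesis by simp
  qed
  have "\<bar>(f (y + d) - f y - f1 y * d - f2 y * d\<^sup>2 / 2) - (f (y + 0) - f y - f1 y * 0 - f2 y * 0\<^sup>2 / 2)\<bar> \<le> L * \<bar>d\<bar> * \<bar>d\<bar> * \<bar>d\<bar>"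
  proof (rule deriv_bound_0[where \<phi>'="\<lambda>e. f1 (y + e) - f1 y - f2 y * e"])
    show "((\<lambda>d. f (y + d) - f y - f1 y * d - f2 y * d\<^sup>2 / 2) has_real_derivative f1 (y + e) - f1 y - f2 y * e) (at e)" for e
      by (auto intro!: derivative_eq_intros DERIV_chain2[OF f])
    fix e' assume "\<bar>e'\<bar> \<le> \<bar>d\<bar>"
    then have "L * \<bar>e'\<bar> * \<bar>e'\<bar> \<le> L * \<bar>d\<bar> * \<bar>d\<bar>" using L0 by (intro mult_mono) auto
    with 1[of e'] show "\<bar>f1 (y + e') - f1 y - f2 y * e'\<bar> \<le> L * \<bar>d\<bar> * \<bar>d\<bar>" by linarith
  qed
  then show ?thesis by (simp add: power3_eq_cube mult.assoc)
qed

text \<open>An increment of order h^(3/2) forces the derivative to vanish everywhere. This replaces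
  summation over partitions in the proofs of Dynkin's formula: the exponent 3/2 is the error left by
  a second-order expansion along a Brownian increment.\<close>

lemma constant_if_local_bound:
  fixes \<Phi> :: "real \<Rightarrow> real"
  assumes "\<And>s t. 0 \<le> s \<Longrightarrow> s < t \<Longrightarrow> t \<le> T \<Longrightarrow> \<bar>\<Phi> t - \<Phi> s\<bar> \<le> C * ((t - s) * sqrt (t - s))"
    and "t \<in> {0..T}"
  shows "\<Phi> t = \<Phi> 0"
proof -
  have b: "\<bar>\<Phi> y - \<Phi> u\<bar> \<le> C * (\<bar>y - u\<bar> * sqrt \<bar>y - u\<bar>)" if "y \<in> {0..T}" "u \<in> {0..T}" for y u
    using assms(1)[of y u] assms(1)[of u y] that by (cases y u rule: linorder_cases) (auto simp: abs_minus_commute)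
  have "\<exists>c. \<forall>u\<in>{0..T}. \<Phi> u = c"
  proof (rule has_field_derivative_zero_constant)
    fix u assume u: "u \<in> {0..T}"
    have "((\<lambda>y. (\<Phi> y - \<Phi> u) / (y - u)) \<longlongrightarrow> 0) (at u within {0..T})"
    proof (rule Lim_null_comparison)
      have "((\<lambda>y. C * sqrt \<bar>y - u\<bar>) \<longlongrightarrow> C * sqrt \<bar>u - u\<bar>) (at u within {0..T})"
        by (intro tendsto_intros)
      then show "((\<lambda>y. C * sqrt \<bar>y - u\<bar>) \<longlongrightarrow> 0) (at u within {0..T})" by simp
      have "norm ((\<Phi> y - \<Phi> u) / (y - u)) \<le> C * sqrt \<bar>y - u\<bar>" if "y \<in> {0..T}" "y \<noteq> u" for y
        using b[OF that(1) u] that(2) by (simp add: abs_divide divide_le_eq ac_simps)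
      then show "\<forall>\<^sub>F y in at u within {0..T}. norm ((\<Phi> y - \<Phi> u) / (y - u)) \<le> C * sqrt \<bar>y - u\<bar>"
        by (auto simp: eventually_at_filter intro!: always_eventually)
    qed
    then show "(\<Phi> has_field_derivative 0) (at u within {0..T})"
      by (simp add: has_field_derivative_iff)
  qed simp
  then show ?thesis using assms(2) by auto
qed

lemma set_integral_Icc_add:
  fixes f :: "real \<Rightarrow> real"
  assumes "set_integrable lborel {a..c} f" "a \<le> b" "b \<le> c"
  shows "(LINT r:{a..c}|lborel. f r) = (LINT r:{a..b}|lborel. f r) + (LINT r:{b..c}|lborel. f r)"
proof -
  have "(LINT r:{a..c}|lborel. f r) = (LINT r:{a..b} \<union> {b<..c}|lborel. f r)"
    using assms by (intro arg_cong2[where f="set_lebesgue_integral lborel"]) auto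
  also have "\<dots> = (LINT r:{a..b}|lborel. f r) + (LINT r:{b<..c}|lborel. f r)"
    using assms by (intro set_integral_Un) (auto intro!: set_integrable_subset[OF assms(1)])
  also have "(LINT r:{b<..c}|lborel. f r) = (LINT r:{b..c}|lborel. f r)"
    unfolding set_lebesgue_integral_def
  proof (intro integral_cong_AE eventually_mono[OF AE_lborel_singleton[of b]])
    have "set_integrable lborel {b<..c} f" "set_integrable lborel {b..c} f"
      using assms by (auto intro!: set_integrable_subset[OF assms(1)])
    then show "(\<lambda>x. indicat_real {b<..c} x *\<^sub>R f x) \<in> borel_measurable lborel"
      "(\<lambda>x. indicat_real {b..c} x *\<^sub>R f x) \<in> borel_measurable lborel"
      by (auto simp: set_integrable_def dest: borel_measurable_integrable)
  qed (auto simp: indicator_def)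
  finally show ?thesis .
qed

lemma set_integrable_bounded_Icc:
  fixes f :: "real \<Rightarrow> real"
  assumes [measurable]: "f \<in> borel_measurable borel" and "\<And>r. \<bar>f r\<bar> \<le> C"
  shows "set_integrable lborel {s..t} f"
  unfolding set_integrable_def
  by (rule integrableI_bounded_set[where A="{s..t}" and B=C])
    (use assms(2) emeasure_lborel_Icc_eq[of s t] in \<open>auto simp: indicator_def intro!: always_eventually\<close>)

lemma set_integral_abs_le:
  fixes f :: "real \<Rightarrow> real"
  assumes "set_integrable lborel {s..t} f" and "\<And>r. r \<in> {s..t} \<Longrightarrow> \<bar>f r\<bar> \<le> C" and "s \<le> t"
  shows "\<bar>LINT r:{s..t}|lborel. f r\<bar> \<le> C * (t - s)"
proof -
  have "norm (LINT r:{s..t}|lborel. f r) \<le> (LINT r:{s..t}|lborel. C)"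
    unfolding set_lebesgue_integral_def
    by (rule Bochner_Integration.integral_norm_bound_integral)
      (use assms in \<open>auto simp: set_integrable_def indicator_def set_integrable_bounded_Icc[of "\<lambda>_. C" "\<bar>C\<bar>", unfolded set_integrable_def indicator_def, simplified]\<close>)
  also have "\<dots> = C * (t - s)" using assms(3) by (simp add: set_lebesgue_integral_def)
  finally show ?thesis by simp
qed

lemma second_difference_bound:
  fixes F F1 :: "real \<Rightarrow> real"
  assumes F: "\<And>y. (F has_real_derivative F1 y) (at y)" and L: "\<And>u v. \<bar>F1 u - F1 v\<bar> \<le> C * \<bar>u - v\<bar>"
  shows "\<bar>F (y + d) - 2 * F y + F (y - d)\<bar> \<le> 2 * C * d\<^sup>2"
proof -
  have C0: "0 \<le> C" using L[of 0 1] by simp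
  have "\<bar>(F (y + d) - 2 * F y + F (y - d)) - (F (y + 0) - 2 * F y + F (y - 0))\<bar> \<le> (2 * C * \<bar>d\<bar>) * \<bar>d\<bar>"
  proof (rule deriv_bound_0[where \<phi>'="\<lambda>e. F1 (y + e) - F1 (y - e)"])
    show "((\<lambda>e. F (y + e) - 2 * F y + F (y - e)) has_real_derivative F1 (y + e) - F1 (y - e)) (at e)" for e
      by (auto intro!: derivative_eq_intros DERIV_chain2[OF F])
    fix e :: real assume e: "\<bar>e\<bar> \<le> \<bar>d\<bar>"
    have "\<bar>F1 (y + e) - F1 (y - e)\<bar> \<le> C * (2 * \<bar>e\<bar>)" using L[of "y + e" "y - e"] by simp
    also have "\<dots> \<le> C * (2 * \<bar>d\<bar>)" using e C0 by (intro mult_left_mono) auto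
    finally show "\<bar>F1 (y + e) - F1 (y - e)\<bar> \<le> 2 * C * \<bar>d\<bar>" by simp
  qed
  then show ?thesis by (simp add: mult.assoc power2_eq_square[symmetric])
qed

text \<open>As a function of the step \<open>e\<close>, the second difference has derivative
  \<open>F1 (y + e) - F1 (y - e)\<close>, which is \<open>2 * D * e\<close> up to a small multiple
  of \<open>e\<close>. The second derivative is required at the one point \<open>y\<close> only,
  which allows the lemma to be used off 0 for functions whose second derivative jumps there.\<close>

lemma second_difference_tendsto:
  fixes F F1 :: "real \<Rightarrow> real"
  assumes F: "\<And>y. (F has_real_derivative F1 y) (at y)" and D: "(F1 has_real_derivative D) (at y)"
    and d: "d \<longlonglongrightarrow> 0" "\<And>n. d n \<noteq> 0"
  shows "(\<lambda>n. (F (y + d n) - 2 * F y + F (y - d n)) / (d n)\<^sup>2) \<longlonglongrightarrow> D"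
proof (rule LIMSEQ_I)
  fix \<epsilon> :: real assume \<epsilon>: "0 < \<epsilon>"
  have "(\<lambda>h. (F1 (y + h) - F1 y) / h) \<midarrow>0\<rightarrow> D" using D by (simp add: DERIV_def)
  then obtain \<delta> where \<delta>: "0 < \<delta>" and lim: "\<And>h. h \<noteq> 0 \<Longrightarrow> \<bar>h\<bar> < \<delta> \<Longrightarrow> \<bar>(F1 (y + h) - F1 y) / h - D\<bar> < \<epsilon> / 4"
    using LIM_D[of "\<lambda>h. (F1 (y + h) - F1 y) / h" D 0 "\<epsilon> / 4"] \<epsilon> by auto
  have near: "\<bar>F1 (y + h) - F1 y - D * h\<bar> \<le> \<epsilon> / 4 * \<bar>h\<bar>" if "\<bar>h\<bar> < \<delta>" for h
  proof (cases "h = 0")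
    case False
    have "F1 (y + h) - F1 y - D * h = ((F1 (y + h) - F1 y) / h - D) * h" using False by (simp add: field_simps)
    then have "\<bar>F1 (y + h) - F1 y - D * h\<bar> = \<bar>(F1 (y + h) - F1 y) / h - D\<bar> * \<bar>h\<bar>" by (simp only: abs_mult)
    also have "\<dots> \<le> \<epsilon> / 4 * \<bar>h\<bar>" using lim[OF False that] by (intro mult_right_mono) auto
    finally show ?thesis .
  qed simp
  obtain n0 where n0: "\<And>n. n \<ge> n0 \<Longrightarrow> \<bar>d n\<bar> < \<delta>"
    using LIMSEQ_D[OF d(1) \<delta>] by auto
  show "\<exists>no. \<forall>n\<ge>no. norm ((F (y + d n) - 2 * F y + F (y - d n)) / (d n)\<^sup>2 - D) < \<epsilon>"
  proof (intro exI allI impI)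
    fix n assume "n \<ge> n0"
    then have dn: "\<bar>d n\<bar> < \<delta>" by (rule n0)
    have "\<bar>(F (y + d n) - 2 * F y + F (y - d n) - D * (d n)\<^sup>2) - (F (y + 0) - 2 * F y + F (y - 0) - D * 0\<^sup>2)\<bar> \<le> (\<epsilon> / 2 * \<bar>d n\<bar>) * \<bar>d n\<bar>"
    proof (rule deriv_bound_0[where \<phi>'="\<lambda>e. F1 (y + e) - F1 (y - e) - 2 * D * e"])
      show "((\<lambda>e. F (y + e) - 2 * F y + F (y - e) - D * e\<^sup>2) has_real_derivative F1 (y + e) - F1 (y - e) - 2 * D * e) (at e)" for e
        by (auto intro!: derivative_eq_intros DERIV_chain2[OF F])
      fix e assume e: "\<bar>e\<bar> \<le> \<bar>d n\<bar>"
      then have "\<bar>F1 (y + e) - F1 y - D * e\<bar> \<le> \<epsilon> / 4 * \<bar>e\<bar>" "\<bar>F1 (y - e) - F1 y + D * e\<bar> \<le> \<epsilon> / 4 * \<bar>e\<bar>"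
        using near[of e] near[of "- e"] dn by auto
      moreover have "\<epsilon> / 4 * \<bar>e\<bar> \<le> \<epsilon> / 4 * \<bar>d n\<bar>" using e \<epsilon> by (intro mult_left_mono) auto
      ultimately show "\<bar>F1 (y + e) - F1 (y - e) - 2 * D * e\<bar> \<le> \<epsilon> / 2 * \<bar>d n\<bar>" by linarith
    qed
    then have "\<bar>F (y + d n) - 2 * F y + F (y - d n) - D * (d n)\<^sup>2\<bar> \<le> \<epsilon> / 2 * (d n)\<^sup>2"
      by (simp add: mult.assoc power2_eq_square)
    then have "\<bar>F (y + d n) - 2 * F y + F (y - d n) - D * (d n)\<^sup>2\<bar> / (d n)\<^sup>2 \<le> \<epsilon> / 2 * (d n)\<^sup>2 / (d n)\<^sup>2"
      by (intro divide_right_mono) auto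
    moreover have "\<bar>F (y + d n) - 2 * F y + F (y - d n) - D * (d n)\<^sup>2\<bar> / (d n)\<^sup>2 = \<bar>(F (y + d n) - 2 * F y + F (y - d n)) / (d n)\<^sup>2 - D\<bar>"
    proof -
      have "(F (y + d n) - 2 * F y + F (y - d n)) / (d n)\<^sup>2 - D = (F (y + d n) - 2 * F y + F (y - d n) - D * (d n)\<^sup>2) / (d n)\<^sup>2"
        using d(2)[of n] by (simp add: diff_divide_distrib)
      then show ?thesis by (simp only: abs_divide abs_power2)
    qed
    ultimately show "norm ((F (y + d n) - 2 * F y + F (y - d n)) / (d n)\<^sup>2 - D) < \<epsilon>"
      using d(2)[of n] \<epsilon> by simp
  qed
qed

lemma ex_antiderivative:
  fixes f :: "real \<Rightarrow> real"
  assumes "continuous_on UNIV f"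
  shows "\<exists>p. \<forall>y. (p has_real_derivative f y) (at y)"
proof (intro exI allI)
  fix y :: real
  define R where "R = \<bar>y\<bar> + 1"
  have "((\<lambda>u. LBINT z=ereal 0..ereal u. f z) has_vector_derivative f y) (at y within {-R..R})"
    by (rule interval_integral_FTC2) (auto simp: R_def intro: continuous_on_subset[OF assms])
  moreover have "at y within {-R..R} = at y" by (rule at_within_interior) (auto simp: R_def interior_atLeastAtMost_real)
  ultimately show "((\<lambda>u. LBINT z=ereal 0..ereal u. f z) has_real_derivative f y) (at y)"
    by (simp add: has_real_derivative_iff_has_vector_derivative)
qed

lemma cube_le: "\<bar>u + v\<bar> ^ 3 \<le> 4 * (\<bar>u\<bar> ^ 3 + \<bar>v\<bar> ^ 3)" for u v :: real
proof -
  define p q where "p = \<bar>u\<bar>" and "q = \<bar>v\<bar>"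
  have pq: "0 \<le> p" "0 \<le> q" by (auto simp: p_def q_def)
  have "\<bar>u + v\<bar> ^ 3 \<le> (p + q) ^ 3" unfolding p_def q_def by (intro power_mono) auto
  also have "\<dots> = 4 * (p ^ 3 + q ^ 3) - 3 * ((p + q) * (p - q)\<^sup>2)"
    by (simp add: power2_eq_square power3_eq_cube algebra_simps)
  also have "\<dots> \<le> 4 * (p ^ 3 + q ^ 3)" using pq by simp
  finally show ?thesis by (simp add: p_def q_def)
qed

text \<open>The arithmetic-geometric mean inequality with weight \<open>sqrt h\<close>. It replaces
  an odd absolute moment of a Brownian increment by its second and fourth moments, which keep the
  right order h^(3/2) with this weight.\<close>

lemma cube_abs_le: "0 < h \<Longrightarrow> \<bar>w\<bar> ^ 3 \<le> (sqrt h * w\<^sup>2 + w ^ 4 / sqrt h) / 2" for w h :: real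
proof -
  assume h: "0 < h"
  have "0 \<le> w\<^sup>2 * ((\<bar>w\<bar> - sqrt h)\<^sup>2 / sqrt h)" using h by simp
  also have "(\<bar>w\<bar> - sqrt h)\<^sup>2 / sqrt h = w\<^sup>2 / sqrt h + sqrt h - 2 * \<bar>w\<bar>"
    using h by (simp add: power2_diff diff_divide_distrib add_divide_distrib real_div_sqrt)
  also have "w\<^sup>2 * (w\<^sup>2 / sqrt h + sqrt h - 2 * \<bar>w\<bar>) = sqrt h * w\<^sup>2 + w ^ 4 / sqrt h - 2 * \<bar>w\<bar> ^ 3"
    by (simp add: algebra_simps power3_eq_cube power2_eq_square power4_eq_xxxx abs_if)
  finally show ?thesis by simp
qed

lemma sq_abs_le: "0 < h \<Longrightarrow> \<bar>w\<bar> \<le> (sqrt h + w\<^sup>2 / sqrt h) / 2" for w h :: real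
proof -
  assume h: "0 < h"
  have "0 \<le> (\<bar>w\<bar> - sqrt h)\<^sup>2 / sqrt h" using h by simp
  also have "\<dots> = w\<^sup>2 / sqrt h + sqrt h - 2 * \<bar>w\<bar>"
    using h by (simp add: power2_diff diff_divide_distrib add_divide_distrib real_div_sqrt)
  finally show ?thesis by simp
qed

lemma half_sum_abs: "u = 2 * q + r \<Longrightarrow> 0 \<le> r \<Longrightarrow> \<bar>u / 2\<bar> \<le> \<bar>q\<bar> + r" for u q r :: real
proof -
  assume "u = 2 * q + r" and r: "0 \<le> r"
  then have u: "u / 2 = q + r / 2" by simp
  have "\<bar>u / 2\<bar> \<le> \<bar>q\<bar> + \<bar>r / 2\<bar>" unfolding u by (rule abs_triangle_ineq)
  also have "\<bar>r / 2\<bar> \<le> r" using r by simp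
  finally show "\<bar>u / 2\<bar> \<le> \<bar>q\<bar> + r" by simp
qed

section \<open>A continuous version of the solution and the moments of its increments\<close>

locale sde =
  fixes P :: "'b measure" and F T b x W X and M :: real
  assumes T: "0 < T" and sol: "sde_solution P F T b x W X"
    and b_measurable [measurable]: "b \<in> borel_measurable borel" and b_bound: "\<And>y. \<bar>b y\<bar> \<le> M"
begin

lemma M_nonneg: "0 \<le> M" using b_bound[of 0] by simp

lemma bm: "brownian_motion P F T W" using sol by (simp add: sde_solution_def)

sublocale prob_space P using bm by (simp add: brownian_motion_def)

sublocale pair: pair_sigma_finite lborel P ..

lemma X_measurable: "t \<in> {0..T} \<Longrightarrow> X t \<in> borel_measurable (F t)"
  and F_sub: "t \<in> {0..T} \<Longrightarrow> subalgebra P (F t)"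
  and W_measurable: "t \<in> {0..T} \<Longrightarrow> W t \<in> borel_measurable P"
  using sol bm by (auto simp: sde_solution_def brownian_motion_def intro: measurable_from_subalg)

text \<open>\<open>X\<close> has continuous paths on \<open>{0..T}\<close> only almost surely.
  Setting the paths to zero on a null set and clamping time to \<open>{0..T}\<close> gives a process
  that is continuous for every outcome and all times, hence jointly measurable. The null set need
  not lie in the filtration, so adaptedness may be lost and is later taken from \<open>X\<close>
  itself (\<open>W_indep\<close>).\<close>

lemma ex_Z: "\<exists>Z. (\<forall>t. Z t \<in> borel_measurable P) \<and> (\<forall>\<omega>. continuous_on UNIV (\<lambda>t. Z t \<omega>)) \<and>
   (AE \<omega> in P. \<forall>t\<in>{0..T}. X t \<omega> = Z t \<omega>)"
proof -
  have "AE \<omega> in P. continuous_on {0..T} (\<lambda>t. X t \<omega>)" using sol by (simp add: sde_solution_def)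
  then obtain A where A: "A \<in> null_sets P" "{\<omega>\<in>space P. \<not> continuous_on {0..T} (\<lambda>t. X t \<omega>)} \<subseteq> A"
    by (auto elim!: AE_E simp: null_sets_def)
  define Z where "Z t \<omega> = (if \<omega> \<in> space P - A then X (max 0 (min t T)) \<omega> else 0)" for t \<omega>
  have "Z t \<in> borel_measurable P" for t
  proof -
    have "X (max 0 (min t T)) \<in> borel_measurable P"
      using T by (intro measurable_from_subalg[OF F_sub X_measurable]) auto
    then show ?thesis unfolding Z_def[abs_def]
      using A by (intro measurable_If_set) auto
  qed
  moreover have "continuous_on UNIV (\<lambda>t. Z t \<omega>)" for \<omega>
  proof (cases "\<omega> \<in> space P - A")
    case True
    then have c: "continuous_on {0..T} (\<lambda>t. X t \<omega>)" using A by auto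
    have "continuous_on UNIV (\<lambda>t. X (max 0 (min t T)) \<omega>)"
      by (rule continuous_on_compose2[OF c]) (use T in \<open>auto intro!: continuous_intros\<close>)
    then show ?thesis using True by (simp add: Z_def)
  qed (auto simp: Z_def)
  moreover have "AE \<omega> in P. \<forall>t\<in>{0..T}. X t \<omega> = Z t \<omega>"
    using AE_not_in[OF A(1)] AE_space by eventually_elim (auto simp: Z_def min_def max_def)
  ultimately show ?thesis by blast
qed

definition "Z = (SOME Z. (\<forall>t. Z t \<in> borel_measurable P) \<and> (\<forall>\<omega>. continuous_on UNIV (\<lambda>t. Z t \<omega>)) \<and>
   (AE \<omega> in P. \<forall>t\<in>{0..T}. X t \<omega> = Z t \<omega>))"

lemma Z_measurable [measurable]: "Z t \<in> borel_measurable P"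
  and Z_continuous: "continuous_on UNIV (\<lambda>t. Z t \<omega>)"
  and Z_eq: "AE \<omega> in P. \<forall>t\<in>{0..T}. X t \<omega> = Z t \<omega>"
  using someI_ex[OF ex_Z, folded Z_def] by auto

lemma Z_path_measurable [measurable]: "(\<lambda>t. Z t \<omega>) \<in> borel_measurable borel"
  by (rule borel_measurable_continuous_onI[OF Z_continuous])

text \<open>Rounding the time down to a lattice leaves countably many values of it, so each
  approximation is measurable; path continuity gives the limit.\<close>

lemma Z_joint: "(\<lambda>p. Z (fst p) (snd p)) \<in> borel_measurable (borel \<Otimes>\<^sub>M P)"
proof (rule borel_measurable_LIMSEQ_real)
  fix n :: nat
  have [measurable]: "(\<lambda>p. Z (of_int i / (real n + 1)) (snd p)) \<in> borel_measurable (borel \<Otimes>\<^sub>M P)" for i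
    by measurable
  show "(\<lambda>p. Z (of_int \<lfloor>(real n + 1) * fst p\<rfloor> / (real n + 1)) (snd p)) \<in> borel_measurable (borel \<Otimes>\<^sub>M P)"
    by (rule measurable_compose_countable[where f="\<lambda>i p. Z (of_int i / (real n + 1)) (snd p)"]) auto
next
  fix p :: "real \<times> 'b"
  have "(\<lambda>n. of_int \<lfloor>(real n + 1) * fst p\<rfloor> / (real n + 1)) \<longlonglongrightarrow> fst p"
  proof (rule real_tendsto_sandwich)
    show "\<forall>\<^sub>F n in sequentially. fst p - 1 / (real n + 1) \<le> of_int \<lfloor>(real n + 1) * fst p\<rfloor> / (real n + 1)"
    proof (intro always_eventually allI)
      fix n
      have "(real n + 1) * fst p - 1 \<le> of_int \<lfloor>(real n + 1) * fst p\<rfloor>" by linarith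
      then have "((real n + 1) * fst p - 1) / (real n + 1) \<le> of_int \<lfloor>(real n + 1) * fst p\<rfloor> / (real n + 1)"
        by (intro divide_right_mono) auto
      then show "fst p - 1 / (real n + 1) \<le> of_int \<lfloor>(real n + 1) * fst p\<rfloor> / (real n + 1)"
        by (simp add: diff_divide_distrib)
    qed
    show "\<forall>\<^sub>F n in sequentially. of_int \<lfloor>(real n + 1) * fst p\<rfloor> / (real n + 1) \<le> fst p"
    proof (intro always_eventually allI)
      fix n
      have "of_int \<lfloor>(real n + 1) * fst p\<rfloor> \<le> (real n + 1) * fst p" by linarith
      then have "of_int \<lfloor>(real n + 1) * fst p\<rfloor> / (real n + 1) \<le> (real n + 1) * fst p / (real n + 1)"
        by (intro divide_right_mono) auto
      then show "of_int \<lfloor>(real n + 1) * fst p\<rfloor> / (real n + 1) \<le> fst p" by simp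
    qed
    have "(\<lambda>n. fst p - inverse (real (Suc n))) \<longlonglongrightarrow> fst p - 0"
      by (intro tendsto_intros LIMSEQ_inverse_real_of_nat)
    then show "(\<lambda>n. fst p - 1 / (real n + 1)) \<longlonglongrightarrow> fst p"
      by (simp add: inverse_eq_divide add.commute)
  qed auto
  then show "(\<lambda>n. Z (of_int \<lfloor>(real n + 1) * fst p\<rfloor> / (real n + 1)) (snd p)) \<longlonglongrightarrow> Z (fst p) (snd p)"
    using Z_continuous[of "snd p"] by (auto simp: continuous_on_eq_continuous_at intro: isCont_tendsto_compose)
qed

lemma Z_joint' [measurable]:
  assumes [measurable]: "f \<in> borel_measurable N" "g \<in> measurable N P"
  shows "(\<lambda>p. Z (f p) (g p)) \<in> borel_measurable N"
  using measurable_compose[OF _ Z_joint, of "\<lambda>p. (f p, g p)" N] by simp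

lemma Fubini_path:
  fixes g :: "real \<Rightarrow> 'b \<Rightarrow> real"
  assumes [measurable]: "case_prod g \<in> borel_measurable (borel \<Otimes>\<^sub>M P)" and C: "\<And>r \<omega>. \<bar>g r \<omega>\<bar> \<le> C"
  shows "integrable P (g r)"
    and "integrable P (\<lambda>\<omega>. LINT r:{s..t}|lborel. g r \<omega>)"
    and "set_integrable lborel {s..t} (\<lambda>r. expectation (g r))"
    and "expectation (\<lambda>\<omega>. LINT r:{s..t}|lborel. g r \<omega>) = (LINT r:{s..t}|lborel. expectation (g r))"
    and "\<omega> \<in> space P \<Longrightarrow> set_integrable lborel {s..t} (\<lambda>r. g r \<omega>)"
proof -
  have [measurable]: "g r \<in> borel_measurable P" for r
    using measurable_compose[OF measurable_Pair1' assms(1)] by simp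
  have gm: "(\<lambda>r. g r \<omega>) \<in> borel_measurable borel" if "\<omega> \<in> space P" for \<omega>
    using measurable_compose[OF measurable_Pair2' assms(1)] that by simp
  show i: "integrable P (g r)" for r
    by (rule integrable_const_bound[where B=C]) (use C in auto)
  have int: "integrable (lborel \<Otimes>\<^sub>M P) (\<lambda>(r, \<omega>). indicator {s..t} r * g r \<omega>)"
  proof (rule integrableI_bounded_set[where A="{s..t} \<times> space P" and B=C])
    show "emeasure (lborel \<Otimes>\<^sub>M P) ({s..t} \<times> space P) < \<infinity>"
      by (subst emeasure_pair_measure_Times) (auto simp: emeasure_space_1 ennreal_mult_less_top emeasure_lborel_Icc_eq)
  qed (use C in \<open>auto simp: indicator_def space_pair_measure intro!: always_eventually AE_I2\<close>)
  show "set_integrable lborel {s..t} (\<lambda>r. g r \<omega>)" if "\<omega> \<in> space P"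
    by (rule set_integrable_bounded_Icc[OF gm[OF that] C])
  have eq: "(\<lambda>\<omega>. LINT r:{s..t}|lborel. g r \<omega>) = (\<lambda>\<omega>. \<integral>r. indicator {s..t} r * g r \<omega> \<partial>lborel)"
    by (simp add: set_lebesgue_integral_def)
  show "integrable P (\<lambda>\<omega>. LINT r:{s..t}|lborel. g r \<omega>)"
    unfolding eq using pair.integrable_snd[OF int] by simp
  show "set_integrable lborel {s..t} (\<lambda>r. expectation (g r))"
    using pair.integrable_fst[OF int] by (simp add: set_integrable_def)
  show "expectation (\<lambda>\<omega>. LINT r:{s..t}|lborel. g r \<omega>) = (LINT r:{s..t}|lborel. expectation (g r))"
    unfolding eq using pair.Fubini_integral[OF int] by (simp add: set_lebesgue_integral_def)
qed

lemma Fubini_Z: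
  fixes g :: "real \<Rightarrow> real \<Rightarrow> real"
  assumes [measurable]: "case_prod g \<in> borel_measurable (borel \<Otimes>\<^sub>M borel)" and C: "\<And>r y. \<bar>g r y\<bar> \<le> C"
  shows "integrable P (\<lambda>\<omega>. g r (Z r' \<omega>))"
    and "set_integrable lborel {s..t} (\<lambda>r. expectation (\<lambda>\<omega>. g r (Z r \<omega>)))"
proof -
  have "case_prod (\<lambda>r \<omega>. g r (Z r \<omega>)) \<in> borel_measurable (borel \<Otimes>\<^sub>M P)" by measurable
  from Fubini_path(3)[OF this C] show "set_integrable lborel {s..t} (\<lambda>r. expectation (\<lambda>\<omega>. g r (Z r \<omega>)))" .
  have "g r \<in> borel_measurable borel"
    using measurable_compose[OF measurable_Pair1' assms(1)] by simp
  then show "integrable P (\<lambda>\<omega>. g r (Z r' \<omega>))"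
    by (intro integrable_const_bound[where B=C]) (use C in auto)
qed

abbreviation "\<beta> s t \<omega> \<equiv> (LINT r:{s..t}|lborel. b (Z r \<omega>))"

lemma \<beta>_bound: "s \<le> t \<Longrightarrow> \<bar>\<beta> s t \<omega>\<bar> \<le> M * (t - s)"
  by (intro set_integral_abs_le set_integrable_bounded_Icc[where C=M]) (auto simp: b_bound)

lemma Z_increment:
  assumes "0 \<le> s" "s < t" "t \<le> T"
  shows "AE \<omega> in P. Z t \<omega> - Z s \<omega> = (W t \<omega> - W s \<omega>) + \<beta> s t \<omega>"
proof -
  have "AE \<omega> in P. \<forall>t\<in>{0..T}. X t \<omega> = x + W t \<omega> + (LINT s:{0..t}|lborel. b (X s \<omega>))"
    using sol by (simp add: sde_solution_def)
  with Z_eq show ?thesis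
  proof eventually_elim
    case (elim \<omega>)
    have Z: "Z r \<omega> = x + W r \<omega> + \<beta> 0 r \<omega>" if "r \<in> {0..T}" for r
    proof -
      have "(LINT s:{0..r}|lborel. b (X s \<omega>)) = \<beta> 0 r \<omega>"
        using elim(1) that by (intro set_lebesgue_integral_cong) auto
      then show ?thesis using elim(1)[rule_format, OF that] elim(2)[rule_format, OF that] by simp
    qed
    have "\<beta> 0 t \<omega> = \<beta> 0 s \<omega> + \<beta> s t \<omega>"
      using assms by (intro set_integral_Icc_add set_integrable_bounded_Icc[where C=M]) (auto simp: b_bound)
    then show ?case using Z[of t] Z[of s] assms by simp
  qed
qed

lemma Z_0: "AE \<omega> in P. Z 0 \<omega> = x"
proof -
  have "AE \<omega> in P. \<forall>t\<in>{0..T}. X t \<omega> = x + W t \<omega> + (LINT s:{0..t}|lborel. b (X s \<omega>))"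
    using sol by (simp add: sde_solution_def)
  moreover have "AE \<omega> in P. W 0 \<omega> = 0" using bm by (simp add: brownian_motion_def)
  ultimately show ?thesis using Z_eq
  proof eventually_elim
    case (elim \<omega>)
    have "(LINT s:{0..0}|lborel. b (X s \<omega>)) = 0"
      unfolding set_lebesgue_integral_def
      by (rule integral_eq_zero_AE) (auto intro!: eventually_mono[OF AE_lborel_singleton[of 0]])
    then show ?case using elim T by (auto dest!: bspec[where x=0])
  qed
qed

lemma W_moments:
  assumes "0 \<le> s" "s < t" "t \<le> T"
  shows "integrable P (\<lambda>\<omega>. (W t \<omega> - W s \<omega>) ^ k)"
    and "expectation (\<lambda>\<omega>. W t \<omega> - W s \<omega>) = 0"
    and "expectation (\<lambda>\<omega>. (W t \<omega> - W s \<omega>)\<^sup>2) = t - s"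
    and "expectation (\<lambda>\<omega>. (W t \<omega> - W s \<omega>) ^ 4) = 3 * (t - s)\<^sup>2"
proof -
  have d: "distributed P lborel (\<lambda>\<omega>. W t \<omega> - W s \<omega>) (normal_density 0 (sqrt (t - s)))"
    using bm assms by (simp add: brownian_motion_def)
  have p: "0 < sqrt (t - s)" using assms by simp
  have eq: "expectation (\<lambda>\<omega>. (W t \<omega> - W s \<omega>) ^ k) = (\<integral>y. normal_density 0 (sqrt (t - s)) y * y ^ k \<partial>lborel)" for k
    by (rule distributed_integral[OF d, symmetric]) auto
  show "integrable P (\<lambda>\<omega>. (W t \<omega> - W s \<omega>) ^ k)"
    using distributed_integrable[OF d, of "\<lambda>y. y ^ k"] integrable_normal_moment[OF p, of 0 k] by simp
  show "expectation (\<lambda>\<omega>. W t \<omega> - W s \<omega>) = 0"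
    using eq[of 1] integral_normal_moment_nz_1[OF p, of 0] by simp
  show "expectation (\<lambda>\<omega>. (W t \<omega> - W s \<omega>)\<^sup>2) = t - s"
    unfolding eq using integral_normal_moment_even[OF p, of 0 1] assms by simp
  show "expectation (\<lambda>\<omega>. (W t \<omega> - W s \<omega>) ^ 4) = 3 * (t - s)\<^sup>2"
    unfolding eq using integral_normal_moment_even[OF p, of 0 2] assms by (simp add: fact_numeral power2_eq_square)
qed

text \<open>The increment is independent of \<open>F s\<close>, which contains the sigma-algebra
  generated by \<open>X s\<close>. Independence is therefore derived for \<open>X s\<close> and
  carried over to \<open>Z s\<close> by almost sure equality at the level of expectations.\<close>

lemma W_indep:
  fixes g k :: "real \<Rightarrow> real"
  assumes "0 \<le> s" "s < t" "t \<le> T" and g: "g \<in> borel_measurable borel" and gC: "\<And>y. \<bar>g y\<bar> \<le> C"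
    and k: "k \<in> borel_measurable borel" and ki: "integrable P (\<lambda>\<omega>. k (W t \<omega> - W s \<omega>))"
  shows "expectation (\<lambda>\<omega>. g (Z s \<omega>) * k (W t \<omega> - W s \<omega>)) = expectation (\<lambda>\<omega>. g (Z s \<omega>)) * expectation (\<lambda>\<omega>. k (W t \<omega> - W s \<omega>))"
    and "integrable P (\<lambda>\<omega>. g (Z s \<omega>) * k (W t \<omega> - W s \<omega>))"
proof -
  note [measurable] = g k W_measurable
  have s: "s \<in> {0..T}" "t \<in> {0..T}" using assms by auto
  have [measurable]: "W t \<in> borel_measurable P" "W s \<in> borel_measurable P" using s by (auto intro: W_measurable)
  have Xs: "X s \<in> borel_measurable P" by (rule measurable_from_subalg[OF F_sub X_measurable]) (use s in auto)
  note [measurable] = Xs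
  let ?w = "\<lambda>\<omega>. W t \<omega> - W s \<omega>"
  have "indep_set (sets (vimage_algebra (space P) ?w borel)) (sets (F s))"
    using bm assms(1-3) by (simp add: brownian_motion_def)
  then have "indep_set (sigma_sets (space P) {?w -` A \<inter> space P |A. A \<in> sets borel})
     (sigma_sets (space P) {X s -` A \<inter> space P |A. A \<in> sets borel})"
    unfolding indep_set_def
  proof (rule indep_sets_mono_sets)
    have sp: "space (F s) = space P" using F_sub[OF s(1)] by (simp add: subalgebra_def)
    have "sigma_sets (space P) {X s -` A \<inter> space P |A. A \<in> sets borel} \<subseteq> sets (F s)"
      using sets.sigma_sets_subset[of "{X s -` A \<inter> space P |A. A \<in> sets borel}" "F s"] measurable_sets[OF X_measurable[OF s(1)]]
      by (auto simp: sp)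
    then show "(case i of True \<Rightarrow> sigma_sets (space P) {?w -` A \<inter> space P |A. A \<in> sets borel}
       | False \<Rightarrow> sigma_sets (space P) {X s -` A \<inter> space P |A. A \<in> sets borel})
      \<subseteq> (case i of True \<Rightarrow> sets (vimage_algebra (space P) ?w borel) | False \<Rightarrow> sets (F s))" for i
      by (cases i) (auto simp: sets_vimage_algebra)
  qed
  then have "indep_var borel ?w borel (X s)"
    unfolding indep_var_eq by auto
  then have iv: "indep_var borel (k \<circ> ?w) borel (g \<circ> X s)"
    by (rule indep_var_compose) auto
  have ae: "AE \<omega> in P. X s \<omega> = Z s \<omega>" using Z_eq by eventually_elim (use s in auto)
  have gX: "integrable P (\<lambda>\<omega>. g (X s \<omega>))"
    by (rule integrable_const_bound[where B=C]) (use gC in auto)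
  have e1: "expectation (\<lambda>\<omega>. g (X s \<omega>)) = expectation (\<lambda>\<omega>. g (Z s \<omega>))"
    by (rule integral_cong_AE) (use ae in auto)
  have e2: "expectation (\<lambda>\<omega>. k (?w \<omega>) * g (X s \<omega>)) = expectation (\<lambda>\<omega>. g (Z s \<omega>) * k (?w \<omega>))"
    by (rule integral_cong_AE) (use ae in auto)
  have "expectation (\<lambda>\<omega>. k (?w \<omega>) * g (X s \<omega>)) = expectation (\<lambda>\<omega>. k (?w \<omega>)) * expectation (\<lambda>\<omega>. g (X s \<omega>))"
    using indep_var_lebesgue_integral[OF iv] ki gX by (simp add: comp_def)
  then show "expectation (\<lambda>\<omega>. g (Z s \<omega>) * k (?w \<omega>)) = expectation (\<lambda>\<omega>. g (Z s \<omega>)) * expectation (\<lambda>\<omega>. k (?w \<omega>))"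
    unfolding e1 e2 by simp
  have "integrable P (\<lambda>\<omega>. C * k (?w \<omega>))" using ki by simp
  then show "integrable P (\<lambda>\<omega>. g (Z s \<omega>) * k (?w \<omega>))"
    by (rule Bochner_Integration.integrable_bound)
      (auto simp: abs_mult intro!: AE_I2 mult_right_mono order_trans[OF gC])
qed

lemma Z_increment_abs:
  assumes "0 \<le> s" "s \<le> t" "t \<le> T"
  shows "integrable P (\<lambda>\<omega>. \<bar>Z t \<omega> - Z s \<omega>\<bar>)"
    and "expectation (\<lambda>\<omega>. \<bar>Z t \<omega> - Z s \<omega>\<bar>) \<le> sqrt (t - s) + M * (t - s)"
proof -
  have "integrable P (\<lambda>\<omega>. \<bar>Z t \<omega> - Z s \<omega>\<bar>) \<and> expectation (\<lambda>\<omega>. \<bar>Z t \<omega> - Z s \<omega>\<bar>) \<le> sqrt (t - s) + M * (t - s)"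
  proof (cases "s = t")
    case False
    then have st: "s < t" using assms by simp
    define h where "h = t - s"
    have h: "0 < h" using st by (simp add: h_def)
    note W = W_moments[OF assms(1) st assms(3), folded h_def]
    let ?B = "\<lambda>\<omega>. (sqrt h + (W t \<omega> - W s \<omega>)\<^sup>2 / sqrt h) / 2 + M * h"
    have Bi: "integrable P ?B" using W(1)[of 2] by simp
    have EB: "expectation ?B = sqrt h + M * h"
      using W(1)[of 2] W(3) h by (simp add: real_div_sqrt prob_space field_simps)
    have "AE \<omega> in P. \<bar>Z t \<omega> - Z s \<omega>\<bar> \<le> ?B \<omega>"
      using Z_increment[OF assms(1) st assms(3)]
    proof eventually_elim
      case (elim \<omega>)
      define w where "w = W t \<omega> - W s \<omega>"
      have "\<bar>w\<bar> \<le> (sqrt h + w\<^sup>2 / sqrt h) / 2"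
      proof -
        have "0 \<le> (\<bar>w\<bar> - sqrt h)\<^sup>2 / sqrt h" using h by simp
        also have "\<dots> = w\<^sup>2 / sqrt h + h / sqrt h - 2 * \<bar>w\<bar>"
          using h by (simp add: power2_diff diff_divide_distrib add_divide_distrib)
        finally show ?thesis using h by (simp add: real_div_sqrt)
      qed
      moreover have "\<bar>\<beta> s t \<omega>\<bar> \<le> M * h" using \<beta>_bound[of s t \<omega>] st by (simp add: h_def)
      ultimately show ?case unfolding elim w_def by linarith
    qed
    then show ?thesis
      unfolding h_def[symmetric] EB[symmetric]
      by (auto intro!: Bochner_Integration.integrable_bound[OF Bi] integral_mono_AE Bi)
  qed (use assms in auto)
  then show "integrable P (\<lambda>\<omega>. \<bar>Z t \<omega> - Z s \<omega>\<bar>)" "expectation (\<lambda>\<omega>. \<bar>Z t \<omega> - Z s \<omega>\<bar>) \<le> sqrt (t - s) + M * (t - s)"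
    by auto
qed


section \<open>Dynkin's formula for test functions with Lipschitz second derivative\<close>

definition "gen f1 f2 y = f2 y / 2 + b y * f1 y" for f1 f2 :: "real \<Rightarrow> real"

lemma gen_measurable [measurable]:
  assumes [measurable]: "f1 \<in> borel_measurable borel" "f2 \<in> borel_measurable borel"
  shows "gen f1 f2 \<in> borel_measurable borel"
  unfolding gen_def[abs_def] by measurable

lemma gen_bound:
  assumes "\<bar>f1 y\<bar> \<le> C" "\<bar>f2 y\<bar> \<le> C"
  shows "\<bar>gen f1 f2 y\<bar> \<le> (1 + M) * C"
proof -
  have "\<bar>b y * f1 y\<bar> \<le> M * C"
    unfolding abs_mult using assms b_bound M_nonneg by (intro mult_mono) auto
  moreover have "\<bar>f2 y / 2\<bar> \<le> C" using assms by simp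
  ultimately show ?thesis unfolding gen_def by (simp add: algebra_simps)
qed

text \<open>Expand \<open>f\<close> to second order at \<open>Z s\<close>, with increment
  \<open>D = w + \<beta>'\<close> split into Brownian part and drift part. The terms
  \<open>f1 (Z s) * w\<close> and \<open>f2 (Z s) * (w^2 - h)\<close> have mean zero by
  independence. The rest is the cubic remainder, the mixed terms
  \<open>2 * w * \<beta>' + \<beta>'^2\<close>, and the cost of freezing the derivatives in the
  generator at time \<open>s\<close>; each is of order h^(3/2) or smaller.\<close>

lemma local_estimate:
  fixes f f1 f2 :: "real \<Rightarrow> real"
  assumes f: "\<And>y. (f has_real_derivative f1 y) (at y)"
    and f1: "\<And>y. (f1 has_real_derivative f2 y) (at y)"
    and bd: "\<And>y. \<bar>f y\<bar> \<le> C" "\<And>y. \<bar>f1 y\<bar> \<le> C" "\<And>y. \<bar>f2 y\<bar> \<le> C"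
    and L: "\<And>u v. \<bar>f2 u - f2 v\<bar> \<le> C * \<bar>u - v\<bar>"
    and st: "0 \<le> s" "s < t" "t \<le> T"
  defines "h \<equiv> t - s"
  shows "\<bar>expectation (\<lambda>\<omega>. f (Z t \<omega>)) - expectation (\<lambda>\<omega>. f (Z s \<omega>))
      - (LINT r:{s..t}|lborel. expectation (\<lambda>\<omega>. gen f1 f2 (Z r \<omega>)))\<bar>
     \<le> 4 * C * (2 * (h * sqrt h) + (M * h) ^ 3) + C * (M * h * sqrt h + (M * h)\<^sup>2) + C * (1 + M) * (sqrt h + M * h) * h"
proof -
  have h: "0 < h" using st by (simp add: h_def)
  have C0: "0 \<le> C" using bd(1)[of 0] by simp
  have cf: "continuous_on UNIV f" "continuous_on UNIV f1" "continuous_on UNIV f2"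
  proof -
    show "continuous_on UNIV f" "continuous_on UNIV f1"
      by (auto intro!: continuous_at_imp_continuous_on DERIV_isCont f f1)
    have "C-lipschitz_on UNIV f2" by (rule lipschitz_onI) (use L C0 in \<open>auto simp: dist_real_def\<close>)
    then show "continuous_on UNIV f2" by (rule lipschitz_on_continuous_on)
  qed
  have fm [measurable]: "f \<in> borel_measurable borel" "f1 \<in> borel_measurable borel" "f2 \<in> borel_measurable borel"
    using cf by (auto intro: borel_measurable_continuous_onI)
  have [measurable]: "W t \<in> borel_measurable P" "W s \<in> borel_measurable P" using st by (auto intro: W_measurable)
  have f1L: "\<bar>f1 u - f1 v\<bar> \<le> C * \<bar>u - v\<bar>" for u v
    using field_differentiable_bound[of UNIV f1 f2 C u v] f1 bd(3) by simp
  note Wm = W_moments[OF st, folded h_def]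
  define w where "w \<omega> = W t \<omega> - W s \<omega>" for \<omega>
  have [measurable]: "w \<in> borel_measurable P" unfolding w_def by measurable
  have wi: "integrable P (\<lambda>\<omega>. w \<omega> ^ k)" "integrable P w" for k
    using Wm(1)[of k] Wm(1)[of 1] by (auto simp: w_def[abs_def])
  have we: "expectation w = 0" "expectation (\<lambda>\<omega>. (w \<omega>)\<^sup>2) = h" "expectation (\<lambda>\<omega>. w \<omega> ^ 4) = 3 * h\<^sup>2"
    using Wm by (auto simp: w_def[abs_def])
  \<comment> \<open>Only the derivatives of \<open>f\<close> are frozen at time \<open>s\<close>.
    The factor \<open>b (Z r \<omega>)\<close> stays as it is, because \<open>b\<close> is merely
    bounded and measurable and its change along the path cannot be estimated.\<close>
  define H where "H r \<omega> = gen f1 f2 (Z r \<omega>) - (f2 (Z s \<omega>) / 2 + b (Z r \<omega>) * f1 (Z s \<omega>))" for r \<omega>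
  have Hm: "case_prod H \<in> borel_measurable (borel \<Otimes>\<^sub>M P)"
    unfolding H_def by measurable
  have Gm: "case_prod (\<lambda>r \<omega>. gen f1 f2 (Z r \<omega>)) \<in> borel_measurable (borel \<Otimes>\<^sub>M P)" by measurable
  have Gb: "\<bar>gen f1 f2 (Z r \<omega>)\<bar> \<le> (1 + M) * C" for r \<omega> by (intro gen_bound bd)
  have Hle: "\<bar>H r \<omega>\<bar> \<le> C * (1 + M) * \<bar>Z r \<omega> - Z s \<omega>\<bar>" for r \<omega>
  proof -
    have "H r \<omega> = (f2 (Z r \<omega>) - f2 (Z s \<omega>)) / 2 + b (Z r \<omega>) * (f1 (Z r \<omega>) - f1 (Z s \<omega>))"
      by (simp add: H_def gen_def algebra_simps diff_divide_distrib)
    moreover have "\<bar>(f2 (Z r \<omega>) - f2 (Z s \<omega>)) / 2\<bar> \<le> C * \<bar>Z r \<omega> - Z s \<omega>\<bar>"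
      using L[of "Z r \<omega>" "Z s \<omega>"] by simp
    moreover have "\<bar>b (Z r \<omega>) * (f1 (Z r \<omega>) - f1 (Z s \<omega>))\<bar> \<le> M * (C * \<bar>Z r \<omega> - Z s \<omega>\<bar>)"
      unfolding abs_mult using M_nonneg by (intro mult_mono f1L b_bound) auto
    moreover have "C * (1 + M) * \<bar>Z r \<omega> - Z s \<omega>\<bar> = C * \<bar>Z r \<omega> - Z s \<omega>\<bar> + M * (C * \<bar>Z r \<omega> - Z s \<omega>\<bar>)"
      by (simp add: algebra_simps)
    ultimately show ?thesis by linarith
  qed
  have Hb: "\<bar>H r \<omega>\<bar> \<le> (1 + M) * C + (1 + M) * C" for r \<omega>
  proof -
    have "\<bar>b (Z r \<omega>) * f1 (Z s \<omega>)\<bar> \<le> M * C"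
      unfolding abs_mult using bd b_bound M_nonneg by (intro mult_mono) auto
    moreover have "\<bar>f2 (Z s \<omega>) / 2\<bar> \<le> C" using bd(3)[of "Z s \<omega>"] by simp
    ultimately show ?thesis using Gb[of r \<omega>] unfolding H_def by (simp add: algebra_simps)
  qed
  have aHm: "case_prod (\<lambda>r \<omega>. \<bar>H r \<omega>\<bar>) \<in> borel_measurable (borel \<Otimes>\<^sub>M P)"
    using Hm by (simp add: case_prod_beta)
  have aHb: "\<bar>\<bar>H r \<omega>\<bar>\<bar> \<le> (1 + M) * C + (1 + M) * C" for r \<omega> using Hb by simp
  note FG = Fubini_path[OF Gm Gb] and FH = Fubini_path[OF Hm Hb] and FaH = Fubini_path[OF aHm aHb]
  \<comment> \<open>The expansion error after removal of the two terms with mean zero. Writing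
    \<open>w^2 - h\<close> instead of \<open>w^2\<close> leaves
    \<open>f2 (Z s \<omega>) * h / 2\<close> to be matched with the second-order part of the
    generator integral.\<close>
  define R where "R \<omega> = f (Z t \<omega>) - f (Z s \<omega>) - f1 (Z s \<omega>) * w \<omega> - f2 (Z s \<omega>) * ((w \<omega>)\<^sup>2 - h) / 2
     - (LINT r:{s..t}|lborel. gen f1 f2 (Z r \<omega>))" for \<omega>
  define Q where "Q \<omega> = 4 * C * ((sqrt h * (w \<omega>)\<^sup>2 + w \<omega> ^ 4 / sqrt h) / 2 + (M * h) ^ 3)
     + C * (M * h * ((sqrt h + (w \<omega>)\<^sup>2 / sqrt h) / 2) + (M * h)\<^sup>2) + (LINT r:{s..t}|lborel. \<bar>H r \<omega>\<bar>)" for \<omega>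
  have RQ: "AE \<omega> in P. \<bar>R \<omega>\<bar> \<le> Q \<omega>"
    using Z_increment[OF st] AE_space
  proof eventually_elim
    case (elim \<omega>)
    define D where "D = Z t \<omega> - Z s \<omega>"
    define \<beta>' where "\<beta>' = \<beta> s t \<omega>"
    have D: "D = w \<omega> + \<beta>'" using elim by (simp add: D_def w_def \<beta>'_def)
    have \<beta>: "\<bar>\<beta>'\<bar> \<le> M * h" using \<beta>_bound[of s t \<omega>] st by (simp add: h_def \<beta>'_def)
    have 1: "\<bar>f (Z t \<omega>) - f (Z s \<omega>) - f1 (Z s \<omega>) * D - f2 (Z s \<omega>) * D\<^sup>2 / 2\<bar> \<le> C * \<bar>D\<bar> ^ 3"
      using taylor2_bound[OF f f1 L, of "Z s \<omega>" D] by (simp add: D_def)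
    have 2: "C * \<bar>D\<bar> ^ 3 \<le> 4 * C * ((sqrt h * (w \<omega>)\<^sup>2 + w \<omega> ^ 4 / sqrt h) / 2 + (M * h) ^ 3)"
    proof -
      have "\<bar>D\<bar> ^ 3 \<le> 4 * (\<bar>w \<omega>\<bar> ^ 3 + \<bar>\<beta>'\<bar> ^ 3)" unfolding D by (rule cube_le)
      also have "\<dots> \<le> 4 * ((sqrt h * (w \<omega>)\<^sup>2 + w \<omega> ^ 4 / sqrt h) / 2 + (M * h) ^ 3)"
        by (intro mult_left_mono add_mono cube_abs_le[OF h] power_mono[OF \<beta>]) auto
      finally have "C * \<bar>D\<bar> ^ 3 \<le> C * (4 * ((sqrt h * (w \<omega>)\<^sup>2 + w \<omega> ^ 4 / sqrt h) / 2 + (M * h) ^ 3))"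
        using C0 by (rule mult_left_mono)
      then show ?thesis by (simp add: mult.assoc mult.left_commute)
    qed
    have 3: "\<bar>f2 (Z s \<omega>) * (D\<^sup>2 - (w \<omega>)\<^sup>2) / 2\<bar> \<le> C * (M * h * ((sqrt h + (w \<omega>)\<^sup>2 / sqrt h) / 2) + (M * h)\<^sup>2)"
    proof -
      have "D\<^sup>2 - (w \<omega>)\<^sup>2 = 2 * (\<beta>' * w \<omega>) + \<beta>'\<^sup>2" by (simp add: D power2_eq_square algebra_simps)
      then have "\<bar>(D\<^sup>2 - (w \<omega>)\<^sup>2) / 2\<bar> \<le> \<bar>\<beta>' * w \<omega>\<bar> + \<beta>'\<^sup>2"
        by (rule half_sum_abs) simp
      also have "\<bar>\<beta>' * w \<omega>\<bar> \<le> M * h * ((sqrt h + (w \<omega>)\<^sup>2 / sqrt h) / 2)"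
        unfolding abs_mult using \<beta> sq_abs_le[OF h, of "w \<omega>"] h M_nonneg by (intro mult_mono) auto
      also have "\<beta>'\<^sup>2 \<le> (M * h)\<^sup>2" using power_mono[OF \<beta>, of 2] by simp
      finally have "\<bar>(D\<^sup>2 - (w \<omega>)\<^sup>2) / 2\<bar> \<le> M * h * ((sqrt h + (w \<omega>)\<^sup>2 / sqrt h) / 2) + (M * h)\<^sup>2" by simp
      then have "\<bar>f2 (Z s \<omega>)\<bar> * \<bar>(D\<^sup>2 - (w \<omega>)\<^sup>2) / 2\<bar> \<le> C * (M * h * ((sqrt h + (w \<omega>)\<^sup>2 / sqrt h) / 2) + (M * h)\<^sup>2)"
        using bd(3) C0 by (intro mult_mono) auto
      then show ?thesis by (simp add: abs_mult[symmetric])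
    qed
    have 4: "\<bar>(LINT r:{s..t}|lborel. gen f1 f2 (Z r \<omega>)) - f2 (Z s \<omega>) * h / 2 - f1 (Z s \<omega>) * \<beta>'\<bar> \<le> (LINT r:{s..t}|lborel. \<bar>H r \<omega>\<bar>)"
    proof -
      have i1: "set_integrable lborel {s..t} (\<lambda>r. gen f1 f2 (Z r \<omega>))" by (rule FG(5)) fact
      have i2: "set_integrable lborel {s..t} (\<lambda>r. f2 (Z s \<omega>) / 2)" "set_integrable lborel {s..t} (\<lambda>r. b (Z r \<omega>))"
        by (rule set_integrable_bounded_Icc[of _ "\<bar>f2 (Z s \<omega>) / 2\<bar>"], auto)
          (rule set_integrable_bounded_Icc[of _ M], auto intro: b_bound)
      have i3: "set_integrable lborel {s..t} (\<lambda>r. b (Z r \<omega>) * f1 (Z s \<omega>))" using i2(2) by simp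
      have "(LINT r:{s..t}|lborel. H r \<omega>) = (LINT r:{s..t}|lborel. gen f1 f2 (Z r \<omega>)) - ((LINT r:{s..t}|lborel. f2 (Z s \<omega>) / 2) + (LINT r:{s..t}|lborel. b (Z r \<omega>) * f1 (Z s \<omega>)))"
        unfolding H_def by (subst set_integral_diff(2)[OF i1 set_integral_add(1)[OF i2(1) i3]], subst set_integral_add(2)[OF i2(1) i3]) simp
      also have "(LINT r:{s..t}|lborel. f2 (Z s \<omega>) / 2) = f2 (Z s \<omega>) * h / 2"
        using st by (simp add: set_lebesgue_integral_def h_def)
      also have "(LINT r:{s..t}|lborel. b (Z r \<omega>) * f1 (Z s \<omega>)) = f1 (Z s \<omega>) * \<beta>'"
        by (simp add: \<beta>'_def)
      finally have "\<bar>(LINT r:{s..t}|lborel. gen f1 f2 (Z r \<omega>)) - f2 (Z s \<omega>) * h / 2 - f1 (Z s \<omega>) * \<beta>'\<bar> = \<bar>LINT r:{s..t}|lborel. H r \<omega>\<bar>"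
        by simp
      also have "\<dots> \<le> (LINT r:{s..t}|lborel. \<bar>H r \<omega>\<bar>)"
        using set_integral_norm_bound[OF FH(5)[OF \<open>\<omega> \<in> space P\<close>, of s t]] by simp
      finally show ?thesis .
    qed
    have "R \<omega> = (f (Z t \<omega>) - f (Z s \<omega>) - f1 (Z s \<omega>) * D - f2 (Z s \<omega>) * D\<^sup>2 / 2) + f2 (Z s \<omega>) * (D\<^sup>2 - (w \<omega>)\<^sup>2) / 2
       - ((LINT r:{s..t}|lborel. gen f1 f2 (Z r \<omega>)) - f2 (Z s \<omega>) * h / 2 - f1 (Z s \<omega>) * \<beta>')"
      unfolding R_def D by (simp add: field_simps)
    then show ?case using 1 2 3 4 unfolding Q_def by linarith
  qed
  have fi: "integrable P (\<lambda>\<omega>. f (Z r \<omega>))" for r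
    by (rule integrable_const_bound[where B=C]) (use bd in auto)
  have w1: "expectation (\<lambda>\<omega>. f1 (Z s \<omega>) * w \<omega>) = 0" "integrable P (\<lambda>\<omega>. f1 (Z s \<omega>) * w \<omega>)"
    using W_indep[OF st fm(2) bd(2), where k="\<lambda>y. y", folded w_def] wi(2) we(1) by simp_all
  have w2: "expectation (\<lambda>\<omega>. f2 (Z s \<omega>) * ((w \<omega>)\<^sup>2 - h)) = 0" "integrable P (\<lambda>\<omega>. f2 (Z s \<omega>) * ((w \<omega>)\<^sup>2 - h))"
  proof -
    have "expectation (\<lambda>\<omega>. (w \<omega>)\<^sup>2 - h) = 0" "integrable P (\<lambda>\<omega>. (w \<omega>)\<^sup>2 - h)"
      using wi(1)[of 2] we(2) by (simp_all add: prob_space)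
    then show "expectation (\<lambda>\<omega>. f2 (Z s \<omega>) * ((w \<omega>)\<^sup>2 - h)) = 0" "integrable P (\<lambda>\<omega>. f2 (Z s \<omega>) * ((w \<omega>)\<^sup>2 - h))"
      using W_indep[OF st fm(3) bd(3), where k="\<lambda>y. y\<^sup>2 - h", folded w_def] by simp_all
  qed
  have Ri: "integrable P R"
    unfolding R_def using fi w1 w2 FG(2) by auto
  have ER: "expectation R = expectation (\<lambda>\<omega>. f (Z t \<omega>)) - expectation (\<lambda>\<omega>. f (Z s \<omega>))
      - (LINT r:{s..t}|lborel. expectation (\<lambda>\<omega>. gen f1 f2 (Z r \<omega>)))"
    unfolding R_def using fi w1 w2 FG(2,4) by simp
  have Qi: "integrable P Q"
    unfolding Q_def using wi FaH(2) by auto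
  have "\<bar>expectation R\<bar> \<le> expectation (\<lambda>\<omega>. \<bar>R \<omega>\<bar>)" by (rule integral_abs_bound)
  also have "\<dots> \<le> expectation Q" using Ri by (intro integral_mono_AE RQ Qi) auto
  also have "expectation Q = 4 * C * ((sqrt h * h + 3 * h\<^sup>2 / sqrt h) / 2 + (M * h) ^ 3)
     + C * (M * h * ((sqrt h + h / sqrt h) / 2) + (M * h)\<^sup>2) + expectation (\<lambda>\<omega>. LINT r:{s..t}|lborel. \<bar>H r \<omega>\<bar>)"
    unfolding Q_def using wi FaH(2) we by (simp add: prob_space)
  also have "expectation (\<lambda>\<omega>. LINT r:{s..t}|lborel. \<bar>H r \<omega>\<bar>) = (LINT r:{s..t}|lborel. expectation (\<lambda>\<omega>. \<bar>H r \<omega>\<bar>))"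
    by (rule FaH(4))
  also have "\<dots> \<le> C * (1 + M) * (sqrt h + M * h) * h"
  proof -
    have "\<bar>LINT r:{s..t}|lborel. expectation (\<lambda>\<omega>. \<bar>H r \<omega>\<bar>)\<bar> \<le> C * (1 + M) * (sqrt h + M * h) * (t - s)"
    proof (rule set_integral_abs_le[OF FaH(3)])
      fix r assume r: "r \<in> {s..t}"
      then have r': "0 \<le> s" "s \<le> r" "r \<le> T" using st by auto
      have "expectation (\<lambda>\<omega>. \<bar>H r \<omega>\<bar>) \<le> expectation (\<lambda>\<omega>. C * (1 + M) * \<bar>Z r \<omega> - Z s \<omega>\<bar>)"
        using Hle Z_increment_abs(1)[OF r'] by (intro integral_mono FaH(1)) auto
      also have "\<dots> = C * (1 + M) * expectation (\<lambda>\<omega>. \<bar>Z r \<omega> - Z s \<omega>\<bar>)" by simp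
      also have "\<dots> \<le> C * (1 + M) * (sqrt h + M * h)"
      proof (intro mult_left_mono)
        have "expectation (\<lambda>\<omega>. \<bar>Z r \<omega> - Z s \<omega>\<bar>) \<le> sqrt (r - s) + M * (r - s)" by (rule Z_increment_abs(2)[OF r'])
        also have "\<dots> \<le> sqrt h + M * h"
          using r M_nonneg by (intro add_mono mult_left_mono) (auto simp: h_def)
        finally show "expectation (\<lambda>\<omega>. \<bar>Z r \<omega> - Z s \<omega>\<bar>) \<le> sqrt h + M * h" .
      qed (use C0 M_nonneg in auto)
      moreover have "0 \<le> expectation (\<lambda>\<omega>. \<bar>H r \<omega>\<bar>)" by (rule integral_nonneg_AE) auto
      ultimately show "\<bar>expectation (\<lambda>\<omega>. \<bar>H r \<omega>\<bar>)\<bar> \<le> C * (1 + M) * (sqrt h + M * h)" by simp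
    qed (use st in auto)
    then show ?thesis by (simp add: h_def)
  qed
  finally have "\<bar>expectation R\<bar> \<le> 4 * C * ((sqrt h * h + 3 * h\<^sup>2 / sqrt h) / 2 + (M * h) ^ 3)
     + C * (M * h * ((sqrt h + h / sqrt h) / 2) + (M * h)\<^sup>2) + C * (1 + M) * (sqrt h + M * h) * h" by simp
  moreover have "3 * h\<^sup>2 / sqrt h = 3 * (h * sqrt h)" "h / sqrt h = sqrt h"
    using h by (simp_all add: power2_eq_square real_div_sqrt flip: times_divide_eq_right)
  ultimately show ?thesis unfolding ER by (simp add: mult.commute)
qed

lemma dynkin_C2:
  fixes f f1 f2 :: "real \<Rightarrow> real"
  assumes f: "\<And>y. (f has_real_derivative f1 y) (at y)"
    and f1: "\<And>y. (f1 has_real_derivative f2 y) (at y)"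
    and bd: "\<And>y. \<bar>f y\<bar> \<le> C" "\<And>y. \<bar>f1 y\<bar> \<le> C" "\<And>y. \<bar>f2 y\<bar> \<le> C"
    and L: "\<And>u v. \<bar>f2 u - f2 v\<bar> \<le> C * \<bar>u - v\<bar>"
    and t: "t \<in> {0..T}"
  shows "expectation (\<lambda>\<omega>. f (Z t \<omega>)) = f x + (LINT r:{0..t}|lborel. expectation (\<lambda>\<omega>. gen f1 f2 (Z r \<omega>)))"
proof -
  have C0: "0 \<le> C" using bd(1)[of 0] by simp
  have [measurable]: "f \<in> borel_measurable borel" "f1 \<in> borel_measurable borel" "f2 \<in> borel_measurable borel"
  proof -
    show "f \<in> borel_measurable borel" "f1 \<in> borel_measurable borel"
      by (auto intro!: borel_measurable_continuous_onI continuous_at_imp_continuous_on DERIV_isCont f f1)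
    have "C-lipschitz_on UNIV f2" by (rule lipschitz_onI) (use L C0 in \<open>auto simp: dist_real_def\<close>)
    then show "f2 \<in> borel_measurable borel"
      by (intro borel_measurable_continuous_onI lipschitz_on_continuous_on)
  qed
  have si: "set_integrable lborel {s..t} (\<lambda>r. expectation (\<lambda>\<omega>. gen f1 f2 (Z r \<omega>)))" for s t
    by (rule Fubini_Z(2)[where C="(1 + M) * C"]) (auto intro: gen_bound bd)
  define \<Phi> where "\<Phi> t = expectation (\<lambda>\<omega>. f (Z t \<omega>)) - (LINT r:{0..t}|lborel. expectation (\<lambda>\<omega>. gen f1 f2 (Z r \<omega>)))" for t
  \<comment> \<open>The powers h^2 and h^3 in the local estimate are absorbed into h^(3/2) by
    \<open>h \<le> T\<close>; the factors \<open>sqrt T\<close> and \<open>T * sqrt T\<close> come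
    from there.\<close>
  define K where "K = 4 * C * (2 + M ^ 3 * (T * sqrt T)) + C * (M + M\<^sup>2 * sqrt T) + C * (1 + M) * (1 + M * sqrt T)"
  have "\<Phi> t = \<Phi> 0"
  proof (rule constant_if_local_bound[where T=T and C=K])
    fix s t :: real assume st: "0 \<le> s" "s < t" "t \<le> T"
    define h where "h = t - s"
    have h: "0 < h" "h \<le> T" using st by (auto simp: h_def)
    have sh: "sqrt h \<le> sqrt T" using h by simp
    have hh: "h = sqrt h * sqrt h" using h by simp
    have "\<Phi> t - \<Phi> s = expectation (\<lambda>\<omega>. f (Z t \<omega>)) - expectation (\<lambda>\<omega>. f (Z s \<omega>))
      - (LINT r:{s..t}|lborel. expectation (\<lambda>\<omega>. gen f1 f2 (Z r \<omega>)))"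
      using set_integral_Icc_add[OF si, of 0 s t] st by (simp add: \<Phi>_def)
    then have "\<bar>\<Phi> t - \<Phi> s\<bar> \<le> 4 * C * (2 * (h * sqrt h) + (M * h) ^ 3) + C * (M * h * sqrt h + (M * h)\<^sup>2) + C * (1 + M) * (sqrt h + M * h) * h"
      using local_estimate[OF f f1 bd L st, folded h_def] by simp
    also have "\<dots> \<le> K * (h * sqrt h)"
    proof -
      have h3: "h ^ 3 \<le> (T * sqrt T) * (h * sqrt h)"
      proof -
        have "h ^ 3 = (h * sqrt h) * (h * sqrt h)"
          using h by (simp add: power3_eq_cube ac_simps)
        also have "\<dots> \<le> (T * sqrt T) * (h * sqrt h)"
          using h sh by (intro mult_right_mono mult_mono) auto
        finally show ?thesis .
      qed
      have h2: "h\<^sup>2 \<le> sqrt T * (h * sqrt h)"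
      proof -
        have "h\<^sup>2 = sqrt h * (h * sqrt h)" using h by (simp add: power2_eq_square ac_simps)
        also have "\<dots> \<le> sqrt T * (h * sqrt h)" using h sh by (intro mult_right_mono) auto
        finally show ?thesis .
      qed
      have "4 * C * (2 * (h * sqrt h) + (M * h) ^ 3) \<le> 4 * C * (2 * (h * sqrt h) + M ^ 3 * ((T * sqrt T) * (h * sqrt h)))"
        using h3 C0 M_nonneg by (intro mult_left_mono add_left_mono) (auto simp: power_mult_distrib intro!: mult_left_mono)
      moreover have "C * (M * h * sqrt h + (M * h)\<^sup>2) \<le> C * (M * h * sqrt h + M\<^sup>2 * (sqrt T * (h * sqrt h)))"
        using h2 C0 M_nonneg by (intro mult_left_mono add_left_mono) (auto simp: power_mult_distrib intro!: mult_left_mono)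
      moreover have "C * (1 + M) * (sqrt h + M * h) * h = C * (1 + M) * (h * sqrt h + M * h\<^sup>2)"
        by (simp add: algebra_simps power2_eq_square)
      moreover have "C * (1 + M) * (h * sqrt h + M * h\<^sup>2) \<le> C * (1 + M) * (h * sqrt h + M * (sqrt T * (h * sqrt h)))"
        using h2 C0 M_nonneg by (intro mult_left_mono add_left_mono) auto
      ultimately show ?thesis unfolding K_def by (simp add: algebra_simps)
    qed
    finally show "\<bar>\<Phi> t - \<Phi> s\<bar> \<le> K * ((t - s) * sqrt (t - s))" by (simp add: h_def)
  qed fact
  also have "\<Phi> 0 = f x"
  proof -
    have "expectation (\<lambda>\<omega>. f (Z 0 \<omega>)) = expectation (\<lambda>\<omega>. f x)"
      by (rule integral_cong_AE) (use Z_0 in auto)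
    moreover have "(LINT r:{0..0}|lborel. expectation (\<lambda>\<omega>. gen f1 f2 (Z r \<omega>))) = 0"
      unfolding set_lebesgue_integral_def
      by (rule integral_eq_zero_AE) (auto intro!: eventually_mono[OF AE_lborel_singleton[of 0]])
    ultimately show ?thesis by (simp add: \<Phi>_def prob_space)
  qed
  finally show ?thesis by (simp add: \<Phi>_def)
qed


section \<open>The expected time that the solution spends at 0 is zero\<close>

lemma Fubini_Z_const:
  fixes g :: "real \<Rightarrow> real"
  assumes [measurable]: "g \<in> borel_measurable borel" and C: "\<And>y. \<bar>g y\<bar> \<le> C"
  shows "integrable P (\<lambda>\<omega>. g (Z r \<omega>))"
    and "set_integrable lborel {s..t} (\<lambda>r. expectation (\<lambda>\<omega>. g (Z r \<omega>)))"
    and "\<bar>expectation (\<lambda>\<omega>. g (Z r \<omega>))\<bar> \<le> C"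
proof -
  show i: "integrable P (\<lambda>\<omega>. g (Z r \<omega>))"
    by (rule integrable_const_bound[where B=C]) (use C in auto)
  show "set_integrable lborel {s..t} (\<lambda>r. expectation (\<lambda>\<omega>. g (Z r \<omega>)))"
    by (rule Fubini_Z(2)[where C=C]) (use C in auto)
  have "\<bar>expectation (\<lambda>\<omega>. g (Z r \<omega>))\<bar> \<le> expectation (\<lambda>\<omega>. \<bar>g (Z r \<omega>)\<bar>)" by (rule integral_abs_bound)
  also have "\<dots> \<le> expectation (\<lambda>\<omega>. C)" using C i by (intro integral_mono) auto
  finally show "\<bar>expectation (\<lambda>\<omega>. g (Z r \<omega>))\<bar> \<le> C" by (simp add: prob_space)
qed

lemma tendsto_expectation_Z:
  fixes g :: "nat \<Rightarrow> real \<Rightarrow> real"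
  assumes [measurable]: "\<And>n. g n \<in> borel_measurable borel" "g' \<in> borel_measurable borel"
    and C: "\<And>n y. \<bar>g n y\<bar> \<le> C" and lim: "\<And>y. (\<lambda>n. g n y) \<longlonglongrightarrow> g' y"
  shows "(\<lambda>n. expectation (\<lambda>\<omega>. g n (Z r \<omega>))) \<longlonglongrightarrow> expectation (\<lambda>\<omega>. g' (Z r \<omega>))"
    and "(\<lambda>n. LINT r:{s..t}|lborel. expectation (\<lambda>\<omega>. g n (Z r \<omega>))) \<longlonglongrightarrow> (LINT r:{s..t}|lborel. expectation (\<lambda>\<omega>. g' (Z r \<omega>)))"
proof -
  show e: "(\<lambda>n. expectation (\<lambda>\<omega>. g n (Z r \<omega>))) \<longlonglongrightarrow> expectation (\<lambda>\<omega>. g' (Z r \<omega>))" for r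
    by (rule integral_dominated_convergence[where w="\<lambda>_. C"]) (use C lim in auto)
  have C': "\<bar>g' y\<bar> \<le> C" for y
    by (rule LIMSEQ_le_const2[OF tendsto_rabs[OF lim]]) (use C in auto)
  show "(\<lambda>n. LINT r:{s..t}|lborel. expectation (\<lambda>\<omega>. g n (Z r \<omega>))) \<longlonglongrightarrow> (LINT r:{s..t}|lborel. expectation (\<lambda>\<omega>. g' (Z r \<omega>)))"
    unfolding set_lebesgue_integral_def
  proof (rule integral_dominated_convergence[where w="\<lambda>r. indicator {s..t} r * C"])
    show "(\<lambda>r. indicat_real {s..t} r *\<^sub>R expectation (\<lambda>\<omega>. g' (Z r \<omega>))) \<in> borel_measurable lborel"
      using Fubini_Z_const(2)[OF _ C', where s=s and t=t] by (auto simp: set_integrable_def dest: borel_measurable_integrable)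
    show "(\<lambda>r. indicat_real {s..t} r *\<^sub>R expectation (\<lambda>\<omega>. g n (Z r \<omega>))) \<in> borel_measurable lborel" for n
      using Fubini_Z_const(2)[OF _ C, where s=s and t=t] by (auto simp: set_integrable_def dest: borel_measurable_integrable)
    show "integrable lborel (\<lambda>r. indicator {s..t} r * C)"
      using set_integrable_bounded_Icc[of "\<lambda>_. C" "\<bar>C\<bar>" s t] by (simp add: set_integrable_def)
    show "AE r in lborel. (\<lambda>n. indicat_real {s..t} r *\<^sub>R expectation (\<lambda>\<omega>. g n (Z r \<omega>))) \<longlonglongrightarrow> indicat_real {s..t} r *\<^sub>R expectation (\<lambda>\<omega>. g' (Z r \<omega>))"
      by (intro AE_I2 tendsto_intros e)
    show "AE r in lborel. norm (indicat_real {s..t} r *\<^sub>R expectation (\<lambda>\<omega>. g n (Z r \<omega>))) \<le> indicator {s..t} r * C" for n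
      using Fubini_Z_const(3)[where g="g n", OF _ C] by (intro AE_I2) (auto simp: indicator_def)
  qed
qed

text \<open>Dynkin's formula is applied to \<open>f n y = F (N * y) / N^2\<close> with
  \<open>N = Suc n\<close> and \<open>F y = - 1 / (2 * (1 + y^2))\<close>. Both \<open>f n\<close>
  and \<open>f1 n\<close> tend to 0 uniformly, while \<open>f2 n\<close> stays bounded by 3 and
  tends to the indicator of 0, since \<open>F''\<close> is 1 at 0 and vanishes at infinity. In the
  limit half the expected occupation time of 0 equals 0.\<close>

lemma occupation_zero:
  assumes t: "t \<in> {0..T}"
  shows "(LINT r:{0..t}|lborel. expectation (\<lambda>\<omega>. indicat_real {0} (Z r \<omega>))) = 0"
proof -
  define D where "D n y = 1 + (real (Suc n) * y)\<^sup>2" for n y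
  have D1: "1 \<le> D n y" for n y by (simp add: D_def)
  have D0: "0 < D n y" "D n y \<noteq> 0" for n y using D1[of n y] by auto
  define f where "f n y = - 1 / (2 * (real (Suc n))\<^sup>2 * D n y)" for n y
  define f1 where "f1 n y = y / (D n y)\<^sup>2" for n y
  define f2 where "f2 n y = (1 - 3 * (real (Suc n) * y)\<^sup>2) / (D n y) ^ 3" for n y
  define f3 where "f3 n y = 12 * (real (Suc n))\<^sup>2 * y * ((real (Suc n) * y)\<^sup>2 - 1) / (D n y) ^ 4" for n y
  have dD: "((\<lambda>y. D n y) has_real_derivative 2 * (real (Suc n))\<^sup>2 * y) (at y)" for n y
    unfolding D_def by (auto intro!: derivative_eq_intros simp: power2_eq_square)
  have df: "(f n has_real_derivative f1 n y) (at y)" for n y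
  proof -
    define c I where "c = (real (Suc n))\<^sup>2" and "I y = inverse (D n y)" for y
    have c: "c \<noteq> 0" by (simp add: c_def)
    have dI: "(I has_real_derivative - (I y * (2 * c * y) * I y)) (at y)"
      unfolding I_def c_def by (intro DERIV_inverse' dD D0)
    have "((\<lambda>y. (- 1 / (2 * c)) * I y) has_real_derivative (- 1 / (2 * c)) * - (I y * (2 * c * y) * I y)) (at y)"
      by (rule DERIV_cmult[OF dI])
    moreover have "(- 1 / (2 * c)) * - (I y * (2 * c * y) * I y) = y * (I y)\<^sup>2"
      using c by (simp add: field_simps power2_eq_square)
    moreover have "y * (I y)\<^sup>2 = f1 n y"
      unfolding f1_def I_def power_inverse divide_inverse ..
    moreover have "(\<lambda>y. (- 1 / (2 * c)) * I y) = f n"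
      unfolding fun_eq_iff f_def c_def[symmetric] I_def divide_inverse inverse_mult_distrib mult.assoc by (rule allI, rule refl)
    ultimately show ?thesis by (simp only:)
  qed
  have df1: "(f1 n has_real_derivative f2 n y) (at y)" for n y
  proof -
    define c I where "c = (real (Suc n))\<^sup>2" and "I y = inverse (D n y)" for y
    have I: "(1 + c * y\<^sup>2) * I y = 1" using D0[of n y] by (simp add: I_def c_def D_def power_mult_distrib)
    have dI: "(I has_real_derivative - (I y * (2 * c * y) * I y)) (at y)"
      unfolding I_def c_def by (intro DERIV_inverse' dD D0)
    have "((\<lambda>y. y * (I y)\<^sup>2) has_real_derivative (I y)\<^sup>2 - 4 * c * y\<^sup>2 * (I y) ^ 3) (at y)"
      by (rule derivative_eq_intros dI refl)+ (simp add: power2_eq_square power3_eq_cube algebra_simps)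
    moreover have "(I y)\<^sup>2 = (1 + c * y\<^sup>2) * I y * (I y)\<^sup>2" unfolding I by simp
    then have "(I y)\<^sup>2 - 4 * c * y\<^sup>2 * (I y) ^ 3 = (1 - 3 * (c * y\<^sup>2)) * (I y) ^ 3"
      by (simp add: power2_eq_square power3_eq_cube algebra_simps)
    moreover have "(\<lambda>y. y * (I y)\<^sup>2) = f1 n" "(1 - 3 * (c * y\<^sup>2)) * (I y) ^ 3 = f2 n y"
      unfolding fun_eq_iff f1_def f2_def I_def c_def power_inverse divide_inverse power_mult_distrib by (intro allI refl)+
    ultimately show ?thesis by (simp only:)
  qed
  have df2: "(f2 n has_real_derivative f3 n y) (at y)" for n y
  proof -
    define c I where "c = (real (Suc n))\<^sup>2" and "I y = inverse (D n y)" for y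
    have I: "(1 + c * y\<^sup>2) * I y = 1" using D0[of n y] by (simp add: I_def c_def D_def power_mult_distrib)
    have dI: "(I has_real_derivative - (I y * (2 * c * y) * I y)) (at y)"
      unfolding I_def c_def by (intro DERIV_inverse' dD D0)
    have "((\<lambda>y. (1 - 3 * (c * y\<^sup>2)) * (I y) ^ 3) has_real_derivative - 6 * c * y * (I y) ^ 3 - 6 * c * y * (1 - 3 * (c * y\<^sup>2)) * (I y) ^ 4) (at y)"
      by (rule derivative_eq_intros dI refl)+ (simp add: power2_eq_square power3_eq_cube power4_eq_xxxx algebra_simps)
    moreover have "(I y) ^ 3 = (1 + c * y\<^sup>2) * I y * (I y) ^ 3" unfolding I by simp
    then have "- 6 * c * y * (I y) ^ 3 = - 6 * c * y * ((1 + c * y\<^sup>2) * (I y) ^ 4)"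
      by (simp add: power3_eq_cube power4_eq_xxxx mult.assoc)
    then have "- 6 * c * y * (I y) ^ 3 - 6 * c * y * (1 - 3 * (c * y\<^sup>2)) * (I y) ^ 4 = 12 * c * y * (c * y\<^sup>2 - 1) * (I y) ^ 4"
      by (simp add: algebra_simps)
    moreover have "(\<lambda>y. (1 - 3 * (c * y\<^sup>2)) * (I y) ^ 3) = f2 n" "12 * c * y * (c * y\<^sup>2 - 1) * (I y) ^ 4 = f3 n y"
      unfolding fun_eq_iff f3_def f2_def I_def c_def power_inverse divide_inverse power_mult_distrib by (intro allI refl)+
    ultimately show ?thesis by (simp only:)
  qed
  have zD: "\<bar>real (Suc n) * y\<bar> \<le> D n y" for n y
  proof -
    have "0 \<le> (\<bar>real (Suc n) * y\<bar> - 1)\<^sup>2" by simp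
    then show ?thesis unfolding D_def by (simp add: power2_diff)
  qed
  have Dp: "D n y \<le> D n y ^ Suc k" "1 \<le> D n y ^ k" for n y k
    using D1[of n y] by (auto intro: one_le_power simp: mult_le_cancel_left1)
  have b0: "\<bar>f n y\<bar> \<le> 1 / (real (Suc n))\<^sup>2" for n y
    unfolding f_def using D1[of n y] D0[of n y] by (auto simp: abs_divide abs_mult divide_simps)
  have b1: "\<bar>f1 n y\<bar> \<le> 1 / real (Suc n)" for n y
  proof -
    have "\<bar>real (Suc n) * y\<bar> \<le> (D n y)\<^sup>2" using zD[of n y] Dp(1)[of n y 1] by (simp add: power2_eq_square)
    then show ?thesis unfolding f1_def using D0[of n y] by (simp add: abs_mult abs_divide divide_simps mult.commute)
  qed
  have b2': "\<bar>f2 n y\<bar> \<le> 3 / D n y" for n y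
  proof -
    have "\<bar>1 - 3 * (real (Suc n) * y)\<^sup>2\<bar> \<le> 3 * D n y" unfolding D_def by (simp add: abs_le_iff)
    also have "\<dots> \<le> 3 * (D n y)\<^sup>2" using Dp(1)[of n y 1] by (simp add: power2_eq_square)
    finally have "\<bar>1 - 3 * (real (Suc n) * y)\<^sup>2\<bar> / (D n y) ^ 3 \<le> 3 * (D n y)\<^sup>2 / (D n y) ^ 3"
      using D0[of n y] by (intro divide_right_mono) auto
    also have "\<dots> = 3 / D n y" using D0[of n y] by (simp add: power2_eq_square power3_eq_cube)
    finally show ?thesis using D0[of n y] by (simp add: f2_def abs_divide)
  qed
  have b2: "\<bar>f2 n y\<bar> \<le> 3" for n y
  proof -
    have "3 / D n y \<le> 3" using D1[of n y] D0[of n y] by (simp add: divide_simps)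
    with b2'[of n y] show ?thesis by linarith
  qed
  have b3: "\<bar>f3 n y\<bar> \<le> 12 * real (Suc n)" for n y
  proof -
    have "\<bar>real (Suc n) * y\<bar> * \<bar>(real (Suc n) * y)\<^sup>2 - 1\<bar> \<le> D n y * D n y"
      using zD[of n y] D0[of n y] by (intro mult_mono) (auto simp: D_def abs_le_iff)
    also have "\<dots> \<le> (D n y) ^ 4"
      using Dp(2)[of n y 2] D0[of n y] mult_left_mono[of 1 "(D n y)\<^sup>2" "(D n y)\<^sup>2"]
      by (simp add: power4_eq_xxxx power2_eq_square mult.assoc)
    finally have "12 * real (Suc n) * (\<bar>real (Suc n) * y\<bar> * \<bar>(real (Suc n) * y)\<^sup>2 - 1\<bar>) / (D n y) ^ 4 \<le> 12 * real (Suc n) * (D n y) ^ 4 / (D n y) ^ 4"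
      using D0[of n y] by (intro divide_right_mono mult_left_mono) auto
    also have "\<dots> = 12 * real (Suc n)" using D0[of n y] by simp
    also have "12 * real (Suc n) * (\<bar>real (Suc n) * y\<bar> * \<bar>(real (Suc n) * y)\<^sup>2 - 1\<bar>) / (D n y) ^ 4 = \<bar>f3 n y\<bar>"
      unfolding f3_def using D0[of n y] by (simp only: abs_mult abs_divide power_abs[symmetric]) (simp add: power2_eq_square)
    finally show ?thesis .
  qed
  have [measurable]: "f1 n \<in> borel_measurable borel" "f2 n \<in> borel_measurable borel" for n
    unfolding f1_def[abs_def] f2_def[abs_def] D_def by measurable
  have b1': "\<bar>f1 n y\<bar> \<le> 3" for n y
  proof -
    have "1 / real (Suc n) \<le> 1" by simp
    with b1[of n y] show ?thesis by linarith
  qed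
  have eq: "expectation (\<lambda>\<omega>. f n (Z t \<omega>)) - f n x = (LINT r:{0..t}|lborel. expectation (\<lambda>\<omega>. gen (f1 n) (f2 n) (Z r \<omega>)))" for n
  proof -
    have "expectation (\<lambda>\<omega>. f n (Z t \<omega>)) = f n x + (LINT r:{0..t}|lborel. expectation (\<lambda>\<omega>. gen (f1 n) (f2 n) (Z r \<omega>)))"
    \<comment> \<open>The Lipschitz constant of \<open>f2 n\<close> grows with \<open>n\<close>.
      This is harmless: \<open>dynkin_C2\<close> is an identity for each \<open>n\<close>, and the
      passage to the limit relies on the bounds \<open>b1'\<close> and \<open>b2\<close>, which do
      not depend on \<open>n\<close>.\<close>
    proof (rule dynkin_C2[OF df df1, where C="12 * real (Suc n)"])
      show "\<bar>f n y\<bar> \<le> 12 * real (Suc n)" for y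
      proof -
        have "1 / (real (Suc n))\<^sup>2 \<le> 1" by (simp add: divide_simps)
        moreover have "1 \<le> 12 * real (Suc n)" by simp
        ultimately show ?thesis using b0[of n y] by linarith
      qed
      show "\<bar>f1 n y\<bar> \<le> 12 * real (Suc n)" "\<bar>f2 n y\<bar> \<le> 12 * real (Suc n)" for y
        using b1'[of n y] b2[of n y] by auto
      show "\<bar>f2 n u - f2 n v\<bar> \<le> 12 * real (Suc n) * \<bar>u - v\<bar>" for u v
        using field_differentiable_bound[of UNIV "f2 n" "f3 n" "12 * real (Suc n)" u v] df2 b3 by simp
    qed fact
    then show ?thesis by simp
  qed
  have inv: "(\<lambda>n. 1 / real (Suc n)) \<longlonglongrightarrow> 0" by (rule LIMSEQ_Suc[OF lim_1_over_n])
  have fl: "(\<lambda>n. f n y) \<longlonglongrightarrow> 0" and f1l: "(\<lambda>n. f1 n y) \<longlonglongrightarrow> 0" for y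
  proof -
    have "(\<lambda>n. 1 / (real (Suc n))\<^sup>2) \<longlonglongrightarrow> 0"
      using tendsto_power[OF inv, of 2] by (simp add: power_divide)
    then show "(\<lambda>n. f n y) \<longlonglongrightarrow> 0"
      by (rule Lim_null_comparison[rotated]) (use b0 in auto)
    show "(\<lambda>n. f1 n y) \<longlonglongrightarrow> 0"
      by (rule Lim_null_comparison[OF _ inv]) (use b1 in auto)
  qed
  have f2l: "(\<lambda>n. f2 n y) \<longlonglongrightarrow> indicator {0} y" for y
  proof (cases "y = 0")
    case False
    have "(\<lambda>n. 3 / y\<^sup>2 * (1 / real (Suc n))) \<longlonglongrightarrow> 3 / y\<^sup>2 * 0" by (intro tendsto_intros inv)
    then have lim: "(\<lambda>n. 3 / y\<^sup>2 * (1 / real (Suc n))) \<longlonglongrightarrow> 0" by (simp only: mult_zero_right)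
    have le: "norm (f2 n y) \<le> 3 / y\<^sup>2 * (1 / real (Suc n))" for n
    proof -
      have "real (Suc n) * y\<^sup>2 \<le> (real (Suc n))\<^sup>2 * y\<^sup>2"
        by (intro mult_right_mono) (auto simp: power2_eq_square)
      also have "\<dots> \<le> D n y" by (simp add: D_def power_mult_distrib)
      finally have "3 / D n y \<le> 3 / (real (Suc n) * y\<^sup>2)"
        using False by (intro divide_left_mono) (auto intro!: mult_pos_pos D0)
      with b2'[of n y] show ?thesis by (simp add: mult.commute)
    qed
    have "(\<lambda>n. f2 n y) \<longlonglongrightarrow> 0"
      by (rule Lim_null_comparison[OF always_eventually[OF allI, OF le] lim])
    then show ?thesis using False by simp
  qed (simp add: f2_def D_def)
  have "(\<lambda>n. LINT r:{0..t}|lborel. expectation (\<lambda>\<omega>. gen (f1 n) (f2 n) (Z r \<omega>)))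
     \<longlonglongrightarrow> (LINT r:{0..t}|lborel. expectation (\<lambda>\<omega>. indicat_real {0} (Z r \<omega>) / 2))"
  proof (rule tendsto_expectation_Z(2))
    show "(\<lambda>n. gen (f1 n) (f2 n) y) \<longlonglongrightarrow> indicator {0} y / 2" for y
      unfolding gen_def using tendsto_add[OF tendsto_divide[OF f2l tendsto_const] tendsto_mult[OF tendsto_const f1l], of 2 y "b y" y]
      by simp
    show "\<bar>gen (f1 n) (f2 n) y\<bar> \<le> (1 + M) * 3" for n y by (intro gen_bound b1' b2)
  qed auto
  moreover have "(\<lambda>n. expectation (\<lambda>\<omega>. f n (Z t \<omega>)) - f n x) \<longlonglongrightarrow> expectation (\<lambda>\<omega>. 0) - 0"
  proof (intro tendsto_diff fl tendsto_expectation_Z(1)[where C=1])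
    show "f n \<in> borel_measurable borel" for n unfolding f_def[abs_def] D_def by measurable
    show "\<bar>f n y\<bar> \<le> 1" for n y
    proof -
      have "1 / (real (Suc n))\<^sup>2 \<le> 1" by (simp add: divide_simps)
      with b0[of n y] show ?thesis by linarith
    qed
  qed (use fl in auto)
  ultimately have "(LINT r:{0..t}|lborel. expectation (\<lambda>\<omega>. indicat_real {0} (Z r \<omega>) / 2)) = 0"
    unfolding eq using LIMSEQ_unique by fastforce
  then show ?thesis by simp
qed

end

section \<open>Dynkin's formula for test functions whose second derivative jumps at 0\<close>

context sde
begin

text \<open>The two integrands differ by at most \<open>2 * C\<close> times the indicator of
  \<open>Z r = 0\<close>, and the expected time integral of that indicator is zero by
  \<open>occupation_zero\<close>.\<close>

lemma integral_Z_cong_off_0: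
  fixes g g' :: "real \<Rightarrow> real \<Rightarrow> real"
  assumes t: "t \<in> {0..T}"
    and g: "case_prod g \<in> borel_measurable (borel \<Otimes>\<^sub>M borel)" "\<And>r y. \<bar>g r y\<bar> \<le> C"
    and g': "case_prod g' \<in> borel_measurable (borel \<Otimes>\<^sub>M borel)" "\<And>r y. \<bar>g' r y\<bar> \<le> C"
    and eq: "\<And>r y. r \<in> {0..t} \<Longrightarrow> y \<noteq> 0 \<Longrightarrow> g r y = g' r y"
  shows "(LINT r:{0..t}|lborel. expectation (\<lambda>\<omega>. g r (Z r \<omega>))) = (LINT r:{0..t}|lborel. expectation (\<lambda>\<omega>. g' r (Z r \<omega>)))"
proof -
  have C0: "0 \<le> C" using g(2)[of 0 0] by simp
  note i = Fubini_Z[OF g] and i' = Fubini_Z[OF g']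
  have ind: "set_integrable lborel {0..t} (\<lambda>r. expectation (\<lambda>\<omega>. indicat_real {0} (Z r \<omega>)))"
    by (rule Fubini_Z_const(2)[where g="indicator {0}" and C=1]) (auto simp: indicator_def)
  have "\<bar>(LINT r:{0..t}|lborel. expectation (\<lambda>\<omega>. g r (Z r \<omega>))) - (LINT r:{0..t}|lborel. expectation (\<lambda>\<omega>. g' r (Z r \<omega>)))\<bar>
     = \<bar>LINT r:{0..t}|lborel. expectation (\<lambda>\<omega>. g r (Z r \<omega>)) - expectation (\<lambda>\<omega>. g' r (Z r \<omega>))\<bar>"
    using i i' by (subst set_integral_diff) auto
  also have "\<dots> \<le> (LINT r:{0..t}|lborel. \<bar>expectation (\<lambda>\<omega>. g r (Z r \<omega>)) - expectation (\<lambda>\<omega>. g' r (Z r \<omega>))\<bar>)"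
    using set_integral_norm_bound[OF set_integral_diff(1)[OF i(2) i'(2)]] by simp
  also have "\<dots> \<le> (LINT r:{0..t}|lborel. 2 * C * expectation (\<lambda>\<omega>. indicat_real {0} (Z r \<omega>)))"
  proof (rule set_integral_mono)
    show "set_integrable lborel {0..t} (\<lambda>r. \<bar>expectation (\<lambda>\<omega>. g r (Z r \<omega>)) - expectation (\<lambda>\<omega>. g' r (Z r \<omega>))\<bar>)"
      using set_integral_diff(1)[OF i(2) i'(2)] by (rule set_integrable_abs)
    show "set_integrable lborel {0..t} (\<lambda>r. 2 * C * expectation (\<lambda>\<omega>. indicat_real {0} (Z r \<omega>)))"
      using ind by simp
    fix r assume r: "r \<in> {0..t}"
    have "\<bar>expectation (\<lambda>\<omega>. g r (Z r \<omega>)) - expectation (\<lambda>\<omega>. g' r (Z r \<omega>))\<bar> = \<bar>expectation (\<lambda>\<omega>. g r (Z r \<omega>) - g' r (Z r \<omega>))\<bar>"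
      using i(1) i'(1) by simp
    also have "\<dots> \<le> expectation (\<lambda>\<omega>. \<bar>g r (Z r \<omega>) - g' r (Z r \<omega>)\<bar>)" by (rule integral_abs_bound)
    also have "\<dots> \<le> expectation (\<lambda>\<omega>. 2 * C * indicat_real {0} (Z r \<omega>))"
    proof (rule integral_mono)
      show "integrable P (\<lambda>\<omega>. \<bar>g r (Z r \<omega>) - g' r (Z r \<omega>)\<bar>)" using i(1) i'(1) by auto
      show "integrable P (\<lambda>\<omega>. 2 * C * indicat_real {0} (Z r \<omega>))"
        using Fubini_Z_const(1)[of "indicator {0}" 1 r] by (auto simp: indicator_def)
      show "\<bar>g r (Z r \<omega>) - g' r (Z r \<omega>)\<bar> \<le> 2 * C * indicat_real {0} (Z r \<omega>)" for \<omega>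
        using eq[OF r, of "Z r \<omega>"] g(2)[of r "Z r \<omega>"] g'(2)[of r "Z r \<omega>"] by (cases "Z r \<omega> = 0") auto
    qed
    finally show "\<bar>expectation (\<lambda>\<omega>. g r (Z r \<omega>)) - expectation (\<lambda>\<omega>. g' r (Z r \<omega>))\<bar> \<le> 2 * C * expectation (\<lambda>\<omega>. indicat_real {0} (Z r \<omega>))"
      by simp
  qed
  also have "\<dots> = 0" using occupation_zero[OF t] by simp
  finally show ?thesis by simp
qed


text \<open>With \<open>q'' = f\<close>, the function \<open>f\<close> is approximated by the
  normalised second difference \<open>S q n\<close>, whose first two derivatives are
  \<open>S p n\<close> and \<open>S f n\<close>. For fixed \<open>n\<close> these are regular enough
  for \<open>dynkin_C2\<close>. As the step shrinks they tend to \<open>f\<close>, to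
  \<open>f1\<close> and, off 0, to \<open>f2\<close>, all bounded by \<open>2 * C\<close> because
  \<open>p\<close>, \<open>f\<close> and \<open>f1\<close> are \<open>C\<close>-Lipschitz. The point
  0 is removed by \<open>integral_Z_cong_off_0\<close>, so the value of \<open>f2\<close> there is
  immaterial.\<close>

lemma dynkin_W2:
  fixes f f1 f2 :: "real \<Rightarrow> real"
  assumes f: "\<And>y. (f has_real_derivative f1 y) (at y)"
    and f1: "\<And>y. y \<noteq> 0 \<Longrightarrow> (f1 has_real_derivative f2 y) (at y)"
    and bd: "\<And>y. \<bar>f y\<bar> \<le> C" "\<And>y. \<bar>f1 y\<bar> \<le> C" "\<And>y. \<bar>f2 y\<bar> \<le> C"
    and L: "\<And>u v. \<bar>f1 u - f1 v\<bar> \<le> C * \<bar>u - v\<bar>"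
    and f2m [measurable]: "f2 \<in> borel_measurable borel"
    and t: "t \<in> {0..T}"
  shows "expectation (\<lambda>\<omega>. f (Z t \<omega>)) = f x + (LINT r:{0..t}|lborel. expectation (\<lambda>\<omega>. gen f1 f2 (Z r \<omega>)))"
proof -
  have C0: "0 \<le> C" using bd(1)[of 0] by simp
  have fL: "\<bar>f u - f v\<bar> \<le> C * \<bar>u - v\<bar>" for u v
    using field_differentiable_bound[of UNIV f f1 C u v] f bd(2) by simp
  have cf: "continuous_on UNIV f" by (auto intro!: continuous_at_imp_continuous_on DERIV_isCont f)
  have cf1: "continuous_on UNIV f1"
  proof -
    have "C-lipschitz_on UNIV f1" by (rule lipschitz_onI) (use L C0 in \<open>auto simp: dist_real_def\<close>)
    then show ?thesis by (rule lipschitz_on_continuous_on)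
  qed
  have fm [measurable]: "f \<in> borel_measurable borel" "f1 \<in> borel_measurable borel"
    using cf cf1 by (auto intro: borel_measurable_continuous_onI)
  obtain p where p: "\<And>y. (p has_real_derivative f y) (at y)" using ex_antiderivative[OF cf] by blast
  have "continuous_on UNIV p" by (auto intro!: continuous_at_imp_continuous_on DERIV_isCont p)
  then obtain q where q: "\<And>y. (q has_real_derivative p y) (at y)" using ex_antiderivative by blast
  have pL: "\<bar>p u - p v\<bar> \<le> C * \<bar>u - v\<bar>" for u v
    using field_differentiable_bound[of UNIV p f C u v] p bd(1) by simp
  define d where "d n = 1 / real (Suc n)" for n
  have d: "d \<longlonglongrightarrow> 0" "\<And>n. d n \<noteq> 0" unfolding d_def by (rule LIMSEQ_Suc[OF lim_1_over_n]) simp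
  define S where "S F n y = (F (y + d n) - 2 * F y + F (y - d n)) / (d n)\<^sup>2" for F :: "real \<Rightarrow> real" and n y
  have S_deriv: "(S F n has_real_derivative S F1 n y) (at y)" if "\<And>y. (F has_real_derivative F1 y) (at y)" for F F1 n y
    unfolding S_def by (rule DERIV_cdivide) (auto intro!: derivative_eq_intros DERIV_chain2[OF that])
  have S_bound: "\<bar>S F n y\<bar> \<le> 2 * C" if "\<And>y. (F has_real_derivative F1 y) (at y)" "\<And>u v. \<bar>F1 u - F1 v\<bar> \<le> C * \<bar>u - v\<bar>" for F F1 n y
    using second_difference_bound[OF that, of y "d n"] d(2)[of n] by (simp add: S_def abs_divide divide_le_eq)
  have S_lim: "(\<lambda>n. S F n y) \<longlonglongrightarrow> D" if "\<And>y. (F has_real_derivative F1 y) (at y)" "(F1 has_real_derivative D) (at y)" for F F1 y D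
    unfolding S_def by (rule second_difference_tendsto[OF that d])
  note b = S_bound[OF q pL] S_bound[OF p fL] S_bound[OF f L]
  have [measurable]: "S f n \<in> borel_measurable borel" "S p n \<in> borel_measurable borel" "S q n \<in> borel_measurable borel" for n
    by (auto intro!: borel_measurable_continuous_onI continuous_at_imp_continuous_on DERIV_isCont S_deriv f p q)
  have eq: "expectation (\<lambda>\<omega>. S q n (Z t \<omega>)) = S q n x + (LINT r:{0..t}|lborel. expectation (\<lambda>\<omega>. gen (S p n) (S f n) (Z r \<omega>)))" for n
  \<comment> \<open>The summand \<open>4 * C / (d n)^2\<close> accounts for the Lipschitz constant
    of \<open>S f n\<close>, whose derivative is a second difference of \<open>f1\<close> divided by
    the squared step. It blows up with \<open>n\<close> but does not enter the limit.\<close>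
  proof (rule dynkin_C2[where C="2 * C + 4 * C / (d n)\<^sup>2"])
    show "(S q n has_real_derivative S p n y) (at y)" "(S p n has_real_derivative S f n y) (at y)" for y
      by (rule S_deriv[OF q] S_deriv[OF p])+
    have "0 \<le> 4 * C / (d n)\<^sup>2" using C0 by simp
    then show "\<bar>S q n y\<bar> \<le> 2 * C + 4 * C / (d n)\<^sup>2" "\<bar>S p n y\<bar> \<le> 2 * C + 4 * C / (d n)\<^sup>2" "\<bar>S f n y\<bar> \<le> 2 * C + 4 * C / (d n)\<^sup>2" for y
      using b[of n y] by linarith+
    show "\<bar>S f n u - S f n v\<bar> \<le> (2 * C + 4 * C / (d n)\<^sup>2) * \<bar>u - v\<bar>" for u v
    proof -
      have "\<bar>S f1 n y\<bar> \<le> 2 * C + 4 * C / (d n)\<^sup>2" for y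
      proof -
        have "\<bar>f1 (y + d n) - 2 * f1 y + f1 (y - d n)\<bar> \<le> 4 * C"
          using bd(2)[of "y + d n"] bd(2)[of y] bd(2)[of "y - d n"] by linarith
        then have "\<bar>S f1 n y\<bar> \<le> 4 * C / (d n)\<^sup>2"
          unfolding S_def abs_divide by (simp add: divide_right_mono)
        then show ?thesis using C0 by linarith
      qed
      then show ?thesis
        using field_differentiable_bound[of UNIV "S f n" "S f1 n" "2 * C + 4 * C / (d n)\<^sup>2" u v] S_deriv[OF f] by simp
    qed
  qed fact
  \<comment> \<open>At 0 the quantities \<open>S f n\<close> need not converge. Both the
    approximating and the limiting integrand are set to 0 there, which makes the convergence
    pointwise everywhere.\<close>
  define g where "g n y = (if y = 0 then 0 else gen (S p n) (S f n) y)" for n y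
  define g' where "g' y = (if y = 0 then 0 else gen f1 f2 y)" for y
  have gm: "g n \<in> borel_measurable borel" "g' \<in> borel_measurable borel" for n
    unfolding g_def[abs_def] g'_def[abs_def] by measurable
  have gb: "\<bar>g n y\<bar> \<le> (1 + M) * (2 * C)" "\<bar>g' y\<bar> \<le> (1 + M) * (2 * C)" for n y
  proof -
    have "0 \<le> (1 + M) * (2 * C)" using C0 M_nonneg by simp
    moreover have "\<bar>f1 y\<bar> \<le> 2 * C" "\<bar>f2 y\<bar> \<le> 2 * C" using bd[of y] by auto
    ultimately show "\<bar>g n y\<bar> \<le> (1 + M) * (2 * C)" "\<bar>g' y\<bar> \<le> (1 + M) * (2 * C)"
      using gen_bound[of "S p n" y "2 * C" "S f n"] gen_bound[of f1 y "2 * C" f2] b[of n y] by (auto simp: g_def g'_def)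
  qed
  have [measurable]: "g n \<in> borel_measurable borel" "g' \<in> borel_measurable borel" for n by (fact gm)+
  have c1: "(LINT r:{0..t}|lborel. expectation (\<lambda>\<omega>. gen (S p n) (S f n) (Z r \<omega>))) = (LINT r:{0..t}|lborel. expectation (\<lambda>\<omega>. g n (Z r \<omega>)))" for n
  proof (rule integral_Z_cong_off_0[OF t, where g="\<lambda>_. gen (S p n) (S f n)" and g'="\<lambda>_. g n" and C="(1 + M) * (2 * C)"])
    show "gen (S p n) (S f n) y = g n y" if "y \<noteq> 0" for y using that by (simp add: g_def)
  qed (auto intro!: gen_bound b gb)
  have c2: "(LINT r:{0..t}|lborel. expectation (\<lambda>\<omega>. gen f1 f2 (Z r \<omega>))) = (LINT r:{0..t}|lborel. expectation (\<lambda>\<omega>. g' (Z r \<omega>)))"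
  proof (rule integral_Z_cong_off_0[OF t, where g="\<lambda>_. gen f1 f2" and g'="\<lambda>_. g'" and C="(1 + M) * (2 * C)"])
    show "\<bar>gen f1 f2 y\<bar> \<le> (1 + M) * (2 * C)" for y
      using bd(2,3)[of y] C0 by (intro gen_bound) auto
    show "gen f1 f2 y = g' y" if "y \<noteq> 0" for y using that by (simp add: g'_def)
  qed (auto intro!: gb)
  have "(\<lambda>n. S q n x + (LINT r:{0..t}|lborel. expectation (\<lambda>\<omega>. g n (Z r \<omega>)))) \<longlonglongrightarrow> f x + (LINT r:{0..t}|lborel. expectation (\<lambda>\<omega>. g' (Z r \<omega>)))"
  proof (intro tendsto_add S_lim[OF q p] tendsto_expectation_Z(2)[where C="(1 + M) * (2 * C)"] gm gb)
    fix y show "(\<lambda>n. g n y) \<longlonglongrightarrow> g' y"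
    proof (cases "y = 0")
      case False
      then show ?thesis unfolding g_def g'_def gen_def
        using S_lim[OF p f, of y] S_lim[OF f f1[OF False]] by (auto intro!: tendsto_intros)
    qed (simp add: g_def g'_def)
  qed
  moreover have "(\<lambda>n. expectation (\<lambda>\<omega>. S q n (Z t \<omega>))) \<longlonglongrightarrow> expectation (\<lambda>\<omega>. f (Z t \<omega>))"
    by (rule tendsto_expectation_Z(1)[where C="2 * C"]) (auto intro: b S_lim[OF q p])
  ultimately show ?thesis unfolding eq c1 c2 by (rule LIMSEQ_unique[rotated])
qed

theorem dynkin_time:
  fixes u u1 u2 us G :: "real \<Rightarrow> real \<Rightarrow> real"
  assumes t: "t \<in> {0..T}"
    and u: "\<And>s y. s \<in> {0..t} \<Longrightarrow> (u s has_real_derivative u1 s y) (at y)"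
    and u1: "\<And>s y. s \<in> {0..t} \<Longrightarrow> y \<noteq> 0 \<Longrightarrow> (u1 s has_real_derivative u2 s y) (at y)"
    and bd: "\<And>s y. s \<in> {0..t} \<Longrightarrow> \<bar>u s y\<bar> \<le> C" "\<And>s y. s \<in> {0..t} \<Longrightarrow> \<bar>u1 s y\<bar> \<le> C" "\<And>s y. s \<in> {0..t} \<Longrightarrow> \<bar>u2 s y\<bar> \<le> C"
    and L: "\<And>s y z. s \<in> {0..t} \<Longrightarrow> \<bar>u1 s y - u1 s z\<bar> \<le> C * \<bar>y - z\<bar>"
    and u2m: "\<And>s. s \<in> {0..t} \<Longrightarrow> u2 s \<in> borel_measurable borel"
    and us: "\<And>s y. s \<in> {0..t} \<Longrightarrow> ((\<lambda>s. u s y) has_real_derivative us s y) (at s)"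
    and usL: "\<And>s r y. s \<in> {0..t} \<Longrightarrow> r \<in> {0..t} \<Longrightarrow> \<bar>us s y - us r y\<bar> \<le> C * \<bar>s - r\<bar>"
      "\<And>s y z. s \<in> {0..t} \<Longrightarrow> \<bar>us s y - us s z\<bar> \<le> C * \<bar>y - z\<bar>"
    and usb: "\<And>s y. s \<in> {0..t} \<Longrightarrow> \<bar>us s y\<bar> \<le> C"
    and genL: "\<And>s r y. s \<in> {0..t} \<Longrightarrow> r \<in> {0..t} \<Longrightarrow> \<bar>gen (u1 s) (u2 s) y - gen (u1 r) (u2 r) y\<bar> \<le> C * \<bar>s - r\<bar>"
    and G: "case_prod G \<in> borel_measurable (borel \<Otimes>\<^sub>M borel)" "\<And>r y. \<bar>G r y\<bar> \<le> C'"
      "\<And>r y. r \<in> {0..t} \<Longrightarrow> G r y = us r y + gen (u1 r) (u2 r) y"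
  shows "expectation (\<lambda>\<omega>. u t (Z t \<omega>)) = u 0 x + (LINT r:{0..t}|lborel. expectation (\<lambda>\<omega>. G r (Z r \<omega>)))"
proof -
  have C0: "0 \<le> C" using bd(1)[of 0 0] t by auto
  have um [measurable]: "u s \<in> borel_measurable borel" "u1 s \<in> borel_measurable borel" "us s \<in> borel_measurable borel" if s: "s \<in> {0..t}" for s
  proof -
    show "u s \<in> borel_measurable borel"
      by (auto intro!: borel_measurable_continuous_onI continuous_at_imp_continuous_on DERIV_isCont u s)
    have "C-lipschitz_on UNIV (u1 s)" "C-lipschitz_on UNIV (us s)"
      by (rule lipschitz_onI, use L[OF s] usL(2)[OF s] C0 in \<open>auto simp: dist_real_def\<close>)+
    then show "u1 s \<in> borel_measurable borel" "us s \<in> borel_measurable borel"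
      by (auto intro: borel_measurable_continuous_onI lipschitz_on_continuous_on)
  qed
  note Gi = Fubini_Z[OF G(1,2)]
  define \<Phi> where "\<Phi> s = expectation (\<lambda>\<omega>. u s (Z s \<omega>)) - (LINT r:{0..s}|lborel. expectation (\<lambda>\<omega>. G r (Z r \<omega>)))" for s
  define K where "K = C + (3 + M) * C * sqrt t"
  have "\<Phi> t = \<Phi> 0"
  proof (rule constant_if_local_bound[where T=t and C=K])
    fix s s' :: real assume ss: "0 \<le> s" "s < s'" "s' \<le> t"
    define h where "h = s' - s"
    have h: "0 < h" "h \<le> t" using ss by (auto simp: h_def)
    have si: "s \<in> {0..t}" "s' \<in> {0..t}" and sT: "s \<in> {0..T}" "s' \<in> {0..T}" using ss t by auto
    note [measurable] = um[OF si(1)] um[OF si(2)] u2m[OF si(1)]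
    have uint: "integrable P (\<lambda>\<omega>. u s (Z r \<omega>))" "integrable P (\<lambda>\<omega>. u s' (Z r \<omega>))" "integrable P (\<lambda>\<omega>. us s (Z r \<omega>))" for r
      by (rule integrable_const_bound[where B=C]; use bd(1)[OF si(1)] bd(1)[OF si(2)] usb[OF si(1)] in auto)+
    have genm: "gen (u1 s) (u2 s) \<in> borel_measurable borel" by measurable
    have genb: "\<bar>gen (u1 s) (u2 s) y\<bar> \<le> (1 + M) * C" for y by (intro gen_bound bd si)
    note geni = Fubini_Z_const[OF genm genb]
    have err: "\<bar>u s' y - u s y - h * us s y\<bar> \<le> C * h\<^sup>2" for y
    proof -
      have "norm ((u s' y - s' * us s y) - (u s y - s * us s y)) \<le> (C * h) * norm (s' - s)"
      proof (rule field_differentiable_bound[where S="{s..s'}" and f'="\<lambda>r. us r y - us s y"])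
        fix r assume r: "r \<in> {s..s'}"
        then have r': "r \<in> {0..t}" using ss by auto
        show "((\<lambda>r. u r y - r * us s y) has_real_derivative us r y - us s y) (at r within {s..s'})"
          by (rule has_field_derivative_at_within) (auto intro!: derivative_eq_intros us r')
        have "\<bar>us r y - us s y\<bar> \<le> C * \<bar>r - s\<bar>" by (rule usL(1)[OF r' si(1)])
        also have "\<dots> \<le> C * h" using r C0 by (intro mult_left_mono) (auto simp: h_def)
        finally show "norm (us r y - us s y) \<le> C * h" by simp
      qed (use ss in auto)
      then show ?thesis using h by (simp add: h_def algebra_simps power2_eq_square)
    qed
    have e1: "\<bar>expectation (\<lambda>\<omega>. u s' (Z s' \<omega>)) - expectation (\<lambda>\<omega>. u s (Z s' \<omega>)) - h * expectation (\<lambda>\<omega>. us s (Z s' \<omega>))\<bar> \<le> C * h\<^sup>2"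
    proof -
      have "\<bar>expectation (\<lambda>\<omega>. u s' (Z s' \<omega>)) - expectation (\<lambda>\<omega>. u s (Z s' \<omega>)) - h * expectation (\<lambda>\<omega>. us s (Z s' \<omega>))\<bar>
         = \<bar>expectation (\<lambda>\<omega>. u s' (Z s' \<omega>) - u s (Z s' \<omega>) - h * us s (Z s' \<omega>))\<bar>"
        by (simp add: uint)
      also have "\<dots> \<le> expectation (\<lambda>\<omega>. \<bar>u s' (Z s' \<omega>) - u s (Z s' \<omega>) - h * us s (Z s' \<omega>)\<bar>)"
        by (rule integral_abs_bound)
      also have "\<dots> \<le> expectation (\<lambda>\<omega>. C * h\<^sup>2)"
      proof (rule integral_mono)
        have "integrable P (\<lambda>\<omega>. h * us s (Z s' \<omega>))" by (simp add: uint(3))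
        then show "integrable P (\<lambda>\<omega>. \<bar>u s' (Z s' \<omega>) - u s (Z s' \<omega>) - h * us s (Z s' \<omega>)\<bar>)"
          using uint(1)[of s'] uint(2)[of s'] by (intro integrable_abs Bochner_Integration.integrable_diff)
      qed (rule integrable_const err)+
      finally show ?thesis by (simp add: prob_space)
    qed
    have e2: "expectation (\<lambda>\<omega>. u s (Z s' \<omega>)) - expectation (\<lambda>\<omega>. u s (Z s \<omega>)) = (LINT r:{s..s'}|lborel. expectation (\<lambda>\<omega>. gen (u1 s) (u2 s) (Z r \<omega>)))"
      using dynkin_W2[OF u[OF si(1)] u1[OF si(1)] bd[OF si(1)] L[OF si(1)] u2m[OF si(1)] sT(1)]
        dynkin_W2[OF u[OF si(1)] u1[OF si(1)] bd[OF si(1)] L[OF si(1)] u2m[OF si(1)] sT(2)]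
        set_integral_Icc_add[OF geni(2), of 0 s s'] ss by simp
    have e3: "h * expectation (\<lambda>\<omega>. us s (Z s' \<omega>)) = (LINT r:{s..s'}|lborel. expectation (\<lambda>\<omega>. us s (Z s' \<omega>)))"
      using ss by (simp add: set_lebesgue_integral_def h_def)
    have ci: "set_integrable lborel {s..s'} (\<lambda>r. expectation (\<lambda>\<omega>. us s (Z s' \<omega>)))"
      by (rule set_integrable_bounded_Icc[of _ "\<bar>expectation (\<lambda>\<omega>. us s (Z s' \<omega>))\<bar>"]) auto
    have ii: "set_integrable lborel {s..s'} (\<lambda>r. expectation (\<lambda>\<omega>. us s (Z s' \<omega>)) + expectation (\<lambda>\<omega>. gen (u1 s) (u2 s) (Z r \<omega>)))"
      by (rule set_integral_add(1)[OF ci geni(2)])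
    have "\<Phi> s' - \<Phi> s = (expectation (\<lambda>\<omega>. u s' (Z s' \<omega>)) - expectation (\<lambda>\<omega>. u s (Z s' \<omega>)) - h * expectation (\<lambda>\<omega>. us s (Z s' \<omega>)))
      + (LINT r:{s..s'}|lborel. expectation (\<lambda>\<omega>. us s (Z s' \<omega>)) + expectation (\<lambda>\<omega>. gen (u1 s) (u2 s) (Z r \<omega>)) - expectation (\<lambda>\<omega>. G r (Z r \<omega>)))"
      using e2 e3 set_integral_Icc_add[OF Gi(2), of 0 s s'] ss
      by (simp add: \<Phi>_def set_integral_diff(2)[OF ii Gi(2)] set_integral_add(2)[OF ci geni(2)])
    moreover have "\<bar>LINT r:{s..s'}|lborel. expectation (\<lambda>\<omega>. us s (Z s' \<omega>)) + expectation (\<lambda>\<omega>. gen (u1 s) (u2 s) (Z r \<omega>)) - expectation (\<lambda>\<omega>. G r (Z r \<omega>))\<bar>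
       \<le> (C * (sqrt h + M * h) + 2 * C * h) * (s' - s)"
    proof (rule set_integral_abs_le[OF set_integral_diff(1)[OF ii Gi(2)]])
      fix r assume r: "r \<in> {s..s'}"
      then have rt: "r \<in> {0..t}" and r0: "0 \<le> r" "r \<le> s'" "s' \<le> T" using ss t by auto
      have "\<bar>expectation (\<lambda>\<omega>. us s (Z s' \<omega>)) + expectation (\<lambda>\<omega>. gen (u1 s) (u2 s) (Z r \<omega>)) - expectation (\<lambda>\<omega>. G r (Z r \<omega>))\<bar>
        = \<bar>expectation (\<lambda>\<omega>. us s (Z s' \<omega>) + gen (u1 s) (u2 s) (Z r \<omega>) - G r (Z r \<omega>))\<bar>"
        using uint geni(1) Gi(1) by simp
      also have "\<dots> \<le> expectation (\<lambda>\<omega>. \<bar>us s (Z s' \<omega>) + gen (u1 s) (u2 s) (Z r \<omega>) - G r (Z r \<omega>)\<bar>)" by (rule integral_abs_bound)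
      also have "\<dots> \<le> expectation (\<lambda>\<omega>. C * \<bar>Z s' \<omega> - Z r \<omega>\<bar> + 2 * C * h)"
      proof (rule integral_mono)
        show "integrable P (\<lambda>\<omega>. \<bar>us s (Z s' \<omega>) + gen (u1 s) (u2 s) (Z r \<omega>) - G r (Z r \<omega>)\<bar>)" by (intro integrable_abs Bochner_Integration.integrable_diff Bochner_Integration.integrable_add uint geni(1) Gi(1))
        show "integrable P (\<lambda>\<omega>. C * \<bar>Z s' \<omega> - Z r \<omega>\<bar> + 2 * C * h)" using Z_increment_abs(1)[OF r0] by auto
        fix \<omega>
        have "C * \<bar>s - r\<bar> \<le> C * h" using r C0 by (intro mult_left_mono) (auto simp: h_def)
        then show "\<bar>us s (Z s' \<omega>) + gen (u1 s) (u2 s) (Z r \<omega>) - G r (Z r \<omega>)\<bar> \<le> C * \<bar>Z s' \<omega> - Z r \<omega>\<bar> + 2 * C * h"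
          unfolding G(3)[OF rt]
          using usL(2)[OF si(1), of "Z s' \<omega>" "Z r \<omega>"] usL(1)[OF si(1) rt, of "Z r \<omega>"] genL[OF si(1) rt, of "Z r \<omega>"] by linarith
      qed
      also have "\<dots> = C * expectation (\<lambda>\<omega>. \<bar>Z s' \<omega> - Z r \<omega>\<bar>) + 2 * C * h"
        using Z_increment_abs(1)[OF r0] by (simp add: prob_space)
      also have "\<dots> \<le> C * (sqrt h + M * h) + 2 * C * h"
      proof -
        have "expectation (\<lambda>\<omega>. \<bar>Z s' \<omega> - Z r \<omega>\<bar>) \<le> sqrt (s' - r) + M * (s' - r)" by (rule Z_increment_abs(2)[OF r0])
        also have "\<dots> \<le> sqrt h + M * h" using r M_nonneg by (intro add_mono mult_left_mono) (auto simp: h_def)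
        finally show ?thesis using C0 by (auto intro!: mult_left_mono)
      qed
      finally show "\<bar>expectation (\<lambda>\<omega>. us s (Z s' \<omega>)) + expectation (\<lambda>\<omega>. gen (u1 s) (u2 s) (Z r \<omega>)) - expectation (\<lambda>\<omega>. G r (Z r \<omega>))\<bar> \<le> C * (sqrt h + M * h) + 2 * C * h" .
    qed (use ss in auto)
    ultimately have "\<bar>\<Phi> s' - \<Phi> s\<bar> \<le> C * h\<^sup>2 + (C * (sqrt h + M * h) + 2 * C * h) * h"
      using e1 by (simp add: h_def)
    also have "\<dots> = C * (h * sqrt h) + (3 + M) * C * h\<^sup>2" by (simp add: algebra_simps power2_eq_square)
    also have "\<dots> \<le> C * (h * sqrt h) + (3 + M) * C * (sqrt t * (h * sqrt h))"
    proof -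
      have "h\<^sup>2 = sqrt h * (h * sqrt h)" using h by (simp add: power2_eq_square ac_simps)
      also have "\<dots> \<le> sqrt t * (h * sqrt h)" using h by (intro mult_right_mono) auto
      finally show ?thesis using C0 M_nonneg by (intro add_left_mono mult_left_mono) auto
    qed
    finally show "\<bar>\<Phi> s' - \<Phi> s\<bar> \<le> K * ((s' - s) * sqrt (s' - s))" by (simp add: K_def h_def algebra_simps)
  qed (use t in auto)
  also have "\<Phi> 0 = u 0 x"
  proof -
    have "0 \<in> {0..t}" using t by auto
    note [measurable] = um[OF this]
    have "expectation (\<lambda>\<omega>. u 0 (Z 0 \<omega>)) = expectation (\<lambda>\<omega>. u 0 x)"
      by (rule integral_cong_AE) (use Z_0 in auto)
    moreover have "(LINT r:{0..0}|lborel. expectation (\<lambda>\<omega>. G r (Z r \<omega>))) = 0"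
      unfolding set_lebesgue_integral_def
      by (rule integral_eq_zero_AE) (auto intro!: eventually_mono[OF AE_lborel_singleton[of 0]])
    ultimately show ?thesis by (simp add: \<Phi>_def prob_space)
  qed
  finally show ?thesis by (simp add: \<Phi>_def)
qed

end

section \<open>Test functions\<close>

lemma DERIV_abs_nonzero:
  fixes y :: real
  assumes "y \<noteq> 0"
  shows "(abs has_real_derivative sgn y) (at y)" "(sgn has_real_derivative 0) (at y)"
proof -
  have "eventually (\<lambda>u. \<bar>u\<bar> = sgn y * u \<and> sgn u = sgn y) (nhds y)"
  proof (cases "0 < y")
    case True
    then show ?thesis
      by (intro eventually_mono[OF eventually_nhds_in_open[of "{0<..}" y]]) auto
  next
    case False
    then show ?thesis using assms
      by (intro eventually_mono[OF eventually_nhds_in_open[of "{..<0}" y]]) auto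
  qed
  then have ev: "eventually (\<lambda>u. \<bar>u\<bar> = sgn y * u) (nhds y)" "eventually (\<lambda>u. sgn u = sgn y) (nhds y)"
    by (auto elim: eventually_mono)
  have "((\<lambda>u. sgn y * u) has_real_derivative sgn y) (at y)"
    by (auto intro!: derivative_eq_intros)
  then show "(abs has_real_derivative sgn y) (at y)"
    using DERIV_cong_ev[OF refl ev(1) refl] by simp
  have "((\<lambda>u. sgn y) has_real_derivative 0) (at y)" by simp
  then show "(sgn has_real_derivative 0) (at y)"
    using DERIV_cong_ev[OF refl ev(2) refl] by simp
qed

text \<open>On a segment that does not cross 0 the mean value theorem needs differentiability in the
  interior only, so 0 may be an end point. A segment across 0 is cut there.\<close>

lemma lipschitz_off_0:
  fixes f f' :: "real \<Rightarrow> real"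
  assumes c: "continuous_on UNIV f" and d: "\<And>y. y \<noteq> 0 \<Longrightarrow> (f has_real_derivative f' y) (at y)"
    and b: "\<And>y. y \<noteq> 0 \<Longrightarrow> \<bar>f' y\<bar> \<le> C" and C0: "0 \<le> C"
  shows "\<bar>f u - f v\<bar> \<le> C * \<bar>u - v\<bar>"
proof -
  have seg: "\<bar>f q - f p\<bar> \<le> C * (q - p)" if "p \<le> q" "0 \<le> p \<or> q \<le> 0" for p q
  proof (cases "p = q")
    case False
    then have "p < q" using that by simp
    have dd: "(f has_derivative (\<lambda>h. f' u * h)) (at u)" if "p < u" "u < q" for u
      using d[of u] that \<open>0 \<le> p \<or> q \<le> 0\<close> by (auto simp: has_field_derivative_def)
    obtain \<xi> where \<xi>: "p < \<xi>" "\<xi> < q" "f q - f p = f' \<xi> * (q - p)"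
      using mvt[OF \<open>p < q\<close> continuous_on_subset[OF c] dd] by auto
    then have "\<bar>f q - f p\<bar> = \<bar>f' \<xi>\<bar> * (q - p)" by (simp add: abs_mult)
    also have "\<dots> \<le> C * (q - p)" using \<xi> that by (intro mult_right_mono b) auto
    finally show ?thesis .
  qed simp
  have le: "\<bar>f q - f p\<bar> \<le> C * (q - p)" if "p \<le> q" for p q
  proof (cases "0 \<le> p \<or> q \<le> 0")
    case False
    then have "\<bar>f q - f 0\<bar> \<le> C * (q - 0)" "\<bar>f 0 - f p\<bar> \<le> C * (0 - p)" by (intro seg; simp)+
    then show ?thesis by (simp add: algebra_simps)
  qed (use seg that in auto)
  show ?thesis using le[of u v] le[of v u] by (cases "u \<le> v") (auto simp: abs_minus_commute)
qed

text \<open>Compare \<open>f\<close> with an antiderivative of \<open>g\<close>: their difference is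
  continuous with derivative 0 off 0, hence constant by \<open>lipschitz_off_0\<close>. This is how
  a candidate derivative that extends continuously to 0 is recognised as the derivative at 0 as
  well.\<close>

lemma DERIV_at_0:
  fixes f g :: "real \<Rightarrow> real"
  assumes f: "continuous_on UNIV f" and g: "continuous_on UNIV g"
    and d: "\<And>y. y \<noteq> 0 \<Longrightarrow> (f has_real_derivative g y) (at y)"
  shows "(f has_real_derivative g y) (at y)"
proof -
  obtain p where p: "\<And>y. (p has_real_derivative g y) (at y)" using ex_antiderivative[OF g] by blast
  have eq: "f u = p u + (f 0 - p 0)" for u
  proof -
    have "\<bar>(f u - p u) - (f 0 - p 0)\<bar> \<le> 0 * \<bar>u - 0\<bar>"
    proof (rule lipschitz_off_0[where f'="\<lambda>_. 0"])
      show "continuous_on UNIV (\<lambda>u. f u - p u)"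
        by (intro continuous_on_diff f continuous_at_imp_continuous_on ballI DERIV_isCont[OF p])
      show "((\<lambda>u. f u - p u) has_real_derivative 0) (at y)" if "y \<noteq> 0" for y
        using DERIV_diff[OF d[OF that] p] by simp
    qed auto
    then show ?thesis by simp
  qed
  have "((\<lambda>u. p u + (f 0 - p 0)) has_real_derivative g y) (at y)"
    by (auto intro!: derivative_eq_intros p)
  then show ?thesis unfolding eq[symmetric] .
qed

text \<open>Decay faster than every exponential, uniformly for times in a compact interval.
  Exponential scales are chosen because the weight \<open>exp (- B)\<close> grows at most like
  \<open>exp (M * \<bar>y\<bar>)\<close> and because factors in \<open>slow\<close>, in particular
  polynomials, are then absorbed (\<open>rapid_mult\<close>).\<close>

definition rapid :: "real \<Rightarrow> real \<Rightarrow> (real \<Rightarrow> real \<Rightarrow> real) \<Rightarrow> bool" where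
  "rapid a e f \<longleftrightarrow> (\<forall>k. \<exists>C. \<forall>t\<in>{a..e}. \<forall>y. \<bar>f t y\<bar> \<le> C * exp (- (k * \<bar>y\<bar>)))"

definition slow :: "real \<Rightarrow> real \<Rightarrow> (real \<Rightarrow> real \<Rightarrow> real) \<Rightarrow> bool" where
  "slow a e f \<longleftrightarrow> (\<exists>C k. 0 \<le> C \<and> (\<forall>t\<in>{a..e}. \<forall>y. \<bar>f t y\<bar> \<le> C * exp (k * \<bar>y\<bar>)))"

lemma rapidD:
  assumes "rapid a e f"
  obtains C where "0 \<le> C" "\<And>t y. t \<in> {a..e} \<Longrightarrow> \<bar>f t y\<bar> \<le> C * exp (- (k * \<bar>y\<bar>))"
proof -
  obtain C where C: "\<And>t y. t \<in> {a..e} \<Longrightarrow> \<bar>f t y\<bar> \<le> C * exp (- (k * \<bar>y\<bar>))"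
    using assms unfolding rapid_def by blast
  have "\<bar>f t y\<bar> \<le> \<bar>C\<bar> * exp (- (k * \<bar>y\<bar>))" if "t \<in> {a..e}" for t y
    using C[OF that, of y] by (smt (verit) mult_right_mono exp_ge_zero)
  then show thesis by (intro that[of "\<bar>C\<bar>"]) auto
qed

lemma rapid_add: "rapid a e f \<Longrightarrow> rapid a e g \<Longrightarrow> rapid a e (\<lambda>t y. f t y + g t y)"
  unfolding rapid_def
proof (intro allI)
  fix k assume f: "\<forall>k. \<exists>C. \<forall>t\<in>{a..e}. \<forall>y. \<bar>f t y\<bar> \<le> C * exp (- (k * \<bar>y\<bar>))" and g: "\<forall>k. \<exists>C. \<forall>t\<in>{a..e}. \<forall>y. \<bar>g t y\<bar> \<le> C * exp (- (k * \<bar>y\<bar>))"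
  obtain C D where "\<And>t y. t\<in>{a..e} \<Longrightarrow> \<bar>f t y\<bar> \<le> C * exp (- (k * \<bar>y\<bar>))" "\<And>t y. t\<in>{a..e} \<Longrightarrow> \<bar>g t y\<bar> \<le> D * exp (- (k * \<bar>y\<bar>))"
    using f g by meson
  then show "\<exists>C. \<forall>t\<in>{a..e}. \<forall>y. \<bar>f t y + g t y\<bar> \<le> C * exp (- (k * \<bar>y\<bar>))"
    by (intro exI[of _ "C + D"]) (auto simp: distrib_right intro!: order_trans[OF abs_triangle_ineq] add_mono)
qed

lemma rapid_mult:
  assumes "slow a e h" "rapid a e f"
  shows "rapid a e (\<lambda>t y. h t y * f t y)"
  unfolding rapid_def
proof
  fix k
  obtain A j where h: "0 \<le> A" "\<And>t y. t \<in> {a..e} \<Longrightarrow> \<bar>h t y\<bar> \<le> A * exp (j * \<bar>y\<bar>)"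
    using assms(1) unfolding slow_def by blast
  obtain C where f: "\<And>t y. t \<in> {a..e} \<Longrightarrow> \<bar>f t y\<bar> \<le> C * exp (- ((k + j) * \<bar>y\<bar>))"
    using assms(2) unfolding rapid_def by blast
  have "\<bar>h t y * f t y\<bar> \<le> (A * C) * exp (- (k * \<bar>y\<bar>))" if t: "t \<in> {a..e}" for t y
  proof -
    have "\<bar>h t y * f t y\<bar> \<le> (A * exp (j * \<bar>y\<bar>)) * (C * exp (- ((k + j) * \<bar>y\<bar>)))"
      unfolding abs_mult using h(1) by (intro mult_mono h(2)[OF t] f[OF t]) auto
    also have "\<dots> = (A * C) * (exp (j * \<bar>y\<bar>) * exp (- ((k + j) * \<bar>y\<bar>)))" by simp
    also have "exp (j * \<bar>y\<bar>) * exp (- ((k + j) * \<bar>y\<bar>)) = exp (- (k * \<bar>y\<bar>))"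
      by (simp add: exp_add[symmetric] algebra_simps)
    finally show ?thesis .
  qed
  then show "\<exists>C. \<forall>t\<in>{a..e}. \<forall>y. \<bar>h t y * f t y\<bar> \<le> C * exp (- (k * \<bar>y\<bar>))" by blast
qed

lemma slow_bounded:
  assumes "\<And>t y. t \<in> {a..e} \<Longrightarrow> \<bar>h t y\<bar> \<le> C"
  shows "slow a e h"
  unfolding slow_def
  by (rule exI[of _ "\<bar>C\<bar>"], rule exI[of _ 0]) (use assms in \<open>auto intro: order_trans[OF _ abs_ge_self]\<close>)

lemma slow_const: "slow a e (\<lambda>t y. c)"
  by (rule slow_bounded[of _ _ _ "\<bar>c\<bar>"]) simp

lemma slow_sgn: "slow a e (\<lambda>t y. sgn y)"
  by (rule slow_bounded[of _ _ _ 1]) (simp add: sgn_if)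

lemma slow_id: "slow a e (\<lambda>t y. y)"
  unfolding slow_def
proof (rule exI[of _ 1], rule exI[of _ 1], intro conjI ballI allI)
  fix t y :: real
  show "\<bar>y\<bar> \<le> 1 * exp (1 * \<bar>y\<bar>)" using exp_ge_add_one_self[of "\<bar>y\<bar>"] unfolding mult_1 by linarith
qed simp

lemma slow_abs: "slow a e (\<lambda>t y. \<bar>y\<bar>)"
  using slow_id[of a e] by (simp add: slow_def)

lemma slow_inverse: "0 < a \<Longrightarrow> slow a e (\<lambda>t y. inverse t)"
  by (rule slow_bounded[of _ _ _ "inverse a"]) (auto intro!: le_imp_inverse_le)

lemma slow_mult: "slow a e f \<Longrightarrow> slow a e g \<Longrightarrow> slow a e (\<lambda>t y. f t y * g t y)"
  unfolding slow_def
proof (elim exE conjE)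
  fix C k D j assume "0 \<le> C" "0 \<le> D" and f: "\<forall>t\<in>{a..e}. \<forall>y. \<bar>f t y\<bar> \<le> C * exp (k * \<bar>y\<bar>)" and g: "\<forall>t\<in>{a..e}. \<forall>y. \<bar>g t y\<bar> \<le> D * exp (j * \<bar>y\<bar>)"
  have "\<bar>f t y * g t y\<bar> \<le> (C * D) * exp ((k + j) * \<bar>y\<bar>)" if "t \<in> {a..e}" for t y
  proof -
    have "\<bar>f t y * g t y\<bar> \<le> (C * exp (k * \<bar>y\<bar>)) * (D * exp (j * \<bar>y\<bar>))"
      unfolding abs_mult using f g that \<open>0 \<le> C\<close> by (intro mult_mono) auto
    moreover have "exp ((k + j) * \<bar>y\<bar>) = exp (k * \<bar>y\<bar>) * exp (j * \<bar>y\<bar>)"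
      by (simp only: distrib_right exp_add)
    ultimately show ?thesis by (simp add: ac_simps)
  qed
  then show "\<exists>C k. 0 \<le> C \<and> (\<forall>t\<in>{a..e}. \<forall>y. \<bar>f t y * g t y\<bar> \<le> C * exp (k * \<bar>y\<bar>))"
    using \<open>0 \<le> C\<close> \<open>0 \<le> D\<close> by (intro exI[of _ "C * D"] exI[of _ "k + j"]) auto
qed

lemma slow_add: "slow a e f \<Longrightarrow> slow a e g \<Longrightarrow> slow a e (\<lambda>t y. f t y + g t y)"
  unfolding slow_def
proof (elim exE conjE)
  fix C k D j assume CD: "0 \<le> C" "0 \<le> D" and f: "\<forall>t\<in>{a..e}. \<forall>y. \<bar>f t y\<bar> \<le> C * exp (k * \<bar>y\<bar>)" and g: "\<forall>t\<in>{a..e}. \<forall>y. \<bar>g t y\<bar> \<le> D * exp (j * \<bar>y\<bar>)"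
  have "\<bar>f t y + g t y\<bar> \<le> (C + D) * exp (max k j * \<bar>y\<bar>)" if "t \<in> {a..e}" for t y
  proof -
    have "C * exp (k * \<bar>y\<bar>) \<le> C * exp (max k j * \<bar>y\<bar>)" "D * exp (j * \<bar>y\<bar>) \<le> D * exp (max k j * \<bar>y\<bar>)"
      using CD by (auto intro!: mult_left_mono mult_right_mono)
    moreover have "\<bar>f t y\<bar> \<le> C * exp (k * \<bar>y\<bar>)" "\<bar>g t y\<bar> \<le> D * exp (j * \<bar>y\<bar>)" using f g that by auto
    ultimately show ?thesis using abs_triangle_ineq[of "f t y" "g t y"] by (simp add: distrib_right)
  qed
  then show "\<exists>C k. 0 \<le> C \<and> (\<forall>t\<in>{a..e}. \<forall>y. \<bar>f t y + g t y\<bar> \<le> C * exp (k * \<bar>y\<bar>))"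
    using CD by (intro exI[of _ "C + D"] exI[of _ "max k j"]) auto
qed

lemma slow_diff: "slow a e f \<Longrightarrow> slow a e g \<Longrightarrow> slow a e (\<lambda>t y. f t y - g t y)"
  using slow_add[OF _ slow_mult[OF slow_const[of _ _ "-1"]], of a e f g] by simp

lemma slow_minus: "slow a e f \<Longrightarrow> slow a e (\<lambda>t y. - f t y)"
  by (simp add: slow_def)

lemma slow_divide: "0 < a \<Longrightarrow> slow a e f \<Longrightarrow> slow a e (\<lambda>t y. f t y / t ^ n)"
proof (induction n)
  case (Suc n)
  have "slow a e (\<lambda>t y. inverse t * (f t y / t ^ n))" by (intro slow_mult slow_inverse Suc)
  then show ?case by (simp add: field_simps)
qed simp

lemma slow_divide1: "0 < a \<Longrightarrow> slow a e f \<Longrightarrow> slow a e (\<lambda>t y. f t y / t)"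
  using slow_divide[of a e f 1] by simp

lemma slow_divide_const: "slow a e f \<Longrightarrow> slow a e (\<lambda>t y. f t y / c)"
  using slow_mult[OF slow_const[of a e "inverse c"]] by (simp add: field_simps)

lemma slow_power: "slow a e f \<Longrightarrow> slow a e (\<lambda>t y. f t y ^ n)"
  by (induction n) (auto intro!: slow_const slow_mult)

lemma rapid_diff: "rapid a e f \<Longrightarrow> rapid a e g \<Longrightarrow> rapid a e (\<lambda>t y. f t y - g t y)"
  using rapid_add[OF _ rapid_mult[OF slow_const[of _ _ "-1"]], of a e f g] by simp

lemma rapid_divide_const: "rapid a e f \<Longrightarrow> rapid a e (\<lambda>t y. f t y / c)"
  using rapid_mult[OF slow_const[of a e "inverse c"]] by (simp add: field_simps)

lemma rapid_mult': "slow a e h \<Longrightarrow> rapid a e f \<Longrightarrow> rapid a e (\<lambda>t y. f t y * h t y)"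
  using rapid_mult[of a e h f] by (simp add: mult.commute)

text \<open>Young's inequality bounds \<open>\<bar>k\<bar> * \<bar>y - d\<bar>\<close> by a constant
  plus \<open>(y - d)^2 / (2 * e)\<close>. Taking the right end \<open>e\<close> of the time
  interval makes the quadratic term at most the Gaussian exponent for every \<open>t\<close> in the
  interval.\<close>

lemma rapid_exp_square:
  assumes a: "0 < a" and f: "\<And>t y. t \<in> {a..e} \<Longrightarrow> \<bar>f t y\<bar> \<le> C * exp (- ((y - d)\<^sup>2 / (2 * t)))" and C: "0 \<le> C"
  shows "rapid a e f"
  unfolding rapid_def
proof
  fix k :: real
  have "\<bar>f t y\<bar> \<le> (C * exp (\<bar>k\<bar> * \<bar>d\<bar> + \<bar>k\<bar>\<^sup>2 * e / 2)) * exp (- (k * \<bar>y\<bar>))" if t: "t \<in> {a..e}" for t y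
  proof -
    have t0: "0 < t" "t \<le> e" using t a by auto
    have "(y - d)\<^sup>2 / (2 * e) \<le> (y - d)\<^sup>2 / (2 * t)" using t0 by (intro divide_left_mono) auto
    moreover have "\<bar>k\<bar> * \<bar>y - d\<bar> \<le> \<bar>k\<bar>\<^sup>2 * e / 2 + (y - d)\<^sup>2 / (2 * e)"
    proof -
      have "0 \<le> (\<bar>k\<bar> * e - \<bar>y - d\<bar>)\<^sup>2 / (2 * e)" using t0 by simp
      also have "\<dots> = \<bar>k\<bar>\<^sup>2 * e / 2 + \<bar>y - d\<bar>\<^sup>2 / (2 * e) - \<bar>k\<bar> * \<bar>y - d\<bar>"
        using t0 by (simp add: power2_diff power_mult_distrib diff_divide_distrib add_divide_distrib) (simp add: power2_eq_square)
      finally show ?thesis by simp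
    qed
    moreover have "k * \<bar>y\<bar> \<le> \<bar>k\<bar> * \<bar>y - d\<bar> + \<bar>k\<bar> * \<bar>d\<bar>"
    proof -
      have "k * \<bar>y\<bar> \<le> \<bar>k\<bar> * \<bar>y\<bar>" by (intro mult_right_mono) auto
      also have "\<dots> \<le> \<bar>k\<bar> * (\<bar>y - d\<bar> + \<bar>d\<bar>)" by (intro mult_left_mono) auto
      finally show ?thesis by (simp add: distrib_left)
    qed
    ultimately have "- ((y - d)\<^sup>2 / (2 * t)) \<le> (\<bar>k\<bar> * \<bar>d\<bar> + \<bar>k\<bar>\<^sup>2 * e / 2) + - (k * \<bar>y\<bar>)" by linarith
    then have "exp (- ((y - d)\<^sup>2 / (2 * t))) \<le> exp (\<bar>k\<bar> * \<bar>d\<bar> + \<bar>k\<bar>\<^sup>2 * e / 2) * exp (- (k * \<bar>y\<bar>))"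
      by (simp only: exp_add[symmetric] exp_le_cancel_iff)
    then have "C * exp (- ((y - d)\<^sup>2 / (2 * t))) \<le> C * (exp (\<bar>k\<bar> * \<bar>d\<bar> + \<bar>k\<bar>\<^sup>2 * e / 2) * exp (- (k * \<bar>y\<bar>)))"
      using C by (rule mult_left_mono)
    with f[OF t, of y] show ?thesis by (simp add: mult.assoc)
  qed
  then show "\<exists>C. \<forall>t\<in>{a..e}. \<forall>y. \<bar>f t y\<bar> \<le> C * exp (- (k * \<bar>y\<bar>))" by blast
qed

lemma rapid_gauss:
  assumes a: "0 < a" shows "rapid a e (\<lambda>t y. gauss t (y - d))"
proof (rule rapid_exp_square[OF a, where C="1 / sqrt (2 * pi * a)"])
  fix t y :: real assume t: "t \<in> {a..e}"
  have "sqrt (2 * pi * a) \<le> sqrt (2 * pi * t)" using t a by simp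
  then have "exp (- ((y - d)\<^sup>2 / (2 * t))) / sqrt (2 * pi * t) \<le> exp (- ((y - d)\<^sup>2 / (2 * t))) / sqrt (2 * pi * a)"
    using t a by (intro divide_left_mono) auto
  then show "\<bar>gauss t (y - d)\<bar> \<le> 1 / sqrt (2 * pi * a) * exp (- ((y - d)\<^sup>2 / (2 * t)))"
    using t a by (simp add: gauss_def)
qed (use a in simp)

lemma rapid_gauss_abs:
  assumes a: "0 < a" shows "rapid a e (\<lambda>t y. gauss t (\<bar>y\<bar> + \<bar>d\<bar>))"
proof -
  have "\<bar>gauss t (\<bar>y\<bar> + \<bar>d\<bar>)\<bar> \<le> \<bar>gauss t (y - d)\<bar>" if "t \<in> {a..e}" for t y
    using gauss_mono[of t "y - d" "\<bar>y\<bar> + \<bar>d\<bar>"] that a by simp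
  then show ?thesis
    using rapid_gauss[OF a, of e d] unfolding rapid_def by (meson order_trans)
qed

lemma rapid_tail:
  assumes a: "0 < a" shows "rapid a e (\<lambda>t y. tail \<theta> t (\<bar>y\<bar> + \<bar>d\<bar>))"
proof (rule rapid_exp_square[OF a, where C="exp (\<theta>\<^sup>2 * e / 2)" and d=0])
  fix t y :: real assume t: "t \<in> {a..e}"
  then have t0: "0 < t" "t \<le> e" using a by auto
  have "tail \<theta> t (\<bar>y\<bar> + \<bar>d\<bar>) \<le> exp (\<theta>\<^sup>2 * t / 2) * exp (- ((\<bar>y\<bar> + \<bar>d\<bar>)\<^sup>2 / (2 * t)))"
    by (intro tail_le_exp t0) auto
  also have "\<dots> \<le> exp (\<theta>\<^sup>2 * e / 2) * exp (- ((y - 0)\<^sup>2 / (2 * t)))"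
  proof (intro mult_mono)
    have "y\<^sup>2 \<le> (\<bar>y\<bar> + \<bar>d\<bar>)\<^sup>2" by (rule abs_le_square_iff[THEN iffD1]) simp
    then show "exp (- ((\<bar>y\<bar> + \<bar>d\<bar>)\<^sup>2 / (2 * t))) \<le> exp (- ((y - 0)\<^sup>2 / (2 * t)))"
      using t0 by (simp add: divide_right_mono)
    show "exp (\<theta>\<^sup>2 * t / 2) \<le> exp (\<theta>\<^sup>2 * e / 2)" using t0 by (simp add: mult_left_mono)
  qed auto
  finally show "\<bar>tail \<theta> t (\<bar>y\<bar> + \<bar>d\<bar>)\<bar> \<le> exp (\<theta>\<^sup>2 * e / 2) * exp (- ((y - 0)\<^sup>2 / (2 * t)))"
    by (simp add: tail_nonneg)
qed simp

text \<open>For positive \<open>t\<close> this is \<open>ker \<theta> t y d\<close>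
  (\<open>psi0_ker\<close>), seen as a function of the remaining time \<open>t\<close> and the state
  \<open>y\<close> with fixed end point \<open>d\<close>. \<open>psi1\<close> and
  \<open>psi2\<close> are its first two time derivatives and \<open>psi1y\<close> is the mixed one.
  The second space derivative has no name of its own, since it equals \<open>2 * psi1\<close> off
  0.\<close>

definition psi0 :: "real \<Rightarrow> real \<Rightarrow> real \<Rightarrow> real \<Rightarrow> real" where
  "psi0 \<theta> d t y = gauss t (y - d) - \<theta> * tail \<theta> t (\<bar>y\<bar> + \<bar>d\<bar>)"

text \<open>What is left of the space derivative of \<open>psi0\<close> once
  \<open>\<theta> * sgn y * psi0\<close> is taken away (\<open>DERIV_psi0\<close>). The jump of the
  derivative at 0 sits entirely in the removed part: the difference of Gaussians next to
  \<open>sgn y\<close> vanishes at 0, so \<open>chi\<close> is continuous.\<close>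

definition chi :: "real \<Rightarrow> real \<Rightarrow> real \<Rightarrow> real \<Rightarrow> real" where
  "chi \<theta> d t y = - ((y - d) / t) * gauss t (y - d) - \<theta> * (sgn y * (gauss t (y - d) - gauss t (\<bar>y\<bar> + \<bar>d\<bar>)))"

definition psi1 :: "real \<Rightarrow> real \<Rightarrow> real \<Rightarrow> real \<Rightarrow> real" where
  "psi1 \<theta> d t y = ((y - d)\<^sup>2 / t\<^sup>2 - 1 / t) / 2 * gauss t (y - d)
     - \<theta> * ((\<theta>\<^sup>2 * tail \<theta> t (\<bar>y\<bar> + \<bar>d\<bar>) - \<theta> * gauss t (\<bar>y\<bar> + \<bar>d\<bar>) + (\<bar>y\<bar> + \<bar>d\<bar>) / t * gauss t (\<bar>y\<bar> + \<bar>d\<bar>)) / 2)"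

definition psi1y :: "real \<Rightarrow> real \<Rightarrow> real \<Rightarrow> real \<Rightarrow> real" where
  "psi1y \<theta> d t y = ((y - d) / t\<^sup>2) * gauss t (y - d) + ((y - d)\<^sup>2 / t\<^sup>2 - 1 / t) / 2 * (- ((y - d) / t) * gauss t (y - d))
     - \<theta> * ((\<theta>\<^sup>2 * ((\<theta> * tail \<theta> t (\<bar>y\<bar> + \<bar>d\<bar>) - gauss t (\<bar>y\<bar> + \<bar>d\<bar>)) * sgn y)
       - \<theta> * (- ((\<bar>y\<bar> + \<bar>d\<bar>) / t) * gauss t (\<bar>y\<bar> + \<bar>d\<bar>) * sgn y)
       + (sgn y / t * gauss t (\<bar>y\<bar> + \<bar>d\<bar>) + (\<bar>y\<bar> + \<bar>d\<bar>) / t * (- ((\<bar>y\<bar> + \<bar>d\<bar>) / t) * gauss t (\<bar>y\<bar> + \<bar>d\<bar>) * sgn y))) / 2)"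

definition psi2 :: "real \<Rightarrow> real \<Rightarrow> real \<Rightarrow> real \<Rightarrow> real" where
  "psi2 \<theta> d t y = (- (2 * (y - d)\<^sup>2) / t ^ 3 + 1 / t\<^sup>2) / 2 * gauss t (y - d)
       + ((y - d)\<^sup>2 / t\<^sup>2 - 1 / t) / 2 * (((y - d)\<^sup>2 / t\<^sup>2 - 1 / t) / 2 * gauss t (y - d))
     - \<theta> * ((\<theta>\<^sup>2 * ((\<theta>\<^sup>2 * tail \<theta> t (\<bar>y\<bar> + \<bar>d\<bar>) - \<theta> * gauss t (\<bar>y\<bar> + \<bar>d\<bar>) + (\<bar>y\<bar> + \<bar>d\<bar>) / t * gauss t (\<bar>y\<bar> + \<bar>d\<bar>)) / 2)
       - \<theta> * (((\<bar>y\<bar> + \<bar>d\<bar>)\<^sup>2 / t\<^sup>2 - 1 / t) / 2 * gauss t (\<bar>y\<bar> + \<bar>d\<bar>))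
       + (- (\<bar>y\<bar> + \<bar>d\<bar>) / t\<^sup>2 * gauss t (\<bar>y\<bar> + \<bar>d\<bar>) + (\<bar>y\<bar> + \<bar>d\<bar>) / t * (((\<bar>y\<bar> + \<bar>d\<bar>)\<^sup>2 / t\<^sup>2 - 1 / t) / 2 * gauss t (\<bar>y\<bar> + \<bar>d\<bar>)))) / 2)"

lemma psi0_ker: "0 < t \<Longrightarrow> psi0 \<theta> d t y = ker \<theta> t y d"
  by (simp add: psi0_def ker_eq gauss_diff_commute)

lemmas slow_intros = slow_add slow_diff slow_mult slow_divide slow_divide1 slow_divide_const slow_power slow_sgn slow_abs slow_id slow_const slow_inverse

lemma rapid_psi:
  assumes a: "0 < a"
  shows "rapid a e (psi0 \<theta> d)" "rapid a e (chi \<theta> d)" "rapid a e (psi1 \<theta> d)" "rapid a e (psi1y \<theta> d)" "rapid a e (psi2 \<theta> d)"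
proof -
  note r = rapid_add rapid_diff rapid_divide_const rapid_gauss rapid_gauss_abs rapid_tail
  have m: "\<And>h f. slow a e h \<Longrightarrow> rapid a e f \<Longrightarrow> rapid a e (\<lambda>t y. h t y * f t y)" by (rule rapid_mult)
  have s1: "slow a e (\<lambda>t y. - ((y - d) / t))" "slow a e (\<lambda>t y. ((y - d)\<^sup>2 / t\<^sup>2 - 1 / t) / 2)"
    "slow a e (\<lambda>t y. (y - d) / t\<^sup>2)" "slow a e (\<lambda>t y. (\<bar>y\<bar> + \<bar>d\<bar>) / t)" "slow a e (\<lambda>t y. - ((\<bar>y\<bar> + \<bar>d\<bar>) / t))"
    "slow a e (\<lambda>t y. ((\<bar>y\<bar> + \<bar>d\<bar>)\<^sup>2 / t\<^sup>2 - 1 / t) / 2)" "slow a e (\<lambda>t y. sgn y / t)"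
    "slow a e (\<lambda>t y. - (\<bar>y\<bar> + \<bar>d\<bar>) / t\<^sup>2)" "slow a e (\<lambda>t y. (- (2 * (y - d)\<^sup>2) / t ^ 3 + 1 / t\<^sup>2) / 2)"
    by (intro slow_intros slow_minus a)+
  show "rapid a e (psi0 \<theta> d)" unfolding psi0_def by (intro r m slow_const a)
  show "rapid a e (chi \<theta> d)" unfolding chi_def by (intro r m slow_const slow_sgn s1 a)
  show "rapid a e (psi1 \<theta> d)" unfolding psi1_def by (intro r m slow_const slow_sgn s1 a)
  show "rapid a e (psi1y \<theta> d)" unfolding psi1y_def by (intro r m rapid_mult'[OF slow_sgn] slow_const slow_sgn s1 a)
  show "rapid a e (psi2 \<theta> d)" unfolding psi2_def by (intro r m slow_const slow_sgn s1 a)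
qed

lemma DERIV_psi0:
  assumes t: "0 < t" and y: "y \<noteq> 0"
  shows "((\<lambda>y. psi0 \<theta> d t y) has_real_derivative chi \<theta> d t y + \<theta> * sgn y * psi0 \<theta> d t y) (at y)"
proof -
  have m: "((\<lambda>y. \<bar>y\<bar> + \<bar>d\<bar>) has_real_derivative sgn y) (at y)"
    using DERIV_add[OF DERIV_abs_nonzero(1)[OF y] DERIV_const[of "\<bar>d\<bar>"]] by simp
  have z: "((\<lambda>y. y - d) has_real_derivative 1) (at y)" by (auto intro!: derivative_eq_intros)
  show ?thesis unfolding psi0_def
    by (rule DERIV_cong[OF DERIV_diff[OF DERIV_gauss_space[OF t z] DERIV_cmult[OF DERIV_tail_space[OF t m]]]])
      (simp add: chi_def algebra_simps)
qed

text \<open>The heat equation off 0: the second space derivative of \<open>psi0\<close> is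
  \<open>2 * psi1\<close>. Written for \<open>chi\<close>, the derivative of the removed part
  \<open>\<theta> * sgn y * psi0\<close> has to be subtracted, and \<open>sgn\<close> is locally
  constant.\<close>

lemma DERIV_chi:
  assumes t: "0 < t" and y: "y \<noteq> 0"
  shows "((\<lambda>y. chi \<theta> d t y) has_real_derivative 2 * psi1 \<theta> d t y - \<theta> * sgn y * (chi \<theta> d t y + \<theta> * sgn y * psi0 \<theta> d t y)) (at y)"
proof -
  have m: "((\<lambda>y. \<bar>y\<bar> + \<bar>d\<bar>) has_real_derivative sgn y) (at y)"
    using DERIV_add[OF DERIV_abs_nonzero(1)[OF y] DERIV_const[of "\<bar>d\<bar>"]] by simp
  have z: "((\<lambda>y. y - d) has_real_derivative 1) (at y)" by (auto intro!: derivative_eq_intros)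
  have zt: "((\<lambda>y. - ((y - d) / t)) has_real_derivative - (1 / t)) (at y)" using t by (auto intro!: derivative_eq_intros)
  have s2: "sgn y * sgn y = 1" using y by (simp add: sgn_if)
  have s3: "sgn y * (sgn y * q) = q" for q using s2 by (simp add: mult.assoc[symmetric])
  note g = DERIV_gauss_space[OF t z] and gm = DERIV_gauss_space[OF t m]
  show ?thesis unfolding chi_def
    by (rule DERIV_cong[OF DERIV_diff[OF DERIV_mult[OF zt g] DERIV_cmult[OF DERIV_mult[OF DERIV_abs_nonzero(2)[OF y] DERIV_diff[OF g gm]]]]])
      (use y in \<open>simp add: psi1_def psi0_def s3 algebra_simps power2_eq_square diff_divide_distrib add_divide_distrib\<close>)
qed

lemma DERIV_psi1:
  assumes t: "0 < t" and y: "y \<noteq> 0"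
  shows "((\<lambda>y. psi1 \<theta> d t y) has_real_derivative psi1y \<theta> d t y) (at y)"
proof -
  have m: "((\<lambda>y. \<bar>y\<bar> + \<bar>d\<bar>) has_real_derivative sgn y) (at y)"
    using DERIV_add[OF DERIV_abs_nonzero(1)[OF y] DERIV_const[of "\<bar>d\<bar>"]] by simp
  have z: "((\<lambda>y. y - d) has_real_derivative 1) (at y)" by (auto intro!: derivative_eq_intros)
  have zt: "((\<lambda>y. ((y - d)\<^sup>2 / t\<^sup>2 - 1 / t) / 2) has_real_derivative (y - d) / t\<^sup>2) (at y)"
    by (rule DERIV_cong[OF DERIV_cdivide[OF DERIV_diff[OF DERIV_cdivide[OF DERIV_power[OF z, of 2]] DERIV_const]]])
      (simp add: diff_divide_distrib)
  note g = DERIV_gauss_space[OF t z] and gm = DERIV_gauss_space[OF t m]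
  show ?thesis unfolding psi1_def
    by (rule DERIV_cong[OF DERIV_diff[OF DERIV_mult[OF zt g] DERIV_cmult[OF DERIV_cdivide[OF
        DERIV_add[OF DERIV_diff[OF DERIV_cmult[OF DERIV_tail_space[OF t m]] DERIV_cmult[OF gm]] DERIV_mult[OF DERIV_cdivide[OF m] gm]]]]]])
      (simp add: psi1y_def algebra_simps)
qed

lemma DERIV_psi0_time:
  assumes t: "0 < t"
  shows "((\<lambda>t. psi0 \<theta> d t y) has_real_derivative psi1 \<theta> d t y) (at t)"
  unfolding psi0_def psi1_def by (intro DERIV_diff DERIV_cmult DERIV_gauss_time DERIV_tail_time t)

lemma DERIV_psi1_time:
  assumes t: "0 < t"
  shows "((\<lambda>t. psi1 \<theta> d t y) has_real_derivative psi2 \<theta> d t y) (at t)"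
proof -
  have z: "((\<lambda>t. ((y - d)\<^sup>2 / t\<^sup>2 - 1 / t) / 2) has_real_derivative (- (2 * (y - d)\<^sup>2) / t ^ 3 + 1 / t\<^sup>2) / 2) (at t)"
    using t by (auto intro!: derivative_eq_intros simp: field_simps power2_eq_square power3_eq_cube)
  have m: "((\<lambda>t. m / t) has_real_derivative - m / t\<^sup>2) (at t)" for m
    using t by (auto intro!: derivative_eq_intros simp: power2_eq_square)
  note g = DERIV_gauss_time[OF t]
  show ?thesis unfolding psi1_def
    by (rule DERIV_cong[OF DERIV_diff[OF DERIV_mult[OF z g] DERIV_cmult[OF DERIV_cdivide[OF
        DERIV_add[OF DERIV_diff[OF DERIV_cmult[OF DERIV_tail_time[OF t]] DERIV_cmult[OF g]] DERIV_mult[OF m g]]]]]])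
      (simp add: psi2_def algebra_simps)
qed

lemma continuous_psi:
  assumes t: "0 < t"
  shows "continuous_on UNIV (psi0 \<theta> d t)" "continuous_on UNIV (chi \<theta> d t)" "continuous_on UNIV (psi1 \<theta> d t)"
proof -
  have g: "continuous_on UNIV (gauss t)" and ta: "continuous_on UNIV (tail \<theta> t)"
    using DERIV_gauss_space[OF t DERIV_ident] DERIV_tail_space[OF t DERIV_ident]
    by (auto intro!: continuous_at_imp_continuous_on DERIV_isCont)
  have gc: "continuous_on UNIV (\<lambda>y. gauss t (f y))" "continuous_on UNIV (\<lambda>y. tail \<theta> t (f y))" if "continuous_on UNIV f" for f :: "real \<Rightarrow> real"
    using continuous_on_compose2[OF g that] continuous_on_compose2[OF ta that] by auto
  show "continuous_on UNIV (psi0 \<theta> d t)" "continuous_on UNIV (psi1 \<theta> d t)"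
    unfolding psi0_def psi1_def using t by (intro continuous_intros gc; simp)+
  \<comment> \<open>At 0 the bracket tends to 0 while \<open>sgn\<close> stays bounded; away from 0
    both factors are continuous.\<close>
  have "isCont (\<lambda>y. sgn y * (gauss t (y - d) - gauss t (\<bar>y\<bar> + \<bar>d\<bar>))) y" for y
  proof (cases "y = 0")
    case True
    have "continuous_on UNIV (\<lambda>y. \<bar>gauss t (y - d) - gauss t (\<bar>y\<bar> + \<bar>d\<bar>)\<bar>)"
      by (intro continuous_intros gc)
    then have "((\<lambda>y. \<bar>gauss t (y - d) - gauss t (\<bar>y\<bar> + \<bar>d\<bar>)\<bar>) \<longlongrightarrow> \<bar>gauss t (0 - d) - gauss t (\<bar>0\<bar> + \<bar>d\<bar>)\<bar>) (at 0)"
      by (simp only: continuous_on_eq_continuous_at[OF open_UNIV] isCont_def) blast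
    then have lim: "((\<lambda>y. \<bar>gauss t (y - d) - gauss t (\<bar>y\<bar> + \<bar>d\<bar>)\<bar>) \<longlongrightarrow> 0) (at 0)" by simp
    have le: "norm (sgn y * q) \<le> \<bar>q\<bar>" for y q :: real
      by (cases y "0 :: real" rule: linorder_cases) auto
    have "((\<lambda>y. sgn y * (gauss t (y - d) - gauss t (\<bar>y\<bar> + \<bar>d\<bar>))) \<longlongrightarrow> 0) (at 0)"
      by (rule Lim_null_comparison[OF always_eventually[OF allI, OF le] lim])
    then show ?thesis using True by (simp add: isCont_def)
  next
    case False
    have "isCont (\<lambda>y. gauss t (y - d) - gauss t (\<bar>y\<bar> + \<bar>d\<bar>)) y"
    proof -
      have "continuous_on UNIV (\<lambda>y. gauss t (y - d) - gauss t (\<bar>y\<bar> + \<bar>d\<bar>))"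
        by (intro continuous_intros gc)
      then show ?thesis by (simp only: continuous_on_eq_continuous_at[OF open_UNIV]) blast
    qed
    then show ?thesis
      using DERIV_isCont[OF DERIV_abs_nonzero(2)[OF False]] by (intro isCont_mult)
  qed
  then have c2: "continuous_on UNIV (\<lambda>y. sgn y * (gauss t (y - d) - gauss t (\<bar>y\<bar> + \<bar>d\<bar>)))"
    by (intro continuous_at_imp_continuous_on) auto
  have c1: "continuous_on UNIV (\<lambda>y. - ((y - d) / t) * gauss t (y - d))"
    using t by (intro continuous_intros gc) auto
  show "continuous_on UNIV (chi \<theta> d t)"
    unfolding chi_def by (rule continuous_on_diff[OF c1 continuous_on_mult[OF continuous_on_const c2]])
qed

section \<open>The drift\<close>

locale drift =
  fixes b :: "real \<Rightarrow> real" and K M :: real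
  assumes adm: "admissible_drift b" and bM: "\<And>y. \<bar>b y\<bar> \<le> M" and K: "\<And>y. phi_tilde b y \<le> K"
begin

abbreviation "\<theta> \<equiv> half_jump b"
abbreviation "B \<equiv> drift_primitive b"

text \<open>The drift with its jump removed. The value at 0 is the mean of the one-sided limits,
  which is what both \<open>b(0+) - \<theta>\<close> and \<open>b(0-) + \<theta>\<close> amount to;
  so \<open>bhat\<close> is continuous, whatever \<open>b 0\<close> is.\<close>

definition "bhat y = (if y = 0 then (Lim (at_right 0) b + Lim (at_left 0) b) / 2 else b y - \<theta> * sgn y)"

lemma DERIV_b: "y \<noteq> 0 \<Longrightarrow> (b has_real_derivative deriv b y) (at y)"
  using adm by (simp add: admissible_drift_def DERIV_deriv_iff_real_differentiable)

lemma ex_deriv_bound: "\<exists>C\<ge>0. \<forall>y. y \<noteq> 0 \<longrightarrow> \<bar>deriv b y\<bar> \<le> C"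
proof -
  have bd: "bounded (deriv b ` {0<..})" "bounded (deriv b ` {..<0})" using adm by (auto simp: admissible_drift_def)
  obtain C where "\<And>y. y > 0 \<Longrightarrow> \<bar>deriv b y\<bar> \<le> C" using bd(1) unfolding bounded_iff by auto
  moreover obtain D where "\<And>y. y < 0 \<Longrightarrow> \<bar>deriv b y\<bar> \<le> D" using bd(2) unfolding bounded_iff by auto
  ultimately show ?thesis
    by (intro exI[of _ "max 0 (max C D)"]) (auto simp: neq_iff le_max_iff_disj)
qed

lemma limits: "(b \<longlongrightarrow> Lim (at_right 0) b) (at_right 0)" "(b \<longlongrightarrow> Lim (at_left 0) b) (at_left 0)"
  using adm tendsto_Lim[of "at_right (0::real)" b] tendsto_Lim[of "at_left (0::real)" b]
  unfolding admissible_drift_def by auto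

lemma DERIV_bhat: "y \<noteq> 0 \<Longrightarrow> (bhat has_real_derivative deriv b y) (at y)"
proof -
  assume y: "y \<noteq> 0"
  have "((\<lambda>y. b y - \<theta> * sgn y) has_real_derivative deriv b y - \<theta> * 0) (at y)"
    by (intro DERIV_diff DERIV_cmult DERIV_b DERIV_abs_nonzero y)
  moreover have "eventually (\<lambda>u. b u - \<theta> * sgn u = bhat u) (nhds y)"
  proof -
    have "open (- {0 :: real})" by auto
    then have "eventually (\<lambda>u. u \<in> - {0}) (nhds y)" using y by (intro eventually_nhds_in_open) auto
    then show ?thesis by eventually_elim (simp add: bhat_def)
  qed
  ultimately show ?thesis by (subst (asm) DERIV_cong_ev[OF refl _ refl]) auto
qed

lemma continuous_bhat: "continuous_on UNIV bhat"
proof (intro continuous_at_imp_continuous_on ballI)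
  fix y :: real
  show "isCont bhat y"
  proof (cases "y = 0")
    case True
    have "((\<lambda>u. b u - \<theta> * 1) \<longlongrightarrow> Lim (at_right 0) b - \<theta> * 1) (at_right 0)"
      by (intro tendsto_intros limits)
    then have "(bhat \<longlongrightarrow> Lim (at_right 0) b - \<theta> * 1) (at_right 0)"
      by (rule Lim_transform_eventually) (auto simp: bhat_def eventually_at_filter)
    moreover have "Lim (at_right 0) b - \<theta> * 1 = bhat 0" "Lim (at_left 0) b - \<theta> * (-1) = bhat 0"
      by (auto simp: bhat_def half_jump_def field_simps)
    moreover have "((\<lambda>u. b u - \<theta> * (-1)) \<longlongrightarrow> Lim (at_left 0) b - \<theta> * (-1)) (at_left 0)"
      by (intro tendsto_intros limits)
    then have "(bhat \<longlongrightarrow> Lim (at_left 0) b - \<theta> * (-1)) (at_left 0)"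
      by (rule Lim_transform_eventually) (auto simp: bhat_def eventually_at_filter)
    ultimately show ?thesis using True by (simp only: isCont_def filterlim_at_split)
  next
    case False then show ?thesis by (rule DERIV_isCont[OF DERIV_bhat])
  qed
qed

lemma b_eq: "y \<noteq> 0 \<Longrightarrow> b y = bhat y + \<theta> * sgn y"
  by (simp add: bhat_def)

lemma b_measurable: "b \<in> borel_measurable borel"
proof -
  have [measurable]: "bhat \<in> borel_measurable borel"
    by (rule borel_measurable_continuous_onI[OF continuous_bhat])
  have "b = (\<lambda>y. if y = 0 then b 0 else bhat y + \<theta> * (if 0 < y then 1 else - 1))"
    by (auto simp: fun_eq_iff bhat_def sgn_if)
  also have "\<dots> \<in> borel_measurable borel" by measurable
  finally show ?thesis .
qed

text \<open>Off 0 the derivative is a pointwise limit of difference quotients along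
  \<open>1 / Suc n\<close>. At 0 \<open>deriv b\<close> may be an arbitrary number, so that point is
  split off.\<close>

lemma deriv_measurable: "deriv b \<in> borel_measurable borel"
proof -
  note [measurable] = b_measurable
  have "(\<lambda>y. if y = 0 then deriv b 0 else deriv b y) \<in> borel_measurable borel"
  proof (rule borel_measurable_LIMSEQ_real)
    show "(\<lambda>y. if y = 0 then deriv b 0 else (b (y + 1 / real (Suc n)) - b y) / (1 / real (Suc n))) \<in> borel_measurable borel" for n
      by measurable
    fix y :: real
    show "(\<lambda>n. if y = 0 then deriv b 0 else (b (y + 1 / real (Suc n)) - b y) / (1 / real (Suc n))) \<longlonglongrightarrow> (if y = 0 then deriv b 0 else deriv b y)"
    proof (cases "y = 0")
      case False
      have l: "(\<lambda>n. 1 / real (Suc n)) \<longlonglongrightarrow> 0" by (rule LIMSEQ_Suc[OF lim_1_over_n])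
      have "(\<lambda>h. (b (y + h) - b y) / h) \<midarrow>0\<rightarrow> deriv b y" using DERIV_b[OF False] by (simp add: DERIV_def)
      then have "(\<lambda>n. (b (y + 1 / real (Suc n)) - b y) / (1 / real (Suc n))) \<longlonglongrightarrow> deriv b y"
        by (rule filterlim_compose[OF _ filterlim_atI[OF l]]) simp
      then show ?thesis using False by (simp only: if_False)
    qed simp
  qed
  also have "(\<lambda>y. if y = 0 then deriv b 0 else deriv b y) = deriv b" by (auto simp: fun_eq_iff)
  finally show ?thesis .
qed

text \<open>Separates the smooth part of \<open>B\<close> from its kink
  \<open>\<theta> * \<bar>y\<bar>\<close>. On the open interval between 0 and \<open>y\<close> the
  sign is the constant \<sigma>, so there \<open>b\<close> equals
  \<open>bhat + \<theta> * \<sigma>\<close>.\<close>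

lemma B_eq: "\<exists>p. (\<forall>y. (p has_real_derivative bhat y) (at y)) \<and> (\<forall>y. B y = p y - p 0 + \<theta> * \<bar>y\<bar>)"
proof -
  obtain p where p: "\<And>y. (p has_real_derivative bhat y) (at y)" using ex_antiderivative[OF continuous_bhat] by blast
  have "B y = p y - p 0 + \<theta> * \<bar>y\<bar>" for y
  proof -
    define \<sigma> where "\<sigma> = sgn y"
    have "B y = (LBINT u=ereal 0..ereal y. bhat u + \<theta> * \<sigma>)"
      unfolding drift_primitive_def zero_ereal_def
    proof (rule interval_integral_cong)
      fix u assume "u \<in> einterval (min (ereal 0) (ereal y)) (max (ereal 0) (ereal y))"
      then have "u \<noteq> 0 \<and> sgn u = \<sigma>" unfolding \<sigma>_def
        by (cases "0 \<le> y") (auto simp: einterval_def min_def max_def sgn_if)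
      then show "b u = bhat u + \<theta> * \<sigma>" by (simp add: b_eq)
    qed
    also have "\<dots> = (p y + \<theta> * \<sigma> * y) - (p 0 + \<theta> * \<sigma> * 0)"
    proof (rule interval_integral_FTC_finite)
      show "continuous_on {min 0 y..max 0 y} (\<lambda>u. bhat u + \<theta> * \<sigma>)"
        by (intro continuous_intros continuous_on_subset[OF continuous_bhat]) auto
      show "((\<lambda>y. p y + \<theta> * \<sigma> * y) has_vector_derivative bhat u + \<theta> * \<sigma>) (at u within {min 0 y..max 0 y})" for u
        by (rule has_vector_derivative_at_within)
          (auto intro!: derivative_eq_intros p simp: has_real_derivative_iff_has_vector_derivative[symmetric])
    qed
    finally show ?thesis by (simp add: \<sigma>_def abs_sgn mult.assoc mult.commute[of "sgn y"])
  qed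
  with p show ?thesis by blast
qed

lemma DERIV_B: "y \<noteq> 0 \<Longrightarrow> (B has_real_derivative b y) (at y)"
  and continuous_B: "continuous_on UNIV B" and B_0 [simp]: "B 0 = 0"
proof -
  obtain p where p: "\<And>y. (p has_real_derivative bhat y) (at y)" and eq: "\<And>y. B y = p y - p 0 + \<theta> * \<bar>y\<bar>"
    using B_eq by blast
  have eq': "B = (\<lambda>y. p y - p 0 + \<theta> * \<bar>y\<bar>)" using eq by (rule ext)
  show "(B has_real_derivative b y) (at y)" if "y \<noteq> 0"
    unfolding eq' b_eq[OF that]
    by (rule DERIV_cong[OF DERIV_add[OF DERIV_diff[OF p DERIV_const] DERIV_cmult[OF DERIV_abs_nonzero(1)[OF that]]]]) simp
  show "continuous_on UNIV B"
    unfolding eq' by (intro continuous_intros continuous_at_imp_continuous_on ballI DERIV_isCont[OF p])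
  show "B 0 = 0" by (simp add: eq)
qed

lemma M_nonneg: "0 \<le> M" using bM[of 0] by simp

lemma B_bound: "\<bar>B y\<bar> \<le> M * \<bar>y\<bar>"
  using lipschitz_off_0[OF continuous_B DERIV_B bM M_nonneg, of y 0] by simp

lemma B_measurable [measurable]: "B \<in> borel_measurable borel"
  by (rule borel_measurable_continuous_onI[OF continuous_B])

definition "V y = K - phi_tilde b y"
definition "c = K + (INF u\<in>-{0}. phi b u)"

lemma phi_bdd: "\<exists>C. \<forall>y. y \<noteq> 0 \<longrightarrow> \<bar>phi b y\<bar> \<le> C"
proof -
  obtain C where C: "0 \<le> C" "\<And>y. y \<noteq> 0 \<Longrightarrow> \<bar>deriv b y\<bar> \<le> C" using ex_deriv_bound by blast
  have "\<bar>phi b y\<bar> \<le> M\<^sup>2 + C" if "y \<noteq> 0" for y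
  proof -
    have "(b y)\<^sup>2 \<le> M\<^sup>2" using power_mono[OF bM[of y], of 2] by simp
    then have "\<bar>(b y)\<^sup>2 + deriv b y\<bar> \<le> M\<^sup>2 + C"
      using abs_triangle_ineq[of "(b y)\<^sup>2" "deriv b y"] C(2)[OF that] by simp
    moreover have "\<bar>q / 2\<bar> \<le> A" if "\<bar>q\<bar> \<le> A" for q A :: real using that by simp
    ultimately show ?thesis unfolding phi_def by blast
  qed
  then show ?thesis by blast
qed

lemma phi_tilde_nonneg: "0 \<le> phi_tilde b y"
proof (cases "y = 0")
  case False
  obtain C where C: "\<And>y. y \<noteq> 0 \<Longrightarrow> \<bar>phi b y\<bar> \<le> C" using phi_bdd by blast
  have "bdd_below (phi b ` (-{0}))"
  proof (rule bdd_belowI2)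
    show "- C \<le> phi b u" if "u \<in> - {0}" for u using C[of u] that by auto
  qed
  then have "(INF u\<in>-{0}. phi b u) \<le> phi b y" using False by (intro cINF_lower) auto
  then show ?thesis using False by (simp add: phi_tilde_def)
qed (simp add: phi_tilde_def)

lemma K_nonneg: "0 \<le> K" using K[of 0] by (simp add: phi_tilde_def)

lemma V_bounds: "0 \<le> V y" "V y \<le> K" using K[of y] phi_tilde_nonneg[of y] by (auto simp: V_def)

lemma phi_V: "y \<noteq> 0 \<Longrightarrow> phi b y = c - V y" by (simp add: V_def c_def phi_tilde_def)

lemma phi_tilde_measurable [measurable]: "phi_tilde b \<in> borel_measurable borel"
proof -
  note [measurable] = b_measurable deriv_measurable
  show ?thesis unfolding phi_tilde_def[abs_def] phi_def by measurable
qed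

lemma V_measurable [measurable]: "V \<in> borel_measurable borel"
  unfolding V_def[abs_def] by measurable

end

section \<open>The Duhamel identity tested against the kernel\<close>

locale drift_sde = drift b K M + sde P F T b x W X M for b K M and P :: "'b measure" and F T x W X
begin

lemma rapid_weighted:
  assumes f: "rapid \<epsilon> (t + \<epsilon>) f"
  shows "\<exists>C\<ge>0. \<forall>s\<in>{0..t}. \<forall>y. \<bar>exp (c * s) * exp (- B y) * f (t + \<epsilon> - s) y\<bar> \<le> C"
proof -
  obtain C where C: "0 \<le> C" "\<And>\<tau> y. \<tau> \<in> {\<epsilon>..t + \<epsilon>} \<Longrightarrow> \<bar>f \<tau> y\<bar> \<le> C * exp (- (M * \<bar>y\<bar>))"
    using rapidD[OF f, of M] by blast
  have "\<bar>exp (c * s) * exp (- B y) * f (t + \<epsilon> - s) y\<bar> \<le> exp (\<bar>c\<bar> * t) * C" if s: "s \<in> {0..t}" for s y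
  proof -
    have "c * s \<le> \<bar>c\<bar> * t" using s by (intro mult_mono) auto
    then have 1: "exp (c * s) \<le> exp (\<bar>c\<bar> * t)" by simp
    have 2: "exp (- B y) \<le> exp (M * \<bar>y\<bar>)" using B_bound[of y] by simp
    have "\<bar>exp (c * s) * exp (- B y) * f (t + \<epsilon> - s) y\<bar> = exp (c * s) * exp (- B y) * \<bar>f (t + \<epsilon> - s) y\<bar>"
      by (simp add: abs_mult)
    also have "\<dots> \<le> (exp (\<bar>c\<bar> * t) * exp (M * \<bar>y\<bar>)) * (C * exp (- (M * \<bar>y\<bar>)))"
      using s by (intro mult_mono 1 2 C(2)) auto
    also have "\<dots> = exp (\<bar>c\<bar> * t) * C * (exp (M * \<bar>y\<bar>) * exp (- (M * \<bar>y\<bar>)))" by (simp add: ac_simps)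
    also have "\<dots> = exp (\<bar>c\<bar> * t) * C" by (simp add: exp_add[symmetric] del: exp_minus_inverse)
    finally show ?thesis .
  qed
  then show ?thesis using C(1) by (intro exI[of _ "exp (\<bar>c\<bar> * t) * C"]) auto
qed

text \<open>\<open>dynkin_time\<close> is applied to \<open>u s y = exp (c * s) * exp (- B y) * ker
  \<theta> (t + \<epsilon> - s) y d\<close>. The additional time \<epsilon> keeps the kernel away
  from its singularity, so that every derivative is bounded for \<open>s\<close> in
  \<open>{0..t}\<close>; at \<open>s = t\<close> it leaves the smooth test function
  \<open>ker \<theta> \<epsilon> y d\<close>.\<close>

lemma mild_point:
  assumes \<epsilon>: "0 < \<epsilon>" and t: "t \<in> {0..T}"
  shows "(\<integral>\<^sup>+\<omega>. ennreal (exp (c * t) * exp (- B (Z t \<omega>)) * ker \<theta> \<epsilon> (Z t \<omega>) d) \<partial>P)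
    = ennreal (exp (- B x) * ker \<theta> (t + \<epsilon>) x d)
      + (\<integral>\<^sup>+r. (\<integral>\<^sup>+\<omega>. ennreal (exp (c * r) * exp (- B (Z r \<omega>)) * (V (Z r \<omega>) * ker \<theta> (t + \<epsilon> - r) (Z r \<omega>) d)) \<partial>P) * indicator {0..t} r \<partial>lborel)"
proof -
  define e where "e = t + \<epsilon>"
  define w where "w s y = exp (c * s) * exp (- B y)" for s y
  define p0 where "p0 s y = psi0 \<theta> d (e - s) y" for s y
  define p1 where "p1 s y = psi1 \<theta> d (e - s) y" for s y
  define p2 where "p2 s y = psi2 \<theta> d (e - s) y" for s y
  define p1y where "p1y s y = psi1y \<theta> d (e - s) y" for s y
  define ch where "ch s y = chi \<theta> d (e - s) y" for s y
  define ph where "ph y = c - V y" for y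
  define u where "u s y = w s y * p0 s y" for s y
  \<comment> \<open>Differentiating \<open>exp (- B)\<close> contributes
    \<open>- b = - bhat - \<theta> * sgn y\<close>, and the last summand cancels the jump in the
    derivative of the kernel. What remains is continuous at 0, and \<open>DERIV_at_0\<close> makes
    it the derivative there too.\<close>
  define u1 where "u1 s y = w s y * (ch s y - bhat y * p0 s y)" for s y
  define us where "us s y = w s y * (c * p0 s y - p1 s y)" for s y
  define Wf where "Wf s y = w s y * (p1 s y - ph y * p0 s y)" for s y
  \<comment> \<open>Chosen so that \<open>gen (u1 s) (u2 s) y\<close> equals \<open>Wf s y\<close>
    identically, at 0 as well. The discontinuous \<open>b\<close> thereby drops out of the
    generator, which must be Lipschitz in time.\<close>
  define u2 where "u2 s y = 2 * (Wf s y - b y * u1 s y)" for s y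
  \<comment> \<open>The indicator makes \<open>G\<close> bounded for all real times, since the
    kernel is controlled only while \<open>t + \<epsilon> - r\<close> is at least \<epsilon> and
    bounded above.\<close>
  define G where "G r y = indicator {0..t} r * (w r y * (V y * p0 r y))" for r y
  have es: "0 < e - s" if "s \<in> {0..t}" for s using that \<epsilon> by (auto simp: e_def)
  obtain C0 where C0: "0 \<le> C0" "\<And>s y. s \<in> {0..t} \<Longrightarrow> \<bar>w s y * p0 s y\<bar> \<le> C0"
    using rapid_weighted[OF rapid_psi(1)[OF \<epsilon>], of t \<theta> d] unfolding w_def p0_def e_def by blast
  obtain C1 where C1: "0 \<le> C1" "\<And>s y. s \<in> {0..t} \<Longrightarrow> \<bar>w s y * ch s y\<bar> \<le> C1"
    using rapid_weighted[OF rapid_psi(2)[OF \<epsilon>], of t \<theta> d] unfolding w_def ch_def e_def by blast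
  obtain C2 where C2: "0 \<le> C2" "\<And>s y. s \<in> {0..t} \<Longrightarrow> \<bar>w s y * p1 s y\<bar> \<le> C2"
    using rapid_weighted[OF rapid_psi(3)[OF \<epsilon>], of t \<theta> d] unfolding w_def p1_def e_def by blast
  obtain C3 where C3: "0 \<le> C3" "\<And>s y. s \<in> {0..t} \<Longrightarrow> \<bar>w s y * p1y s y\<bar> \<le> C3"
    using rapid_weighted[OF rapid_psi(4)[OF \<epsilon>], of t \<theta> d] unfolding w_def p1y_def e_def by blast
  obtain C4 where C4: "0 \<le> C4" "\<And>s y. s \<in> {0..t} \<Longrightarrow> \<bar>w s y * p2 s y\<bar> \<le> C4"
    using rapid_weighted[OF rapid_psi(5)[OF \<epsilon>], of t \<theta> d] unfolding w_def p2_def e_def by blast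
  define Mh where "Mh = \<bar>bhat 0\<bar> + M + \<bar>\<theta>\<bar>"
  define Mp where "Mp = \<bar>c\<bar> + K"
  have Mh: "0 \<le> Mh" "\<bar>bhat y\<bar> \<le> Mh" for y
  proof -
    have "\<bar>\<theta> * sgn y\<bar> \<le> \<bar>\<theta>\<bar>" by (simp add: abs_mult sgn_if)
    then have "bhat y = bhat 0 \<or> \<bar>bhat y\<bar> \<le> M + \<bar>\<theta>\<bar>"
      using bM[of y] by (cases "y = 0") (auto simp: bhat_def intro!: order_trans[OF abs_triangle_ineq4] add_mono)
    moreover have M0: "0 \<le> M" using bM[of 0] by simp
    ultimately show "\<bar>bhat y\<bar> \<le> Mh" unfolding Mh_def by auto
    show "0 \<le> Mh" using M0 by (simp add: Mh_def)
  qed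
  have Mp: "0 \<le> Mp" "\<bar>ph y\<bar> \<le> Mp" for y
    using V_bounds[of y] K_nonneg by (auto simp: Mp_def ph_def)
  have mul: "\<bar>g * z\<bar> \<le> A * D" if "\<bar>g\<bar> \<le> A" "\<bar>z\<bar> \<le> D" "0 \<le> A" for g z A D :: real
    unfolding abs_mult using that by (intro mult_mono) auto
  have bu: "\<bar>u s y\<bar> \<le> C0" if "s \<in> {0..t}" for s y using C0(2)[OF that] by (simp add: u_def)
  have bu1: "\<bar>u1 s y\<bar> \<le> C1 + Mh * C0" if "s \<in> {0..t}" for s y
  proof -
    have "u1 s y = w s y * ch s y - bhat y * (w s y * p0 s y)" by (simp add: u1_def algebra_simps)
    then show ?thesis using C1(2)[OF that, of y] mul[OF Mh(2) C0(2)[OF that] Mh(1), of y y] by linarith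
  qed
  have bW: "\<bar>Wf s y\<bar> \<le> C2 + Mp * C0" if "s \<in> {0..t}" for s y
  proof -
    have "Wf s y = w s y * p1 s y - ph y * (w s y * p0 s y)" by (simp add: Wf_def algebra_simps)
    then show ?thesis using C2(2)[OF that, of y] mul[OF Mp(2) C0(2)[OF that] Mp(1), of y y] by linarith
  qed
  have bu2: "\<bar>u2 s y\<bar> \<le> 2 * (C2 + Mp * C0 + M * (C1 + Mh * C0))" if "s \<in> {0..t}" for s y
  proof -
    have two: "\<bar>2 * (p - q)\<bar> \<le> 2 * (a + a')" if "\<bar>p\<bar> \<le> a" "\<bar>q\<bar> \<le> a'" for p q a a' :: real
    proof -
      have "\<bar>2 * (p - q)\<bar> = 2 * \<bar>p - q\<bar>" by (subst abs_mult) simp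
      also have "\<dots> \<le> 2 * (a + a')" by (intro mult_left_mono order_trans[OF abs_triangle_ineq4] add_mono that) simp
      finally show ?thesis .
    qed
    show ?thesis unfolding u2_def by (intro two bW[OF that] mul bM bu1[OF that] M_nonneg)
  qed
  have bus: "\<bar>us s y\<bar> \<le> \<bar>c\<bar> * C0 + C2" if "s \<in> {0..t}" for s y
  proof -
    have "us s y = c * (w s y * p0 s y) - w s y * p1 s y" by (simp add: us_def algebra_simps)
    then show ?thesis using C2(2)[OF that, of y] mul[OF order_refl C0(2)[OF that], of c y] by simp
  qed
  have w_pos: "0 < w s y" for s y by (simp add: w_def)
  have dw: "((\<lambda>y. w s y) has_real_derivative - b y * w s y) (at y)" if "y \<noteq> 0" for s y
    unfolding w_def by (rule DERIV_cong[OF DERIV_cmult[OF DERIV_fun_exp[OF DERIV_minus[OF DERIV_B[OF that]]]]]) simp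
  have dws: "((\<lambda>s. w s y) has_real_derivative c * w s y) (at s)" for s y
    unfolding w_def by (auto intro!: derivative_eq_intros)
  have cw: "continuous_on UNIV (w s)" for s
    unfolding w_def by (intro continuous_intros continuous_B)
  have dp0: "((\<lambda>y. p0 s y) has_real_derivative ch s y + \<theta> * sgn y * p0 s y) (at y)" if "s \<in> {0..t}" "y \<noteq> 0" for s y
    using DERIV_psi0[OF es[OF that(1)] that(2)] by (simp add: p0_def ch_def)
  have dch: "((\<lambda>y. ch s y) has_real_derivative 2 * p1 s y - \<theta> * sgn y * (ch s y + \<theta> * sgn y * p0 s y)) (at y)" if "s \<in> {0..t}" "y \<noteq> 0" for s y
    using DERIV_chi[OF es[OF that(1)] that(2)] by (simp add: p0_def ch_def p1_def)
  have dp1: "((\<lambda>y. p1 s y) has_real_derivative p1y s y) (at y)" if "s \<in> {0..t}" "y \<noteq> 0" for s y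
    using DERIV_psi1[OF es[OF that(1)] that(2)] by (simp add: p1_def p1y_def)
  have des: "((\<lambda>s. e - s) has_real_derivative - 1) (at s)" for s by (auto intro!: derivative_eq_intros)
  have dp0s: "((\<lambda>s. p0 s y) has_real_derivative - p1 s y) (at s)" if "s \<in> {0..t}" for s y
    using DERIV_chain2[OF DERIV_psi0_time[OF es[OF that]] des] by (simp add: p0_def p1_def)
  have dp1s: "((\<lambda>s. p1 s y) has_real_derivative - p2 s y) (at s)" if "s \<in> {0..t}" for s y
    using DERIV_chain2[OF DERIV_psi1_time[OF es[OF that]] des] by (simp add: p1_def p2_def)
  have cp: "continuous_on UNIV (p0 s)" "continuous_on UNIV (ch s)" "continuous_on UNIV (p1 s)" if "s \<in> {0..t}" for s
    using continuous_psi[OF es[OF that]] by (auto simp: p0_def[abs_def] ch_def[abs_def] p1_def[abs_def])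
  have cu: "continuous_on UNIV (u s)" "continuous_on UNIV (u1 s)" "continuous_on UNIV (us s)" if "s \<in> {0..t}" for s
    unfolding u_def[abs_def] u1_def[abs_def] us_def[abs_def] using that
    by (intro continuous_intros cw cp continuous_bhat; assumption)+
  have du: "(u s has_real_derivative u1 s y) (at y)" if s: "s \<in> {0..t}" for s y
  proof (rule DERIV_at_0[OF cu(1)[OF s] cu(2)[OF s]])
    fix y :: real assume y: "y \<noteq> 0"
    show "(u s has_real_derivative u1 s y) (at y)"
      unfolding u_def[abs_def]
      by (rule DERIV_cong[OF DERIV_mult[OF dw[OF y] dp0[OF s y]]]) (simp add: u1_def b_eq[OF y] algebra_simps)
  qed
  have du1: "(u1 s has_real_derivative u2 s y) (at y)" if s: "s \<in> {0..t}" and y: "y \<noteq> 0" for s y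
  proof -
    \<comment> \<open>Here the particular form of \<open>phi\<close> enters: conjugating the
      generator by \<open>exp (- B)\<close> creates the potential \<open>(b^2 + b') / 2\<close>,
      which is \<open>c - V\<close> off 0.\<close>
    have ph: "2 * ph y = (bhat y + \<theta> * sgn y)\<^sup>2 + deriv b y"
      using phi_V[OF y] by (simp add: ph_def phi_def b_eq[OF y])
    have "(u1 s has_real_derivative - b y * w s y * (ch s y - bhat y * p0 s y) +
        (2 * p1 s y - \<theta> * sgn y * (ch s y + \<theta> * sgn y * p0 s y) - (deriv b y * p0 s y + (ch s y + \<theta> * sgn y * p0 s y) * bhat y)) * w s y) (at y)"
      unfolding u1_def[abs_def]
      by (rule DERIV_mult[OF dw[OF y] DERIV_diff[OF dch[OF s y] DERIV_mult[OF DERIV_bhat[OF y] dp0[OF s y]]]])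
    moreover have "u2 s y = w s y * (2 * p1 s y - (2 * ph y) * p0 s y) - 2 * (bhat y + \<theta> * sgn y) * (w s y * (ch s y - bhat y * p0 s y))"
      by (simp add: u2_def Wf_def u1_def b_eq[OF y] algebra_simps)
    then have "u2 s y = - b y * w s y * (ch s y - bhat y * p0 s y) +
        (2 * p1 s y - \<theta> * sgn y * (ch s y + \<theta> * sgn y * p0 s y) - (deriv b y * p0 s y + (ch s y + \<theta> * sgn y * p0 s y) * bhat y)) * w s y"
      unfolding ph b_eq[OF y] by (simp add: algebra_simps power2_eq_square)
    ultimately show ?thesis by simp
  qed
  have dus: "((\<lambda>s. u s y) has_real_derivative us s y) (at s)" if s: "s \<in> {0..t}" for s y
    unfolding u_def by (rule DERIV_cong[OF DERIV_mult[OF dws dp0s[OF s]]]) (simp add: us_def algebra_simps)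
  have duss: "((\<lambda>s. us s y) has_real_derivative c * us s y + (- c * (w s y * p1 s y) + w s y * p2 s y)) (at s)" if s: "s \<in> {0..t}" for s y
    unfolding us_def by (rule DERIV_cong[OF DERIV_mult[OF dws DERIV_diff[OF DERIV_cmult[OF dp0s[OF s]] dp1s[OF s]]]]) (simp add: algebra_simps)
  have dWs: "((\<lambda>s. Wf s y) has_real_derivative c * Wf s y + (ph y * (w s y * p1 s y) - w s y * p2 s y)) (at s)" if s: "s \<in> {0..t}" for s y
    unfolding Wf_def by (rule DERIV_cong[OF DERIV_mult[OF dws DERIV_diff[OF dp1s[OF s] DERIV_cmult[OF dp0s[OF s]]]]]) (simp add: algebra_simps)
  have dusy: "(us s has_real_derivative - b y * us s y + (c * (w s y * ch s y) + c * (\<theta> * sgn y * (w s y * p0 s y)) - w s y * p1y s y)) (at y)"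
    if s: "s \<in> {0..t}" and y: "y \<noteq> 0" for s y
    unfolding us_def[abs_def]
    by (rule DERIV_cong[OF DERIV_mult[OF dw[OF y] DERIV_diff[OF DERIV_cmult[OF dp0[OF s y]] dp1[OF s y]]]]) (simp add: algebra_simps)
  define k1 where "k1 = C1 + Mh * C0"
  define k2 where "k2 = 2 * (C2 + Mp * C0 + M * (C1 + Mh * C0))"
  define k3 where "k3 = \<bar>c\<bar> * C0 + C2"
  define k4 where "k4 = \<bar>c\<bar> * k3 + (\<bar>c\<bar> * C2 + C4)"
  define k5 where "k5 = \<bar>c\<bar> * (C2 + Mp * C0) + (Mp * C2 + C4)"
  define k6 where "k6 = M * k3 + (\<bar>c\<bar> * C1 + \<bar>c\<bar> * (\<bar>\<theta>\<bar> * C0) + C3)"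
  define C where "C = C0 + k1 + k2 + k3 + k4 + k5 + k6"
  have k: "0 \<le> k1" "0 \<le> k2" "0 \<le> k3" "0 \<le> k4" "0 \<le> k5" "0 \<le> k6"
    using C0(1) C1(1) C2(1) C3(1) C4(1) Mh(1) Mp(1) M_nonneg
    by (auto simp: k1_def k2_def k3_def k4_def k5_def k6_def intro!: add_nonneg_nonneg mult_nonneg_nonneg)
  have kC: "C0 \<le> C" "k1 \<le> C" "k2 \<le> C" "k3 \<le> C" "k4 \<le> C" "k5 \<le> C" "k6 \<le> C"
    using k C0(1) by (auto simp: C_def)
  have lip_time: "\<bar>f s y - f r y\<bar> \<le> D * \<bar>s - r\<bar>"
    if d: "\<And>s. s \<in> {0..t} \<Longrightarrow> ((\<lambda>s. f s y) has_real_derivative f' s) (at s)" and bd: "\<And>s. s \<in> {0..t} \<Longrightarrow> \<bar>f' s\<bar> \<le> D"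
      and sr: "s \<in> {0..t}" "r \<in> {0..t}" for f :: "real \<Rightarrow> real \<Rightarrow> real" and y f' D s r
  proof -
    have "norm (f s y - f r y) \<le> D * norm (s - r)"
    proof (rule field_differentiable_bound[where S="{0..t}" and f="\<lambda>s. f s y" and f'=f'])
      fix z assume "z \<in> {0..t}"
      then show "((\<lambda>s. f s y) has_real_derivative f' z) (at z within {0..t})" "norm (f' z) \<le> D"
        using bd d[THEN has_field_derivative_at_within] by (simp_all only: real_norm_def)
    qed (use sr in simp_all)
    then show ?thesis by simp
  qed
  have gen: "gen (u1 s) (u2 s) y = Wf s y" for s y
    by (simp add: gen_def u2_def diff_divide_distrib)
  \<comment> \<open>The terms with \<open>p1\<close> cancel by the heat equation and those with
    \<open>c\<close> by the factor \<open>exp (c * s)\<close>; only the potential \<open>V\<close>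
    survives.\<close>
  have Geq: "G r y = us r y + gen (u1 r) (u2 r) y" if "r \<in> {0..t}" for r y
    using that by (simp add: G_def gen us_def Wf_def ph_def algebra_simps)
  have m0: "case_prod G \<in> borel_measurable (borel \<Otimes>\<^sub>M borel)"
    unfolding G_def w_def p0_def psi0_def by measurable
  have Gb: "\<bar>G r y\<bar> \<le> K * C0" for r y
  proof (cases "r \<in> {0..t}")
    case True
    have "\<bar>V y\<bar> \<le> K" using V_bounds[of y] by simp
    from mul[OF this C0(2)[OF True] K_nonneg, of y] show ?thesis using True by (simp add: G_def mult.left_commute)
  qed (use K_nonneg C0(1) in \<open>auto simp: G_def\<close>)
  have u2m: "u2 s \<in> borel_measurable borel" if s: "s \<in> {0..t}" for s
  proof -
    have [measurable]: "u1 s \<in> borel_measurable borel" "p1 s \<in> borel_measurable borel" "p0 s \<in> borel_measurable borel" "w s \<in> borel_measurable borel"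
      using cu(2)[OF s] cp[OF s] cw by (auto intro: borel_measurable_continuous_onI)
    have [measurable]: "b \<in> borel_measurable borel" by (rule b_measurable)
    show ?thesis unfolding u2_def[abs_def] Wf_def ph_def by measurable
  qed
  have main: "expectation (\<lambda>\<omega>. u t (Z t \<omega>)) = u 0 x + (LINT r:{0..t}|lborel. expectation (\<lambda>\<omega>. G r (Z r \<omega>)))"
  proof (rule dynkin_time[OF t, where ?u1.0=u1 and ?u2.0=u2 and us=us and C=C and C'="K * C0"])
    fix s y assume s: "s \<in> {0..t}"
    show "(u s has_real_derivative u1 s y) (at y)" by (rule du[OF s])
    show "\<bar>u s y\<bar> \<le> C" using bu[OF s, of y] kC(1) by linarith
    show "\<bar>u1 s y\<bar> \<le> C" using bu1[OF s, of y] kC(2) by (simp add: k1_def)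
    show "\<bar>u2 s y\<bar> \<le> C" using bu2[OF s, of y] kC(3) by (simp add: k2_def)
    show "u2 s \<in> borel_measurable borel" by (rule u2m[OF s])
    show "((\<lambda>s. u s y) has_real_derivative us s y) (at s)" by (rule dus[OF s])
    show "\<bar>us s y\<bar> \<le> C" using bus[OF s, of y] kC(4) by (simp add: k3_def)
    show "G s y = us s y + gen (u1 s) (u2 s) y" by (rule Geq[OF s])
  next
    fix s y assume s: "s \<in> {0..t}" and y: "y \<noteq> (0 :: real)"
    show "(u1 s has_real_derivative u2 s y) (at y)" by (rule du1[OF s y])
  next
    fix s y z assume s: "s \<in> {0..t}"
    have "\<bar>u1 s y - u1 s z\<bar> \<le> k2 * \<bar>y - z\<bar>"
      by (rule lipschitz_off_0[OF cu(2)[OF s] du1[OF s]]) (use bu2[OF s] k in \<open>auto simp: k2_def\<close>)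
    also have "\<dots> \<le> C * \<bar>y - z\<bar>" using kC by (intro mult_right_mono) auto
    finally show "\<bar>u1 s y - u1 s z\<bar> \<le> C * \<bar>y - z\<bar>" .
    have "\<bar>us s y - us s z\<bar> \<le> k6 * \<bar>y - z\<bar>"
    proof (rule lipschitz_off_0[OF cu(3)[OF s] dusy[OF s]])
      fix y :: real assume "y \<noteq> 0"
      have "\<bar>b y * us s y\<bar> \<le> M * k3" using mul[OF bM bus[OF s] M_nonneg] by (simp add: k3_def)
      moreover have "\<bar>c * (w s y * ch s y)\<bar> \<le> \<bar>c\<bar> * C1" by (rule mul[OF order_refl C1(2)[OF s]]) simp
      moreover have "\<bar>\<theta> * sgn y\<bar> \<le> \<bar>\<theta>\<bar>" by (simp add: abs_mult sgn_if)
      then have "\<bar>c * (\<theta> * sgn y * (w s y * p0 s y))\<bar> \<le> \<bar>c\<bar> * (\<bar>\<theta>\<bar> * C0)"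
        by (intro mul order_refl C0(2)[OF s]) auto
      ultimately show "\<bar>- b y * us s y + (c * (w s y * ch s y) + c * (\<theta> * sgn y * (w s y * p0 s y)) - w s y * p1y s y)\<bar> \<le> k6"
        using C3(2)[OF s, of y] unfolding k6_def by linarith
    qed (use k in auto)
    also have "\<dots> \<le> C * \<bar>y - z\<bar>" using kC by (intro mult_right_mono) auto
    finally show "\<bar>us s y - us s z\<bar> \<le> C * \<bar>y - z\<bar>" .
  next
    fix s r y assume sr: "s \<in> {0..t}" "r \<in> {0..t}"
    have "\<bar>us s y - us r y\<bar> \<le> k4 * \<bar>s - r\<bar>"
    proof (rule lip_time[OF duss _ sr])
      fix s assume s: "s \<in> {0..t}"
      have "\<bar>c * us s y\<bar> \<le> \<bar>c\<bar> * k3" using mul[OF order_refl bus[OF s]] by (simp add: k3_def)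
      moreover have "\<bar>c * (w s y * p1 s y)\<bar> \<le> \<bar>c\<bar> * C2" by (rule mul[OF order_refl C2(2)[OF s]]) simp
      ultimately show "\<bar>c * us s y + (- c * (w s y * p1 s y) + w s y * p2 s y)\<bar> \<le> k4"
        using C4(2)[OF s, of y] unfolding k4_def by linarith
    qed
    also have "\<dots> \<le> C * \<bar>s - r\<bar>" using kC by (intro mult_right_mono) auto
    finally show "\<bar>us s y - us r y\<bar> \<le> C * \<bar>s - r\<bar>" .
    have "\<bar>Wf s y - Wf r y\<bar> \<le> k5 * \<bar>s - r\<bar>"
    proof (rule lip_time[OF dWs _ sr])
      fix s assume s: "s \<in> {0..t}"
      have "\<bar>c * Wf s y\<bar> \<le> \<bar>c\<bar> * (C2 + Mp * C0)" by (rule mul[OF order_refl bW[OF s]]) simp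
      moreover have "\<bar>ph y * (w s y * p1 s y)\<bar> \<le> Mp * C2" by (rule mul[OF Mp(2) C2(2)[OF s] Mp(1)])
      ultimately show "\<bar>c * Wf s y + (ph y * (w s y * p1 s y) - w s y * p2 s y)\<bar> \<le> k5"
        using C4(2)[OF s, of y] unfolding k5_def by linarith
    qed
    also have "\<dots> \<le> C * \<bar>s - r\<bar>" using kC by (intro mult_right_mono) auto
    finally show "\<bar>gen (u1 s) (u2 s) y - gen (u1 r) (u2 r) y\<bar> \<le> C * \<bar>s - r\<bar>" by (simp add: gen)
  qed (use m0 Gb in auto)
  have k0: "p0 s y = ker \<theta> (t + \<epsilon> - s) y d" if "s \<in> {0..t}" for s y
    using psi0_ker[OF es[OF that]] by (simp add: p0_def e_def)
  have p0_nonneg: "0 \<le> p0 s y" if "s \<in> {0..t}" for s y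
    unfolding k0[OF that] using es[OF that] by (simp add: e_def)
  have G_nonneg: "0 \<le> G r y" for r y
  proof (cases "r \<in> {0..t}")
    case True
    then show ?thesis using V_bounds[of y] p0_nonneg[OF True, of y] w_pos[of r y] by (auto simp: G_def intro!: mult_nonneg_nonneg)
  qed (simp add: G_def)
  have tt: "t \<in> {0..t}" "0 \<in> {0..t}" using t by auto
  have [measurable]: "u t \<in> borel_measurable borel"
    using cu(1)[OF tt(1)] by (rule borel_measurable_continuous_onI)
  have ui: "integrable P (\<lambda>\<omega>. u t (Z t \<omega>))"
    by (rule integrable_const_bound[where B=C0]) (use bu[OF tt(1)] in auto)
  have u_nonneg: "0 \<le> u s y" if "s \<in> {0..t}" for s y
    using p0_nonneg[OF that, of y] w_pos[of s y] by (simp add: u_def)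
  note Gi = Fubini_Z[OF m0 Gb]
  have "(\<integral>\<^sup>+\<omega>. ennreal (u t (Z t \<omega>)) \<partial>P) = ennreal (expectation (\<lambda>\<omega>. u t (Z t \<omega>)))"
    by (rule nn_integral_eq_integral[OF ui]) (auto intro: u_nonneg[OF tt(1)])
  also have "\<dots> = ennreal (u 0 x) + ennreal (LINT r:{0..t}|lborel. expectation (\<lambda>\<omega>. G r (Z r \<omega>)))"
    unfolding main
  proof (rule ennreal_plus)
    show "0 \<le> u 0 x" by (rule u_nonneg[OF tt(2)])
    show "0 \<le> (LINT r:{0..t}|lborel. expectation (\<lambda>\<omega>. G r (Z r \<omega>)))"
      unfolding set_lebesgue_integral_def real_scaleR_def
      by (intro integral_nonneg_AE AE_I2 mult_nonneg_nonneg G_nonneg) auto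
  qed
  also have "ennreal (LINT r:{0..t}|lborel. expectation (\<lambda>\<omega>. G r (Z r \<omega>)))
     = (\<integral>\<^sup>+r. ennreal (indicator {0..t} r * expectation (\<lambda>\<omega>. G r (Z r \<omega>))) \<partial>lborel)"
    unfolding set_lebesgue_integral_def real_scaleR_def
  proof (rule nn_integral_eq_integral[symmetric])
    show "integrable lborel (\<lambda>r. indicat_real {0..t} r * expectation (\<lambda>\<omega>. G r (Z r \<omega>)))"
      using Gi(2)[of 0 t] by (simp add: set_integrable_def)
    show "AE r in lborel. 0 \<le> indicat_real {0..t} r * expectation (\<lambda>\<omega>. G r (Z r \<omega>))"
      by (intro AE_I2 mult_nonneg_nonneg integral_nonneg_AE G_nonneg) auto
  qed
  also have "\<dots> = (\<integral>\<^sup>+r. (\<integral>\<^sup>+\<omega>. ennreal (exp (c * r) * exp (- B (Z r \<omega>)) * (V (Z r \<omega>) * ker \<theta> (t + \<epsilon> - r) (Z r \<omega>) d)) \<partial>P) * indicator {0..t} r \<partial>lborel)"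
  proof (rule nn_integral_cong)
    fix r
    show "ennreal (indicator {0..t} r * expectation (\<lambda>\<omega>. G r (Z r \<omega>)))
       = (\<integral>\<^sup>+\<omega>. ennreal (exp (c * r) * exp (- B (Z r \<omega>)) * (V (Z r \<omega>) * ker \<theta> (t + \<epsilon> - r) (Z r \<omega>) d)) \<partial>P) * indicator {0..t} r"
    proof (cases "r \<in> {0..t}")
      case True
      have "ennreal (expectation (\<lambda>\<omega>. G r (Z r \<omega>))) = (\<integral>\<^sup>+\<omega>. ennreal (G r (Z r \<omega>)) \<partial>P)"
        by (rule nn_integral_eq_integral[symmetric]) (auto intro: Gi(1) G_nonneg)
      then show ?thesis using True by (simp add: G_def w_def k0)
    qed simp
  qed
  finally show ?thesis using tt by (simp add: u_def w_def k0)
qed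

end

section \<open>Measures are determined by their integrals against the kernel\<close>

lemma integral_gauss_exp: "0 < t \<Longrightarrow> (\<integral>\<^sup>+y. ennreal (gauss t (y - a) * exp (m * (y - a))) \<partial>lborel) = ennreal (exp (m\<^sup>2 * t / 2))"
proof -
  assume t: "0 < t"
  have eq: "gauss t (y - a) * exp (m * (y - a)) = exp (m\<^sup>2 * t / 2) * gauss t (y - (a + m * t))" for y
  proof -
    have "- ((y - a)\<^sup>2 / (2 * t)) + m * (y - a) = m\<^sup>2 * t / 2 + - ((y - (a + m * t))\<^sup>2 / (2 * t))"
      using t by (simp add: power2_eq_square field_simps)
    then have "exp (- ((y - a)\<^sup>2 / (2 * t))) * exp (m * (y - a)) = exp (m\<^sup>2 * t / 2) * exp (- ((y - (a + m * t))\<^sup>2 / (2 * t)))"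
      by (simp only: exp_add[symmetric])
    then show ?thesis by (simp add: gauss_def)
  qed
  have "(\<integral>\<^sup>+y. ennreal (exp (m\<^sup>2 * t / 2) * gauss t (y - (a + m * t))) \<partial>lborel) = ennreal (\<integral>y. exp (m\<^sup>2 * t / 2) * gauss t (y - (a + m * t)) \<partial>lborel)"
    using t by (intro nn_integral_eq_integral integrable_mult_right integrable_gauss) auto
  then show ?thesis unfolding eq using integral_gauss[OF t, of "a + m * t"] by simp
qed

definition Pk :: "real \<Rightarrow> real \<Rightarrow> (real \<Rightarrow> ennreal) \<Rightarrow> real \<Rightarrow> ennreal" where
  "Pk \<theta> t f z = (\<integral>\<^sup>+y. ennreal (ker \<theta> t z y) * f y \<partial>lborel)"

text \<open>The kernel is at most a constant times the Gaussian,
  \<open>exp (- (M * \<bar>y\<bar>))\<close> is at most \<open>exp (- (M * \<bar>z\<bar>))\<close>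
  times the sum of two exponentials in \<open>y - z\<close>, and their Gaussian integrals are
  explicit. \<open>M\<close> may have either sign: a positive one serves for damped test functions,
  a negative one for integrating the growing factor \<open>exp (B y)\<close>.\<close>

lemma Pk_exp_le:
  assumes T: "0 < T"
  shows "\<exists>C. \<forall>t z. 0 < t \<longrightarrow> t \<le> T \<longrightarrow> Pk \<theta> t (\<lambda>y. ennreal (exp (- (M * \<bar>y\<bar>)))) z \<le> ennreal (C * exp (- (M * \<bar>z\<bar>)))"
proof (intro exI allI impI)
  fix t z :: real assume t: "0 < t" "t \<le> T"
  define C1 where "C1 = 1 + \<bar>\<theta>\<bar> * (exp (\<theta>\<^sup>2 * T / 2) * sqrt (2 * pi * T))"
  have C1: "0 \<le> C1" by (auto simp: C1_def intro!: add_nonneg_nonneg mult_nonneg_nonneg) (use T in simp)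
  have k: "ker \<theta> t z y \<le> C1 * gauss t (y - z)" for y
  proof -
    have "exp (\<theta>\<^sup>2 * t / 2) * sqrt (2 * pi * t) \<le> exp (\<theta>\<^sup>2 * T / 2) * sqrt (2 * pi * T)"
      using t by (intro mult_mono) (auto intro!: mult_left_mono)
    then have "1 + \<bar>\<theta>\<bar> * (exp (\<theta>\<^sup>2 * t / 2) * sqrt (2 * pi * t)) \<le> C1" unfolding C1_def by (intro add_left_mono mult_left_mono) auto
    then have "(1 + \<bar>\<theta>\<bar> * (exp (\<theta>\<^sup>2 * t / 2) * sqrt (2 * pi * t))) * gauss t (y - z) \<le> C1 * gauss t (y - z)"
      using t by (intro mult_right_mono) auto
    with ker_le_gauss[OF t(1), of \<theta> z y] show ?thesis by linarith
  qed
  have "ker \<theta> t z y * exp (- (M * \<bar>y\<bar>)) \<le> C1 * exp (- (M * \<bar>z\<bar>)) * (gauss t (y - z) * exp (\<bar>M\<bar> * (y - z)) + gauss t (y - z) * exp (- \<bar>M\<bar> * (y - z)))" for y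
  proof -
    have "M * (\<bar>z\<bar> - \<bar>y\<bar>) \<le> \<bar>M\<bar> * \<bar>y - z\<bar>"
    proof -
      have "M * (\<bar>z\<bar> - \<bar>y\<bar>) \<le> \<bar>M * (\<bar>z\<bar> - \<bar>y\<bar>)\<bar>" by simp
      also have "\<dots> \<le> \<bar>M\<bar> * \<bar>y - z\<bar>" unfolding abs_mult by (intro mult_left_mono) auto
      finally show ?thesis .
    qed
    then have "exp (- (M * \<bar>y\<bar>)) \<le> exp (- (M * \<bar>z\<bar>)) * exp (\<bar>M\<bar> * \<bar>y - z\<bar>)"
      unfolding exp_add[symmetric] by (simp add: algebra_simps)
    also have "\<dots> \<le> exp (- (M * \<bar>z\<bar>)) * (exp (\<bar>M\<bar> * (y - z)) + exp (- \<bar>M\<bar> * (y - z)))"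
    proof (intro mult_left_mono)
      have "exp (\<bar>M\<bar> * \<bar>y - z\<bar>) = exp (\<bar>M\<bar> * (y - z)) \<or> exp (\<bar>M\<bar> * \<bar>y - z\<bar>) = exp (- \<bar>M\<bar> * (y - z))"
        by (cases "z \<le> y") (auto simp: algebra_simps)
      then show "exp (\<bar>M\<bar> * \<bar>y - z\<bar>) \<le> exp (\<bar>M\<bar> * (y - z)) + exp (- \<bar>M\<bar> * (y - z))"
        by (elim disjE) (simp_all only: le_add_same_cancel1 le_add_same_cancel2 exp_ge_zero)
    qed simp
    finally have "ker \<theta> t z y * exp (- (M * \<bar>y\<bar>)) \<le> (C1 * gauss t (y - z)) * (exp (- (M * \<bar>z\<bar>)) * (exp (\<bar>M\<bar> * (y - z)) + exp (- \<bar>M\<bar> * (y - z))))"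
      using t C1 by (intro mult_mono k) auto
    then show ?thesis by (simp add: algebra_simps)
  qed
  then have "Pk \<theta> t (\<lambda>y. ennreal (exp (- (M * \<bar>y\<bar>)))) z
     \<le> (\<integral>\<^sup>+y. ennreal (C1 * exp (- (M * \<bar>z\<bar>))) * (ennreal (gauss t (y - z) * exp (\<bar>M\<bar> * (y - z))) + ennreal (gauss t (y - z) * exp (- \<bar>M\<bar> * (y - z)))) \<partial>lborel)"
    unfolding Pk_def using t C1
    by (intro nn_integral_mono) (auto simp: ennreal_mult[symmetric] ennreal_plus[symmetric] simp del: ennreal_plus intro!: ennreal_leI)
  also have "\<dots> = ennreal (C1 * exp (- (M * \<bar>z\<bar>))) * (ennreal (exp (\<bar>M\<bar>\<^sup>2 * t / 2)) + ennreal (exp ((- \<bar>M\<bar>)\<^sup>2 * t / 2)))"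
    unfolding integral_gauss_exp[OF t(1), symmetric, where a=z]
    by (subst nn_integral_cmult) (auto simp: nn_integral_add)
  also have "\<dots> \<le> ennreal (C1 * exp (- (M * \<bar>z\<bar>))) * ennreal (2 * exp (M\<^sup>2 * T / 2))"
    using t by (intro mult_left_mono) (auto simp: ennreal_plus[symmetric] simp del: ennreal_plus intro!: ennreal_leI mult_left_mono)
  also have "\<dots> = ennreal ((1 + \<bar>\<theta>\<bar> * (exp (\<theta>\<^sup>2 * T / 2) * sqrt (2 * pi * T))) * (2 * exp (M\<^sup>2 * T / 2)) * exp (- (M * \<bar>z\<bar>)))"
    using C1 by (simp add: ennreal_mult[symmetric] C1_def ac_simps)
  finally show "Pk \<theta> t (\<lambda>y. ennreal (exp (- (M * \<bar>y\<bar>)))) z \<le> ennreal ((1 + \<bar>\<theta>\<bar> * (exp (\<theta>\<^sup>2 * T / 2) * sqrt (2 * pi * T))) * (2 * exp (M\<^sup>2 * T / 2)) * exp (- (M * \<bar>z\<bar>)))" .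
qed

lemma gauss_abs_moment:
  assumes t: "0 < t"
  shows "integrable lborel (\<lambda>d. gauss t (d - y) * \<bar>d - y\<bar>)" "(\<integral>d. gauss t (d - y) * \<bar>d - y\<bar> \<partial>lborel) \<le> sqrt t"
proof -
  have p: "0 < sqrt t" using t by simp
  have m2: "has_bochner_integral lborel (\<lambda>d. gauss t (d - y) * (d - y)\<^sup>2) t"
    using normal_moment_even[OF p, of y 1] t by (simp add: normal_density_gauss)
  have m0: "has_bochner_integral lborel (\<lambda>d. gauss t (d - y)) 1"
    using integrable_gauss[OF t, of y] integral_gauss[OF t, of y] by (simp add: has_bochner_integral_iff)
  have h: "has_bochner_integral lborel (\<lambda>d. sqrt t / 2 * (gauss t (d - y)) + 1 / (2 * sqrt t) * (gauss t (d - y) * (d - y)\<^sup>2)) (sqrt t / 2 * 1 + 1 / (2 * sqrt t) * t)"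
    by (intro has_bochner_integral_add has_bochner_integral_mult_right m0 m2)
  have le: "gauss t (d - y) * \<bar>d - y\<bar> \<le> sqrt t / 2 * (gauss t (d - y)) + 1 / (2 * sqrt t) * (gauss t (d - y) * (d - y)\<^sup>2)" for d
    using mult_left_mono[OF sq_abs_le[OF t, of "d - y"] gauss_nonneg[OF t, of "d - y"]]
    by (simp add: field_simps)
  show i: "integrable lborel (\<lambda>d. gauss t (d - y) * \<bar>d - y\<bar>)"
    by (rule Bochner_Integration.integrable_bound[of _ "\<lambda>d. sqrt t / 2 * (gauss t (d - y)) + 1 / (2 * sqrt t) * (gauss t (d - y) * (d - y)\<^sup>2)"])
      (use h t le in \<open>auto simp: has_bochner_integral_iff abs_mult intro!: AE_I2 order_trans[OF _ abs_ge_self]\<close>)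
  have "(\<integral>d. gauss t (d - y) * \<bar>d - y\<bar> \<partial>lborel) \<le> sqrt t / 2 * 1 + 1 / (2 * sqrt t) * t"
    unfolding has_bochner_integral_integral_eq[OF h, symmetric]
    using h by (intro integral_mono i le) (auto simp: has_bochner_integral_iff)
  also have "\<dots> = sqrt t" using real_div_sqrt[of t] t by (simp add: field_simps)
  finally show "(\<integral>d. gauss t (d - y) * \<bar>d - y\<bar> \<partial>lborel) \<le> sqrt t" .
qed

text \<open>The Gaussian part moves a Lipschitz function by at most \<open>L\<close> times the mean
  displacement, that is \<open>L * sqrt e\<close>. The tail part has total mass of order
  \<open>sqrt e\<close>, so the point interaction at 0 disappears in the limit, even for
  \<open>z = 0\<close>.\<close>

lemma Pk_tendsto:
  assumes L: "\<And>u v. \<bar>F u - F v\<bar> \<le> L * \<bar>u - v\<bar>" and F: "\<And>u. 0 \<le> F u" "\<And>u. F u \<le> 1"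
    and \<epsilon>: "\<epsilon> \<longlonglongrightarrow> 0" "\<And>n. 0 < \<epsilon> n"
  shows "(\<lambda>n. Pk \<theta> (\<epsilon> n) (\<lambda>y. ennreal (F y)) z) \<longlonglongrightarrow> ennreal (F z)"
proof -
  have L0: "0 \<le> L" using L[of 0 1] by simp
  have Fm [measurable]: "F \<in> borel_measurable borel"
  proof -
    have "L-lipschitz_on UNIV F" by (rule lipschitz_onI) (use L L0 in \<open>auto simp: dist_real_def\<close>)
    then show ?thesis by (intro borel_measurable_continuous_onI lipschitz_on_continuous_on)
  qed
  have F1: "\<bar>F u\<bar> \<le> 1" for u using F[of u] by simp
  define q where "q e = (\<integral>d. ker \<theta> e z d * F d \<partial>lborel)" for e
  have gi: "integrable lborel (\<lambda>d. gauss e (d - z) * F d)" if "0 < e" for e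
    by (rule Bochner_Integration.integrable_bound[OF integrable_gauss[OF that, of z]])
      (use that F1 in \<open>auto simp: abs_mult intro!: mult_left_le\<close>)
  have ti: "integrable lborel (\<lambda>d. tail \<theta> e (\<bar>d\<bar> + \<bar>z\<bar>) * F d)" if "0 < e" for e
    by (rule Bochner_Integration.integrable_bound[OF integrable_tail_abs[OF that, of "\<bar>z\<bar>" \<theta>]])
      (use that F1 in \<open>auto simp: abs_mult tail_nonneg intro!: mult_left_le\<close>)
  have k: "ker \<theta> e z d * F d = gauss e (d - z) * F d - \<theta> * (tail \<theta> e (\<bar>d\<bar> + \<bar>z\<bar>) * F d)" if "0 < e" for e d
    using that by (simp add: ker_eq algebra_simps)
  have Pkq: "Pk \<theta> e (\<lambda>y. ennreal (F y)) z = ennreal (q e)" if e: "0 < e" for e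
  proof -
    have "Pk \<theta> e (\<lambda>y. ennreal (F y)) z = (\<integral>\<^sup>+d. ennreal (ker \<theta> e z d * F d) \<partial>lborel)"
      unfolding Pk_def using e F by (simp add: ennreal_mult)
    also have "\<dots> = ennreal (q e)" unfolding q_def
    proof (rule nn_integral_eq_integral)
      show "integrable lborel (\<lambda>d. ker \<theta> e z d * F d)"
        unfolding k[OF e] by (intro Bochner_Integration.integrable_diff gi e integrable_mult_right ti)
    qed (use e F in auto)
    finally show ?thesis .
  qed
  have bound: "\<bar>q e - F z\<bar> \<le> L * sqrt e + \<bar>\<theta>\<bar> * (exp (\<theta>\<^sup>2 * e / 2) * sqrt (2 * pi * e))" if e: "0 < e" for e
  proof -
    have "q e = (\<integral>d. gauss e (d - z) * F d \<partial>lborel) - \<theta> * (\<integral>d. tail \<theta> e (\<bar>d\<bar> + \<bar>z\<bar>) * F d \<partial>lborel)"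
      unfolding q_def k[OF e] using gi[OF e] ti[OF e] by simp
    moreover have "\<bar>(\<integral>d. gauss e (d - z) * F d \<partial>lborel) - F z\<bar> \<le> L * sqrt e"
    proof -
      have gF: "integrable lborel (\<lambda>d. gauss e (d - z) * F z)" using integrable_gauss[OF e, of z] by simp
      have "(\<integral>d. gauss e (d - z) * F d \<partial>lborel) - F z = (\<integral>d. gauss e (d - z) * F d - gauss e (d - z) * F z \<partial>lborel)"
        using integral_gauss[OF e, of z] by (subst Bochner_Integration.integral_diff[OF gi[OF e] gF]) simp
      then have "\<bar>(\<integral>d. gauss e (d - z) * F d \<partial>lborel) - F z\<bar> = \<bar>\<integral>d. gauss e (d - z) * F d - gauss e (d - z) * F z \<partial>lborel\<bar>" by simp
      also have "\<dots> \<le> (\<integral>d. \<bar>gauss e (d - z) * F d - gauss e (d - z) * F z\<bar> \<partial>lborel)" by (rule integral_abs_bound)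
      also have "\<dots> \<le> (\<integral>d. L * (gauss e (d - z) * \<bar>d - z\<bar>) \<partial>lborel)"
      proof (rule integral_mono)
        show "integrable lborel (\<lambda>d. \<bar>gauss e (d - z) * F d - gauss e (d - z) * F z\<bar>)"
          by (intro integrable_abs Bochner_Integration.integrable_diff gi e gF)
        show "integrable lborel (\<lambda>d. L * (gauss e (d - z) * \<bar>d - z\<bar>))"
          by (intro integrable_mult_right gauss_abs_moment e)
        fix d
        have "\<bar>gauss e (d - z) * F d - gauss e (d - z) * F z\<bar> = gauss e (d - z) * \<bar>F d - F z\<bar>"
          using e by (simp add: right_diff_distrib[symmetric] abs_mult)
        also have "\<dots> \<le> gauss e (d - z) * (L * \<bar>d - z\<bar>)" using e L by (intro mult_left_mono) auto
        finally show "\<bar>gauss e (d - z) * F d - gauss e (d - z) * F z\<bar> \<le> L * (gauss e (d - z) * \<bar>d - z\<bar>)" by (simp add: ac_simps)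
      qed
      also have "\<dots> = L * (\<integral>d. gauss e (d - z) * \<bar>d - z\<bar> \<partial>lborel)" by simp
      also have "\<dots> \<le> L * sqrt e" by (intro mult_left_mono gauss_abs_moment e L0)
      finally show ?thesis .
    qed
    moreover have "\<bar>\<theta> * (\<integral>d. tail \<theta> e (\<bar>d\<bar> + \<bar>z\<bar>) * F d \<partial>lborel)\<bar> \<le> \<bar>\<theta>\<bar> * (exp (\<theta>\<^sup>2 * e / 2) * sqrt (2 * pi * e))"
      unfolding abs_mult
    proof (rule mult_left_mono)
      have "\<bar>\<integral>d. tail \<theta> e (\<bar>d\<bar> + \<bar>z\<bar>) * F d \<partial>lborel\<bar> \<le> (\<integral>d. \<bar>tail \<theta> e (\<bar>d\<bar> + \<bar>z\<bar>) * F d\<bar> \<partial>lborel)" by (rule integral_abs_bound)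
      also have "\<dots> \<le> (\<integral>d. exp (\<theta>\<^sup>2 * e / 2) * sqrt (2 * pi * e) * gauss e (d - 0) \<partial>lborel)"
      proof (rule integral_mono)
        show "integrable lborel (\<lambda>d. \<bar>tail \<theta> e (\<bar>d\<bar> + \<bar>z\<bar>) * F d\<bar>)" by (intro integrable_abs ti e)
        show "integrable lborel (\<lambda>d. exp (\<theta>\<^sup>2 * e / 2) * sqrt (2 * pi * e) * gauss e (d - 0))"
          by (intro integrable_mult_right integrable_gauss e)
        fix d
        have "\<bar>tail \<theta> e (\<bar>d\<bar> + \<bar>z\<bar>) * F d\<bar> \<le> tail \<theta> e (\<bar>d\<bar> + \<bar>z\<bar>)"
          using F1[of d] by (simp add: abs_mult tail_nonneg mult_left_le)
        also have "\<dots> \<le> exp (\<theta>\<^sup>2 * e / 2) * sqrt (2 * pi * e) * gauss e (\<bar>d\<bar> + \<bar>z\<bar>)" by (intro tail_le_gauss e) auto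
        also have "\<dots> \<le> exp (\<theta>\<^sup>2 * e / 2) * sqrt (2 * pi * e) * gauss e (d - 0)" using e by (intro mult_left_mono gauss_mono) auto
        finally show "\<bar>tail \<theta> e (\<bar>d\<bar> + \<bar>z\<bar>) * F d\<bar> \<le> exp (\<theta>\<^sup>2 * e / 2) * sqrt (2 * pi * e) * gauss e (d - 0)" .
      qed
      also have "\<dots> = exp (\<theta>\<^sup>2 * e / 2) * sqrt (2 * pi * e)" using integral_gauss[OF e, of 0] by simp
      finally show "\<bar>\<integral>d. tail \<theta> e (\<bar>d\<bar> + \<bar>z\<bar>) * F d \<partial>lborel\<bar> \<le> exp (\<theta>\<^sup>2 * e / 2) * sqrt (2 * pi * e)" .
    qed simp
    ultimately show ?thesis by linarith
  qed
  have "(\<lambda>n. q (\<epsilon> n) - F z) \<longlonglongrightarrow> 0"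
  proof (rule Lim_null_comparison)
    show "eventually (\<lambda>n. norm (q (\<epsilon> n) - F z) \<le> L * sqrt (\<epsilon> n) + \<bar>\<theta>\<bar> * (exp (\<theta>\<^sup>2 * \<epsilon> n / 2) * sqrt (2 * pi * \<epsilon> n))) sequentially"
      unfolding real_norm_def by (intro always_eventually allI bound \<epsilon>)
    have "(\<lambda>n. L * sqrt (\<epsilon> n) + \<bar>\<theta>\<bar> * (exp (\<theta>\<^sup>2 * \<epsilon> n / 2) * sqrt (2 * pi * \<epsilon> n))) \<longlonglongrightarrow> L * sqrt 0 + \<bar>\<theta>\<bar> * (exp (\<theta>\<^sup>2 * 0 / 2) * sqrt (2 * pi * 0))"
      by (intro tendsto_intros \<epsilon>) auto
    then show "(\<lambda>n. L * sqrt (\<epsilon> n) + \<bar>\<theta>\<bar> * (exp (\<theta>\<^sup>2 * \<epsilon> n / 2) * sqrt (2 * pi * \<epsilon> n))) \<longlonglongrightarrow> 0" by simp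
  qed
  then have "(\<lambda>n. q (\<epsilon> n)) \<longlonglongrightarrow> F z" by (simp add: LIM_zero_iff)
  then have "(\<lambda>n. ennreal (q (\<epsilon> n))) \<longlonglongrightarrow> ennreal (F z)" by (rule tendsto_ennrealI)
  then show ?thesis by (simp add: Pkq \<epsilon>)
qed

text \<open>Integrate the assumed equality over \<open>d\<close> against a damped Lipschitz function
  and let \<epsilon> tend to 0: the kernels form an approximate identity, so integrals of Lipschitz
  functions with values in the unit interval agree. Such functions increase to indicators of half
  lines. The weight \<open>exp (M * \<bar>y\<bar>)\<close> in the assumption allows the lemma to be
  applied to measures that become finite only after damping.\<close>

lemma finite_measure_eq_ker:
  fixes m1 m2 :: "real measure"
  assumes f1: "finite_measure m1" and f2: "finite_measure m2" and s: "sets m1 = sets borel" "sets m2 = sets borel" and M: "0 \<le> M"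
    and eq: "\<And>\<epsilon> d. 0 < \<epsilon> \<Longrightarrow> (\<integral>\<^sup>+y. ennreal (exp (M * \<bar>y\<bar>)) * ennreal (ker \<theta> \<epsilon> y d) \<partial>m1) = (\<integral>\<^sup>+y. ennreal (exp (M * \<bar>y\<bar>)) * ennreal (ker \<theta> \<epsilon> y d) \<partial>m2)"
  shows "m1 = m2"
proof (rule measure_eqI_lessThan)
  show "sets m1 = sets borel" "sets m2 = sets borel" by (fact s)+
  show "emeasure m1 {u<..} < \<infinity>" for u using finite_measure.emeasure_finite[OF f1] by (auto simp: less_top[symmetric])
  obtain C where C: "\<And>t z. 0 < t \<Longrightarrow> t \<le> 1 \<Longrightarrow> Pk \<theta> t (\<lambda>y. ennreal (exp (- (M * \<bar>y\<bar>)))) z \<le> ennreal (C * exp (- (M * \<bar>z\<bar>)))"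
    using Pk_exp_le[of 1 \<theta> M] by auto
  define \<epsilon> where "\<epsilon> n = 1 / real (Suc n)" for n
  have \<epsilon>: "\<epsilon> \<longlonglongrightarrow> 0" "\<And>n. 0 < \<epsilon> n" "\<And>n. \<epsilon> n \<le> 1"
    unfolding \<epsilon>_def by (rule LIMSEQ_Suc[OF lim_1_over_n]) auto
  have key: "(\<integral>\<^sup>+y. ennreal (f y) \<partial>m1) = (\<integral>\<^sup>+y. ennreal (f y) \<partial>m2)"
    if f: "\<And>u v. \<bar>f u - f v\<bar> \<le> L * \<bar>u - v\<bar>" "\<And>u. 0 \<le> f u" "\<And>u. f u \<le> 1" for f :: "real \<Rightarrow> real" and L
  proof -
    have L0: "0 \<le> L" using f(1)[of 0 1] by simp
    have [measurable]: "f \<in> borel_measurable borel"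
    proof -
      have "L-lipschitz_on UNIV f" by (rule lipschitz_onI) (use f L0 in \<open>auto simp: dist_real_def\<close>)
      then show ?thesis by (intro borel_measurable_continuous_onI lipschitz_on_continuous_on)
    qed
    \<comment> \<open>The damping makes the kernel average of \<open>F\<close> at \<open>y\<close>
      of size \<open>exp (- (M * \<bar>y\<bar>))\<close>. This cancels the weight and provides a
      constant dominating function; in the limit the two exponentials cancel and leave
      \<open>f\<close>.\<close>
    define F where "F d = exp (- (M * \<bar>d\<bar>)) * f d" for d
    have e1: "exp (- (M * \<bar>d\<bar>)) \<le> 1" for d using M by simp
    have F: "0 \<le> F u" "F u \<le> 1" "F u \<le> exp (- (M * \<bar>u\<bar>))" for u
    proof -
      show "0 \<le> F u" using f(2) by (simp add: F_def)
      show "F u \<le> exp (- (M * \<bar>u\<bar>))" unfolding F_def using f(2,3)[of u] by (intro mult_left_le) auto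
      with e1[of u] show "F u \<le> 1" by linarith
    qed
    have FL: "\<bar>F u - F v\<bar> \<le> (M + L) * \<bar>u - v\<bar>" for u v
    proof -
      have ee: "\<bar>exp (- (M * \<bar>u\<bar>)) - exp (- (M * \<bar>v\<bar>))\<bar> \<le> M * \<bar>u - v\<bar>"
      proof -
        have x: "\<bar>exp (- p) - exp (- q)\<bar> \<le> \<bar>p - q\<bar>" if "0 \<le> p" "0 \<le> q" for p q :: real
        proof -
          have "norm (exp (- p) - exp (- q)) \<le> 1 * norm (p - q)"
            by (rule field_differentiable_bound[where S="{0..}" and f="\<lambda>p. exp (- p)" and f'="\<lambda>p. - exp (- p)"])
              (use that in \<open>auto intro!: derivative_eq_intros\<close>)
          then show ?thesis by simp
        qed
        have "\<bar>exp (- (M * \<bar>u\<bar>)) - exp (- (M * \<bar>v\<bar>))\<bar> \<le> \<bar>M * \<bar>u\<bar> - M * \<bar>v\<bar>\<bar>" using M by (intro x) auto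
        also have "\<dots> = M * \<bar>\<bar>u\<bar> - \<bar>v\<bar>\<bar>" using M by (simp add: right_diff_distrib[symmetric] abs_mult)
        also have "\<dots> \<le> M * \<bar>u - v\<bar>" using M by (intro mult_left_mono) auto
        finally show ?thesis .
      qed
      have "F u - F v = exp (- (M * \<bar>u\<bar>)) * (f u - f v) + (exp (- (M * \<bar>u\<bar>)) - exp (- (M * \<bar>v\<bar>))) * f v"
        by (simp add: F_def algebra_simps)
      also have "\<bar>\<dots>\<bar> \<le> \<bar>exp (- (M * \<bar>u\<bar>)) * (f u - f v)\<bar> + \<bar>(exp (- (M * \<bar>u\<bar>)) - exp (- (M * \<bar>v\<bar>))) * f v\<bar>" by (rule abs_triangle_ineq)
      also have "\<dots> \<le> 1 * (L * \<bar>u - v\<bar>) + (M * \<bar>u - v\<bar>) * 1"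
        unfolding abs_mult using M f(1)[of u v] f(2,3)[of v] e1[of u] ee L0 by (intro add_mono mult_mono) auto
      finally show ?thesis by (simp add: algebra_simps)
    qed
    have [measurable]: "F \<in> borel_measurable borel" unfolding F_def by measurable
    have lim: "(\<lambda>n. \<integral>\<^sup>+y. ennreal (exp (M * \<bar>y\<bar>)) * Pk \<theta> (\<epsilon> n) (\<lambda>y. ennreal (F y)) y \<partial>m) \<longlonglongrightarrow> (\<integral>\<^sup>+y. ennreal (f y) \<partial>m)"
      if fin: "finite_measure m" and sm: "sets m = sets borel" for m
    proof (rule nn_integral_dominated_convergence[where w="\<lambda>_. ennreal \<bar>C\<bar>"])
      note [measurable_cong] = sm
      show "(\<lambda>y. ennreal (exp (M * \<bar>y\<bar>)) * Pk \<theta> (\<epsilon> n) (\<lambda>y. ennreal (F y)) y) \<in> borel_measurable m" for n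
        unfolding Pk_def by measurable
      show "(\<lambda>y. ennreal (f y)) \<in> borel_measurable m" by measurable
      show "(\<lambda>_. ennreal \<bar>C\<bar>) \<in> borel_measurable m" by simp
      show "(\<integral>\<^sup>+y. ennreal \<bar>C\<bar> \<partial>m) < \<infinity>"
        using finite_measure.emeasure_finite[OF fin, of "space m"]
        by (auto simp: ennreal_mult_eq_top_iff less_top[symmetric])
      show "AE y in m. ennreal (exp (M * \<bar>y\<bar>)) * Pk \<theta> (\<epsilon> n) (\<lambda>y. ennreal (F y)) y \<le> ennreal \<bar>C\<bar>" for n
      proof (rule AE_I2)
        fix y
        have "Pk \<theta> (\<epsilon> n) (\<lambda>y. ennreal (F y)) y \<le> Pk \<theta> (\<epsilon> n) (\<lambda>y. ennreal (exp (- (M * \<bar>y\<bar>)))) y"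
          unfolding Pk_def by (intro nn_integral_mono mult_left_mono ennreal_leI F) auto
        also have "\<dots> \<le> ennreal (C * exp (- (M * \<bar>y\<bar>)))" by (rule C[OF \<epsilon>(2,3)])
        also have "\<dots> \<le> ennreal (\<bar>C\<bar> * exp (- (M * \<bar>y\<bar>)))" by (intro ennreal_leI mult_right_mono) auto
        finally have "ennreal (exp (M * \<bar>y\<bar>)) * Pk \<theta> (\<epsilon> n) (\<lambda>y. ennreal (F y)) y \<le> ennreal (exp (M * \<bar>y\<bar>)) * ennreal (\<bar>C\<bar> * exp (- (M * \<bar>y\<bar>)))"
          by (intro mult_left_mono) auto
        also have "\<dots> = ennreal (\<bar>C\<bar> * (exp (M * \<bar>y\<bar>) * exp (- (M * \<bar>y\<bar>))))" by (subst ennreal_mult[symmetric]) (auto simp: ac_simps)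
        also have "exp (M * \<bar>y\<bar>) * exp (- (M * \<bar>y\<bar>)) = 1" by (simp flip: exp_add)
        finally show "ennreal (exp (M * \<bar>y\<bar>)) * Pk \<theta> (\<epsilon> n) (\<lambda>y. ennreal (F y)) y \<le> ennreal \<bar>C\<bar>" by simp
      qed
      show "AE y in m. (\<lambda>n. ennreal (exp (M * \<bar>y\<bar>)) * Pk \<theta> (\<epsilon> n) (\<lambda>y. ennreal (F y)) y) \<longlonglongrightarrow> ennreal (f y)"
      proof (rule AE_I2)
        fix y
        have "(\<lambda>n. ennreal (exp (M * \<bar>y\<bar>)) * Pk \<theta> (\<epsilon> n) (\<lambda>y. ennreal (F y)) y) \<longlonglongrightarrow> ennreal (exp (M * \<bar>y\<bar>)) * ennreal (F y)"
          by (intro tendsto_mult_ennreal Pk_tendsto[OF FL F(1,2) \<epsilon>(1,2)] tendsto_const) auto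
        also have "ennreal (exp (M * \<bar>y\<bar>)) * ennreal (F y) = ennreal ((exp (M * \<bar>y\<bar>) * exp (- (M * \<bar>y\<bar>))) * f y)"
          using f(2) by (subst ennreal_mult[symmetric]) (auto simp: F_def mult.assoc)
        also have "exp (M * \<bar>y\<bar>) * exp (- (M * \<bar>y\<bar>)) = 1" by (simp flip: exp_add)
        finally show "(\<lambda>n. ennreal (exp (M * \<bar>y\<bar>)) * Pk \<theta> (\<epsilon> n) (\<lambda>y. ennreal (F y)) y) \<longlonglongrightarrow> ennreal (f y)" by simp
      qed
    qed
    have tonelli: "(\<integral>\<^sup>+y. ennreal (exp (M * \<bar>y\<bar>)) * Pk \<theta> e (\<lambda>y. ennreal (F y)) y \<partial>m)
       = (\<integral>\<^sup>+d. (\<integral>\<^sup>+y. ennreal (exp (M * \<bar>y\<bar>)) * ennreal (ker \<theta> e y d) \<partial>m) * ennreal (F d) \<partial>lborel)"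
      if fin: "finite_measure m" and sm: "sets m = sets borel" for m e
    proof -
      note [measurable_cong] = sm
      interpret m: finite_measure m by fact
      interpret pr: pair_sigma_finite m lborel ..
      have "(\<integral>\<^sup>+y. ennreal (exp (M * \<bar>y\<bar>)) * Pk \<theta> e (\<lambda>y. ennreal (F y)) y \<partial>m)
         = (\<integral>\<^sup>+y. \<integral>\<^sup>+d. ennreal (exp (M * \<bar>y\<bar>)) * ennreal (ker \<theta> e y d) * ennreal (F d) \<partial>lborel \<partial>m)"
        unfolding Pk_def by (subst nn_integral_cmult[symmetric]) (auto simp: mult.assoc)
      also have "\<dots> = (\<integral>\<^sup>+d. \<integral>\<^sup>+y. ennreal (exp (M * \<bar>y\<bar>)) * ennreal (ker \<theta> e y d) * ennreal (F d) \<partial>m \<partial>lborel)"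
        by (rule pr.Fubini'[symmetric]) measurable
      also have "\<dots> = (\<integral>\<^sup>+d. (\<integral>\<^sup>+y. ennreal (exp (M * \<bar>y\<bar>)) * ennreal (ker \<theta> e y d) \<partial>m) * ennreal (F d) \<partial>lborel)"
        by (intro nn_integral_cong nn_integral_multc) measurable
      finally show ?thesis .
    qed
    have "(\<integral>\<^sup>+y. ennreal (exp (M * \<bar>y\<bar>)) * Pk \<theta> (\<epsilon> n) (\<lambda>y. ennreal (F y)) y \<partial>m1) = (\<integral>\<^sup>+y. ennreal (exp (M * \<bar>y\<bar>)) * Pk \<theta> (\<epsilon> n) (\<lambda>y. ennreal (F y)) y \<partial>m2)" for n
      unfolding tonelli[OF f1 s(1)] tonelli[OF f2 s(2)] eq[OF \<epsilon>(2)] ..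
    with lim[OF f1 s(1)] lim[OF f2 s(2)] show ?thesis by (simp add: LIMSEQ_unique)
  qed
  fix u
  \<comment> \<open>Ramps of slope \<open>n\<close> that rise from 0 at \<open>u\<close> to 1 and
    increase with \<open>n\<close> to the indicator of \<open>{u<..}\<close>.\<close>
  define f where "f n y = min 1 (max 0 (real n * (y - u)))" for n :: nat and y
  have fL: "\<bar>f n p - f n q\<bar> \<le> real n * \<bar>p - q\<bar>" for n p q
  proof -
    have "\<bar>f n p - f n q\<bar> \<le> \<bar>real n * (p - u) - real n * (q - u)\<bar>"
      unfolding f_def by (auto simp: min_def max_def)
    also have "\<dots> = real n * \<bar>p - q\<bar>" by (simp add: right_diff_distrib[symmetric] abs_mult)
    finally show ?thesis .
  qed
  have sup: "(SUP n. ennreal (f n y)) = indicator {u<..} y" for y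
  proof (rule antisym)
    show "(SUP n. ennreal (f n y)) \<le> indicator {u<..} y"
      by (rule SUP_least) (auto simp: f_def indicator_def mult_nonneg_nonpos ennreal_le_1)
    show "indicator {u<..} y \<le> (SUP n. ennreal (f n y))"
    proof (cases "u < y")
      case True
      obtain n :: nat where "1 / (y - u) \<le> real n" using real_arch_simple by blast
      then have "f n y = 1" using True by (simp add: f_def field_simps)
      then show ?thesis using True by (intro SUP_upper2[of n]) auto
    qed simp
  qed
  have inc: "incseq (\<lambda>n y. ennreal (f n y))"
  proof (intro incseq_SucI le_funI ennreal_leI)
    fix n y
    show "f n y \<le> f (Suc n) y"
    proof (cases "u \<le> y")
      case True
      then have "real n * (y - u) \<le> real (Suc n) * (y - u)" by (intro mult_right_mono) auto
      then show ?thesis unfolding f_def by (intro min.mono max.mono order_refl)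
    next
      case False
      then have "real n * (y - u) \<le> 0" by (intro mult_nonneg_nonpos) auto
      then have "f n y = 0" by (simp add: f_def max_absorb1)
      then show ?thesis by (simp add: f_def)
    qed
  qed
  have em: "emeasure m {u<..} = (SUP n. \<integral>\<^sup>+y. ennreal (f n y) \<partial>m)" if sm: "sets m = sets borel" for m
  proof -
    note [measurable_cong] = sm
    have "emeasure m {u<..} = (\<integral>\<^sup>+y. (SUP n. ennreal (f n y)) \<partial>m)"
      unfolding sup by (rule nn_integral_indicator[symmetric]) (simp add: sm)
    also have "\<dots> = (SUP n. \<integral>\<^sup>+y. ennreal (f n y) \<partial>m)"
      by (rule nn_integral_monotone_convergence_SUP[OF inc]) (simp add: f_def)
    finally show ?thesis .
  qed
  show "emeasure m1 {u<..} = emeasure m2 {u<..}"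
    unfolding em[OF s(1)] em[OF s(2)] by (intro SUP_cong refl key[OF fL]) (auto simp: f_def)
qed

section \<open>The semigroup property and the terms of the perturbation series\<close>

lemma borel_measurable_Pk [measurable]:
  assumes [measurable]: "g \<in> borel_measurable N" "h \<in> borel_measurable N" "f \<in> borel_measurable borel"
  shows "(\<lambda>p. Pk \<theta> (g p) f (h p)) \<in> borel_measurable N"
  unfolding Pk_def by measurable

lemma Pk_Pk:
  assumes "0 < s" "0 < t" and [measurable]: "f \<in> borel_measurable borel"
  shows "Pk \<theta> s (Pk \<theta> t f) z = Pk \<theta> (s + t) f z"
proof -
  have "Pk \<theta> s (Pk \<theta> t f) z = (\<integral>\<^sup>+y. \<integral>\<^sup>+u. ennreal (ker \<theta> s z y) * ennreal (ker \<theta> t y u) * f u \<partial>lborel \<partial>lborel)"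
    unfolding Pk_def by (subst nn_integral_cmult[symmetric]) (auto simp: mult.assoc)
  also have "\<dots> = (\<integral>\<^sup>+u. \<integral>\<^sup>+y. ennreal (ker \<theta> s z y) * ennreal (ker \<theta> t y u) * f u \<partial>lborel \<partial>lborel)"
    by (rule lborel_pair.Fubini') measurable
  also have "\<dots> = (\<integral>\<^sup>+u. ennreal (ker \<theta> (s + t) z u) * f u \<partial>lborel)"
    by (intro nn_integral_cong) (simp add: nn_integral_multc nn_integral_ker assms)
  finally show ?thesis by (simp add: Pk_def)
qed

text \<open>The \<open>n\<close>-th Dyson term: paths of the kernel from \<open>x\<close> to
  \<open>y\<close> in time \<open>t\<close> with a factor \<open>V\<close> collected at
  \<open>n\<close> ordered intermediate times. Values in \<open>ennreal\<close> leave every exchange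
  of integrals to Tonelli.\<close>

primrec Rn :: "real \<Rightarrow> (real \<Rightarrow> real) \<Rightarrow> real \<Rightarrow> nat \<Rightarrow> real \<Rightarrow> real \<Rightarrow> ennreal" where
  "Rn \<theta> V x 0 = (\<lambda>t y. ennreal (ker \<theta> t x y))"
| "Rn \<theta> V x (Suc n) = (\<lambda>t y. \<integral>\<^sup>+s. (\<integral>\<^sup>+z. Rn \<theta> V x n s z * ennreal (V z) * ennreal (ker \<theta> (t - s) z y) \<partial>lborel) * indicator {0<..<t} s \<partial>lborel)"

lemma borel_measurable_indicator_Ioo [measurable]:
  fixes f g :: "'a \<Rightarrow> real"
  assumes [measurable]: "f \<in> borel_measurable M" "g \<in> borel_measurable M"
  shows "(\<lambda>x. indicator {0<..<f x} (g x) :: ennreal) \<in> borel_measurable M"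
proof -
  have "(\<lambda>x. indicator {0<..<f x} (g x) :: ennreal) = (\<lambda>x. if 0 < g x \<and> g x < f x then 1 else 0)"
    by (auto simp: indicator_def)
  then show ?thesis by simp
qed

lemma borel_measurable_Rn [measurable]:
  assumes V [measurable]: "V \<in> borel_measurable borel" and [measurable]: "g \<in> borel_measurable N" "h \<in> borel_measurable N"
  shows "(\<lambda>p. Rn \<theta> V x n (g p) (h p)) \<in> borel_measurable N"
proof -
  have "(\<lambda>p. Rn \<theta> V x n (fst p) (snd p)) \<in> borel_measurable (borel \<Otimes>\<^sub>M borel)"
  proof (induction n)
    case (Suc n)
    have [measurable]: "(\<lambda>q. Rn \<theta> V x n (snd (fst q)) (snd q)) \<in> borel_measurable (((borel \<Otimes>\<^sub>M borel) \<Otimes>\<^sub>M lborel) \<Otimes>\<^sub>M lborel)"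
      using measurable_compose[OF _ Suc, of "\<lambda>q. (snd (fst q), snd q)" "((borel \<Otimes>\<^sub>M borel) \<Otimes>\<^sub>M lborel) \<Otimes>\<^sub>M lborel"] by simp
    show ?case by simp measurable
  qed simp
  from measurable_compose[OF _ this, of "\<lambda>p. (g p, h p)" N] show ?thesis by simp
qed

section \<open>The Duhamel equation for arbitrary test functions\<close>

context drift_sde
begin

abbreviation "wt s \<omega> \<equiv> ennreal (exp (c * s) * exp (B x) * exp (- B (Z s \<omega>)))"

text \<open>Integration against the law of \<open>Z s\<close> reweighted by
  \<open>exp (c * s + B x - B)\<close>. It is kept as a functional on nonnegative functions, so that
  no total mass has to be finite.\<close>

definition "nu s f = (\<integral>\<^sup>+\<omega>. wt s \<omega> * f (Z s \<omega>) \<partial>P)" for f :: "real \<Rightarrow> ennreal"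

lemma borel_measurable_nu [measurable]:
  assumes [measurable]: "g \<in> borel_measurable N" "(\<lambda>(p, y). f p y) \<in> borel_measurable (N \<Otimes>\<^sub>M borel)"
  shows "(\<lambda>p. nu (g p) (f p)) \<in> borel_measurable N"
  unfolding nu_def by measurable

definition "rhs t f = Pk \<theta> t f x + (\<integral>\<^sup>+s. nu s (\<lambda>z. ennreal (V z) * Pk \<theta> (t - s) f z) * indicator {0<..<t} s \<partial>lborel)"

lemma nu_mono: "(\<And>y. f y \<le> g y) \<Longrightarrow> nu s f \<le> nu s g"
  unfolding nu_def by (intro nn_integral_mono mult_left_mono) auto

lemma nu_cmult: "f \<in> borel_measurable borel \<Longrightarrow> nu s (\<lambda>y. a * f y) = a * nu s f"
  unfolding nu_def by (subst nn_integral_cmult[symmetric]) (auto simp: ac_simps)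

lemma nu_exp_le:
  assumes "s \<in> {0..T}"
  shows "nu s (\<lambda>y. ennreal (exp (- (M * \<bar>y\<bar>)))) \<le> ennreal (exp (\<bar>c\<bar> * T) * exp (B x))"
proof -
  have "nu s (\<lambda>y. ennreal (exp (- (M * \<bar>y\<bar>)))) \<le> (\<integral>\<^sup>+\<omega>. ennreal (exp (\<bar>c\<bar> * T) * exp (B x)) \<partial>P)"
    unfolding nu_def
  proof (rule nn_integral_mono)
    fix \<omega>
    have "c * s \<le> \<bar>c\<bar> * T" using assms by (intro mult_mono) auto
    moreover have "- B (Z s \<omega>) + - (M * \<bar>Z s \<omega>\<bar>) \<le> 0" using B_bound[of "Z s \<omega>"] by linarith
    ultimately have "c * s + B x + (- B (Z s \<omega>) + - (M * \<bar>Z s \<omega>\<bar>)) \<le> \<bar>c\<bar> * T + B x" by linarith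
    then have "exp (c * s) * exp (B x) * (exp (- B (Z s \<omega>)) * exp (- (M * \<bar>Z s \<omega>\<bar>))) \<le> exp (\<bar>c\<bar> * T) * exp (B x)"
      by (simp only: exp_add[symmetric] exp_le_cancel_iff)
    then show "wt s \<omega> * ennreal (exp (- (M * \<bar>Z s \<omega>\<bar>))) \<le> ennreal (exp (\<bar>c\<bar> * T) * exp (B x))"
      by (subst ennreal_mult[symmetric]) (auto intro!: ennreal_leI simp: mult.assoc)
  qed
  then show ?thesis by (simp add: emeasure_space_1)
qed

text \<open>\<open>mild_point\<close> multiplied by \<open>exp (B x)\<close>. Chapman--Kolmogorov
  turns \<open>ker \<theta> (t + \<epsilon> - s)\<close> into \<open>Pk \<theta> (t - s)\<close>
  acting on \<open>ker \<theta> \<epsilon>\<close>; the end points of the time interval are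
  discarded as null sets because this needs \<open>t - s > 0\<close>.\<close>

lemma rhs_ker:
  assumes t: "0 < t" "t \<le> T" and \<epsilon>: "0 < \<epsilon>"
  shows "nu t (\<lambda>y. ennreal (ker \<theta> \<epsilon> y d)) = rhs t (\<lambda>y. ennreal (ker \<theta> \<epsilon> y d))"
proof -
  have e: "ennreal (exp (B x)) * ennreal (exp (- B x)) = 1" by (subst ennreal_mult[symmetric]) (auto simp flip: exp_add)
  have "nu t (\<lambda>y. ennreal (ker \<theta> \<epsilon> y d)) = ennreal (exp (B x)) * (\<integral>\<^sup>+\<omega>. ennreal (exp (c * t) * exp (- B (Z t \<omega>)) * ker \<theta> \<epsilon> (Z t \<omega>) d) \<partial>P)"
    unfolding nu_def using \<epsilon> by (subst nn_integral_cmult[symmetric]) (auto simp: ennreal_mult ac_simps intro!: nn_integral_cong)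
  also have "\<dots> = ennreal (exp (B x)) * ennreal (exp (- B x) * ker \<theta> (t + \<epsilon>) x d)
      + ennreal (exp (B x)) * (\<integral>\<^sup>+r. (\<integral>\<^sup>+\<omega>. ennreal (exp (c * r) * exp (- B (Z r \<omega>)) * (V (Z r \<omega>) * ker \<theta> (t + \<epsilon> - r) (Z r \<omega>) d)) \<partial>P) * indicator {0..t} r \<partial>lborel)"
    using t by (subst mild_point[OF \<epsilon>]) (auto simp: distrib_left)
  also have "ennreal (exp (B x)) * ennreal (exp (- B x) * ker \<theta> (t + \<epsilon>) x d) = Pk \<theta> t (\<lambda>y. ennreal (ker \<theta> \<epsilon> y d)) x"
    unfolding Pk_def using t \<epsilon> e by (simp add: nn_integral_ker ennreal_mult mult.assoc[symmetric])
  also have "ennreal (exp (B x)) * (\<integral>\<^sup>+r. (\<integral>\<^sup>+\<omega>. ennreal (exp (c * r) * exp (- B (Z r \<omega>)) * (V (Z r \<omega>) * ker \<theta> (t + \<epsilon> - r) (Z r \<omega>) d)) \<partial>P) * indicator {0..t} r \<partial>lborel)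
     = (\<integral>\<^sup>+s. ennreal (exp (B x)) * ((\<integral>\<^sup>+\<omega>. ennreal (exp (c * s) * exp (- B (Z s \<omega>)) * (V (Z s \<omega>) * ker \<theta> (t + \<epsilon> - s) (Z s \<omega>) d)) \<partial>P) * indicator {0..t} s) \<partial>lborel)"
    by (rule nn_integral_cmult[symmetric]) measurable
  also have "\<dots> = (\<integral>\<^sup>+s. nu s (\<lambda>z. ennreal (V z) * Pk \<theta> (t - s) (\<lambda>y. ennreal (ker \<theta> \<epsilon> y d)) z) * indicator {0<..<t} s \<partial>lborel)"
  proof (rule nn_integral_cong_AE)
    show "AE s in lborel. ennreal (exp (B x)) * ((\<integral>\<^sup>+\<omega>. ennreal (exp (c * s) * exp (- B (Z s \<omega>)) * (V (Z s \<omega>) * ker \<theta> (t + \<epsilon> - s) (Z s \<omega>) d)) \<partial>P) * indicator {0..t} s)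
      = nu s (\<lambda>z. ennreal (V z) * Pk \<theta> (t - s) (\<lambda>y. ennreal (ker \<theta> \<epsilon> y d)) z) * indicator {0<..<t} s"
      using AE_lborel_singleton[of 0] AE_lborel_singleton[of t]
    proof eventually_elim
      case (elim s)
      show ?case
      proof (cases "s \<in> {0<..<t}")
        case True
        then have s: "0 < t - s" by auto
        have k: "Pk \<theta> (t - s) (\<lambda>y. ennreal (ker \<theta> \<epsilon> y d)) z = ennreal (ker \<theta> (t + \<epsilon> - s) z d)" for z
          unfolding Pk_def nn_integral_ker[OF s \<epsilon>] by (simp add: algebra_simps)
        have k0: "0 \<le> ker \<theta> (t + \<epsilon> - s) z d" for z using s \<epsilon> by (intro ker_nonneg) auto
        have "ennreal (exp (B x)) * (\<integral>\<^sup>+\<omega>. ennreal (exp (c * s) * exp (- B (Z s \<omega>)) * (V (Z s \<omega>) * ker \<theta> (t + \<epsilon> - s) (Z s \<omega>) d)) \<partial>P)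
           = nu s (\<lambda>z. ennreal (V z) * ennreal (ker \<theta> (t + \<epsilon> - s) z d))"
          unfolding nu_def using k0 V_bounds(1)
          by (subst nn_integral_cmult[symmetric]) (auto simp: ennreal_mult ac_simps intro!: nn_integral_cong)
        then show ?thesis using True by (simp add: k)
      qed (use elim in auto)
    qed
  qed
  finally show ?thesis by (simp add: rhs_def)
qed

lemma rhs_exp_finite:
  assumes t: "0 < t" "t \<le> T"
  shows "rhs t (\<lambda>y. ennreal (exp (- (M * \<bar>y\<bar>)))) < \<infinity>"
proof -
  obtain C where C: "\<And>t z. 0 < t \<Longrightarrow> t \<le> T \<Longrightarrow> Pk \<theta> t (\<lambda>y. ennreal (exp (- (M * \<bar>y\<bar>)))) z \<le> ennreal (C * exp (- (M * \<bar>z\<bar>)))"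
    using Pk_exp_le[OF T, of \<theta> M] by blast
  have "(\<integral>\<^sup>+s. nu s (\<lambda>z. ennreal (V z) * Pk \<theta> (t - s) (\<lambda>y. ennreal (exp (- (M * \<bar>y\<bar>)))) z) * indicator {0<..<t} s \<partial>lborel)
     \<le> (\<integral>\<^sup>+s. (ennreal (K * \<bar>C\<bar>) * ennreal (exp (\<bar>c\<bar> * T) * exp (B x))) * indicator {0<..<t} s \<partial>lborel)"
  proof (rule nn_integral_mono)
    fix s
    show "nu s (\<lambda>z. ennreal (V z) * Pk \<theta> (t - s) (\<lambda>y. ennreal (exp (- (M * \<bar>y\<bar>)))) z) * indicator {0<..<t} s
      \<le> (ennreal (K * \<bar>C\<bar>) * ennreal (exp (\<bar>c\<bar> * T) * exp (B x))) * indicator {0<..<t} s"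
    proof (cases "s \<in> {0<..<t}")
      case True
      have "nu s (\<lambda>z. ennreal (V z) * Pk \<theta> (t - s) (\<lambda>y. ennreal (exp (- (M * \<bar>y\<bar>)))) z) \<le> nu s (\<lambda>z. ennreal (K * \<bar>C\<bar>) * ennreal (exp (- (M * \<bar>z\<bar>))))"
      proof (rule nu_mono)
        fix z
        have "Pk \<theta> (t - s) (\<lambda>y. ennreal (exp (- (M * \<bar>y\<bar>)))) z \<le> ennreal (C * exp (- (M * \<bar>z\<bar>)))" using True t by (intro C) auto
        also have "\<dots> \<le> ennreal (\<bar>C\<bar> * exp (- (M * \<bar>z\<bar>)))" by (intro ennreal_leI mult_right_mono) auto
        finally have "ennreal (V z) * Pk \<theta> (t - s) (\<lambda>y. ennreal (exp (- (M * \<bar>y\<bar>)))) z \<le> ennreal K * ennreal (\<bar>C\<bar> * exp (- (M * \<bar>z\<bar>)))"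
          using V_bounds[of z] by (intro mult_mono ennreal_leI) auto
        then show "ennreal (V z) * Pk \<theta> (t - s) (\<lambda>y. ennreal (exp (- (M * \<bar>y\<bar>)))) z \<le> ennreal (K * \<bar>C\<bar>) * ennreal (exp (- (M * \<bar>z\<bar>)))"
          using K_nonneg by (simp add: ennreal_mult mult.assoc)
      qed
      also have "\<dots> = ennreal (K * \<bar>C\<bar>) * nu s (\<lambda>z. ennreal (exp (- (M * \<bar>z\<bar>))))"
        by (rule nu_cmult) auto
      also have "\<dots> \<le> ennreal (K * \<bar>C\<bar>) * ennreal (exp (\<bar>c\<bar> * T) * exp (B x))"
        using True t by (intro mult_left_mono nu_exp_le) auto
      finally show ?thesis using True by simp
    qed simp
  qed
  also have "\<dots> < \<infinity>"
    using t by (subst nn_integral_cmult_indicator) (auto simp: ennreal_mult[symmetric] ennreal_mult_less_top)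
  finally have "(\<integral>\<^sup>+s. nu s (\<lambda>z. ennreal (V z) * Pk \<theta> (t - s) (\<lambda>y. ennreal (exp (- (M * \<bar>y\<bar>)))) z) * indicator {0<..<t} s \<partial>lborel) < \<infinity>" .
  moreover have "Pk \<theta> t (\<lambda>y. ennreal (exp (- (M * \<bar>y\<bar>)))) x < \<infinity>"
    using C[OF t, of x] by (auto simp: less_top[symmetric] top_unique)
  ultimately show ?thesis by (simp add: rhs_def)
qed

text \<open>Both sides, damped by \<open>exp (- (M * \<bar>y\<bar>))\<close>, are integrals against
  finite measures \<open>m1\<close> and \<open>m2\<close>. These agree on the kernels by
  \<open>rhs_ker\<close>, hence coincide by \<open>finite_measure_eq_ker\<close>.\<close>

lemma measure_equation:
  assumes t: "0 < t" "t \<le> T" and f [measurable]: "f \<in> borel_measurable borel"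
  shows "nu t f = rhs t f"
proof -
  define m1 where "m1 = distr (density P (\<lambda>\<omega>. wt t \<omega> * ennreal (exp (- (M * \<bar>Z t \<omega>\<bar>))))) borel (Z t)"
  \<comment> \<open>\<open>m2\<close> is built as an image of one density on time, outcomes and
    states. Positive times carry the Duhamel integral. The otherwise empty time slot
    \<open>-1 < s < 0\<close> has length 1 and carries the free term
    \<open>Pk \<theta> t f x\<close>.\<close>
  define k where "k s \<omega> y = (if -1 < s \<and> s < 0 then ennreal (ker \<theta> t x y) else
      wt s \<omega> * ennreal (V (Z s \<omega>)) * ennreal (ker \<theta> (t - s) (Z s \<omega>) y) * indicator {0<..<t} s) * ennreal (exp (- (M * \<bar>y\<bar>)))" for s \<omega> y
  have km [measurable]: "(\<lambda>q. k (fst (fst q)) (snd (fst q)) (snd q)) \<in> borel_measurable ((lborel \<Otimes>\<^sub>M P) \<Otimes>\<^sub>M lborel)"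
    unfolding k_def by measurable
  define m2 where "m2 = distr (density ((lborel \<Otimes>\<^sub>M P) \<Otimes>\<^sub>M lborel) (\<lambda>q. k (fst (fst q)) (snd (fst q)) (snd q))) borel snd"
  have ex: "ennreal (exp (M * \<bar>y\<bar>)) * ennreal (exp (- (M * \<bar>y\<bar>))) = 1" for y
    by (subst ennreal_mult[symmetric]) (auto simp flip: exp_add)
  have i1: "(\<integral>\<^sup>+y. ennreal (exp (M * \<bar>y\<bar>)) * g y \<partial>m1) = nu t g" if [measurable]: "g \<in> borel_measurable borel" for g
  proof -
    have "(\<integral>\<^sup>+y. ennreal (exp (M * \<bar>y\<bar>)) * g y \<partial>m1) = (\<integral>\<^sup>+\<omega>. (wt t \<omega> * ennreal (exp (- (M * \<bar>Z t \<omega>\<bar>)))) * (ennreal (exp (M * \<bar>Z t \<omega>\<bar>)) * g (Z t \<omega>)) \<partial>P)"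
      unfolding m1_def by (simp add: nn_integral_distr nn_integral_density)
    also have "\<dots> = (\<integral>\<^sup>+\<omega>. wt t \<omega> * g (Z t \<omega>) * (ennreal (exp (M * \<bar>Z t \<omega>\<bar>)) * ennreal (exp (- (M * \<bar>Z t \<omega>\<bar>)))) \<partial>P)"
      by (intro nn_integral_cong) (simp only: ac_simps)
    finally show ?thesis by (simp add: ex nu_def)
  qed
  interpret pp: sigma_finite_measure "lborel \<Otimes>\<^sub>M P" by (rule sigma_finite_pair_measure) (unfold_locales)
  interpret pq: pair_sigma_finite "lborel \<Otimes>\<^sub>M P" lborel ..
  have i2: "(\<integral>\<^sup>+y. ennreal (exp (M * \<bar>y\<bar>)) * g y \<partial>m2) = rhs t g" if g [measurable]: "g \<in> borel_measurable borel" for g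
  proof -
    define h where "h s \<omega> y = (if -1 < s \<and> s < 0 then ennreal (ker \<theta> t x y) else
      wt s \<omega> * ennreal (V (Z s \<omega>)) * ennreal (ker \<theta> (t - s) (Z s \<omega>) y) * indicator {0<..<t} s) * g y" for s \<omega> y
    have hm [measurable]: "(\<lambda>q. h (fst (fst q)) (snd (fst q)) (snd q)) \<in> borel_measurable ((lborel \<Otimes>\<^sub>M P) \<Otimes>\<^sub>M lborel)"
      unfolding h_def by measurable
    have "(\<integral>\<^sup>+y. ennreal (exp (M * \<bar>y\<bar>)) * g y \<partial>m2) = (\<integral>\<^sup>+p. k (fst (fst p)) (snd (fst p)) (snd p) * (ennreal (exp (M * \<bar>snd p\<bar>)) * g (snd p)) \<partial>((lborel \<Otimes>\<^sub>M P) \<Otimes>\<^sub>M lborel))"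
      unfolding m2_def by (simp add: nn_integral_distr nn_integral_density)
    also have "\<dots> = (\<integral>\<^sup>+p. h (fst (fst p)) (snd (fst p)) (snd p) \<partial>((lborel \<Otimes>\<^sub>M P) \<Otimes>\<^sub>M lborel))"
    proof (rule nn_integral_cong)
      fix p :: "(real \<times> 'b) \<times> real"
      obtain s \<omega> y where p: "p = ((s, \<omega>), y)" by (metis surj_pair)
      have "k s \<omega> y * (ennreal (exp (M * \<bar>y\<bar>)) * g y) = h s \<omega> y * (ennreal (exp (M * \<bar>y\<bar>)) * ennreal (exp (- (M * \<bar>y\<bar>))))"
        unfolding k_def h_def by (simp only: ac_simps)
      then show "k (fst (fst p)) (snd (fst p)) (snd p) * (ennreal (exp (M * \<bar>snd p\<bar>)) * g (snd p)) = h (fst (fst p)) (snd (fst p)) (snd p)"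
        by (simp add: p ex)
    qed
    also have "\<dots> = (\<integral>\<^sup>+q. \<integral>\<^sup>+y. h (fst q) (snd q) y \<partial>lborel \<partial>(lborel \<Otimes>\<^sub>M P))"
      by (subst lborel.nn_integral_fst[symmetric]) auto
    also have "\<dots> = (\<integral>\<^sup>+s. \<integral>\<^sup>+\<omega>. \<integral>\<^sup>+y. h s \<omega> y \<partial>lborel \<partial>P \<partial>lborel)"
      by (subst nn_integral_fst[symmetric]) auto
    also have "\<dots> = (\<integral>\<^sup>+s. Pk \<theta> t g x * indicator {-1<..<0} s + nu s (\<lambda>z. ennreal (V z) * Pk \<theta> (t - s) g z) * indicator {0<..<t} s \<partial>lborel)"
    proof (rule nn_integral_cong)
      fix s :: real
      have inner: "(\<integral>\<^sup>+y. h s \<omega> y \<partial>lborel) = Pk \<theta> t g x * indicator {-1<..<0} s + wt s \<omega> * (ennreal (V (Z s \<omega>)) * Pk \<theta> (t - s) g (Z s \<omega>)) * indicator {0<..<t} s" for \<omega>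
      proof (cases "-1 < s \<and> s < 0")
        case True then show ?thesis by (simp add: h_def Pk_def)
      next
        case False
        have "(\<integral>\<^sup>+y. h s \<omega> y \<partial>lborel) = (\<integral>\<^sup>+y. (wt s \<omega> * ennreal (V (Z s \<omega>)) * indicator {0<..<t} s) * (ennreal (ker \<theta> (t - s) (Z s \<omega>) y) * g y) \<partial>lborel)"
          using False by (intro nn_integral_cong) (auto simp: h_def ac_simps)
        also have "\<dots> = (wt s \<omega> * ennreal (V (Z s \<omega>)) * indicator {0<..<t} s) * Pk \<theta> (t - s) g (Z s \<omega>)"
          unfolding Pk_def by (rule nn_integral_cmult) measurable
        finally show ?thesis using False by (auto simp: ac_simps)
      qed
      show "(\<integral>\<^sup>+\<omega>. \<integral>\<^sup>+y. h s \<omega> y \<partial>lborel \<partial>P) = Pk \<theta> t g x * indicator {-1<..<0} s + nu s (\<lambda>z. ennreal (V z) * Pk \<theta> (t - s) g z) * indicator {0<..<t} s"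
        unfolding inner nu_def
        by (subst nn_integral_add) (auto simp: nn_integral_multc emeasure_space_1)
    qed
    also have "\<dots> = (\<integral>\<^sup>+s. Pk \<theta> t g x * indicator {-1<..<(0::real)} s \<partial>lborel) + (\<integral>\<^sup>+s. nu s (\<lambda>z. ennreal (V z) * Pk \<theta> (t - s) g z) * indicator {0<..<t} s \<partial>lborel)"
      by (rule nn_integral_add) measurable
    also have "(\<integral>\<^sup>+s. Pk \<theta> t g x * indicator {-1<..<(0::real)} s \<partial>lborel) = Pk \<theta> t g x"
      by (subst nn_integral_cmult_indicator) auto
    finally show ?thesis by (simp add: rhs_def)
  qed
  have "m1 = m2"
  proof (rule finite_measure_eq_ker[where M=M and \<theta>=\<theta>])
    have c1: "(\<integral>\<^sup>+y. 1 \<partial>m) = (\<integral>\<^sup>+y. ennreal (exp (M * \<bar>y\<bar>)) * ennreal (exp (- (M * \<bar>y\<bar>))) \<partial>m)" for m :: "real measure"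
      by (simp add: ex)
    have "emeasure m1 (space m1) = nu t (\<lambda>y. ennreal (exp (- (M * \<bar>y\<bar>))))"
      using c1[of m1] i1[of "\<lambda>y. ennreal (exp (- (M * \<bar>y\<bar>)))"] by simp
    also have "\<dots> < \<infinity>" using nu_exp_le[of t] t by (auto simp: less_top[symmetric] top_unique)
    finally show "finite_measure m1" by (intro finite_measureI) auto
    have "emeasure m2 (space m2) = rhs t (\<lambda>y. ennreal (exp (- (M * \<bar>y\<bar>))))"
      using c1[of m2] i2[of "\<lambda>y. ennreal (exp (- (M * \<bar>y\<bar>)))"] by simp
    also have "\<dots> < \<infinity>" by (rule rhs_exp_finite[OF t])
    finally show "finite_measure m2" by (intro finite_measureI) auto
    show "sets m1 = sets borel" "sets m2 = sets borel" by (auto simp: m1_def m2_def)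
    show "0 \<le> M" using bM[of 0] by simp
    show "(\<integral>\<^sup>+y. ennreal (exp (M * \<bar>y\<bar>)) * ennreal (ker \<theta> \<epsilon> y d) \<partial>m1) = (\<integral>\<^sup>+y. ennreal (exp (M * \<bar>y\<bar>)) * ennreal (ker \<theta> \<epsilon> y d) \<partial>m2)"
      if "0 < \<epsilon>" for \<epsilon> d
      using rhs_ker[OF t that] by (simp add: i1 i2)
  qed
  then show ?thesis using i1[OF f] i2[OF f] by simp
qed

text \<open>By the semigroup property, the Duhamel equation at time \<open>s\<close> for
  \<open>Pk \<theta> (t - s) f\<close> is the equation at time \<open>t\<close> for \<open>f\<close>
  with the time integral stopped at \<open>s\<close>. The integrand is nonnegative, so stopping
  early can only decrease the value.\<close>

lemma nu_Pk_le:
  assumes s: "0 < s" "s < t" "t \<le> T" and f [measurable]: "f \<in> borel_measurable borel"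
  shows "nu s (Pk \<theta> (t - s) f) \<le> nu t f"
proof -
  have "nu s (Pk \<theta> (t - s) f) = rhs s (Pk \<theta> (t - s) f)" using s by (intro measure_equation) auto
  also have "\<dots> \<le> rhs t f"
    unfolding rhs_def
  proof (intro add_mono nn_integral_mono)
    show "Pk \<theta> s (Pk \<theta> (t - s) f) x \<le> Pk \<theta> t f x" using s by (simp add: Pk_Pk)
    fix r
    show "nu r (\<lambda>z. ennreal (V z) * Pk \<theta> (s - r) (Pk \<theta> (t - s) f) z) * indicator {0<..<s} r \<le> nu r (\<lambda>z. ennreal (V z) * Pk \<theta> (t - r) f z) * indicator {0<..<t} r"
      using s by (cases "r \<in> {0<..<s}") (auto simp: Pk_Pk)
  qed
  also have "\<dots> = nu t f" using s by (intro measure_equation[symmetric]) auto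
  finally show ?thesis .
qed

section \<open>Iteration of the Duhamel equation into a series\<close>

abbreviation "Sn n t f \<equiv> (\<integral>\<^sup>+y. Rn \<theta> V x n t y * f y \<partial>lborel)"

lemma Sn_Suc:
  assumes f [measurable]: "f \<in> borel_measurable borel"
  shows "Sn (Suc n) t f = (\<integral>\<^sup>+s. Sn n s (\<lambda>z. ennreal (V z) * Pk \<theta> (t - s) f z) * indicator {0<..<t} s \<partial>lborel)"
proof -
  have "Sn (Suc n) t f = (\<integral>\<^sup>+y. \<integral>\<^sup>+s. (\<integral>\<^sup>+z. Rn \<theta> V x n s z * ennreal (V z) * ennreal (ker \<theta> (t - s) z y) * f y * indicator {0<..<t} s \<partial>lborel) \<partial>lborel \<partial>lborel)"
    by (simp add: nn_integral_multc[symmetric]) (simp add: ac_simps)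
  also have "\<dots> = (\<integral>\<^sup>+s. \<integral>\<^sup>+y. (\<integral>\<^sup>+z. Rn \<theta> V x n s z * ennreal (V z) * ennreal (ker \<theta> (t - s) z y) * f y * indicator {0<..<t} s \<partial>lborel) \<partial>lborel \<partial>lborel)"
    by (rule lborel_pair.Fubini') measurable
  also have "\<dots> = (\<integral>\<^sup>+s. Sn n s (\<lambda>z. ennreal (V z) * Pk \<theta> (t - s) f z) * indicator {0<..<t} s \<partial>lborel)"
  proof (rule nn_integral_cong)
    fix s :: real
    have "(\<integral>\<^sup>+y. (\<integral>\<^sup>+z. Rn \<theta> V x n s z * ennreal (V z) * ennreal (ker \<theta> (t - s) z y) * f y * indicator {0<..<t} s \<partial>lborel) \<partial>lborel)
      = (\<integral>\<^sup>+z. (\<integral>\<^sup>+y. Rn \<theta> V x n s z * ennreal (V z) * ennreal (ker \<theta> (t - s) z y) * f y * indicator {0<..<t} s \<partial>lborel) \<partial>lborel)"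
      by (rule lborel_pair.Fubini') measurable
    also have "\<dots> = (\<integral>\<^sup>+z. (Rn \<theta> V x n s z * (ennreal (V z) * Pk \<theta> (t - s) f z)) * indicator {0<..<t} s \<partial>lborel)"
    proof (rule nn_integral_cong)
      fix z
      have "(\<integral>\<^sup>+y. Rn \<theta> V x n s z * ennreal (V z) * ennreal (ker \<theta> (t - s) z y) * f y * indicator {0<..<t} s \<partial>lborel)
        = (\<integral>\<^sup>+y. (Rn \<theta> V x n s z * ennreal (V z) * indicator {0<..<t} s) * (ennreal (ker \<theta> (t - s) z y) * f y) \<partial>lborel)"
        by (intro nn_integral_cong) (simp only: ac_simps)
      also have "\<dots> = (Rn \<theta> V x n s z * ennreal (V z) * indicator {0<..<t} s) * Pk \<theta> (t - s) f z"
        unfolding Pk_def by (rule nn_integral_cmult) measurable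
      finally show "(\<integral>\<^sup>+y. Rn \<theta> V x n s z * ennreal (V z) * ennreal (ker \<theta> (t - s) z y) * f y * indicator {0<..<t} s \<partial>lborel) = (Rn \<theta> V x n s z * (ennreal (V z) * Pk \<theta> (t - s) f z)) * indicator {0<..<t} s"
        by (simp only: ac_simps)
    qed
    also have "\<dots> = Sn n s (\<lambda>z. ennreal (V z) * Pk \<theta> (t - s) f z) * indicator {0<..<t} s"
      by (rule nn_integral_multc) measurable
    finally show "(\<integral>\<^sup>+y. (\<integral>\<^sup>+z. Rn \<theta> V x n s z * ennreal (V z) * ennreal (ker \<theta> (t - s) z y) * f y * indicator {0<..<t} s \<partial>lborel) \<partial>lborel) = \<dots>" .
  qed
  finally show ?thesis .
qed

lemma nn_integral_pow:
  assumes t: "0 \<le> t"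
  shows "(\<integral>\<^sup>+s. ennreal (K * ((K * s) ^ n / fact n)) * indicator {0<..<t} s \<partial>lborel) = ennreal ((K * t) ^ Suc n / fact (Suc n))"
proof -
  have "(\<integral>\<^sup>+s. ennreal (K * ((K * s) ^ n / fact n)) * indicator {0<..<t} s \<partial>lborel) = (\<integral>\<^sup>+s. ennreal (K * ((K * s) ^ n / fact n)) * indicator {0..t} s \<partial>lborel)"
    using AE_lborel_singleton[of 0] AE_lborel_singleton[of t]
    by (intro nn_integral_cong_AE, eventually_elim) (auto simp: indicator_def)
  also have "\<dots> = ennreal ((K * t) ^ Suc n / fact (Suc n) - (K * 0) ^ Suc n / fact (Suc n))"
  proof (rule nn_integral_FTC_Icc[where F="\<lambda>s. (K * s) ^ Suc n / fact (Suc n)"])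
    fix s :: real assume s: "s \<in> {0..t}"
    have "((\<lambda>s. (K * s) ^ Suc n / fact (Suc n)) has_real_derivative ((1 + real n) * (K * (K * s) ^ n)) / fact (Suc n)) (at s)"
      by (rule DERIV_cdivide[OF DERIV_power_Suc[OF DERIV_cmult_Id]])
    moreover have "((1 + real n) * (K * (K * s) ^ n)) / fact (Suc n) = K * ((K * s) ^ n / fact n)"
    proof -
      have f: "fact (Suc n) = (1 + real n) * (fact n :: real)" by simp
      have "((1 + real n) * (K * (K * s) ^ n)) / ((1 + real n) * fact n) = (K * (K * s) ^ n) / fact n"
        by (rule mult_divide_mult_cancel_left) linarith
      then show ?thesis unfolding f by simp
    qed
    ultimately have d: "((\<lambda>s. (K * s) ^ Suc n / fact (Suc n)) has_real_derivative K * ((K * s) ^ n / fact n)) (at s)" by (simp only:)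
    then show "((\<lambda>s. (K * s) ^ Suc n / fact (Suc n)) has_real_derivative K * ((K * s) ^ n / fact n)) (at s)" .
    show "0 \<le> K * ((K * s) ^ n / fact n)" using s K_nonneg by auto
  qed (use t in auto)
  finally show ?thesis by simp
qed

text \<open>Each use of the Duhamel equation applies the induction hypothesis at an earlier time
  \<open>s\<close>. There the error involves \<open>nu s\<close> of
  \<open>V * Pk \<theta> (t - s) f\<close>, which \<open>V \<le> K\<close> and
  \<open>nu_Pk_le\<close> bound by \<open>K * nu t f\<close>; what is left to integrate is a power
  of \<open>s\<close>. The remainder thus refers back to \<open>nu t f\<close> itself, and the
  bounds make sense even where that is infinite.\<close>

lemma nu_series_bounds:
  "0 < t \<Longrightarrow> t \<le> T \<Longrightarrow> f \<in> borel_measurable borel \<Longrightarrow>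
   (\<Sum>k<n. Sn k t f) \<le> nu t f \<and> nu t f \<le> (\<Sum>k<n. Sn k t f) + ennreal ((K * t) ^ n / fact n) * nu t f"
proof (induction n arbitrary: t f)
  case (Suc n)
  note t = Suc.prems(1,2) and f [measurable] = Suc.prems(3)
  let ?g = "\<lambda>s z. ennreal (V z) * Pk \<theta> (t - s) f z"
  have eq: "nu t f = Sn 0 t f + (\<integral>\<^sup>+s. nu s (?g s) * indicator {0<..<t} s \<partial>lborel)"
    using measure_equation[OF t f] by (simp add: rhs_def Pk_def)
  have sum: "(\<Sum>k<Suc n. Sn k t f) = Sn 0 t f + (\<integral>\<^sup>+s. (\<Sum>k<n. Sn k s (?g s)) * indicator {0<..<t} s \<partial>lborel)"
  proof -
    have "(\<Sum>k<n. Sn (Suc k) t f) = (\<integral>\<^sup>+s. (\<Sum>k<n. Sn k s (?g s) * indicator {0<..<t} s) \<partial>lborel)"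
      unfolding Sn_Suc[OF f] by (rule nn_integral_sum[symmetric]) measurable
    then show ?thesis by (simp only: sum.lessThan_Suc_shift sum_distrib_right)
  qed
  have IH: "(\<Sum>k<n. Sn k s (?g s)) \<le> nu s (?g s)" "nu s (?g s) \<le> (\<Sum>k<n. Sn k s (?g s)) + ennreal ((K * s) ^ n / fact n) * nu s (?g s)"
    if "s \<in> {0<..<t}" for s
    using Suc.IH[of s "?g s"] that t by auto
  have low: "(\<Sum>k<Suc n. Sn k t f) \<le> nu t f"
    unfolding sum eq using IH(1) by (intro add_left_mono nn_integral_mono) (auto simp: indicator_def)
  have step: "nu s (?g s) * indicator {0<..<t} s \<le> (\<Sum>k<n. Sn k s (?g s)) * indicator {0<..<t} s + (ennreal (K * ((K * s) ^ n / fact n)) * indicator {0<..<t} s) * nu t f" for s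
  proof (cases "s \<in> {0<..<t}")
    case True
    have "nu s (?g s) \<le> nu s (\<lambda>z. ennreal K * Pk \<theta> (t - s) f z)"
      using V_bounds by (intro nu_mono mult_right_mono ennreal_leI) auto
    also have "\<dots> = ennreal K * nu s (Pk \<theta> (t - s) f)" by (rule nu_cmult) measurable
    also have "\<dots> \<le> ennreal K * nu t f" using True t by (intro mult_left_mono nu_Pk_le f) auto
    finally have "ennreal ((K * s) ^ n / fact n) * nu s (?g s) \<le> ennreal ((K * s) ^ n / fact n) * (ennreal K * nu t f)"
      by (intro mult_left_mono) auto
    also have "\<dots> = ennreal (K * ((K * s) ^ n / fact n)) * nu t f"
      using True K_nonneg by (subst ennreal_mult) (auto simp: ac_simps)
    finally have "(\<Sum>k<n. Sn k s (?g s)) + ennreal ((K * s) ^ n / fact n) * nu s (?g s) \<le> (\<Sum>k<n. Sn k s (?g s)) + ennreal (K * ((K * s) ^ n / fact n)) * nu t f"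
      by (rule add_left_mono)
    from order_trans[OF IH(2)[OF True] this] show ?thesis using True by simp
  qed simp
  have "nu t f \<le> Sn 0 t f + (\<integral>\<^sup>+s. (\<Sum>k<n. Sn k s (?g s)) * indicator {0<..<t} s + (ennreal (K * ((K * s) ^ n / fact n)) * indicator {0<..<t} s) * nu t f \<partial>lborel)"
    unfolding eq[of] by (intro add_left_mono nn_integral_mono step[unfolded eq])
  also have "(\<integral>\<^sup>+s. (\<Sum>k<n. Sn k s (?g s)) * indicator {0<..<t} s + (ennreal (K * ((K * s) ^ n / fact n)) * indicator {0<..<t} s) * nu t f \<partial>lborel)
    = (\<integral>\<^sup>+s. (\<Sum>k<n. Sn k s (?g s)) * indicator {0<..<t} s \<partial>lborel) + (\<integral>\<^sup>+s. (ennreal (K * ((K * s) ^ n / fact n)) * indicator {0<..<t} s) * nu t f \<partial>lborel)"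
    by (rule nn_integral_add) measurable
  also have "(\<integral>\<^sup>+s. (ennreal (K * ((K * s) ^ n / fact n)) * indicator {0<..<t} s) * nu t f \<partial>lborel) = ennreal ((K * t) ^ Suc n / fact (Suc n)) * nu t f"
    using t by (subst nn_integral_multc, measurable) (subst nn_integral_pow, auto)
  finally show ?case using low unfolding sum by (simp add: add.assoc)
qed simp

text \<open>The test function undoes the weight in \<open>nu\<close>, so that \<open>nu T\<close> of
  it is the probability of \<open>C\<close>. This is finite, and therefore the remainder of the
  series tends to 0.\<close>

theorem law_series:
  assumes C [measurable]: "C \<in> sets borel"
  shows "emeasure (distr P borel (X T)) C = (\<Sum>n. \<integral>\<^sup>+y. Rn \<theta> V x n T y * (ennreal (exp (B y - B x - c * T)) * indicator C y) \<partial>lborel)"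
proof -
  have XT [measurable]: "X T \<in> borel_measurable P"
    using T by (intro measurable_from_subalg[OF F_sub X_measurable]) auto
  let ?f = "\<lambda>y. ennreal (exp (B y - B x - c * T)) * indicator C y"
  have "emeasure (distr P borel (X T)) C = emeasure P (X T -` C \<inter> space P)" by (simp add: emeasure_distr)
  also have "\<dots> = emeasure P (Z T -` C \<inter> space P)"
    by (rule emeasure_eq_AE) (use Z_eq T in \<open>auto elim!: eventually_mono\<close>)
  also have "\<dots> = nu T ?f"
  proof -
    have "nu T ?f = (\<integral>\<^sup>+\<omega>. indicator (Z T -` C \<inter> space P) \<omega> \<partial>P)"
      unfolding nu_def
    proof (rule nn_integral_cong)
      fix \<omega> assume \<omega>: "\<omega> \<in> space P"
      have "wt T \<omega> * ennreal (exp (B (Z T \<omega>) - B x - c * T)) = ennreal ((exp (c * T) * exp (B x) * exp (- B (Z T \<omega>))) * exp (B (Z T \<omega>) - B x - c * T))"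
        by (subst ennreal_mult[symmetric]) auto
      also have "(exp (c * T) * exp (B x) * exp (- B (Z T \<omega>))) * exp (B (Z T \<omega>) - B x - c * T) = 1"
        by (simp flip: exp_add)
      finally show "wt T \<omega> * (ennreal (exp (B (Z T \<omega>) - B x - c * T)) * indicator C (Z T \<omega>)) = indicator (Z T -` C \<inter> space P) \<omega>"
        using \<omega> by (simp add: mult.assoc[symmetric] indicator_def)
    qed
    then show ?thesis by simp
  qed
  also have "\<dots> = (\<Sum>n. Sn n T ?f)"
  proof (rule antisym)
    have fm: "?f \<in> borel_measurable borel" by measurable
    note b = nu_series_bounds[OF T order_refl fm]
    have fin: "nu T ?f < \<infinity>"
      unfolding calculation[symmetric] by (simp add: emeasure_distr less_top[THEN iffD1, OF emeasure_finite])
    have "(\<lambda>n. (K * T) ^ n / fact n) \<longlonglongrightarrow> 0"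
      using summable_LIMSEQ_zero[OF summable_exp[of "K * T"]] by (simp add: divide_inverse mult.commute)
    then have "(\<lambda>n. ennreal ((K * T) ^ n / fact n)) \<longlonglongrightarrow> ennreal 0" by (rule tendsto_ennrealI)
    then have lim: "(\<lambda>n. ennreal ((K * T) ^ n / fact n) * nu T ?f) \<longlonglongrightarrow> 0 * nu T ?f"
      using fin by (intro tendsto_mult_ennreal tendsto_const) auto
    have "(\<lambda>n. (\<Sum>k<n. Sn k T ?f) + ennreal ((K * T) ^ n / fact n) * nu T ?f) \<longlonglongrightarrow> (\<Sum>n. Sn n T ?f) + 0 * nu T ?f"
      by (intro tendsto_add lim summable_LIMSEQ summableI)
    then have "(\<lambda>n. (\<Sum>k<n. Sn k T ?f) + ennreal ((K * T) ^ n / fact n) * nu T ?f) \<longlonglongrightarrow> (\<Sum>n. Sn n T ?f)" by simp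
    then show "nu T ?f \<le> (\<Sum>n. Sn n T ?f)"
      by (rule LIMSEQ_le_const) (use b in auto)
    show "(\<Sum>n. Sn n T ?f) \<le> nu T ?f"
      by (rule suminf_le_const[OF summableI]) (use b in auto)
  qed
  finally show ?thesis .
qed

end

section \<open>Poisson points in increasing order\<close>

definition increasing_points :: "nat \<Rightarrow> (nat \<Rightarrow> real \<times> real) set" where
  "increasing_points n = {p. \<forall>i\<in>{1..n}. \<forall>j\<in>{1..n}. i < j \<longrightarrow> fst (p i) < fst (p j)}"

text \<open>For such boxes the labelling by time is automatic: one point in each \<open>A i\<close>
  and none elsewhere already means that the \<open>i\<close>-th point in time lies in
  \<open>A i\<close>. Counts alone then decide whether the ordered configuration is in the
  box.\<close>

definition separated :: "nat \<Rightarrow> (nat \<Rightarrow> (real \<times> real) set) \<Rightarrow> bool" where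
  "separated n A \<longleftrightarrow> (\<forall>i\<in>{1..n}. \<forall>j\<in>{1..n}. i < j \<longrightarrow> (\<forall>u\<in>A i. \<forall>v\<in>A j. fst u < fst v))"

text \<open>The times between two consecutive separators, closed on the left. The first strip
  extends to minus infinity, since \<open>q 0\<close> is not a separator.\<close>

definition strip :: "(nat \<Rightarrow> real) \<Rightarrow> nat \<Rightarrow> (real \<times> real) set" where
  "strip q j = {u. (2 \<le> j \<longrightarrow> q (j - 1) \<le> fst u) \<and> fst u < q j}"

text \<open>Rational values keep the family countable, and functions extensional outside the index
  range make it a subset of a finite product. Weak monotonicity is enough because the strips are
  half-open.\<close>

definition separators :: "nat \<Rightarrow> (nat \<Rightarrow> real) set" where
  "separators n = {q \<in> \<Pi>\<^sub>E i\<in>{1..n}. \<rat>. \<forall>i\<in>{1..n}. \<forall>j\<in>{1..n}. i \<le> j \<longrightarrow> q i \<le> q j}"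

lemma countable_separators: "countable (separators n)"
  by (rule countable_subset[of _ "\<Pi>\<^sub>E i\<in>{1..n}. \<rat>"]) (auto simp: separators_def intro!: countable_PiE countable_rat)

lemma separated_strip: "q \<in> separators n \<Longrightarrow> separated n (strip q)"
  unfolding separated_def
proof (intro ballI impI)
  fix i j u v assume q: "q \<in> separators n" and ij: "i \<in> {1..n}" "j \<in> {1..n}" "i < j" and u: "u \<in> strip q i" and v: "v \<in> strip q j"
  have "fst u < q i" using u by (simp add: strip_def)
  also have "q i \<le> q (j - 1)"
  proof -
    have "j - 1 \<in> {1..n}" "i \<le> j - 1" using ij by auto
    then show ?thesis using q ij(1) unfolding separators_def by blast
  qed
  also have "\<dots> \<le> fst v" using v ij by (simp add: strip_def)
  finally show "fst u < fst v" .
qed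

lemma ex_separator:
  assumes p: "p \<in> increasing_points n"
  shows "\<exists>q\<in>separators n. \<forall>i\<in>{1..n}. p i \<in> strip q i"
proof -
  have "\<exists>r\<in>\<rat>. fst (p i) < r \<and> (i < n \<longrightarrow> r < fst (p (Suc i)))" if "i \<in> {1..n}" for i
  proof (cases "i < n")
    case True
    then have "fst (p i) < fst (p (Suc i))" using p that by (auto simp: increasing_points_def)
    then show ?thesis using Rats_dense_in_real by blast
  next
    case False
    obtain r where "r \<in> \<rat>" "fst (p i) < r" "r < fst (p i) + 1" using Rats_dense_in_real[of "fst (p i)" "fst (p i) + 1"] by auto
    then show ?thesis using False by auto
  qed
  then obtain r where r: "\<And>i. i \<in> {1..n} \<Longrightarrow> r i \<in> \<rat> \<and> fst (p i) < r i \<and> (i < n \<longrightarrow> r i < fst (p (Suc i)))" by metis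
  define q where "q = restrict r {1..n}"
  have le: "r i \<le> r j" if "i \<in> {1..n}" "j \<in> {1..n}" "i \<le> j" for i j
  proof (cases "i = j")
    case False
    then have "i < n" "Suc i \<le> j" using that by auto
    then have "r i < fst (p (Suc i))" using r[OF that(1)] by simp
    also have "\<dots> \<le> fst (p j)"
      using p that \<open>Suc i \<le> j\<close> by (cases "Suc i = j") (auto simp: increasing_points_def less_imp_le)
    also have "\<dots> < r j" using r[OF that(2)] by simp
    finally show ?thesis by simp
  qed simp
  have "q \<in> separators n" unfolding separators_def q_def using r le by auto
  moreover have "p i \<in> strip q i" if i: "i \<in> {1..n}" for i
    using r[OF i] r[of "i - 1"] i by (auto simp: strip_def q_def less_imp_le)
  ultimately show ?thesis by blast
qed

abbreviation "points_space n \<equiv> (\<Pi>\<^sub>M i\<in>{1..n::nat}. (borel :: (real \<times> real) measure))"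

definition "separated_boxes n = {Pi\<^sub>E {1..n} A | A. (\<forall>i\<in>{1..n}. A i \<in> sets borel) \<and> separated n A}"

definition "increasing_space n = {p \<in> space (points_space n). p \<in> increasing_points n}"

lemma increasing_measurable [measurable]: "increasing_space n \<in> sets (points_space n)"
  unfolding increasing_space_def increasing_points_def mem_Collect_eq
proof (intro sets.sets_Collect_finite_All)
  have f: "fst \<in> borel_measurable (borel :: (real \<times> real) measure)"
    by (intro borel_measurable_continuous_onI continuous_intros)
  have m: "(\<lambda>p. fst (p i)) \<in> borel_measurable (points_space n)" if "i \<in> {1..n}" for i
    by (rule measurable_compose[OF measurable_component_singleton[OF that] f])
  fix i j assume "i \<in> {1..n}" "j \<in> {1..n}"
  then show "{p \<in> space (points_space n). i < j \<longrightarrow> fst (p i) < fst (p j)} \<in> sets (points_space n)"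
    using borel_measurable_less[OF m m, of i j] by (cases "i < j") simp_all
qed simp_all

lemma strip_measurable [measurable]: "strip q j \<in> sets borel"
proof -
  have "strip q j = {u \<in> space (borel \<Otimes>\<^sub>M borel). (2 \<le> j \<longrightarrow> q (j - 1) \<le> fst u) \<and> fst u < q j}"
    by (auto simp: strip_def space_pair_measure)
  also have "\<dots> \<in> sets (borel \<Otimes>\<^sub>M borel)" by measurable
  finally show ?thesis unfolding borel_prod .
qed

lemma separated_box_increasing:
  assumes "separated n A" "p \<in> Pi\<^sub>E {1..n} A"
  shows "p \<in> increasing_points n"
  unfolding increasing_points_def
proof (intro CollectI ballI impI)
  fix i j assume ij: "i \<in> {1..n}" "j \<in> {1..n}" "i < j"
  have "p i \<in> A i" "p j \<in> A j" using assms(2) ij by (auto simp: PiE_iff)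
  then show "fst (p i) < fst (p j)" using assms(1) ij unfolding separated_def by blast
qed

lemma separated_boxes_subset: "separated_boxes n \<subseteq> Pow (increasing_space n)"
proof (intro subsetI PowI)
  fix b p assume "b \<in> separated_boxes n" "p \<in> b"
  then obtain A where A: "separated n A" "p \<in> Pi\<^sub>E {1..n} A" by (auto simp: separated_boxes_def)
  then show "p \<in> increasing_space n"
    using separated_box_increasing[OF A] by (auto simp: increasing_space_def space_PiM PiE_iff)
qed

text \<open>An increasing configuration can be separated by rational times. A cylinder restricted to
  increasing configurations is therefore a countable union of separated boxes, one for each
  separator, and the cylinders generate the product sigma-algebra.\<close>

lemma sets_increasing_space: "sets (restrict_space (points_space n) (increasing_space n)) = sigma_sets (increasing_space n) (separated_boxes n)"
proof (rule antisym)
  let ?O = "increasing_space n"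
  have sub: "?O \<subseteq> (\<Pi>\<^sub>E i\<in>{1..n}. UNIV)" by (auto simp: increasing_space_def space_PiM)
  let ?G = "{{f \<in> \<Pi>\<^sub>E i\<in>{1..n}. space (borel :: (real\<times>real) measure). f i \<in> A} | i A. i \<in> {1..n} \<and> A \<in> sets (borel :: (real\<times>real) measure)}"
  have sP: "sets (points_space n) = sigma_sets (\<Pi>\<^sub>E i\<in>{1..n}. space (borel :: (real\<times>real) measure)) ?G"
    by (rule sets_PiM_single)
  have "sets (restrict_space (points_space n) ?O) = (\<inter>) ?O ` sigma_sets (\<Pi>\<^sub>E i\<in>{1..n}. space (borel :: (real\<times>real) measure)) ?G"
    unfolding sets_restrict_space sP ..
  also have "\<dots> = sigma_sets ?O ((\<inter>) ?O ` ?G)"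
  proof (rule sigma_sets_Int)
    show "?O \<in> sigma_sets (\<Pi>\<^sub>E i\<in>{1..n}. space (borel :: (real\<times>real) measure)) ?G"
      using increasing_measurable[of n] unfolding sP .
    show "?O \<subseteq> (\<Pi>\<^sub>E i\<in>{1..n}. space (borel :: (real\<times>real) measure))" using sub by simp
  qed
  also have "\<dots> \<subseteq> sigma_sets ?O (separated_boxes n)"
  proof (rule sigma_sets_mono)
    show "(\<inter>) ?O ` ?G \<subseteq> sigma_sets ?O (separated_boxes n)"
    proof
      fix S assume "S \<in> (\<inter>) ?O ` ?G"
      then obtain i A where i: "i \<in> {1..n}" and A: "A \<in> sets borel" and S: "S = {f \<in> ?O. f i \<in> A}"
        using sub by auto
      have eq: "S = (\<Union>q\<in>separators n. Pi\<^sub>E {1..n} (\<lambda>j. if j = i then A \<inter> strip q j else strip q j))"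
      proof (intro set_eqI iffI)
        fix p assume "p \<in> S"
        then have p: "p \<in> ?O" "p i \<in> A" by (auto simp: S)
        then obtain q where "q \<in> separators n" "\<forall>j\<in>{1..n}. p j \<in> strip q j"
          using ex_separator[of p n] by (auto simp: increasing_space_def)
        then show "p \<in> (\<Union>q\<in>separators n. Pi\<^sub>E {1..n} (\<lambda>j. if j = i then A \<inter> strip q j else strip q j))"
          using p sub by (auto simp: PiE_iff)
      next
        fix p assume "p \<in> (\<Union>q\<in>separators n. Pi\<^sub>E {1..n} (\<lambda>j. if j = i then A \<inter> strip q j else strip q j))"
        then obtain q where q: "q \<in> separators n" and p: "p \<in> Pi\<^sub>E {1..n} (\<lambda>j. if j = i then A \<inter> strip q j else strip q j)" by auto
        have pj: "p j \<in> strip q j" if "j \<in> {1..n}" for j using p that by (auto simp: PiE_iff split: if_splits)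
        have "p i \<in> A" using PiE_mem[OF p i] by simp
        moreover have "p \<in> increasing_points n"
          using p pj by (intro separated_box_increasing[OF separated_strip[OF q]]) (auto simp: PiE_iff)
        moreover have "p \<in> space (points_space n)" using p by (auto simp: space_PiM PiE_iff)
        ultimately show "p \<in> S" by (simp add: S increasing_space_def)
      qed
      show "S \<in> sigma_sets ?O (separated_boxes n)"
        unfolding eq
      proof (rule sigma_sets_UNION)
        show "countable ((\<lambda>q. Pi\<^sub>E {1..n} (\<lambda>j. if j = i then A \<inter> strip q j else strip q j)) ` separators n)"
          by (intro countable_image countable_separators)
        fix b assume "b \<in> (\<lambda>q. Pi\<^sub>E {1..n} (\<lambda>j. if j = i then A \<inter> strip q j else strip q j)) ` separators n"
        then obtain q where q: "q \<in> separators n" and b: "b = Pi\<^sub>E {1..n} (\<lambda>j. if j = i then A \<inter> strip q j else strip q j)" by auto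
        have "separated n (\<lambda>j. if j = i then A \<inter> strip q j else strip q j)"
          using separated_strip[OF q] unfolding separated_def by (metis IntE)
        then have "b \<in> separated_boxes n"
          unfolding separated_boxes_def b using A by auto
        then show "b \<in> sigma_sets ?O (separated_boxes n)" by (rule sigma_sets.Basic)
      qed
    qed
  qed
  finally show "sets (restrict_space (points_space n) ?O) \<subseteq> sigma_sets ?O (separated_boxes n)" .
  have "separated_boxes n \<subseteq> sets (restrict_space (points_space n) ?O)"
  proof
    fix S assume S: "S \<in> separated_boxes n"
    then have "S \<in> sets (points_space n)" by (auto simp: separated_boxes_def intro!: sets_PiM_I_finite)
    moreover have "S \<subseteq> ?O" using S separated_boxes_subset by auto
    ultimately show "S \<in> sets (restrict_space (points_space n) ?O)" by (auto simp: sets_restrict_space)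
  qed
  then show "sigma_sets ?O (separated_boxes n) \<subseteq> sets (restrict_space (points_space n) ?O)"
  proof -
    have sp: "space (restrict_space (points_space n) ?O) = ?O"
      by (auto simp: space_restrict_space increasing_space_def)
    assume "separated_boxes n \<subseteq> sets (restrict_space (points_space n) ?O)"
    from sets.sigma_sets_subset[OF this] show ?thesis unfolding sp .
  qed
qed

text \<open>Uniqueness of measures on the intersection-stable family of separated boxes. The strips
  of all rational separators supply the countable cover of the increasing configurations. The form
  of the hypothesis is dictated by what counts of a point process can provide.\<close>

lemma measure_eqI_increasing:
  assumes s: "sets m1 = sets (points_space n)" "sets m2 = sets (points_space n)"
    and eq: "\<And>A. (\<And>i. i \<in> {1..n} \<Longrightarrow> A i \<in> sets borel) \<Longrightarrow> separated n A \<Longrightarrow> emeasure m1 (Pi\<^sub>E {1..n} A) = emeasure m2 (Pi\<^sub>E {1..n} A)"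
    and ae: "AE p in m1. p \<in> increasing_space n" "AE p in m2. p \<in> increasing_space n"
    and fin: "finite_measure m1"
  shows "m1 = m2"
proof (rule measure_eqI_restrict_generator[where E="separated_boxes n" and \<Omega>="increasing_space n" and A="(\<lambda>q. Pi\<^sub>E {1..n} (strip q)) ` separators n"])
  show "Int_stable (separated_boxes n)"
  proof (rule Int_stableI)
    fix a b assume "a \<in> separated_boxes n" "b \<in> separated_boxes n"
    then obtain A A' where a: "a = Pi\<^sub>E {1..n} A" "b = Pi\<^sub>E {1..n} A'" "\<forall>i\<in>{1..n}. A i \<in> sets borel" "\<forall>i\<in>{1..n}. A' i \<in> sets borel" "separated n A" "separated n A'"
      by (auto simp: separated_boxes_def)
    have "a \<inter> b = Pi\<^sub>E {1..n} (\<lambda>i. A i \<inter> A' i)" using a by (simp add: PiE_Int)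
    moreover have "separated n (\<lambda>i. A i \<inter> A' i)" using a(5) by (auto simp: separated_def)
    moreover have "\<forall>i\<in>{1..n}. A i \<inter> A' i \<in> sets borel" using a(3,4) by blast
    ultimately show "a \<inter> b \<in> separated_boxes n" unfolding separated_boxes_def
      by (intro CollectI exI[of _ "\<lambda>i. A i \<inter> A' i"] conjI)
  qed
  show "separated_boxes n \<subseteq> Pow (increasing_space n)" by (rule separated_boxes_subset)
  show "emeasure m1 S = emeasure m2 S" if "S \<in> separated_boxes n" for S
    using that eq by (auto simp: separated_boxes_def)
  show "sets m1 = sets m2" using s by simp
  show "increasing_space n \<in> sets m1" unfolding s(1) by (rule increasing_measurable)
  have r: "sets (restrict_space m (increasing_space n)) = sigma_sets (increasing_space n) (separated_boxes n)" if "sets m = sets (points_space n)" for m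
    unfolding sets_increasing_space[symmetric] sets_restrict_space that ..
  show "sets (restrict_space m1 (increasing_space n)) = sigma_sets (increasing_space n) (separated_boxes n)"
    "sets (restrict_space m2 (increasing_space n)) = sigma_sets (increasing_space n) (separated_boxes n)"
    by (intro r s)+
  show "AE x in m1. x \<in> increasing_space n" "AE x in m2. x \<in> increasing_space n" by (fact ae)+
  show "countable ((\<lambda>q. Pi\<^sub>E {1..n} (strip q)) ` separators n)" by (intro countable_image countable_separators)
  have "restrict (\<lambda>_. 0) {1..n} \<in> separators n" by (auto simp: separators_def)
  then show "(\<lambda>q. Pi\<^sub>E {1..n} (strip q)) ` separators n \<noteq> {}" by auto
  show box: "(\<lambda>q. Pi\<^sub>E {1..n} (strip q)) ` separators n \<subseteq> separated_boxes n"
  proof (rule image_subsetI)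
    fix q assume q: "q \<in> separators n"
    show "Pi\<^sub>E {1..n} (strip q) \<in> separated_boxes n" unfolding separated_boxes_def
      by (intro CollectI exI[of _ "strip q"] conjI refl ballI strip_measurable separated_strip[OF q])
  qed
  show "\<Union> ((\<lambda>q. Pi\<^sub>E {1..n} (strip q)) ` separators n) = increasing_space n"
  proof (rule antisym)
    show "\<Union> ((\<lambda>q. Pi\<^sub>E {1..n} (strip q)) ` separators n) \<subseteq> increasing_space n"
      using box separated_boxes_subset by blast
    show "increasing_space n \<subseteq> \<Union> ((\<lambda>q. Pi\<^sub>E {1..n} (strip q)) ` separators n)"
    proof
      fix p assume p: "p \<in> increasing_space n"
      then obtain q where "q \<in> separators n" "\<forall>i\<in>{1..n}. p i \<in> strip q i"
        using ex_separator[of p n] by (auto simp: increasing_space_def)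
      then show "p \<in> \<Union> ((\<lambda>q. Pi\<^sub>E {1..n} (strip q)) ` separators n)"
        using p by (auto simp: increasing_space_def space_PiM PiE_iff)
    qed
  qed
  show "emeasure m1 a \<noteq> \<infinity>" for a using finite_measure.emeasure_finite[OF fin] by simp
qed

section \<open>The law of the ordered points of one round\<close>

lemma round_spaceD:
  assumes "round_data N t z Y E \<in> measurable M round_space"
  shows "N \<in> measurable M (count_space UNIV)" "E \<in> borel_measurable M"
    "(\<lambda>\<omega>. if i \<in> {1..N \<omega>} then (t i \<omega>, z i \<omega>, Y i \<omega>) else 0) \<in> borel_measurable M"
proof -
  note d = assms[unfolded round_space_def]
  show "N \<in> measurable M (count_space UNIV)"
    using measurable_compose[OF d measurable_fst] by (simp add: round_data_def)
  note d2 = measurable_compose[OF d measurable_snd]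
  show "E \<in> borel_measurable M"
    using measurable_compose[OF d2 measurable_snd] by (simp add: round_data_def)
  show "(\<lambda>\<omega>. if i \<in> {1..N \<omega>} then (t i \<omega>, z i \<omega>, Y i \<omega>) else 0) \<in> borel_measurable M"
    using measurable_compose[OF measurable_compose[OF d2 measurable_fst] measurable_component_singleton[of i UNIV "\<lambda>_. borel"]]
    by (simp add: round_data_def)
qed


text \<open>Measurability is given for the record of a round only, in which entries beyond
  \<open>N\<close> are replaced by 0. Points and skeleton are therefore formed from the masked
  values, which agree with the true ones on \<open>N \<omega> = n\<close> (\<open>points_eq\<close>,
  \<open>skel_eq\<close>).\<close>

definition masked :: "('a \<Rightarrow> nat) \<Rightarrow> (nat \<Rightarrow> 'a \<Rightarrow> real) \<Rightarrow> (nat \<Rightarrow> 'a \<Rightarrow> real) \<Rightarrow> (nat \<Rightarrow> 'a \<Rightarrow> real) \<Rightarrow> nat \<Rightarrow> 'a \<Rightarrow> real \<times> real \<times> real" where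
  "masked N t z Y i \<omega> = (if i \<in> {1..N \<omega>} then (t i \<omega>, z i \<omega>, Y i \<omega>) else 0)"

definition points :: "('a \<Rightarrow> nat) \<Rightarrow> (nat \<Rightarrow> 'a \<Rightarrow> real) \<Rightarrow> (nat \<Rightarrow> 'a \<Rightarrow> real) \<Rightarrow> (nat \<Rightarrow> 'a \<Rightarrow> real) \<Rightarrow> nat \<Rightarrow> 'a \<Rightarrow> nat \<Rightarrow> real \<times> real" where
  "points N t z Y n \<omega> = (\<lambda>i\<in>{1..n}. (fst (masked N t z Y i \<omega>), fst (snd (masked N t z Y i \<omega>))))"

definition skel :: "('a \<Rightarrow> nat) \<Rightarrow> (nat \<Rightarrow> 'a \<Rightarrow> real) \<Rightarrow> (nat \<Rightarrow> 'a \<Rightarrow> real) \<Rightarrow> (nat \<Rightarrow> 'a \<Rightarrow> real) \<Rightarrow> nat \<Rightarrow> 'a \<Rightarrow> nat \<Rightarrow> real" where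
  "skel N t z Y n \<omega> = (\<lambda>i\<in>{1..n}. snd (snd (masked N t z Y i \<omega>)))"

lemma points_eq: "N \<omega> = n \<Longrightarrow> points N t z Y n \<omega> = (\<lambda>i\<in>{1..n}. (t i \<omega>, z i \<omega>))"
  and skel_eq: "N \<omega> = n \<Longrightarrow> skel N t z Y n \<omega> = (\<lambda>i\<in>{1..n}. Y i \<omega>)"
  by (auto simp: points_def skel_def masked_def restrict_def fun_eq_iff)

lemma masked_measurable:
  assumes "round_data N t z Y E \<in> measurable M round_space"
  shows "masked N t z Y i \<in> borel_measurable M"
  unfolding masked_def[abs_def] by (rule round_spaceD(3)[OF assms])

lemma points_measurable:
  assumes "round_data N t z Y E \<in> measurable M round_space"
  shows "points N t z Y n \<in> measurable M (points_space n)" "skel N t z Y n \<in> measurable M (\<Pi>\<^sub>M i\<in>{1..n}. borel)"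
proof -
  have [measurable]: "masked N t z Y i \<in> measurable M (borel \<Otimes>\<^sub>M (borel \<Otimes>\<^sub>M borel))" for i
    using masked_measurable[OF assms, of i] by (simp add: borel_prod)
  have p: "(\<lambda>\<omega>. (fst (masked N t z Y i \<omega>), fst (snd (masked N t z Y i \<omega>)))) \<in> borel_measurable M" for i
    unfolding borel_prod[symmetric] by measurable
  show "points N t z Y n \<in> measurable M (points_space n)" "skel N t z Y n \<in> measurable M (\<Pi>\<^sub>M i\<in>{1..n}. borel)"
    unfolding points_def[abs_def] skel_def[abs_def] by (intro measurable_restrict p, measurable)
qed

text \<open>The Poisson density for exactly \<open>n\<close> points listed in order of time; the
  ordering removes the factor \<open>1 / fact n\<close>. The time interval is open at both ends, a
  change by a null set, because the bridges need strictly positive durations.\<close>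

definition points_density :: "real \<Rightarrow> real \<Rightarrow> nat \<Rightarrow> (nat \<Rightarrow> real \<times> real) \<Rightarrow> ennreal" where
  "points_density T K n p = ennreal (exp (- (T * K))) * indicator (increasing_points n) p * (\<Prod>i\<in>{1..n}. indicator ({0<..<T} \<times> {0..K}) (p i))"

lemma points_density_measurable [measurable]: "points_density T K n \<in> borel_measurable (points_space n)"
proof -
  have "(\<lambda>p. indicator (increasing_points n) p :: ennreal) \<in> borel_measurable (points_space n)"
    using borel_measurable_indicator[OF increasing_measurable[of n]]
    by (rule measurable_cong[THEN iffD1, rotated]) (auto simp: increasing_space_def indicator_def)
  moreover have "{0<..<T} \<times> {0..K} \<in> sets (borel :: (real \<times> real) measure)"
    by (auto simp: borel_prod[symmetric] intro!: pair_measureI)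
  then have "(\<lambda>p. indicator ({0<..<T} \<times> {0..K}) (p i) :: ennreal) \<in> borel_measurable (points_space n)" if "i \<in> {1..n}" for i
    using that by measurable
  ultimately show ?thesis unfolding points_density_def[abs_def]
    by (intro borel_measurable_times_ennreal borel_measurable_prod_ennreal borel_measurable_const)
qed

lemma emeasure_points_strip:
  fixes T K :: real
  assumes "A \<in> sets (borel :: (real \<times> real) measure)"
  shows "emeasure lborel (A \<inter> {0<..<T} \<times> {0..K}) = emeasure lborel (A \<inter> {0..T} \<times> {0..K})"
proof -
  have n: "{a} \<times> (UNIV :: real set) \<in> null_sets lborel" for a :: real
    unfolding lborel_prod[symmetric] by (rule lborel.times_in_null_sets1) auto
  have S: "{0<..<T} \<times> {0..K} \<in> sets (borel :: (real \<times> real) measure)" "{0..T} \<times> {0..K} \<in> sets (borel :: (real \<times> real) measure)"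
    by (auto simp: borel_prod[symmetric] intro!: pair_measureI)
  show ?thesis
  proof (rule emeasure_eq_AE)
    show "AE u in lborel. u \<in> A \<inter> {0<..<T} \<times> {0..K} \<longleftrightarrow> u \<in> A \<inter> {0..T} \<times> {0..K}"
      using AE_not_in[OF n[of 0]] AE_not_in[OF n[of T]] by eventually_elim auto
  qed (use assms S in auto)
qed

text \<open>On a separated box, the event that there are \<open>n\<close> points with the ordered
  configuration in the box is almost surely the event that each \<open>A j\<close> contains one
  point and the rest of the rectangle none. Independence of the counts turns its probability into
  the product of the areas times \<open>exp (- (T * K))\<close>. Then
  \<open>measure_eqI_increasing\<close> applies.\<close>

lemma poisson_points_law:
  assumes M: "prob_space M" and r: "round_data N t z Y E \<in> measurable M round_space"
    and pp: "poisson_point_process M (restrict_space lborel ({0..T} \<times> {0..K})) (\<lambda>\<omega>. (\<lambda>i. (t i \<omega>, z i \<omega>)) ` {1..N \<omega>})"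
    and mono: "AE \<omega> in M. strict_mono_on {1..N \<omega>} (\<lambda>i. t i \<omega>)"
    and TK: "0 \<le> T" "0 \<le> K"
  shows "distr (density M (indicator {\<omega> \<in> space M. N \<omega> = n})) (points_space n) (points N t z Y n)
       = density (\<Pi>\<^sub>M i\<in>{1..n}. lborel) (points_density T K n)"
    (is "?m1 = ?m2")
proof -
  interpret prob_space M by fact
  interpret L: product_sigma_finite "\<lambda>_. lborel :: (real \<times> real) measure" by standard
  note [measurable] = round_spaceD(1)[OF r] points_measurable(1)[OF r, of n]
  define S where "S = {0..T} \<times> {0..K}"
  define \<eta> where "\<eta> \<omega> = (\<lambda>i. (t i \<omega>, z i \<omega>)) ` {1..N \<omega>}" for \<omega>
  let ?\<mu> = "restrict_space lborel S"
  have Sm [measurable]: "S \<in> sets borel"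
    by (auto simp: S_def borel_prod[symmetric] intro!: pair_measureI)
  have Nn [measurable]: "{\<omega> \<in> space M. N \<omega> = n} \<in> sets M" by measurable
  have sp: "sets (\<Pi>\<^sub>M i\<in>{1..n}. lborel) = sets (points_space n)" by (intro sets_PiM_cong) auto
  have spc: "space ?\<mu> = S" by (simp add: space_restrict_space)
  have \<mu>sets: "A \<in> sets ?\<mu> \<longleftrightarrow> A \<in> sets borel \<and> A \<subseteq> S" for A
    using sets_restrict_space_iff[of S lborel A] by auto
  have \<mu>m: "measure ?\<mu> A = measure lborel A" if "A \<subseteq> S" for A
    using that by (intro measure_restrict_space) auto
  have emS: "emeasure lborel S = ennreal (T * K)"
    unfolding S_def lborel_prod[symmetric] using TK by (simp add: lborel.emeasure_pair_measure_Times ennreal_mult)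
  have finS: "emeasure lborel A \<noteq> \<infinity>" if "A \<subseteq> S" for A
    using emeasure_mono[OF that, of lborel] emS by (auto simp: top_unique)
  have sub: "\<eta> \<omega> \<subseteq> S" if "\<omega> \<in> space M" for \<omega>
    using pp that unfolding poisson_point_process_def by (auto simp: \<eta>_def S_def space_restrict_space)
  have fin\<eta>: "finite (\<eta> \<omega>)" for \<omega> by (simp add: \<eta>_def)
  show ?thesis
  proof (rule measure_eqI_increasing)
    show "sets ?m1 = sets (points_space n)" "sets ?m2 = sets (points_space n)" using sp by auto
    have "AE \<omega> in M. N \<omega> = n \<longrightarrow> points N t z Y n \<omega> \<in> increasing_space n"
      using mono AE_space
    proof eventually_elim
      case (elim \<omega>)
      show ?case
      proof
        assume n: "N \<omega> = n"
        have "points N t z Y n \<omega> \<in> space (points_space n)" using measurable_space[OF points_measurable(1)[OF r] elim(2)] .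
        then show "points N t z Y n \<omega> \<in> increasing_space n"
          using elim(1) n by (auto simp: increasing_space_def increasing_points_def points_eq strict_mono_on_def)
      qed
    qed
    then have "AE \<omega> in density M (indicator {\<omega> \<in> space M. N \<omega> = n}). points N t z Y n \<omega> \<in> increasing_space n"
      by (subst AE_density) (auto simp: indicator_def elim!: eventually_mono)
    moreover have "{p \<in> space (points_space n). p \<in> increasing_space n} \<in> sets (points_space n)"
    proof -
      have "{p \<in> space (points_space n). p \<in> increasing_space n} = increasing_space n"
        by (auto simp: increasing_space_def)
      then show ?thesis using increasing_measurable[of n] by (simp only:)
    qed
    moreover have "points N t z Y n \<in> measurable (density M (indicator {\<omega> \<in> space M. N \<omega> = n})) (points_space n)"
      using points_measurable(1)[OF r] by (simp only: measurable_cong_sets[OF sets_density refl])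
    ultimately show "AE p in ?m1. p \<in> increasing_space n"
      by (subst AE_distr_iff) assumption+
    show "AE p in ?m2. p \<in> increasing_space n"
    proof (subst AE_density)
      show "points_density T K n \<in> borel_measurable (\<Pi>\<^sub>M i\<in>{1..n}. lborel)"
        using points_density_measurable[of T K n] by (simp only: measurable_cong_sets[OF sp refl])
      show "AE p in \<Pi>\<^sub>M i\<in>{1..n}. lborel. 0 < points_density T K n p \<longrightarrow> p \<in> increasing_space n"
        by (rule AE_I2) (auto simp: points_density_def increasing_space_def space_PiM indicator_def split: if_splits)
    qed
    show "finite_measure ?m1"
    proof (rule finite_measureI)
      have "emeasure ?m1 (space ?m1) = emeasure (density M (indicator {\<omega> \<in> space M. N \<omega> = n})) (space M)"
      proof -
        have "points N t z Y n \<in> measurable (density M (indicator {\<omega> \<in> space M. N \<omega> = n})) (points_space n)"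
          using points_measurable(1)[OF r] by (simp only: measurable_cong_sets[OF sets_density refl])
        then have "emeasure ?m1 (space ?m1) = emeasure (density M (indicator {\<omega> \<in> space M. N \<omega> = n})) (points N t z Y n -` space (points_space n) \<inter> space (density M (indicator {\<omega> \<in> space M. N \<omega> = n})))"
          by (simp only: emeasure_distr[OF _ sets.top] space_distr)
        also have "points N t z Y n -` space (points_space n) \<inter> space (density M (indicator {\<omega> \<in> space M. N \<omega> = n})) = space M"
          using measurable_space[OF points_measurable(1)[OF r, of n]] by (auto simp del: One_nat_def)
        finally show ?thesis .
      qed
      also have "\<dots> = (\<integral>\<^sup>+\<omega>. indicator {\<omega> \<in> space M. N \<omega> = n} \<omega> * indicator (space M) \<omega> \<partial>M)"
        by (rule emeasure_density) measurable
      also have "\<dots> \<le> (\<integral>\<^sup>+\<omega>. 1 \<partial>M)"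
        by (intro nn_integral_mono) (auto simp: indicator_def)
      finally show "emeasure ?m1 (space ?m1) \<noteq> \<infinity>" by (auto simp: emeasure_space_1 top_unique)
    qed
    fix A assume A: "\<And>i. i \<in> {1..n} \<Longrightarrow> A i \<in> sets (borel :: (real \<times> real) measure)" and sep: "separated n A"
    \<comment> \<open>Slot 0 is the part of the rectangle outside all boxes, which has to stay empty
      of points. Slots beyond \<open>n\<close> are the empty set, as the Poisson hypothesis takes
      sequences of sets indexed by all naturals.\<close>
    define A' where "A' j = (if j = 0 then S - (\<Union>i\<in>{1..n}. A i) else if j \<in> {1..n} then A j \<inter> S else {})" for j
    have A'm: "A' j \<in> sets borel" "A' j \<subseteq> S" for j
      using A by (auto simp: A'_def intro!: sets.finite_UN)
    have disj0: "A i \<inter> A j = {}" if "i \<in> {1..n}" "j \<in> {1..n}" "i < j" for i j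
      using sep that unfolding separated_def by fastforce
    have disjA: "A i \<inter> A j = {}" if "i \<in> {1..n}" "j \<in> {1..n}" "i \<noteq> j" for i j
      using disj0[of i j] disj0[of j i] that by (cases "i < j") auto
    have disj: "disjoint_family A'"
      unfolding disjoint_family_on_def
    proof (intro ballI impI)
      fix i j :: nat assume "i \<noteq> j"
      then show "A' i \<inter> A' j = {}"
        using disjA[of i j] by (cases "i \<in> {1..n} \<and> j \<in> {1..n}") (auto simp: A'_def)
    qed
    define k where "k j = (if j = 0 then 0 else 1 :: nat)" for j :: nat
    have prob_k: "prob {\<omega> \<in> space M. card (\<eta> \<omega> \<inter> A' j) = k j} = measure lborel (A' j) ^ k j * exp (- measure lborel (A' j))" for j
      using pp A'm[of j] \<mu>m[OF A'm(2)[of j]] unfolding poisson_point_process_def \<eta>_def[symmetric] S_def[symmetric]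
      by (auto simp: \<mu>sets k_def)
    have iv: "indep_vars (\<lambda>_. count_space UNIV) (\<lambda>j \<omega>. card (\<eta> \<omega> \<inter> A' j)) UNIV"
      using pp A'm disj unfolding poisson_point_process_def \<eta>_def[symmetric] S_def[symmetric]
      by (auto simp: \<mu>sets image_subset_iff)
    have "prob (\<Inter>j\<in>{0..n}. (\<lambda>\<omega>. card (\<eta> \<omega> \<inter> A' j)) -` {k j} \<inter> space M) = (\<Prod>j\<in>{0..n}. prob ((\<lambda>\<omega>. card (\<eta> \<omega> \<inter> A' j)) -` {k j} \<inter> space M))"
      by (rule indep_varsD[OF iv]) auto
    also have "\<dots> = (\<Prod>j\<in>{0..n}. measure lborel (A' j) ^ k j * exp (- measure lborel (A' j)))"
      by (intro prod.cong refl) (auto simp: prob_k[symmetric] intro!: arg_cong[where f=prob])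
    also have "\<dots> = (\<Prod>j\<in>{0..n}. measure lborel (A' j) ^ k j) * exp (- (\<Sum>j\<in>{0..n}. measure lborel (A' j)))"
      by (simp add: prod.distrib exp_sum sum_negf[symmetric])
    also have "(\<Prod>j\<in>{0..n}. measure lborel (A' j) ^ k j) = (\<Prod>j\<in>{1..n}. measure lborel (A j \<inter> S))"
      by (subst prod.atLeast_Suc_atMost) (auto simp: k_def A'_def intro!: prod.cong)
    also have "(\<Sum>j\<in>{0..n}. measure lborel (A' j)) = measure lborel (\<Union>j\<in>{0..n}. A' j)"
      by (rule measure_finite_Union[symmetric])
        (use A'm disj finS in \<open>auto intro: disjoint_family_on_mono[of _ UNIV]\<close>)
    also have "(\<Union>j\<in>{0..n}. A' j) = S"
    proof (intro antisym subsetI)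
      fix u assume u: "u \<in> S"
      show "u \<in> (\<Union>j\<in>{0..n}. A' j)"
      proof (cases "u \<in> (\<Union>i\<in>{1..n}. A i)")
        case True
        then obtain i where "i \<in> {1..n}" "u \<in> A i" by auto
        then show ?thesis using u by (auto simp: A'_def intro!: bexI[of _ i])
      next
        case False
        then show ?thesis using u by (auto simp: A'_def intro!: bexI[of _ 0])
      qed
    qed (use A'm(2) in auto)
    also have "measure lborel S = T * K" using emS TK by (simp add: measure_def)
    finally have prob_all: "prob (\<Inter>j\<in>{0..n}. (\<lambda>\<omega>. card (\<eta> \<omega> \<inter> A' j)) -` {k j} \<inter> space M) = (\<Prod>j\<in>{1..n}. measure lborel (A j \<inter> S)) * exp (- (T * K))" .
    have Abox: "Pi\<^sub>E {1..n} A \<in> sets (points_space n)" using A by (intro sets_PiM_I_finite) auto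
    have "emeasure ?m1 (Pi\<^sub>E {1..n} A) = emeasure (density M (indicator {\<omega> \<in> space M. N \<omega> = n})) (points N t z Y n -` Pi\<^sub>E {1..n} A \<inter> space M)"
    proof -
      have "points N t z Y n \<in> measurable (density M (indicator {\<omega> \<in> space M. N \<omega> = n})) (points_space n)"
        using points_measurable(1)[OF r] by (simp only: measurable_cong_sets[OF sets_density refl])
      from emeasure_distr[OF this Abox] show ?thesis by (simp only: space_density)
    qed
    also have "\<dots> = emeasure M {\<omega> \<in> space M. N \<omega> = n \<and> points N t z Y n \<omega> \<in> Pi\<^sub>E {1..n} A}"
    proof -
      have m: "points N t z Y n -` Pi\<^sub>E {1..n} A \<inter> space M \<in> sets M" using Abox by (rule measurable_sets[OF points_measurable(1)[OF r]])
      have "emeasure (density M (indicator {\<omega> \<in> space M. N \<omega> = n})) (points N t z Y n -` Pi\<^sub>E {1..n} A \<inter> space M)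
        = (\<integral>\<^sup>+\<omega>. indicator {\<omega> \<in> space M. N \<omega> = n} \<omega> * indicator (points N t z Y n -` Pi\<^sub>E {1..n} A \<inter> space M) \<omega> \<partial>M)"
        by (rule emeasure_density[OF _ m]) measurable
      also have "\<dots> = (\<integral>\<^sup>+\<omega>. indicator ({\<omega> \<in> space M. N \<omega> = n} \<inter> (points N t z Y n -` Pi\<^sub>E {1..n} A \<inter> space M)) \<omega> \<partial>M)"
        by (simp only: indicator_inter_arith[where A="{\<omega> \<in> space M. N \<omega> = n}"])
      also have "\<dots> = emeasure M ({\<omega> \<in> space M. N \<omega> = n} \<inter> (points N t z Y n -` Pi\<^sub>E {1..n} A \<inter> space M))"
        using m by (intro nn_integral_indicator) auto
      also have "{\<omega> \<in> space M. N \<omega> = n} \<inter> (points N t z Y n -` Pi\<^sub>E {1..n} A \<inter> space M) = {\<omega> \<in> space M. N \<omega> = n \<and> points N t z Y n \<omega> \<in> Pi\<^sub>E {1..n} A}" by auto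
      finally show ?thesis .
    qed
    also have "\<dots> = emeasure M (\<Inter>j\<in>{0..n}. (\<lambda>\<omega>. card (\<eta> \<omega> \<inter> A' j)) -` {k j} \<inter> space M)"
    proof (rule emeasure_eq_AE)
      show "{\<omega> \<in> space M. N \<omega> = n \<and> points N t z Y n \<omega> \<in> Pi\<^sub>E {1..n} A} \<in> sets M"
      proof -
        have "{\<omega> \<in> space M. N \<omega> = n \<and> points N t z Y n \<omega> \<in> Pi\<^sub>E {1..n} A} = {\<omega> \<in> space M. N \<omega> = n} \<inter> (points N t z Y n -` Pi\<^sub>E {1..n} A \<inter> space M)" by auto
        then show ?thesis using Nn measurable_sets[OF points_measurable(1)[OF r] Abox] by auto
      qed
      have cm: "(\<lambda>\<omega>. card (\<eta> \<omega> \<inter> A' j)) \<in> measurable M (count_space UNIV)" for j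
        using iv unfolding indep_vars_def by blast
      show "(\<Inter>j\<in>{0..n}. (\<lambda>\<omega>. card (\<eta> \<omega> \<inter> A' j)) -` {k j} \<inter> space M) \<in> sets M"
      proof (rule sets.finite_INT)
        show "(\<lambda>\<omega>. card (\<eta> \<omega> \<inter> A' j)) -` {k j} \<inter> space M \<in> sets M" for j
          by (rule measurable_sets[OF cm]) simp
      qed auto
      show "AE \<omega> in M. \<omega> \<in> {\<omega> \<in> space M. N \<omega> = n \<and> points N t z Y n \<omega> \<in> Pi\<^sub>E {1..n} A} \<longleftrightarrow> \<omega> \<in> (\<Inter>j\<in>{0..n}. (\<lambda>\<omega>. card (\<eta> \<omega> \<inter> A' j)) -` {k j} \<inter> space M)"
        using mono AE_space
      proof eventually_elim
        case (elim \<omega>)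
        define f where "f i = (t i \<omega>, z i \<omega>)" for i
        have f\<eta>: "\<eta> \<omega> = f ` {1..N \<omega>}" unfolding \<eta>_def f_def ..
        have inj: "inj_on f {1..N \<omega>}"
        proof (rule inj_onI)
          fix i j assume ij: "i \<in> {1..N \<omega>}" "j \<in> {1..N \<omega>}" "f i = f j"
          then have "t i \<omega> = t j \<omega>" unfolding f_def by blast
          then show "i = j" by (rule inj_onD[OF strict_mono_on_imp_inj_on[OF elim(1)] _ ij(1,2)])
        qed
        have fS: "f i \<in> S" if "i \<in> {1..N \<omega>}" for i
          using sub[OF elim(2)] imageI[OF that, of f] unfolding f\<eta> by blast
        have "(N \<omega> = n \<and> (\<forall>i\<in>{1..n}. f i \<in> A i)) \<longleftrightarrow> (\<forall>j\<in>{0..n}. card (\<eta> \<omega> \<inter> A' j) = k j)"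
        proof
          assume L: "N \<omega> = n \<and> (\<forall>i\<in>{1..n}. f i \<in> A i)"
          show "\<forall>j\<in>{0..n}. card (\<eta> \<omega> \<inter> A' j) = k j"
          proof
            fix j assume j: "j \<in> {0..n}"
            show "card (\<eta> \<omega> \<inter> A' j) = k j"
            proof (cases "j = 0")
              case True
              then have "\<eta> \<omega> \<inter> A' j = {}" using L by (auto simp: f\<eta> A'_def)
              then show ?thesis using True by (simp add: k_def)
            next
              case False
              then have jn: "j \<in> {1..n}" using j by auto
              have "\<eta> \<omega> \<inter> A' j = {f j}"
              proof (intro antisym subsetI)
                fix u assume "u \<in> \<eta> \<omega> \<inter> A' j"
                then obtain i where i: "i \<in> {1..n}" "u = f i" "f i \<in> A j" using L False jn by (auto simp: f\<eta> A'_def)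
                have "i = j" using disjA[OF i(1) jn] i(3) L i(1) by blast
                then show "u \<in> {f j}" using i by simp
              qed (use L jn fS False in \<open>auto simp: f\<eta> A'_def\<close>)
              then show ?thesis using False by (simp add: k_def)
            qed
          qed
        next
          assume R: "\<forall>j\<in>{0..n}. card (\<eta> \<omega> \<inter> A' j) = k j"
          have "card (\<eta> \<omega> \<inter> A' 0) = 0" using bspec[OF R, of 0] by (simp add: k_def)
          then have R0: "\<eta> \<omega> \<inter> A' 0 = {}" using fin\<eta>[of \<omega>] by simp
          have ex: "\<exists>j\<in>{1..n}. f i \<in> A j" if i: "i \<in> {1..N \<omega>}" for i
          proof (rule ccontr)
            assume "\<not> (\<exists>j\<in>{1..n}. f i \<in> A j)"
            then have "f i \<in> A' 0" unfolding A'_def using fS[OF i] by auto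
            moreover have "f i \<in> \<eta> \<omega>" unfolding f\<eta> using i by (rule imageI)
            ultimately show False using R0 by blast
          qed
          \<comment> \<open>\<open>\<sigma> i\<close> is the index of the box that contains the
            \<open>i\<close>-th point. Counts equal to one make it a bijection onto
            \<open>{1..n}\<close>, which forces \<open>N \<omega> = n\<close>; separation makes it
            strictly increasing.\<close>
          then obtain \<sigma> where \<sigma>: "\<And>i. i \<in> {1..N \<omega>} \<Longrightarrow> \<sigma> i \<in> {1..n} \<and> f i \<in> A (\<sigma> i)" by metis
          have one: "\<exists>u. \<eta> \<omega> \<inter> A' j = {u}" if "j \<in> {1..n}" for j
          proof -
            have "card (\<eta> \<omega> \<inter> A' j) = 1" using bspec[OF R, of j] that by (simp add: k_def)
            then show ?thesis by (rule card_1_singletonE) blast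
          qed
          have \<sigma>inj: "i = i'" if i: "i \<in> {1..N \<omega>}" "i' \<in> {1..N \<omega>}" "\<sigma> i = \<sigma> i'" for i i'
          proof -
            have "f i \<in> \<eta> \<omega> \<inter> A' (\<sigma> i)" "f i' \<in> \<eta> \<omega> \<inter> A' (\<sigma> i)"
              using \<sigma>[OF i(1)] \<sigma>[OF i(2)] i(3) fS[OF i(1)] fS[OF i(2)] imageI[OF i(1), of f] imageI[OF i(2), of f]
              unfolding A'_def f\<eta> by auto
            moreover obtain u where "\<eta> \<omega> \<inter> A' (\<sigma> i) = {u}" using one[of "\<sigma> i"] \<sigma>[OF i(1)] by blast
            ultimately have "f i = f i'" using i(3) by (metis singletonD)
            then show ?thesis by (rule inj_onD[OF inj _ i(1,2)])
          qed
          have \<sigma>surj: "\<sigma> ` {1..N \<omega>} = {1..n}"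
          proof (intro antisym subsetI)
            fix j assume j: "j \<in> {1..n}"
            then obtain u where "\<eta> \<omega> \<inter> A' j = {u}" using one by blast
            then have "u \<in> f ` {1..N \<omega>}" "u \<in> A' j" unfolding f\<eta> by blast+
            then obtain i where i: "i \<in> {1..N \<omega>}" "f i \<in> A' j" by blast
            then have "f i \<in> A j" using j by (auto simp: A'_def)
            then have "\<sigma> i = j" using \<sigma>[OF i(1)] disjA[of "\<sigma> i" j] j by blast
            then show "j \<in> \<sigma> ` {1..N \<omega>}" using i by blast
          next
            fix j assume "j \<in> \<sigma> ` {1..N \<omega>}"
            then show "j \<in> {1..n}" using \<sigma> by blast
          qed
          have N: "N \<omega> = n"
          proof -
            have "inj_on \<sigma> {1..N \<omega>}" by (rule inj_onI) (rule \<sigma>inj)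
            from card_image[OF this] show ?thesis unfolding \<sigma>surj by simp
          qed
          have \<sigma>mono: "\<sigma> i < \<sigma> i'" if i: "i \<in> {1..N \<omega>}" "i' \<in> {1..N \<omega>}" "i < i'" for i i'
          proof (rule ccontr)
            assume "\<not> \<sigma> i < \<sigma> i'"
            moreover have "\<sigma> i \<noteq> \<sigma> i'" using \<sigma>inj[OF i(1,2)] i(3) by auto
            ultimately have "\<sigma> i' < \<sigma> i" by simp
            then have "fst (f i') < fst (f i)" using sep \<sigma>[OF i(1)] \<sigma>[OF i(2)] unfolding separated_def by blast
            moreover have "t i \<omega> < t i' \<omega>" by (rule strict_mono_onD[OF elim(1) i])
            ultimately show False by (simp add: f_def)
          qed
          \<comment> \<open>A strictly increasing map of \<open>{1..n}\<close> into itself is the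
            identity: induction upwards from 1 gives \<open>i \<le> \<sigma> i\<close>, and
            induction downwards from \<open>n\<close> gives the converse.\<close>
          have ge: "i \<le> \<sigma> i" if "i \<in> {1..n}" for i
            using that
          proof (induction i)
            case (Suc i)
            show ?case
            proof (cases "i = 0")
              case True then show ?thesis using \<sigma>[of "Suc i"] Suc.prems N by auto
            next
              case False
              then have "i \<le> \<sigma> i" using Suc by auto
              also have "\<sigma> i < \<sigma> (Suc i)" using Suc.prems False N by (intro \<sigma>mono) auto
              finally show ?thesis by simp
            qed
          qed simp
          have le: "\<sigma> (n - d) \<le> n - d" if "d < n" for d
            using that
          proof (induction d)
            case 0 then show ?case using \<sigma>[of n] N by auto
          next
            case (Suc d)
            have "\<sigma> (n - Suc d) < \<sigma> (n - d)" using Suc.prems N by (intro \<sigma>mono) auto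
            also have "\<sigma> (n - d) \<le> n - d" using Suc by auto
            finally show ?case by simp
          qed
          have "\<sigma> i = i" if "i \<in> {1..n}" for i
            using ge[OF that] le[of "n - i"] that by auto
          then show "N \<omega> = n \<and> (\<forall>i\<in>{1..n}. f i \<in> A i)" using \<sigma> N by metis
        qed
        moreover have "N \<omega> = n \<Longrightarrow> points N t z Y n \<omega> \<in> Pi\<^sub>E {1..n} A \<longleftrightarrow> (\<forall>i\<in>{1..n}. f i \<in> A i)"
          by (simp only: points_eq f_def PiE_iff) (simp del: One_nat_def)
        ultimately show ?case using elim(2) by (simp del: One_nat_def) blast
      qed
    qed
    also have "\<dots> = ennreal ((\<Prod>j\<in>{1..n}. measure lborel (A j \<inter> S)) * exp (- (T * K)))"
      unfolding emeasure_eq_measure prob_all ..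
    also have "\<dots> = (\<Prod>j\<in>{1..n}. emeasure lborel (A j \<inter> S)) * ennreal (exp (- (T * K)))"
    proof -
      have "ennreal (\<Prod>j\<in>{1..n}. measure lborel (A j \<inter> S)) = (\<Prod>j\<in>{1..n}. emeasure lborel (A j \<inter> S))"
        using finS[of "A _ \<inter> S"] by (subst prod_ennreal[symmetric]) (auto intro!: prod.cong simp: emeasure_eq_ennreal_measure)
      then show ?thesis by (simp add: ennreal_mult prod_nonneg)
    qed
    also have "\<dots> = emeasure ?m2 (Pi\<^sub>E {1..n} A)"
    proof -
      let ?S = "{0<..<T} \<times> {0..K}"
      have Sm': "?S \<in> sets (borel :: (real \<times> real) measure)" by (auto simp: borel_prod[symmetric] intro!: pair_measureI)
      have bm: "Pi\<^sub>E {1..n} (\<lambda>i. A i \<inter> ?S) \<in> sets (\<Pi>\<^sub>M i\<in>{1..n}. lborel)"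
        using A Sm' by (intro sets_PiM_I_finite) auto
      have "emeasure ?m2 (Pi\<^sub>E {1..n} A) = (\<integral>\<^sup>+p. points_density T K n p * indicator (Pi\<^sub>E {1..n} A) p \<partial>(\<Pi>\<^sub>M i\<in>{1..n}. lborel))"
      proof (rule emeasure_density)
        show "points_density T K n \<in> borel_measurable (\<Pi>\<^sub>M i\<in>{1..n}. lborel)"
          using points_density_measurable[of T K n] by (simp only: measurable_cong_sets[OF sp refl])
        show "Pi\<^sub>E {1..n} A \<in> sets (\<Pi>\<^sub>M i\<in>{1..n}. lborel)" using Abox by (simp only: sp)
      qed
      also have "\<dots> = (\<integral>\<^sup>+p. ennreal (exp (- (T * K))) * indicator (Pi\<^sub>E {1..n} (\<lambda>i. A i \<inter> ?S)) p \<partial>(\<Pi>\<^sub>M i\<in>{1..n}. lborel))"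
      proof (rule nn_integral_cong)
        fix p :: "nat \<Rightarrow> real \<times> real"
        have inc: "p \<in> increasing_points n" if "p \<in> Pi\<^sub>E {1..n} A"
          by (rule separated_box_increasing[OF sep that])
        have pr: "(\<Prod>i\<in>{1..n}. indicator ?S (p i) :: ennreal) = (if \<forall>i\<in>{1..n}. p i \<in> ?S then 1 else 0)"
          by (auto simp: indicator_def intro!: prod.neutral prod_zero)
        show "points_density T K n p * indicator (Pi\<^sub>E {1..n} A) p = ennreal (exp (- (T * K))) * indicator (Pi\<^sub>E {1..n} (\<lambda>i. A i \<inter> ?S)) p"
          unfolding points_density_def pr using inc by (auto simp: indicator_def PiE_iff)
      qed
      also have "\<dots> = ennreal (exp (- (T * K))) * emeasure (\<Pi>\<^sub>M i\<in>{1..n}. lborel) (Pi\<^sub>E {1..n} (\<lambda>i. A i \<inter> ?S))"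
        using bm by (simp add: nn_integral_cmult_indicator)
      also have "emeasure (\<Pi>\<^sub>M i\<in>{1..n}. lborel) (Pi\<^sub>E {1..n} (\<lambda>i. A i \<inter> ?S)) = (\<Prod>i\<in>{1..n}. emeasure lborel (A i \<inter> ?S))"
        using A Sm' by (intro L.emeasure_PiM) auto
      also have "\<dots> = (\<Prod>i\<in>{1..n}. emeasure lborel (A i \<inter> S))"
        unfolding S_def by (intro prod.cong refl emeasure_points_strip A)
      finally show ?thesis by (simp add: mult.commute)
    qed
    finally show "emeasure ?m1 (Pi\<^sub>E {1..n} A) = emeasure ?m2 (Pi\<^sub>E {1..n} A)" .
  qed
qed

section \<open>The skeleton density\<close>

context drift
begin

definition "normaliser x T = (\<integral>y. exp (B y - B x) * ker \<theta> T x y \<partial>lborel)"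

lemma integrable_end_density:
  assumes T: "0 < T"
  shows "integrable lborel (\<lambda>y. exp (B y - B x) * ker \<theta> T x y)"
proof (rule integrableI_bounded)
  \<comment> \<open>The bound is taken with \<open>- M\<close> in place of \<open>M\<close>, so that
    it controls the growing weight \<open>exp (M * \<bar>y\<bar>)\<close>, which dominates
    \<open>exp (B y)\<close>.\<close>
  obtain C where "Pk \<theta> T (\<lambda>y. ennreal (exp (- (- M * \<bar>y\<bar>)))) x \<le> ennreal (C * exp (- (- M * \<bar>x\<bar>)))"
    using Pk_exp_le[OF T, of \<theta> "- M"] T by blast
  then have fin: "Pk \<theta> T (\<lambda>y. ennreal (exp (M * \<bar>y\<bar>))) x < \<infinity>"
    by (simp add: le_less_trans)
  have "(\<integral>\<^sup>+y. ennreal (norm (exp (B y - B x) * ker \<theta> T x y)) \<partial>lborel) \<le> (\<integral>\<^sup>+y. ennreal (exp (- B x)) * (ennreal (ker \<theta> T x y) * ennreal (exp (M * \<bar>y\<bar>))) \<partial>lborel)"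
  proof (intro nn_integral_mono)
    fix y
    have "exp (B y - B x) * ker \<theta> T x y \<le> (exp (M * \<bar>y\<bar>) * exp (- B x)) * ker \<theta> T x y"
      unfolding exp_add[symmetric] using B_bound[of y] T by (intro mult_right_mono) auto
    then show "ennreal (norm (exp (B y - B x) * ker \<theta> T x y)) \<le> ennreal (exp (- B x)) * (ennreal (ker \<theta> T x y) * ennreal (exp (M * \<bar>y\<bar>)))"
      using T by (auto simp: ennreal_mult[symmetric] abs_mult ac_simps intro!: ennreal_leI)
  qed
  also have "\<dots> = ennreal (exp (- B x)) * Pk \<theta> T (\<lambda>y. ennreal (exp (M * \<bar>y\<bar>))) x"
    unfolding Pk_def by (intro nn_integral_cmult) measurable
  also have "\<dots> < \<infinity>" using fin by (simp add: ennreal_mult_less_top)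
  finally show "(\<integral>\<^sup>+y. ennreal (norm (exp (B y - B x) * ker \<theta> T x y)) \<partial>lborel) < \<infinity>" .
qed measurable

lemma normaliser_pos:
  assumes T: "0 < T"
  shows "0 < normaliser x T"
proof -
  have p: "0 < exp (B y - B x) * ker \<theta> T x y" for y using ker_pos[OF T] by simp
  then have nn: "0 \<le> exp (B y - B x) * ker \<theta> T x y" for y by (rule less_imp_le)
  have "normaliser x T \<noteq> 0"
  proof
    assume "normaliser x T = 0"
    then have "AE y in lborel. exp (B y - B x) * ker \<theta> T x y = 0"
      unfolding normaliser_def
      by (subst (asm) integral_nonneg_eq_0_iff_AE[OF integrable_end_density[OF T]]) (use nn in auto)
    then have "AE y in (lborel :: real measure). False" by eventually_elim (use p in \<open>simp add: less_le\<close>)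
    then show False by (simp add: eventually_False ae_filter_eq_bot_iff)
  qed
  moreover have "0 \<le> normaliser x T" unfolding normaliser_def using nn by (intro integral_nonneg_AE) auto
  ultimately show ?thesis by simp
qed

lemma h_theta_eq: "h_theta b x T y = exp (B y - B x) * ker \<theta> T x y / normaliser x T"
  by (simp add: h_theta_def normalised_def normaliser_def ker_def mult.assoc)

text \<open>Chapman--Kolmogorov evaluates the normalising integral as
  \<open>ker \<theta> T' a e\<close> divided by the Gaussian density that \<open>q00\<close> carries
  in its denominator; that density cancels.\<close>

lemma q_theta_eq:
  assumes t: "0 < t" "t < T'"
  shows "q_theta \<theta> t T' a e y = ker \<theta> t a y * ker \<theta> (T' - t) y e / ker \<theta> T' a e"
proof -
  have p: "p00 T' a e > 0" using t by (simp add: p00_gauss gauss_pos)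
  have v: "v_theta \<theta> t a y * v_theta \<theta> (T' - t) y e * q00 t T' a e y = ker \<theta> t a y * ker \<theta> (T' - t) y e / p00 T' a e" for y
    by (simp add: q00_def ker_def ac_simps)
  have "(\<integral>y. ker \<theta> t a y * ker \<theta> (T' - t) y e / p00 T' a e \<partial>lborel) = ker \<theta> T' a e / p00 T' a e"
    using ker_chapman_kolmogorov[of t "T' - t" \<theta> a e] t by (simp add: has_bochner_integral_iff)
  then show ?thesis using p by (simp add: q_theta_def normalised_def v)
qed

definition "ptime p i = (if i = 0 then 0 else fst (p i))" for p :: "nat \<Rightarrow> real \<times> real"
definition "positions x ys i = (if i = 0 then x else ys i)" for x :: real and ys :: "nat \<Rightarrow> real"
text \<open>The value 0 for times that do not increase builds the order of the points into the
  integrand, so that integrals may run over all times instead of a simplex.\<close>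

definition "hop s a s' a' = (if s < s' then ennreal (ker \<theta> (s' - s) a a') else 0)"

definition "route x n p ys t y =
  (\<Prod>i<n. hop (ptime p i) (positions x ys i) (ptime p (Suc i)) (positions x ys (Suc i))) * hop (ptime p n) (positions x ys n) t y"

lemma skeleton_density_route:
  assumes T: "0 < T" and n: "ptime p n < T" and inc: "\<And>i. i < n \<Longrightarrow> ptime p i < ptime p (Suc i)"
    and ts: "\<And>i. i \<in> {1..n} \<Longrightarrow> ts i = fst (p i)"
  shows "ennreal (skeleton_density b x T n ts ys y) = ennreal (exp (B y - B x) / normaliser x T) * route x n p ys T y"
    and "0 \<le> skeleton_density b x T n ts ys y"
proof -
  let ?s = "ptime p" and ?w = "positions x ys"
  \<comment> \<open>\<open>g i\<close> is the kernel from the \<open>i\<close>-th skeleton point to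
    the end point. Each bridge density is \<open>k i * (g (Suc i) / g i)\<close>; the quotients
    telescope to \<open>g n / g 0\<close>, and \<open>h_theta\<close> supplies the missing
    \<open>g 0\<close>.\<close>
  define g where "g i = ker \<theta> (T - ?s i) (?w i) y" for i
  define k where "k i = ker \<theta> (?s (Suc i) - ?s i) (?w i) (?w (Suc i))" for i
  have s: "(ts(0 := 0)) i = ?s i" if "i \<le> n" for i
    using that ts[of i] by (auto simp: ptime_def)
  have w: "ys(0 := x) = ?w" by (auto simp: positions_def)
  \<comment> \<open>Induction from the last time backwards: the assumption places only
    \<open>ptime p n\<close> before \<open>T\<close>, and the earlier times are smaller.\<close>
  have lt: "?s (n - d) < T" for d
  proof (induction d)
    case (Suc d)
    then show ?case
      using inc[of "n - Suc d"] by (cases "d < n") (auto simp: Suc_diff_Suc)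
  qed (use n in simp)
  have lt': "?s i < T" if "i \<le> n" for i using lt[of "n - i"] that by simp
  have gpos: "0 < g i" if "i \<le> n" for i unfolding g_def using lt'[OF that] by (intro ker_pos) simp
  have kpos: "0 < k i" if "i < n" for i unfolding k_def using inc[OF that] by (intro ker_pos) simp
  have q: "q_theta \<theta> (?s (Suc i) - ?s i) (T - ?s i) (?w i) y (?w (Suc i)) = k i * (g (Suc i) / g i)" if "i < n" for i
    using q_theta_eq[of "?s (Suc i) - ?s i" "T - ?s i" "?w i" y "?w (Suc i)"] inc[OF that] lt'[of "Suc i"] that
    by (simp add: k_def g_def)
  have tel: "(\<Prod>i<m. g (Suc i) / g i) = g m / g 0" if "m \<le> n" for m
    using that
  proof (induction m)
    case 0 then show ?case using gpos[of 0] by simp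
  next
    case (Suc m) then show ?case using gpos[of m] by simp
  qed
  have "(\<Prod>i<n. q_theta \<theta> ((ts(0 := 0)) (Suc i) - (ts(0 := 0)) i) (T - (ts(0 := 0)) i) (?w i) y (?w (Suc i))) = (\<Prod>i<n. k i * (g (Suc i) / g i))"
  proof (rule prod.cong[OF refl])
    fix i assume "i \<in> {..<n}"
    then have i: "i < n" "i \<le> n" "Suc i \<le> n" by auto
    show "q_theta \<theta> ((ts(0 := 0)) (Suc i) - (ts(0 := 0)) i) (T - (ts(0 := 0)) i) (?w i) y (?w (Suc i)) = k i * (g (Suc i) / g i)"
      unfolding s[OF i(2)] s[OF i(3)] by (rule q[OF i(1)])
  qed
  moreover have "h_theta b x T y = exp (B y - B x) * g 0 / normaliser x T"
    unfolding h_theta_eq by (simp add: g_def ptime_def positions_def)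
  ultimately have "skeleton_density b x T n ts ys y
      = exp (B y - B x) * g 0 / normaliser x T * (\<Prod>i<n. k i * (g (Suc i) / g i))"
    unfolding skeleton_density_def Let_def w by (simp only:)
  also have "\<dots> = exp (B y - B x) / normaliser x T * ((\<Prod>i<n. k i) * g n)"
    unfolding prod.distrib tel[OF order_refl] using gpos[of 0] by simp
  finally have eq: "skeleton_density b x T n ts ys y = exp (B y - B x) / normaliser x T * ((\<Prod>i<n. k i) * g n)" .
  have P: "0 \<le> (\<Prod>i<n. k i)" using kpos by (intro prod_nonneg) (auto intro: less_imp_le)
  have "route x n p ys T y = (\<Prod>i<n. ennreal (k i)) * ennreal (g n)"
    unfolding route_def by (intro arg_cong2[where f="(*)"] prod.cong) (auto simp: hop_def inc n k_def g_def)
  also have "(\<Prod>i<n. ennreal (k i)) = ennreal (\<Prod>i<n. k i)"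
    by (intro prod_ennreal) (auto intro: less_imp_le[OF kpos])
  finally have "route x n p ys T y = ennreal ((\<Prod>i<n. k i) * g n)"
    using P gpos[of n] by (simp add: ennreal_mult)
  then show "ennreal (skeleton_density b x T n ts ys y) = ennreal (exp (B y - B x) / normaliser x T) * route x n p ys T y"
    unfolding eq using P gpos[of n] normaliser_pos[OF T, of x] by (subst ennreal_mult) auto
  show "0 \<le> skeleton_density b x T n ts ys y"
    unfolding eq using P gpos[of n] normaliser_pos[OF T, of x] by (intro mult_nonneg_nonneg) auto
qed

text \<open>Besides acceptance of the mark it includes the upper edge \<open>K\<close> of the
  rectangle, so that integrating over all real marks gives exactly \<open>V a\<close>
  (\<open>nn_integral_lid\<close>).\<close>

definition "lid \<zeta> a = indicator {phi_tilde b a..K} \<zeta>" for \<zeta> a :: real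

definition "thinned_route x n p ys t y = route x n p ys t y * (\<Prod>i\<in>{1..n}. lid (snd (p i)) (ys i) :: ennreal)"

lemma borel_measurable_hop [measurable]:
  assumes [measurable]: "f \<in> borel_measurable N" "g \<in> borel_measurable N" "h \<in> borel_measurable N" "k \<in> borel_measurable N"
  shows "(\<lambda>\<omega>. hop (f \<omega>) (g \<omega>) (h \<omega>) (k \<omega>)) \<in> borel_measurable N"
  unfolding hop_def by measurable

lemma borel_measurable_lid [measurable]:
  assumes [measurable]: "f \<in> borel_measurable N" "g \<in> borel_measurable N"
  shows "(\<lambda>\<omega>. lid (f \<omega>) (g \<omega>) :: ennreal) \<in> borel_measurable N"
proof -
  have [measurable]: "phi_tilde b \<in> borel_measurable borel" by (rule phi_tilde_measurable)
  have "(\<lambda>\<omega>. lid (f \<omega>) (g \<omega>) :: ennreal) = (\<lambda>\<omega>. if phi_tilde b (g \<omega>) \<le> f \<omega> \<and> f \<omega> \<le> K then 1 else 0)"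
    by (auto simp: lid_def indicator_def)
  then show ?thesis by simp
qed

lemma borel_measurable_route:
  assumes f: "\<And>i. i \<in> {1..n} \<Longrightarrow> (\<lambda>\<omega>. f \<omega> i) \<in> borel_measurable N" and g: "\<And>i. i \<in> {1..n} \<Longrightarrow> (\<lambda>\<omega>. g \<omega> i) \<in> borel_measurable N"
    and [measurable]: "h \<in> borel_measurable N" "k \<in> borel_measurable N"
  shows "(\<lambda>\<omega>. route x n (f \<omega>) (g \<omega>) (h \<omega>) (k \<omega>)) \<in> borel_measurable N"
    "(\<lambda>\<omega>. thinned_route x n (f \<omega>) (g \<omega>) (h \<omega>) (k \<omega>)) \<in> borel_measurable N"
proof -
  have fst: "fst \<in> borel_measurable (borel :: (real \<times> real) measure)" and snd: "snd \<in> borel_measurable (borel :: (real \<times> real) measure)"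
    by (intro borel_measurable_continuous_onI continuous_intros)+
  have t: "(\<lambda>\<omega>. ptime (f \<omega>) i) \<in> borel_measurable N" if "i \<le> n" for i
    using that measurable_compose[OF f[of i] fst] unfolding ptime_def by (cases "i = 0") auto
  have p: "(\<lambda>\<omega>. positions x (g \<omega>) i) \<in> borel_measurable N" if "i \<le> n" for i
    using that g[of i] unfolding positions_def by (cases "i = 0") auto
  show *: "(\<lambda>\<omega>. route x n (f \<omega>) (g \<omega>) (h \<omega>) (k \<omega>)) \<in> borel_measurable N"
    unfolding route_def
    by (intro borel_measurable_times_ennreal borel_measurable_prod_ennreal borel_measurable_hop t p) auto
  show "(\<lambda>\<omega>. thinned_route x n (f \<omega>) (g \<omega>) (h \<omega>) (k \<omega>)) \<in> borel_measurable N"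
    unfolding thinned_route_def
    by (intro borel_measurable_times_ennreal * borel_measurable_prod_ennreal borel_measurable_lid g measurable_compose[OF f snd])
qed

lemma thinned_route_Suc:
  "thinned_route x (Suc n) (p(Suc n := (s, \<zeta>))) (ys(Suc n := a)) t y = thinned_route x n p ys s a * (lid \<zeta> a * hop s a t y)"
proof -
  have t: "ptime (p(Suc n := (s, \<zeta>))) i = (if i = Suc n then s else ptime p i)" for i by (simp add: ptime_def)
  have w: "positions x (ys(Suc n := a)) i = (if i = Suc n then a else positions x ys i)" for i by (simp add: positions_def)
  have "route x (Suc n) (p(Suc n := (s, \<zeta>))) (ys(Suc n := a)) t y = route x n p ys s a * hop s a t y"
    unfolding route_def t w prod.lessThan_Suc by (intro arg_cong2[where f="(*)"] prod.cong refl) auto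
  moreover have "(\<Prod>i\<in>{1..Suc n}. lid (snd ((p(Suc n := (s, \<zeta>))) i)) ((ys(Suc n := a)) i) :: ennreal) = (\<Prod>i\<in>{1..n}. lid (snd (p i)) (ys i)) * lid \<zeta> a"
    unfolding prod.cl_ivl_Suc by (auto intro!: arg_cong2[where f="(*)"] prod.cong)
  ultimately show ?thesis unfolding thinned_route_def by (simp only: ac_simps)
qed

lemma nn_integral_lid: "(\<integral>\<^sup>+\<zeta>. lid \<zeta> a \<partial>lborel) = ennreal (V a)"
  using K[of a] by (simp add: lid_def V_def)

abbreviation "points_leb n \<equiv> (\<Pi>\<^sub>M i\<in>{1..n::nat}. (lborel :: (real \<times> real) measure))"
abbreviation "skel_leb n \<equiv> (\<Pi>\<^sub>M i\<in>{1..n::nat}. (lborel :: real measure))"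

lemma measurable_components:
  "i \<in> {1..n} \<Longrightarrow> (\<lambda>p. p i) \<in> borel_measurable (points_leb n)" "i \<in> {1..n} \<Longrightarrow> (\<lambda>p. p i) \<in> borel_measurable (skel_leb n)"
  using measurable_component_singleton[of i "{1..n}" "\<lambda>_. lborel :: (real \<times> real) measure"]
    measurable_component_singleton[of i "{1..n}" "\<lambda>_. lborel :: real measure"] by simp_all

definition "route_integral x n t y = (\<integral>\<^sup>+p. (\<integral>\<^sup>+ys. thinned_route x n p ys t y \<partial>skel_leb n) \<partial>points_leb n)"

text \<open>The last point enters only through the final factors (\<open>thinned_route_Suc\<close>),
  so its time, mark and position can be integrated outermost; its mark contributes
  \<open>V a\<close>. Naming the integral over the first \<open>n\<close> points \<open>R\<close>
  lets its measurability come from a closed form.\<close>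

lemma route_integral_Suc:
  assumes R: "\<And>s a. route_integral x n s a = R s a" and Rm: "(\<lambda>u. R (fst u) (snd u)) \<in> borel_measurable (borel \<Otimes>\<^sub>M borel)"
  shows "route_integral x (Suc n) t y = (\<integral>\<^sup>+s. (\<integral>\<^sup>+a. R s a * (ennreal (V a) * hop s a t y) \<partial>lborel) \<partial>lborel)"
proof -
  interpret P: product_sigma_finite "\<lambda>_. lborel :: (real \<times> real) measure" by standard
  interpret S: product_sigma_finite "\<lambda>_. lborel :: real measure" by standard
  interpret Pn: sigma_finite_measure "points_leb n" by (rule P.sigma_finite) simp
  interpret Sn: sigma_finite_measure "skel_leb n" by (rule S.sigma_finite) simp
  interpret Sn1: sigma_finite_measure "skel_leb (Suc n)" by (rule S.sigma_finite) simp
  interpret PL: pair_sigma_finite "points_leb n" "lborel :: real measure" ..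
  have Rm' [measurable]: "(\<lambda>\<omega>. R (f \<omega>) (g \<omega>)) \<in> borel_measurable N" if "f \<in> borel_measurable N" "g \<in> borel_measurable N" for f g :: "'z \<Rightarrow> real" and N
    using measurable_compose[OF measurable_Pair[OF that] Rm] by simp
  have ins: "{1..Suc n} = insert (Suc n) {1..n}" by auto
  have tp1: "(\<lambda>ys. thinned_route x (Suc n) p ys t y) \<in> borel_measurable (skel_leb (Suc n))" for p
    by (intro borel_measurable_route measurable_components measurable_const) auto
  have tp2: "(\<lambda>p. \<integral>\<^sup>+ys. thinned_route x (Suc n) p ys t y \<partial>skel_leb (Suc n)) \<in> borel_measurable (points_leb (Suc n))"
    by (intro Sn1.borel_measurable_nn_integral)
      (auto simp: split_beta' simp del: One_nat_def intro!: borel_measurable_route measurable_compose[OF measurable_fst measurable_components(1)] measurable_compose[OF measurable_snd measurable_components(2)])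
  have m3: "(\<lambda>q. thinned_route x n (fst (fst q)) (snd q) s (snd (fst q))) \<in> borel_measurable ((points_leb n \<Otimes>\<^sub>M lborel) \<Otimes>\<^sub>M skel_leb n)" for s
    by (intro borel_measurable_route measurable_compose[OF measurable_compose[OF measurable_fst measurable_fst] measurable_components(1)] measurable_compose[OF measurable_snd measurable_components(2)]) auto
  define J where "J p s a = (\<integral>\<^sup>+ys. thinned_route x n p ys s a \<partial>skel_leb n)" for p s a
  have m2: "(\<lambda>q. J (fst q) s (snd q)) \<in> borel_measurable (points_leb n \<Otimes>\<^sub>M lborel)" for s
    unfolding J_def by (rule Sn.borel_measurable_nn_integral) (use m3[of s] in \<open>simp add: split_beta' del: One_nat_def\<close>)
  have m1: "(\<lambda>ys. thinned_route x n p ys s a) \<in> borel_measurable (skel_leb n)" for p s a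
    by (intro borel_measurable_route measurable_components measurable_const) auto
  have m2': "(\<lambda>p. J p s a) \<in> borel_measurable (points_leb n)" for s a
    using measurable_compose[OF measurable_Pair2'[of a lborel "points_leb n"] m2[of s]] by simp
  have inner: "(\<integral>\<^sup>+ys. thinned_route x (Suc n) (p(Suc n := u)) ys t y \<partial>skel_leb (Suc n)) = (\<integral>\<^sup>+a. J p (fst u) a * (lid (snd u) a * hop (fst u) a t y) \<partial>lborel)" for p u
  proof -
    have "(\<integral>\<^sup>+ys. thinned_route x (Suc n) (p(Suc n := u)) ys t y \<partial>skel_leb (Suc n))
      = (\<integral>\<^sup>+a. \<integral>\<^sup>+ys. thinned_route x (Suc n) (p(Suc n := u)) (ys(Suc n := a)) t y \<partial>skel_leb n \<partial>lborel)"
      unfolding ins by (rule S.product_nn_integral_insert_rev) (use tp1[of "p(Suc n := u)"] in \<open>unfold ins, auto\<close>)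
    also have "\<dots> = (\<integral>\<^sup>+a. \<integral>\<^sup>+ys. thinned_route x n p ys (fst u) a * (lid (snd u) a * hop (fst u) a t y) \<partial>skel_leb n \<partial>lborel)"
      using thinned_route_Suc[of x n p "fst u" "snd u" _ _ t y] by simp
    also have "\<dots> = (\<integral>\<^sup>+a. J p (fst u) a * (lid (snd u) a * hop (fst u) a t y) \<partial>lborel)"
      unfolding J_def by (intro nn_integral_cong nn_integral_multc m1)
    finally show ?thesis .
  qed
  have "route_integral x (Suc n) t y = (\<integral>\<^sup>+u. \<integral>\<^sup>+p. (\<integral>\<^sup>+ys. thinned_route x (Suc n) (p(Suc n := u)) ys t y \<partial>skel_leb (Suc n)) \<partial>points_leb n \<partial>lborel)"
    unfolding route_integral_def ins by (rule P.product_nn_integral_insert_rev) (use tp2 in \<open>unfold ins, auto\<close>)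
  also have "\<dots> = (\<integral>\<^sup>+u. \<integral>\<^sup>+p. (\<integral>\<^sup>+a. J p (fst u) a * (lid (snd u) a * hop (fst u) a t y) \<partial>lborel) \<partial>points_leb n \<partial>lborel)"
    by (simp only: inner)
  also have "\<dots> = (\<integral>\<^sup>+u. \<integral>\<^sup>+a. (\<integral>\<^sup>+p. J p (fst u) a * (lid (snd u) a * hop (fst u) a t y) \<partial>points_leb n) \<partial>lborel \<partial>lborel)"
  proof (intro nn_integral_cong PL.Fubini'[symmetric])
    fix u :: "real \<times> real"
    note [measurable] = m2[of "fst u"]
    show "(\<lambda>(p, a). J p (fst u) a * (lid (snd u) a * hop (fst u) a t y)) \<in> borel_measurable (points_leb n \<Otimes>\<^sub>M lborel)"
      unfolding split_beta' by (intro borel_measurable_times_ennreal m2) measurable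
  qed
  also have "\<dots> = (\<integral>\<^sup>+u. \<integral>\<^sup>+a. R (fst u) a * (lid (snd u) a * hop (fst u) a t y) \<partial>lborel \<partial>lborel)"
    unfolding R[symmetric] route_integral_def J_def[symmetric] by (intro nn_integral_cong nn_integral_multc m2')
  also have "\<dots> = (\<integral>\<^sup>+s. \<integral>\<^sup>+\<zeta>. \<integral>\<^sup>+a. R s a * (lid \<zeta> a * hop s a t y) \<partial>lborel \<partial>lborel \<partial>lborel)"
  proof -
    have "(\<lambda>u. \<integral>\<^sup>+a. R (fst u) a * (lid (snd u) a * hop (fst u) a t y) \<partial>lborel) \<in> borel_measurable (lborel \<Otimes>\<^sub>M lborel)"
      by measurable
    from lborel.nn_integral_fst[OF this] show ?thesis by (simp add: lborel_prod)
  qed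
  also have "\<dots> = (\<integral>\<^sup>+s. \<integral>\<^sup>+a. \<integral>\<^sup>+\<zeta>. lid \<zeta> a * (R s a * hop s a t y) \<partial>lborel \<partial>lborel \<partial>lborel)"
    by (subst lborel_pair.Fubini') (measurable, simp add: ac_simps)
  also have "\<dots> = (\<integral>\<^sup>+s. (\<integral>\<^sup>+a. R s a * (ennreal (V a) * hop s a t y) \<partial>lborel) \<partial>lborel)"
  proof (intro nn_integral_cong)
    fix s a
    have "(\<integral>\<^sup>+\<zeta>. lid \<zeta> a * (R s a * hop s a t y) \<partial>lborel) = ennreal (V a) * (R s a * hop s a t y)"
      unfolding nn_integral_lid[symmetric] by (rule nn_integral_multc) measurable
    then show "(\<integral>\<^sup>+\<zeta>. lid \<zeta> a * (R s a * hop s a t y) \<partial>lborel) = R s a * (ennreal (V a) * hop s a t y)"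
      by (simp only: ac_simps)
  qed
  finally show ?thesis .
qed

text \<open>The recursion for thinned routes is the recursion that defines \<open>Rn\<close>. The
  indicator is there because \<open>hop\<close> vanishes when the final time is not positive, a
  restriction that the formula for \<open>Rn\<close> at index 0 does not contain.\<close>

lemma route_integral_eq: "route_integral x n t y = Rn \<theta> V x n t y * indicator {0<..} t"
proof (induction n arbitrary: t y)
  case 0
  show ?case
    by (simp add: route_integral_def PiM_empty nn_integral_count_space_finite thinned_route_def route_def
      ptime_def positions_def hop_def)
next
  case (Suc n)
  have [measurable]: "V \<in> borel_measurable borel" by (rule V_measurable)
  have "route_integral x (Suc n) t y = (\<integral>\<^sup>+s. (\<integral>\<^sup>+a. (Rn \<theta> V x n s a * indicator {0<..} s) * (ennreal (V a) * hop s a t y) \<partial>lborel) \<partial>lborel)"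
    by (rule route_integral_Suc[OF Suc]) measurable
  also have "\<dots> = (\<integral>\<^sup>+s. (\<integral>\<^sup>+z. Rn \<theta> V x n s z * ennreal (V z) * ennreal (ker \<theta> (t - s) z y) \<partial>lborel) * indicator {0<..<t} s \<partial>lborel) * indicator {0<..} t"
  proof (cases "0 < t")
    case True
    have "(\<integral>\<^sup>+a. (Rn \<theta> V x n s a * indicator {0<..} s) * (ennreal (V a) * hop s a t y) \<partial>lborel)
      = (\<integral>\<^sup>+z. Rn \<theta> V x n s z * ennreal (V z) * ennreal (ker \<theta> (t - s) z y) \<partial>lborel) * indicator {0<..<t} s" for s
      by (cases "0 < s \<and> s < t") (auto simp: hop_def indicator_def ac_simps)
    then show ?thesis using True by simp
  next
    case False
    then have "indicator {0<..} s * hop s a t y = 0" for s a by (auto simp: hop_def indicator_def)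
    then have "(Rn \<theta> V x n s a * indicator {0<..} s) * (ennreal (V a) * hop s a t y) = 0" for s a
      by (metis mult.assoc mult.commute mult_zero_right)
    then show ?thesis using False by (simp only: nn_integral_const) simp
  qed
  finally show ?case by simp
qed

end

section \<open>The law of an accepted round\<close>

abbreviation "skel_space n \<equiv> (\<Pi>\<^sub>M i\<in>{1..n::nat}. (borel :: real measure)) \<Otimes>\<^sub>M (borel :: real measure)"

lemma sets_leb:
  "sets (\<Pi>\<^sub>M i\<in>{1..n::nat}. (lborel :: (real \<times> real) measure)) = sets (points_space n)"
  "sets ((\<Pi>\<^sub>M i\<in>{1..n::nat}. (lborel :: real measure)) \<Otimes>\<^sub>M lborel) = sets (skel_space n)"
  by (intro sets_PiM_cong sets_pair_measure_cong; simp)+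

context drift
begin

abbreviation "round_leb n \<equiv> points_leb n \<Otimes>\<^sub>M (skel_leb n \<Otimes>\<^sub>M (lborel :: real measure))"

definition "weighted_route x T n p ys y = ennreal (exp (B y - B x) / normaliser x T) * route x n p ys T y"

lemma weighted_route_measurable:
  "(\<lambda>q. weighted_route x T n (fst q) (fst (snd q)) (snd (snd q))) \<in> borel_measurable (round_leb n)"
proof -
  note [measurable] = B_measurable
  have "(\<lambda>q. route x n (fst q) (fst (snd q)) T (snd (snd q))) \<in> borel_measurable (round_leb n)"
    by (intro borel_measurable_route measurable_compose[OF measurable_fst measurable_components(1)]
      measurable_compose[OF measurable_compose[OF measurable_snd measurable_fst] measurable_components(2)]) auto
  moreover have "(\<lambda>q. ennreal (exp (B (snd (snd q)) - B x) / normaliser x T)) \<in> borel_measurable (round_leb n)"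
    by measurable
  ultimately show ?thesis unfolding weighted_route_def by (intro borel_measurable_times_ennreal)
qed

lemma weighted_route_measurable_snd: "(\<lambda>q. weighted_route x T n p (fst q) (snd q)) \<in> borel_measurable (skel_leb n \<Otimes>\<^sub>M lborel)"
proof -
  note [measurable] = B_measurable
  have "(\<lambda>q. route x n p (fst q) T (snd q)) \<in> borel_measurable (skel_leb n \<Otimes>\<^sub>M lborel)"
    by (intro borel_measurable_route measurable_compose[OF measurable_fst measurable_components(2)]) auto
  moreover have "(\<lambda>q. ennreal (exp (B (snd q) - B x) / normaliser x T)) \<in> borel_measurable (skel_leb n \<Otimes>\<^sub>M lborel)"
    by measurable
  ultimately show ?thesis unfolding weighted_route_def by (intro borel_measurable_times_ennreal)
qed

lemma emeasure_skeleton_law: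
  assumes T: "0 < T" and p: "p \<in> increasing_points n" "\<And>i. i \<in> {1..n} \<Longrightarrow> fst (p i) \<in> {0<..<T}"
    and ts: "\<And>i. i \<in> {1..n} \<Longrightarrow> ts i = fst (p i)" and C: "C \<in> sets (skel_space n)"
  shows "emeasure (skeleton_law b x T n ts) C = (\<integral>\<^sup>+q. weighted_route x T n p (fst q) (snd q) * indicator C q \<partial>(skel_leb n \<Otimes>\<^sub>M lborel))"
proof -
  have n: "ptime p n < T" using p(2)[of n] T by (cases "n = 0") (auto simp: ptime_def)
  have inc: "ptime p i < ptime p (Suc i)" if "i < n" for i
    using that p(1) p(2)[of "Suc i"] by (cases "i = 0") (auto simp: ptime_def increasing_points_def)
  have "ennreal (skeleton_density b x T n ts ys y) = weighted_route x T n p ys y" for ys y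
    unfolding weighted_route_def by (rule skeleton_density_route(1)[OF T n inc ts])
  then have "skeleton_law b x T n ts = density (skel_leb n \<Otimes>\<^sub>M lborel) (\<lambda>q. weighted_route x T n p (fst q) (snd q))"
    by (simp add: skeleton_law_def split_beta')
  then show ?thesis
    using C weighted_route_measurable_snd by (simp only: emeasure_density sets_leb)
qed

text \<open>Where the thinned route does not vanish, its hops force strictly increasing times inside
  \<open>{0<..<T}\<close>, and its lids force marks in \<open>{0..K}\<close> because
  \<open>phi_tilde\<close> is nonnegative. There the Poisson density is the constant
  \<open>exp (- (T * K))\<close>; elsewhere both sides are 0.\<close>

lemma points_density_thinned:
  assumes T: "0 < T"
  shows "points_density T K n p * (route x n p ys T y * (\<Prod>i\<in>{1..n}. lid (snd (p i)) (ys i))) = ennreal (exp (- (T * K))) * thinned_route x n p ys T y"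
proof (cases "thinned_route x n p ys T y = 0")
  case True
  then show ?thesis unfolding thinned_route_def by (simp only: mult_zero_right)
next
  case False
  then have r: "route x n p ys T y \<noteq> 0" and l: "(\<Prod>i\<in>{1..n}. lid (snd (p i)) (ys i) :: ennreal) \<noteq> 0"
    unfolding thinned_route_def by (metis mult_zero_left, metis mult_zero_right)
  have hop: "s < s'" if "hop s a s' a' \<noteq> 0" for s a s' a' using that unfolding hop_def by metis
  have P: "(\<Prod>i<n. hop (ptime p i) (positions x ys i) (ptime p (Suc i)) (positions x ys (Suc i))) \<noteq> 0" and Tn: "ptime p n < T"
    using r unfolding route_def by (metis mult_zero_left, metis hop mult_zero_right)
  have step: "ptime p i < ptime p (Suc i)" if "i < n" for i
  proof (rule hop)
    show "hop (ptime p i) (positions x ys i) (ptime p (Suc i)) (positions x ys (Suc i)) \<noteq> 0"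
      using P that by (auto simp: prod_zero_iff)
  qed
  have less: "ptime p i < ptime p j" if "i < j" "j \<le> n" for i j
    using that
  proof (induction j)
    case (Suc j)
    then show ?case using step[of j] by (cases "i = j") (auto intro: less_trans)
  qed simp
  have inc: "p \<in> increasing_points n"
    unfolding increasing_points_def
  proof (intro CollectI ballI impI)
    fix i j assume "i \<in> {1..n}" "j \<in> {1..n}" "i < j"
    then show "fst (p i) < fst (p j)" using less[of i j] by (simp add: ptime_def)
  qed
  have box: "p i \<in> {0<..<T} \<times> {0..K}" if i: "i \<in> {1..n}" for i
  proof -
    have "0 < fst (p i)" using less[of 0 i] i by (simp add: ptime_def)
    moreover have "fst (p i) < T" using less[of i n] i Tn by (cases "i = n") (simp_all add: ptime_def)
    moreover have "lid (snd (p i)) (ys i) \<noteq> (0 :: ennreal)" using l i by (simp add: prod_zero_iff)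
    then have "phi_tilde b (ys i) \<le> snd (p i)" "snd (p i) \<le> K" by (auto simp: lid_def indicator_def split: if_splits)
    ultimately show ?thesis using phi_tilde_nonneg[of "ys i"] by (cases "p i") auto
  qed
  have "(\<Prod>i\<in>{1..n}. indicator ({0<..<T} \<times> {0..K}) (p i) :: ennreal) = 1"
    by (rule prod.neutral) (use box in simp)
  then have "points_density T K n p = ennreal (exp (- (T * K)))"
    using inc by (simp add: points_density_def)
  then show ?thesis by (simp only: thinned_route_def)
qed

text \<open>After \<open>points_density_thinned\<close> the integrand is a thinned route times a
  function of the end point alone. Integrating the skeleton and the points first, by Tonelli, leaves
  \<open>route_integral\<close>, that is \<open>Rn\<close>. The constant in front is the same for
  every \<open>n\<close>, so the terms can later be added up.\<close>

lemma accepted_integral: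
  assumes T: "0 < T" and C [measurable]: "C \<in> sets (borel :: real measure)"
  shows "(\<integral>\<^sup>+q. points_density T K n (fst q) * weighted_route x T n (fst q) (fst (snd q)) (snd (snd q))
         * ((\<Prod>i\<in>{1..n}. lid (snd (fst q i)) (fst (snd q) i)) * indicator C (snd (snd q))) \<partial>round_leb n)
    = ennreal (exp (- (T * K)) / normaliser x T) * (\<integral>\<^sup>+y. Rn \<theta> V x n T y * (ennreal (exp (B y - B x)) * indicator C y) \<partial>lborel)"
proof -
  interpret P: product_sigma_finite "\<lambda>_. lborel :: (real \<times> real) measure" by standard
  interpret S: product_sigma_finite "\<lambda>_. lborel :: real measure" by standard
  interpret Pn: sigma_finite_measure "points_leb n" by (rule P.sigma_finite) simp
  interpret Sn: sigma_finite_measure "skel_leb n" by (rule S.sigma_finite) simp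
  interpret PL: pair_sigma_finite "points_leb n" "lborel :: real measure" ..
  interpret PS: sigma_finite_measure "skel_leb n \<Otimes>\<^sub>M (lborel :: real measure)" by (rule sigma_finite_pair_measure) unfold_locales
  interpret SL: pair_sigma_finite "skel_leb n" "lborel :: real measure" ..
  note [measurable] = B_measurable V_measurable
  define Z where "Z = normaliser x T"
  have Z: "0 < Z" unfolding Z_def by (rule normaliser_pos[OF T])
  define w where "w y = ennreal (exp (- (T * K)) / Z) * (ennreal (exp (B y - B x)) * indicator C y)" for y
  have w [measurable]: "w \<in> borel_measurable borel" unfolding w_def by measurable
  have w1: "(\<lambda>q. w (snd (snd q))) \<in> borel_measurable (round_leb n)"
    and w2: "(\<lambda>q. w (snd q)) \<in> borel_measurable (skel_leb n \<Otimes>\<^sub>M lborel)"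
    and w3: "(\<lambda>q. w (snd q)) \<in> borel_measurable (points_leb n \<Otimes>\<^sub>M lborel)" by measurable
  have tm: "(\<lambda>q. thinned_route x n (fst q) (fst (snd q)) T (snd (snd q))) \<in> borel_measurable (round_leb n)"
    by (intro borel_measurable_route measurable_compose[OF measurable_fst measurable_components(1)]
      measurable_compose[OF measurable_compose[OF measurable_snd measurable_fst] measurable_components(2)]) auto
  have tm2: "(\<lambda>q. thinned_route x n p (fst q) T (snd q)) \<in> borel_measurable (skel_leb n \<Otimes>\<^sub>M lborel)" for p
    by (intro borel_measurable_route measurable_compose[OF measurable_fst measurable_components(2)]) auto
  have tm1: "(\<lambda>ys. thinned_route x n p ys T y) \<in> borel_measurable (skel_leb n)" for p y
    by (intro borel_measurable_route measurable_components measurable_const) auto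
  have m3: "(\<lambda>q. thinned_route x n (fst (fst q)) (snd q) T (snd (fst q))) \<in> borel_measurable ((points_leb n \<Otimes>\<^sub>M lborel) \<Otimes>\<^sub>M skel_leb n)"
    by (intro borel_measurable_route measurable_compose[OF measurable_compose[OF measurable_fst measurable_fst] measurable_components(1)] measurable_compose[OF measurable_snd measurable_components(2)]) auto
  define J where "J p y = (\<integral>\<^sup>+ys. thinned_route x n p ys T y \<partial>skel_leb n)" for p y
  have m2: "(\<lambda>q. J (fst q) (snd q)) \<in> borel_measurable (points_leb n \<Otimes>\<^sub>M lborel)"
    unfolding J_def by (rule Sn.borel_measurable_nn_integral) (use m3 in \<open>simp add: split_beta' del: One_nat_def\<close>)
  have m2': "(\<lambda>p. J p y) \<in> borel_measurable (points_leb n)" for y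
    using measurable_compose[OF measurable_Pair2'[of y lborel "points_leb n"] m2] by simp
  have "points_density T K n p * weighted_route x T n p ys y * ((\<Prod>i\<in>{1..n}. lid (snd (p i)) (ys i)) * indicator C y)
      = thinned_route x n p ys T y * w y" for p ys y
  proof -
    have "points_density T K n p * weighted_route x T n p ys y * ((\<Prod>i\<in>{1..n}. lid (snd (p i)) (ys i)) * indicator C y)
      = (points_density T K n p * (route x n p ys T y * (\<Prod>i\<in>{1..n}. lid (snd (p i)) (ys i)))) * (ennreal (exp (B y - B x) / Z) * indicator C y)"
      unfolding weighted_route_def Z_def by (simp only: ac_simps)
    also have "\<dots> = thinned_route x n p ys T y * ((ennreal (exp (- (T * K))) * ennreal (exp (B y - B x) / Z)) * indicator C y)"
      unfolding points_density_thinned[OF T] by (simp only: ac_simps)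
    also have "ennreal (exp (- (T * K))) * ennreal (exp (B y - B x) / Z) = ennreal (exp (- (T * K)) / Z) * ennreal (exp (B y - B x))"
      using Z by (simp add: ennreal_mult[symmetric])
    finally show ?thesis unfolding w_def by (simp only: ac_simps)
  qed
  then have "(\<integral>\<^sup>+q. points_density T K n (fst q) * weighted_route x T n (fst q) (fst (snd q)) (snd (snd q))
         * ((\<Prod>i\<in>{1..n}. lid (snd (fst q i)) (fst (snd q) i)) * indicator C (snd (snd q))) \<partial>round_leb n)
      = (\<integral>\<^sup>+q. thinned_route x n (fst q) (fst (snd q)) T (snd (snd q)) * w (snd (snd q)) \<partial>round_leb n)"
    by (simp only:)
  also have "\<dots> = (\<integral>\<^sup>+p. \<integral>\<^sup>+q. thinned_route x n p (fst q) T (snd q) * w (snd q) \<partial>(skel_leb n \<Otimes>\<^sub>M lborel) \<partial>points_leb n)"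
  proof -
    have "(\<lambda>q. thinned_route x n (fst q) (fst (snd q)) T (snd (snd q)) * w (snd (snd q))) \<in> borel_measurable (round_leb n)"
      by (intro borel_measurable_times_ennreal tm w1)
    from PS.nn_integral_fst[OF this] show ?thesis by (simp only: fst_conv snd_conv)
  qed
  also have "\<dots> = (\<integral>\<^sup>+p. \<integral>\<^sup>+y. J p y * w y \<partial>lborel \<partial>points_leb n)"
  proof (rule nn_integral_cong)
    fix p
    have "(\<lambda>q. thinned_route x n p (fst q) T (snd q) * w (snd q)) \<in> borel_measurable (skel_leb n \<Otimes>\<^sub>M lborel)"
      by (intro borel_measurable_times_ennreal tm2 w2)
    then have "(\<integral>\<^sup>+q. thinned_route x n p (fst q) T (snd q) * w (snd q) \<partial>(skel_leb n \<Otimes>\<^sub>M lborel))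
       = (\<integral>\<^sup>+y. \<integral>\<^sup>+ys. thinned_route x n p ys T y * w y \<partial>skel_leb n \<partial>lborel)"
      using SL.nn_integral_snd[of "\<lambda>q. thinned_route x n p (fst q) T (snd q) * w (snd q)"] by (simp only: fst_conv snd_conv)
    also have "\<dots> = (\<integral>\<^sup>+y. J p y * w y \<partial>lborel)"
      unfolding J_def by (intro nn_integral_cong nn_integral_multc tm1)
    finally show "(\<integral>\<^sup>+q. thinned_route x n p (fst q) T (snd q) * w (snd q) \<partial>(skel_leb n \<Otimes>\<^sub>M lborel)) = (\<integral>\<^sup>+y. J p y * w y \<partial>lborel)" .
  qed
  also have "\<dots> = (\<integral>\<^sup>+y. \<integral>\<^sup>+p. J p y * w y \<partial>points_leb n \<partial>lborel)"
  proof (rule PL.Fubini'[symmetric])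
    show "(\<lambda>(p, y). J p y * w y) \<in> borel_measurable (points_leb n \<Otimes>\<^sub>M lborel)"
      unfolding split_beta' by (intro borel_measurable_times_ennreal m2 w3)
  qed
  also have "\<dots> = (\<integral>\<^sup>+y. route_integral x n T y * w y \<partial>lborel)"
    unfolding route_integral_def J_def[symmetric] by (intro nn_integral_cong nn_integral_multc m2')
  also have "\<dots> = (\<integral>\<^sup>+y. ennreal (exp (- (T * K)) / Z) * (Rn \<theta> V x n T y * (ennreal (exp (B y - B x)) * indicator C y)) \<partial>lborel)"
    unfolding route_integral_eq w_def using T by (intro nn_integral_cong) (simp add: ac_simps)
  also have "\<dots> = ennreal (exp (- (T * K)) / Z) * (\<integral>\<^sup>+y. Rn \<theta> V x n T y * (ennreal (exp (B y - B x)) * indicator C y) \<partial>lborel)"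
    by (rule nn_integral_cmult) measurable
  finally show ?thesis unfolding Z_def .
qed

text \<open>The joint law of points, skeleton and end point on \<open>N \<omega> = n\<close> is
  identified as a density with respect to Lebesgue measure, and the indicator of acceptance is
  integrated against it.\<close>

lemma emeasure_accepted_round_n:
  assumes T: "0 < T" and m: "prob_space m" and sr: "sampling_round m b x T K N t z Y E" and C: "C \<in> sets (borel :: real measure)"
  shows "{\<omega> \<in> space m. N \<omega> = n \<and> (\<forall>i\<in>{1..n}. phi_tilde b (Y i \<omega>) \<le> z i \<omega>) \<and> E \<omega> \<in> C} \<in> sets m" (is "?A \<in> _")
    "emeasure m {\<omega> \<in> space m. N \<omega> = n \<and> (\<forall>i\<in>{1..n}. phi_tilde b (Y i \<omega>) \<le> z i \<omega>) \<and> E \<omega> \<in> C}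
    = ennreal (exp (- (T * K)) / normaliser x T) * (\<integral>\<^sup>+y. Rn \<theta> V x n T y * (ennreal (exp (B y - B x)) * indicator C y) \<partial>lborel)"
proof -
  interpret prob_space m by fact
  interpret S: product_sigma_finite "\<lambda>_. lborel :: real measure" by standard
  interpret Sn: sigma_finite_measure "skel_leb n" by (rule S.sigma_finite) simp
  interpret PS: sigma_finite_measure "skel_leb n \<Otimes>\<^sub>M (lborel :: real measure)" by (rule sigma_finite_pair_measure) unfold_locales
  interpret SL: pair_sigma_finite "skel_leb n" "lborel :: real measure" ..
  have r: "round_data N t z Y E \<in> measurable m round_space"
    and pp: "poisson_point_process m (restrict_space lborel ({0..T} \<times> {0..K})) (\<lambda>\<omega>. (\<lambda>i. (t i \<omega>, z i \<omega>)) ` {1..N \<omega>})"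
    and mono: "AE \<omega> in m. strict_mono_on {1..N \<omega>} (\<lambda>i. t i \<omega>)"
    using sr unfolding sampling_round_def by blast+
  have cond: "emeasure m {\<omega> \<in> space m. N \<omega> = n \<and> (\<lambda>i\<in>{1..n}. (t i \<omega>, z i \<omega>)) \<in> A \<and> ((\<lambda>i\<in>{1..n}. Y i \<omega>), E \<omega>) \<in> D} =
        (\<integral>\<^sup>+\<omega>. emeasure (skeleton_law b x T n (\<lambda>i. t i \<omega>)) D * indicator {\<omega> \<in> space m. N \<omega> = n \<and> (\<lambda>i\<in>{1..n}. (t i \<omega>, z i \<omega>)) \<in> A} \<omega> \<partial>m)"
    if "A \<in> sets (points_space n)" "D \<in> sets (skel_space n)" for A D
    using sr that unfolding sampling_round_def by blast
  define pt where "pt = points N t z Y n"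
  define sk where "sk = skel N t z Y n"
  define Nn where "Nn = {\<omega> \<in> space m. N \<omega> = n}"
  define PR where "PR \<omega> = (pt \<omega>, (sk \<omega>, E \<omega>))" for \<omega>
  note pl = poisson_points_law[OF m r pp mono less_imp_le[OF T] K_nonneg, of n, folded pt_def Nn_def]
  have ptm: "pt \<in> measurable m (points_space n)" and skm: "sk \<in> measurable m (\<Pi>\<^sub>M i\<in>{1..n}. borel)"
    unfolding pt_def sk_def by (rule points_measurable[OF r])+
  have Em: "E \<in> borel_measurable m" by (rule round_spaceD(2)[OF r])
  have Nnm: "Nn \<in> sets m" unfolding Nn_def using round_spaceD(1)[OF r] by measurable
  have sr_leb: "sets (round_leb n) = sets (points_space n \<Otimes>\<^sub>M skel_space n)"
    by (intro sets_pair_measure_cong sets_leb)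
  have PRm: "PR \<in> measurable m (round_leb n)"
    unfolding measurable_cong_sets[OF refl sr_leb] PR_def[abs_def] by (intro measurable_Pair ptm skm Em)
  let ?Mn = "density m (indicator Nn)"
  have toMn: "f \<in> measurable m M' \<Longrightarrow> f \<in> measurable ?Mn M'" for f and M' :: "'z measure"
    by (simp only: measurable_cong_sets[OF sets_density refl])
  have pdm: "points_density T K n \<in> borel_measurable (points_leb n)"
    using points_density_measurable[of T K n] by (simp only: measurable_cong_sets[OF sets_leb(1) refl])
  \<comment> \<open>Almost surely the times are strictly increasing and strictly inside the
    interval. The skeleton density factorises into kernels only for such points; the null set is
    dropped before \<open>emeasure_skeleton_law\<close> is used.\<close>
  have "AE p in density (points_leb n) (points_density T K n). p \<in> increasing_points n \<and> (\<forall>i\<in>{1..n}. fst (p i) \<in> {0<..<T})"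
  proof (subst AE_density[OF pdm], rule AE_I2, intro impI)
    fix p assume p: "0 < points_density T K n p"
    then have "p \<in> increasing_points n" by (rule contrapos_pp) (simp add: points_density_def)
    moreover have "p i \<in> {0<..<T} \<times> {0..K}" if "i \<in> {1..n}" for i
    proof (rule ccontr)
      assume "p i \<notin> {0<..<T} \<times> {0..K}"
      then have "(\<Prod>i\<in>{1..n}. indicator ({0<..<T} \<times> {0..K}) (p i) :: ennreal) = 0"
        using that by (intro prod_zero bexI[of _ i]) auto
      then show False using p unfolding points_density_def by (simp only: mult_zero_right less_irrefl)
    qed
    ultimately show "p \<in> increasing_points n \<and> (\<forall>i\<in>{1..n}. fst (p i) \<in> {0<..<T})"
      by (auto simp: mem_Times_iff simp del: One_nat_def)
  qed
  then have "AE p in distr ?Mn (points_space n) pt. p \<in> increasing_points n \<and> (\<forall>i\<in>{1..n}. fst (p i) \<in> {0<..<T})"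
    by (simp only: pl)
  then have "AE \<omega> in ?Mn. pt \<omega> \<in> increasing_points n \<and> (\<forall>i\<in>{1..n}. fst (pt \<omega> i) \<in> {0<..<T})"
    by (rule AE_distrD[OF toMn[OF ptm]])
  then have good: "AE \<omega> in m. 0 < (indicator Nn \<omega> :: ennreal) \<longrightarrow> pt \<omega> \<in> increasing_points n \<and> (\<forall>i\<in>{1..n}. fst (pt \<omega> i) \<in> {0<..<T})"
    by (subst (asm) AE_density) (use Nnm in simp_all)
  define h where "h D p = (\<integral>\<^sup>+q. weighted_route x T n p (fst q) (snd q) * indicator D q \<partial>(skel_leb n \<Otimes>\<^sub>M lborel))" for D p
  have fm: "(\<lambda>q. points_density T K n (fst q) * weighted_route x T n (fst q) (fst (snd q)) (snd (snd q))) \<in> borel_measurable (round_leb n)"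
    by (intro borel_measurable_times_ennreal measurable_compose[OF measurable_fst pdm] weighted_route_measurable)
  have im: "(\<lambda>q. indicator D (snd q) :: ennreal) \<in> borel_measurable (round_leb n)" if "D \<in> sets (skel_space n)" for D
    using that by (intro measurable_compose[OF measurable_snd] borel_measurable_indicator) (simp only: sets_leb)
  have wm: "(\<lambda>q. weighted_route x T n (fst q) (fst (snd q)) (snd (snd q)) * indicator D (snd q)) \<in> borel_measurable (round_leb n)" if "D \<in> sets (skel_space n)" for D
    by (intro borel_measurable_times_ennreal weighted_route_measurable im that)
  have hm: "h D \<in> borel_measurable (points_space n)" if "D \<in> sets (skel_space n)" for D
  proof -
    have "h D \<in> borel_measurable (points_leb n)" unfolding h_def
      by (rule PS.borel_measurable_nn_integral) (use wm[OF that] in \<open>simp only: split_beta'\<close>)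
    then show ?thesis by (simp only: measurable_cong_sets[OF sets_leb(1) refl])
  qed
  have rect: "emeasure m (Nn \<inter> (PR -` (A \<times> D) \<inter> space m)) = (\<integral>\<^sup>+q. points_density T K n (fst q) * weighted_route x T n (fst q) (fst (snd q)) (snd (snd q)) * indicator (A \<times> D) q \<partial>round_leb n)"
    if A: "A \<in> sets (points_space n)" and D: "D \<in> sets (skel_space n)" for A D
  proof -
    have "Nn \<inter> (PR -` (A \<times> D) \<inter> space m) = {\<omega> \<in> space m. N \<omega> = n \<and> (\<lambda>i\<in>{1..n}. (t i \<omega>, z i \<omega>)) \<in> A \<and> ((\<lambda>i\<in>{1..n}. Y i \<omega>), E \<omega>) \<in> D}"
    proof (intro set_eqI)
      fix \<omega>
      show "\<omega> \<in> Nn \<inter> (PR -` (A \<times> D) \<inter> space m) \<longleftrightarrow> \<omega> \<in> {\<omega> \<in> space m. N \<omega> = n \<and> (\<lambda>i\<in>{1..n}. (t i \<omega>, z i \<omega>)) \<in> A \<and> ((\<lambda>i\<in>{1..n}. Y i \<omega>), E \<omega>) \<in> D}"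
      proof (cases "N \<omega> = n")
        case True
        show ?thesis
          unfolding Nn_def PR_def pt_def sk_def Int_iff mem_Collect_eq vimage_eq points_eq[of N \<omega> n t z Y, OF True] skel_eq[of N \<omega> n t z Y, OF True]
            mem_Sigma_iff by blast
      qed (simp add: Nn_def)
    qed
    then have "emeasure m (Nn \<inter> (PR -` (A \<times> D) \<inter> space m)) = (\<integral>\<^sup>+\<omega>. emeasure (skeleton_law b x T n (\<lambda>i. t i \<omega>)) D * indicator {\<omega> \<in> space m. N \<omega> = n \<and> (\<lambda>i\<in>{1..n}. (t i \<omega>, z i \<omega>)) \<in> A} \<omega> \<partial>m)"
      using cond[OF A D] by (simp only:)
    also have "\<dots> = (\<integral>\<^sup>+\<omega>. indicator Nn \<omega> * (h D (pt \<omega>) * indicator A (pt \<omega>)) \<partial>m)"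
    proof (rule nn_integral_cong_AE)
     show "AE \<omega> in m. emeasure (skeleton_law b x T n (\<lambda>i. t i \<omega>)) D * indicator {\<omega> \<in> space m. N \<omega> = n \<and> (\<lambda>i\<in>{1..n}. (t i \<omega>, z i \<omega>)) \<in> A} \<omega>
       = indicator Nn \<omega> * (h D (pt \<omega>) * indicator A (pt \<omega>))"
      using good AE_space
     proof eventually_elim
      case (elim \<omega>)
      show ?case
      proof (cases "N \<omega> = n")
        case True
        then have p: "pt \<omega> = (\<lambda>i\<in>{1..n}. (t i \<omega>, z i \<omega>))" unfolding pt_def by (rule points_eq)
        have Nw: "\<omega> \<in> Nn" using True elim(2) by (simp add: Nn_def)
        then have "0 < (indicator Nn \<omega> :: ennreal)" by simp
        with elim(1) have g: "pt \<omega> \<in> increasing_points n" "\<And>i. i \<in> {1..n} \<Longrightarrow> fst (pt \<omega> i) \<in> {0<..<T}" by blast+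
        have ts: "t i \<omega> = fst (pt \<omega> i)" if "i \<in> {1..n}" for i unfolding p using that by (simp only: restrict_apply if_True fst_conv)
        have "emeasure (skeleton_law b x T n (\<lambda>i. t i \<omega>)) D = h D (pt \<omega>)"
          unfolding h_def by (rule emeasure_skeleton_law[OF T g ts D])
        moreover have "indicator {\<omega> \<in> space m. N \<omega> = n \<and> (\<lambda>i\<in>{1..n}. (t i \<omega>, z i \<omega>)) \<in> A} \<omega> = (indicator A (pt \<omega>) :: ennreal)"
          unfolding p using True elim(2) by (simp only: indicator_def mem_Collect_eq simp_thms)
        ultimately show ?thesis using Nw by simp
      qed (simp add: Nn_def)
     qed
    qed
    also have "\<dots> = (\<integral>\<^sup>+\<omega>. h D (pt \<omega>) * indicator A (pt \<omega>) \<partial>?Mn)"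
      by (rule nn_integral_density[symmetric])
        (intro borel_measurable_times_ennreal measurable_compose[OF ptm hm[OF D]] measurable_compose[OF ptm borel_measurable_indicator[OF A]] borel_measurable_indicator Nnm)+
    also have "\<dots> = (\<integral>\<^sup>+p. h D p * indicator A p \<partial>distr ?Mn (points_space n) pt)"
      by (rule nn_integral_distr[symmetric, OF toMn[OF ptm]], subst measurable_cong_sets[OF sets_distr refl])
        (intro borel_measurable_times_ennreal hm D borel_measurable_indicator A)
    also have "\<dots> = (\<integral>\<^sup>+p. points_density T K n p * (h D p * indicator A p) \<partial>points_leb n)"
      unfolding pl
    proof (rule nn_integral_density[OF pdm])
      have "(\<lambda>p. h D p * indicator A p) \<in> borel_measurable (points_space n)"
        by (intro borel_measurable_times_ennreal hm D borel_measurable_indicator A)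
      then show "(\<lambda>p. h D p * indicator A p) \<in> borel_measurable (points_leb n)"
        by (simp only: measurable_cong_sets[OF sets_leb(1) refl])
    qed
    also have "\<dots> = (\<integral>\<^sup>+p. \<integral>\<^sup>+q. points_density T K n p * weighted_route x T n p (fst q) (snd q) * indicator (A \<times> D) (p, q) \<partial>(skel_leb n \<Otimes>\<^sub>M lborel) \<partial>points_leb n)"
    proof (rule nn_integral_cong)
      fix p
      have "(\<lambda>q. weighted_route x T n p (fst q) (snd q) * indicator D q) \<in> borel_measurable (skel_leb n \<Otimes>\<^sub>M lborel)"
        by (intro borel_measurable_times_ennreal weighted_route_measurable_snd borel_measurable_indicator) (use D in \<open>simp only: sets_leb\<close>)
      then have "points_density T K n p * indicator A p * h D p = (\<integral>\<^sup>+q. points_density T K n p * indicator A p * (weighted_route x T n p (fst q) (snd q) * indicator D q) \<partial>(skel_leb n \<Otimes>\<^sub>M lborel))"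
        unfolding h_def by (rule nn_integral_cmult[symmetric])
      then show "points_density T K n p * (h D p * indicator A p) = (\<integral>\<^sup>+q. points_density T K n p * weighted_route x T n p (fst q) (snd q) * indicator (A \<times> D) (p, q) \<partial>(skel_leb n \<Otimes>\<^sub>M lborel))"
        by (simp only: indicator_times fst_conv snd_conv ac_simps)
    qed
    also have "\<dots> = (\<integral>\<^sup>+q. points_density T K n (fst q) * weighted_route x T n (fst q) (fst (snd q)) (snd (snd q)) * indicator (A \<times> D) q \<partial>round_leb n)"
    proof -
      have "A \<times> D \<in> sets (round_leb n)" unfolding sr_leb by (intro pair_measureI A D)
      then have "(\<lambda>q. points_density T K n (fst q) * weighted_route x T n (fst q) (fst (snd q)) (snd (snd q)) * indicator (A \<times> D) q) \<in> borel_measurable (round_leb n)"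
        by (intro borel_measurable_times_ennreal fm[THEN borel_measurable_times_ennreal] fm borel_measurable_indicator)
      from PS.nn_integral_fst[OF this] show ?thesis by (simp only: fst_conv snd_conv)
    qed
    finally show ?thesis .
  qed
  \<comment> \<open>The sampling hypothesis prescribes the conditional law on rectangles
    \<open>A \<times> D\<close>. These are stable under intersection and generate the product
    sigma-algebra, which determines the joint law.\<close>
  have law: "distr ?Mn (round_leb n) PR = density (round_leb n) (\<lambda>q. points_density T K n (fst q) * weighted_route x T n (fst q) (fst (snd q)) (snd (snd q)))"
    (is "?l = ?d")
  proof (rule measure_eqI_generator_eq[where E="{A \<times> D |A D. A \<in> sets (points_space n) \<and> D \<in> sets (skel_space n)}" and \<Omega>="space (points_space n) \<times> space (skel_space n)" and A="\<lambda>_. space (points_space n) \<times> space (skel_space n)"])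
    show "Int_stable {A \<times> D |A D. A \<in> sets (points_space n) \<and> D \<in> sets (skel_space n)}"
      by (rule Int_stable_pair_measure_generator)
    show "{A \<times> D |A D. A \<in> sets (points_space n) \<and> D \<in> sets (skel_space n)} \<subseteq> Pow (space (points_space n) \<times> space (skel_space n))"
      by (rule pair_measure_closed)
    show "sets ?l = sigma_sets (space (points_space n) \<times> space (skel_space n)) {A \<times> D |A D. A \<in> sets (points_space n) \<and> D \<in> sets (skel_space n)}"
      "sets ?d = sigma_sets (space (points_space n) \<times> space (skel_space n)) {A \<times> D |A D. A \<in> sets (points_space n) \<and> D \<in> sets (skel_space n)}"
      unfolding sets_distr sets_density sr_leb by (rule sets_pair_measure)+
    have eml: "emeasure ?l S = emeasure m (Nn \<inter> (PR -` S \<inter> space m))" if "S \<in> sets (round_leb n)" for S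
      by (simp only: emeasure_distr[OF toMn[OF PRm] that] space_density emeasure_restricted[OF Nnm measurable_sets[OF PRm that]])
    show "emeasure ?l S = emeasure ?d S" if S: "S \<in> {A \<times> D |A D. A \<in> sets (points_space n) \<and> D \<in> sets (skel_space n)}" for S
    proof -
      obtain A D where AD: "A \<in> sets (points_space n)" "D \<in> sets (skel_space n)" "S = A \<times> D" using S by blast
      have Sm: "S \<in> sets (round_leb n)" unfolding sr_leb AD(3) by (intro pair_measureI AD)
      show ?thesis unfolding eml[OF Sm] emeasure_density[OF fm Sm] unfolding AD(3) by (rule rect[OF AD(1,2)])
    qed
    show "range (\<lambda>_. space (points_space n) \<times> space (skel_space n)) \<subseteq> {A \<times> D |A D. A \<in> sets (points_space n) \<and> D \<in> sets (skel_space n)}"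
      by blast
    have "space (points_space n) \<times> space (skel_space n) \<in> sets (round_leb n)" unfolding sr_leb by (intro pair_measureI sets.top)
    from eml[OF this] show "emeasure ?l (space (points_space n) \<times> space (skel_space n)) \<noteq> \<infinity>"
      by (simp only: emeasure_eq_measure) simp
  qed simp
  \<comment> \<open>The acceptance indicator as a function of the recorded data. It also demands
    marks at most \<open>K\<close>, which holds on the whole space since the points lie in the
    rectangle.\<close>
  define g where "g q = (\<Prod>i\<in>{1..n}. lid (snd (fst q i)) (fst (snd q) i)) * (indicator C (snd (snd q)) :: ennreal)" for q :: "(nat \<Rightarrow> real \<times> real) \<times> (nat \<Rightarrow> real) \<times> real"
  have snd: "snd \<in> borel_measurable (borel :: (real \<times> real) measure)"
    by (intro borel_measurable_continuous_onI continuous_intros)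
  have Cm: "(\<lambda>q. indicator C (snd (snd q)) :: ennreal) \<in> borel_measurable (round_leb n)"
    by (intro measurable_compose[OF measurable_compose[OF measurable_snd measurable_snd]] borel_measurable_indicator) (use C in simp)
  have gm: "g \<in> borel_measurable (round_leb n)"
    unfolding g_def[abs_def]
    by (intro borel_measurable_times_ennreal borel_measurable_prod_ennreal borel_measurable_lid Cm
        measurable_compose[OF measurable_compose[OF measurable_fst measurable_components(1)] snd]
        measurable_compose[OF measurable_compose[OF measurable_snd measurable_fst] measurable_components(2)])
  have ind: "indicator ?A \<omega> = indicator Nn \<omega> * g (PR \<omega>)" if w: "\<omega> \<in> space m" for \<omega>
  proof (cases "N \<omega> = n")
    case True
    then have p: "pt \<omega> = (\<lambda>i\<in>{1..n}. (t i \<omega>, z i \<omega>))" "sk \<omega> = (\<lambda>i\<in>{1..n}. Y i \<omega>)"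
      unfolding pt_def sk_def by (rule points_eq skel_eq)+
    have zK: "z i \<omega> \<le> K" if "i \<in> {1..n}" for i
    proof -
      have "(\<lambda>i. (t i \<omega>, z i \<omega>)) ` {1..N \<omega>} \<subseteq> space (restrict_space lborel ({0..T} \<times> {0..K}))"
        using pp w unfolding poisson_point_process_def by blast
      then have "(t i \<omega>, z i \<omega>) \<in> space (restrict_space lborel ({0..T} \<times> {0..K}))" using that True by blast
      then show ?thesis by (simp add: space_restrict_space)
    qed
    have "(\<Prod>i\<in>{1..n}. lid (snd (pt \<omega> i)) (sk \<omega> i) :: ennreal) = (if \<forall>i\<in>{1..n}. phi_tilde b (Y i \<omega>) \<le> z i \<omega> then 1 else 0)"
    proof (cases "\<forall>i\<in>{1..n}. phi_tilde b (Y i \<omega>) \<le> z i \<omega>")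
      case True
      then show ?thesis using zK by (auto simp: p lid_def intro!: prod.neutral)
    next
      case False
      then obtain i where i: "i \<in> {1..n}" "\<not> phi_tilde b (Y i \<omega>) \<le> z i \<omega>" by blast
      have "lid (snd (pt \<omega> i)) (sk \<omega> i) = (0 :: ennreal)" using i by (simp add: p lid_def)
      then have "(\<Prod>i\<in>{1..n}. lid (snd (pt \<omega> i)) (sk \<omega> i) :: ennreal) = 0"
        using i(1) by (intro prod_zero bexI[of _ i]) auto
      then show ?thesis unfolding if_not_P[OF False] .
    qed
    then show ?thesis using True w by (auto simp: g_def PR_def Nn_def indicator_def)
  qed (simp add: Nn_def)
  have gPR: "(\<lambda>\<omega>. g (PR \<omega>)) \<in> borel_measurable m" by (rule measurable_compose[OF PRm gm])
  show Am: "?A \<in> sets m"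
  proof -
    have "(\<lambda>\<omega>. indicator Nn \<omega> * g (PR \<omega>)) \<in> borel_measurable m"
      by (intro borel_measurable_times_ennreal gPR borel_measurable_indicator Nnm)
    then have "(\<lambda>\<omega>. indicator Nn \<omega> * g (PR \<omega>)) -` {1} \<inter> space m \<in> sets m" by (rule measurable_sets) simp
    also have "(\<lambda>\<omega>. indicator Nn \<omega> * g (PR \<omega>)) -` {1} \<inter> space m = ?A"
    proof (intro set_eqI)
      fix \<omega>
      show "\<omega> \<in> (\<lambda>\<omega>. indicator Nn \<omega> * g (PR \<omega>)) -` {1} \<inter> space m \<longleftrightarrow> \<omega> \<in> ?A"
      proof (cases "\<omega> \<in> space m")
        case True
        then show ?thesis unfolding Int_iff vimage_eq ind[OF True, symmetric] by (auto simp: indicator_def)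
      qed simp
    qed
    finally show ?thesis .
  qed
  have "emeasure m ?A = (\<integral>\<^sup>+\<omega>. indicator ?A \<omega> \<partial>m)" using Am by (rule nn_integral_indicator[symmetric])
  also have "\<dots> = (\<integral>\<^sup>+\<omega>. indicator Nn \<omega> * g (PR \<omega>) \<partial>m)" by (intro nn_integral_cong ind)
  also have "\<dots> = (\<integral>\<^sup>+\<omega>. g (PR \<omega>) \<partial>?Mn)" by (rule nn_integral_density[symmetric]) (use Nnm gPR in simp_all)
  also have "\<dots> = (\<integral>\<^sup>+q. g q \<partial>distr ?Mn (round_leb n) PR)" by (rule nn_integral_distr[symmetric, OF toMn[OF PRm]], subst measurable_cong_sets[OF sets_distr refl], rule gm)
  also have "\<dots> = (\<integral>\<^sup>+q. points_density T K n (fst q) * weighted_route x T n (fst q) (fst (snd q)) (snd (snd q)) * g q \<partial>round_leb n)"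
    unfolding law by (rule nn_integral_density[OF fm gm])
  finally show "emeasure m ?A = ennreal (exp (- (T * K)) / normaliser x T) * (\<integral>\<^sup>+y. Rn \<theta> V x n T y * (ennreal (exp (B y - B x)) * indicator C y) \<partial>lborel)"
    unfolding g_def accepted_integral[OF T C] .
qed

end

section \<open>Rejection sampling\<close>

text \<open>Decompose by the index \<open>k\<close> of the first round in \<open>G\<close>:
  independence gives probability \<open>(1 - p)^k * (p * measure \<mu> C)\<close>, and the geometric
  sum is \<open>measure \<mu> C\<close>. So it is enough to know the law of an accepted round up to
  the constant \<open>p\<close>. With \<open>C = UNIV\<close> the same sum shows that acceptance
  occurs almost surely.\<close>

lemma rejection_sampling:
  fixes D :: "nat \<Rightarrow> 'a \<Rightarrow> 'd" and f :: "'d \<Rightarrow> real" and \<mu> :: "real measure"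
  assumes m: "prob_space m" and iv: "prob_space.indep_vars m (\<lambda>_. R) D UNIV"
    and G [measurable]: "G \<in> sets R" and f [measurable]: "f \<in> borel_measurable R"
    and \<mu>: "prob_space \<mu>" "sets \<mu> = sets borel" and p: "0 < p"
    and law: "\<And>k C. C \<in> sets borel \<Longrightarrow> emeasure m {\<omega> \<in> space m. D k \<omega> \<in> G \<and> f (D k \<omega>) \<in> C} = ennreal p * emeasure \<mu> C"
  shows "AE \<omega> in m. \<exists>k. D k \<omega> \<in> G"
    and "(\<lambda>\<omega>. f (D (LEAST k. D k \<omega> \<in> G) \<omega>)) \<in> borel_measurable m"
    and "distr m borel (\<lambda>\<omega>. f (D (LEAST k. D k \<omega> \<in> G) \<omega>)) = \<mu>"
proof -
  interpret prob_space m by fact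
  interpret \<mu>: prob_space \<mu> by fact
  have Dm [measurable]: "D k \<in> measurable m R" for k using iv unfolding indep_vars_def by blast
  have pr: "prob {\<omega> \<in> space m. D k \<omega> \<in> G \<and> f (D k \<omega>) \<in> C} = p * measure \<mu> C" if "C \<in> sets borel" for k C
    using law[OF that, of k] p by (simp add: emeasure_eq_measure \<mu>.emeasure_eq_measure ennreal_mult[symmetric])
  have acc: "prob (D k -` G \<inter> space m) = p" for k
  proof -
    have "D k -` G \<inter> space m = {\<omega> \<in> space m. D k \<omega> \<in> G \<and> f (D k \<omega>) \<in> UNIV}" by auto
    moreover have "measure \<mu> UNIV = 1" using \<mu>.prob_space sets_eq_imp_space_eq[OF \<mu>(2)] by simp
    ultimately show ?thesis using pr[of UNIV k] by simp
  qed
  have p1: "p \<le> 1" unfolding acc[of 0, symmetric] by (rule prob_le_1)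
  define A where "A k C = {\<omega> \<in> space m. (\<forall>j<k. D j \<omega> \<notin> G) \<and> D k \<omega> \<in> G \<and> f (D k \<omega>) \<in> C}" for k C
  have Am [measurable]: "A k C \<in> sets m" if [measurable]: "C \<in> sets borel" for k C
    unfolding A_def by measurable
  have pA: "prob (A k C) = (1 - p) ^ k * (p * measure \<mu> C)" if C [measurable]: "C \<in> sets borel" for k C
  proof -
    \<comment> \<open>One set per round, rejection before \<open>k\<close> and acceptance with value
      in \<open>C\<close> at \<open>k\<close>, which brings the event into the product form required
      by independence.\<close>
    define S where "S j = (if j < k then space R - G else G \<inter> (f -` C \<inter> space R))" for j
    have Sm: "S j \<in> sets R" for j unfolding S_def by (simp add: measurable_sets[OF f C])
    have sp: "D j \<omega> \<in> space R" if "\<omega> \<in> space m" for j \<omega> using measurable_space[OF Dm that] .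
    have "A k C = (\<Inter>j\<in>{..k}. D j -` S j \<inter> space m)"
    proof (intro set_eqI iffI)
      fix \<omega> assume w: "\<omega> \<in> A k C"
      then show "\<omega> \<in> (\<Inter>j\<in>{..k}. D j -` S j \<inter> space m)"
        using sp[of \<omega>] by (auto simp: A_def S_def le_less)
    next
      fix \<omega> assume w: "\<omega> \<in> (\<Inter>j\<in>{..k}. D j -` S j \<inter> space m)"
      then have "D j \<omega> \<in> S j" if "j \<le> k" for j using that by auto
      from this[of k] this[OF less_imp_le] w show "\<omega> \<in> A k C" by (auto simp: A_def S_def)
    qed
    then have "prob (A k C) = (\<Prod>j\<in>{..k}. prob (D j -` S j \<inter> space m))"
      using indep_varsD[OF iv, of "{..k}" S] Sm by simp
    also have "\<dots> = (\<Prod>j<k. prob (D j -` S j \<inter> space m)) * prob (D k -` S k \<inter> space m)"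
      by (simp add: lessThan_Suc_atMost[symmetric])
    also have "(\<Prod>j<k. prob (D j -` S j \<inter> space m)) = (\<Prod>j<k. 1 - p)"
    proof (rule prod.cong[OF refl])
      fix j assume "j \<in> {..<k}"
      then have "D j -` S j \<inter> space m = space m - (D j -` G \<inter> space m)" using sp[of _ j] by (auto simp: S_def)
      then show "prob (D j -` S j \<inter> space m) = 1 - p"
        using prob_compl[OF measurable_sets[OF Dm G], of j] acc[of j] by simp
    qed
    also have "D k -` S k \<inter> space m = {\<omega> \<in> space m. D k \<omega> \<in> G \<and> f (D k \<omega>) \<in> C}"
      using sp[of _ k] by (auto simp: S_def)
    finally show ?thesis using pr[OF C, of k] by simp
  qed
  have disj: "disjoint_family (\<lambda>k. A k C)" for C
  proof -
    have "A i C \<inter> A j C = {}" if "i < j" for i j using that by (auto simp: A_def)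
    then show ?thesis unfolding disjoint_family_on_def by (metis Int_commute linorder_neqE_nat)
  qed
  have geo: "(\<Sum>k. emeasure m (A k C)) = emeasure \<mu> C" if C: "C \<in> sets borel" for C
  proof -
    have "(\<lambda>k. (1 - p) ^ k) sums (1 / (1 - (1 - p)))" using p p1 by (intro geometric_sums) auto
    then have "(\<lambda>k. (1 - p) ^ k * (p * measure \<mu> C)) sums (1 / (1 - (1 - p)) * (p * measure \<mu> C))" by (rule sums_mult2)
    then have "(\<lambda>k. prob (A k C)) sums measure \<mu> C" using p by (simp add: pA[OF C])
    then show ?thesis
      unfolding emeasure_eq_measure \<mu>.emeasure_eq_measure by (intro suminf_ennreal_eq) auto
  qed
  have all: "emeasure m (\<Union>k. A k C) = emeasure \<mu> C" if C: "C \<in> sets borel" for C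
  proof -
    have "(\<Sum>k. emeasure m (A k C)) = emeasure m (\<Union>k. A k C)"
      by (rule suminf_emeasure) (use Am[OF C] disj in auto)
    then show ?thesis by (simp add: geo[OF C])
  qed
  have "emeasure m (\<Union>k. A k UNIV) = 1"
    using all[of UNIV] \<mu>.emeasure_space_1 sets_eq_imp_space_eq[OF \<mu>(2)] by simp
  then have "AE \<omega> in m. \<omega> \<in> (\<Union>k. A k UNIV)"
    by (intro AE_prob_1) (simp add: emeasure_eq_measure)
  then show ex: "AE \<omega> in m. \<exists>k. D k \<omega> \<in> G" by eventually_elim (auto simp: A_def)
  define out where "out \<omega> = f (D (LEAST k. D k \<omega> \<in> G) \<omega>)" for \<omega>
  have "(\<lambda>\<omega>. LEAST k. D k \<omega> \<in> G) \<in> measurable m (count_space UNIV)"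
    by (rule measurable_Least) measurable
  then have outm: "out \<in> borel_measurable m" unfolding out_def[abs_def]
    by (rule measurable_compose_countable[where f="\<lambda>k \<omega>. f (D k \<omega>)", OF measurable_compose[OF Dm f]])
  then show "(\<lambda>\<omega>. f (D (LEAST k. D k \<omega> \<in> G) \<omega>)) \<in> borel_measurable m" unfolding out_def[abs_def] .
  have "distr m borel out = \<mu>"
  proof (rule measure_eqI)
    show "sets (distr m borel out) = sets \<mu>" by (simp add: \<mu>)
    fix C assume "C \<in> sets (distr m borel out)"
    then have C: "C \<in> sets borel" by simp
    have "emeasure (distr m borel out) C = emeasure m (out -` C \<inter> space m)" by (rule emeasure_distr[OF outm C])
    also have "\<dots> = emeasure m (\<Union>k. A k C)"
    proof (rule emeasure_eq_AE)
      show "out -` C \<inter> space m \<in> sets m" using outm C by (rule measurable_sets)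
      show "(\<Union>k. A k C) \<in> sets m" using Am[OF C] by auto
      show "AE \<omega> in m. \<omega> \<in> out -` C \<inter> space m \<longleftrightarrow> \<omega> \<in> (\<Union>k. A k C)"
        using ex AE_space
      proof eventually_elim
        case (elim \<omega>)
        define k where "k = (LEAST k. D k \<omega> \<in> G)"
        have k: "D k \<omega> \<in> G" "\<And>j. j < k \<Longrightarrow> D j \<omega> \<notin> G"
          unfolding k_def using elim(1) by (auto intro: LeastI_ex dest: not_less_Least)
        have "i = k" if "\<omega> \<in> A i C" for i
        proof (rule linorder_cases[of i k])
          assume "i < k"
          then show ?thesis using k(2)[of i] that by (simp add: A_def)
        next
          assume "k < i"
          then show ?thesis using k(1) that by (simp add: A_def)
        qed
        then have "\<omega> \<in> (\<Union>k. A k C) \<longleftrightarrow> \<omega> \<in> A k C" by blast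
        also have "\<dots> \<longleftrightarrow> out \<omega> \<in> C" using k elim(2) by (auto simp: A_def out_def k_def[symmetric])
        finally show ?case using elim(2) by auto
      qed
    qed
    finally show "emeasure (distr m borel out) C = emeasure \<mu> C" by (simp add: all[OF C])
  qed
  then show "distr m borel (\<lambda>\<omega>. f (D (LEAST k. D k \<omega> \<in> G) \<omega>)) = \<mu>" unfolding out_def[abs_def] .
qed

section \<open>From a single round to the output of the algorithm\<close>

context drift_sde
begin

text \<open>Summing over the number of points matches \<open>law_series\<close> term by term. Since
  \<open>c - K\<close> is the infimum of \<open>phi\<close>, the constant is
  \<open>exp (T * inf phi)\<close> divided by the normaliser; with \<open>C = UNIV\<close> it is the
  acceptance probability of a round.\<close>

lemma emeasure_accepted_round:
  assumes m: "prob_space m" and sr: "sampling_round m b x T K N t z Y E" and C: "C \<in> sets (borel :: real measure)"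
  shows "emeasure m {\<omega> \<in> space m. (\<forall>i\<in>{1..N \<omega>}. phi_tilde b (Y i \<omega>) \<le> z i \<omega>) \<and> E \<omega> \<in> C}
    = ennreal (exp (c * T - T * K) / normaliser x T) * emeasure (distr P borel (X T)) C"
proof -
  note [measurable] = B_measurable V_measurable C
  define A where "A n = {\<omega> \<in> space m. N \<omega> = n \<and> (\<forall>i\<in>{1..n}. phi_tilde b (Y i \<omega>) \<le> z i \<omega>) \<and> E \<omega> \<in> C}" for n
  define I where "I n = (\<integral>\<^sup>+y. Rn \<theta> V x n T y * (ennreal (exp (B y - B x - c * T)) * indicator C y) \<partial>lborel)" for n
  define Z where "Z = normaliser x T"
  have Z: "0 < Z" unfolding Z_def by (rule normaliser_pos[OF T])
  have Am: "A n \<in> sets m" for n unfolding A_def by (rule emeasure_accepted_round_n(1)[OF T m sr C])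
  have An: "emeasure m (A n) = ennreal (exp (c * T - T * K) / Z) * I n" for n
  proof -
    have "ennreal (exp (B y - B x)) = ennreal (exp (c * T)) * ennreal (exp (B y - B x - c * T))" for y
      by (simp add: ennreal_mult[symmetric] exp_add[symmetric])
    then have "(\<integral>\<^sup>+y. Rn \<theta> V x n T y * (ennreal (exp (B y - B x)) * indicator C y) \<partial>lborel)
      = (\<integral>\<^sup>+y. ennreal (exp (c * T)) * (Rn \<theta> V x n T y * (ennreal (exp (B y - B x - c * T)) * indicator C y)) \<partial>lborel)"
      by (simp only: ac_simps)
    also have "\<dots> = ennreal (exp (c * T)) * I n" unfolding I_def by (rule nn_integral_cmult) measurable
    finally have "emeasure m (A n) = ennreal (exp (- (T * K)) / Z) * (ennreal (exp (c * T)) * I n)"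
      unfolding A_def emeasure_accepted_round_n(2)[OF T m sr C] Z_def by (simp only:)
    moreover have "ennreal (exp (- (T * K)) / Z) * ennreal (exp (c * T)) = ennreal (exp (c * T - T * K) / Z)"
      using Z by (simp add: ennreal_mult[symmetric] exp_diff exp_minus field_simps)
    ultimately show ?thesis by (simp only: mult.assoc[symmetric])
  qed
  have "{\<omega> \<in> space m. (\<forall>i\<in>{1..N \<omega>}. phi_tilde b (Y i \<omega>) \<le> z i \<omega>) \<and> E \<omega> \<in> C} = (\<Union>n. A n)"
    unfolding A_def by blast
  moreover have "emeasure m (\<Union>n. A n) = (\<Sum>n. emeasure m (A n))"
    by (rule suminf_emeasure[symmetric]) (use Am in \<open>auto simp: A_def disjoint_family_on_def\<close>)
  moreover have "(\<Sum>n. emeasure m (A n)) = ennreal (exp (c * T - T * K) / Z) * (\<Sum>n. I n)"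
    unfolding An by (rule ennreal_suminf_cmult)
  moreover have "(\<Sum>n. I n) = emeasure (distr P borel (X T)) C"
    unfolding I_def by (rule law_series[OF C, symmetric])
  ultimately show ?thesis unfolding Z_def by (simp only:)
qed

end

text \<open>The range of the quantifier depends on the data. It is rewritten as a countable
  conjunction over all indices of implications with measurable premise and conclusion.\<close>

lemma accepting_data_measurable:
  assumes g [measurable]: "g \<in> borel_measurable borel"
  shows "{r \<in> space round_space. \<forall>i\<in>{1..fst r}. g (snd (snd (fst (snd r) i))) \<le> fst (snd (fst (snd r) i))} \<in> sets round_space"
proof -
  have cm: "(\<lambda>r. fst (snd r) i) \<in> measurable round_space (borel \<Otimes>\<^sub>M (borel \<Otimes>\<^sub>M borel))" for i
    unfolding round_space_def borel_prod
    by (rule measurable_compose[OF measurable_compose[OF measurable_snd measurable_fst] measurable_component_singleton[of i UNIV "\<lambda>_. borel"]]) simp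
  have nm: "fst \<in> measurable round_space (count_space UNIV)" unfolding round_space_def by (rule measurable_fst)
  have le: "{r \<in> space round_space. g (snd (snd (fst (snd r) i))) \<le> fst (snd (fst (snd r) i))} \<in> sets round_space" for i
    by (rule borel_measurable_le) (use cm[of i] in measurable)
  have idx: "{r \<in> space round_space. i \<in> {1..fst r}} \<in> sets round_space" for i
    using measurable_sets[OF nm, of "{n. i \<in> {1..n}}"] by (simp add: vimage_def Int_def conj_commute)
  have "{r \<in> space round_space. i \<in> {1..fst r} \<longrightarrow> g (snd (snd (fst (snd r) i))) \<le> fst (snd (fst (snd r) i))} \<in> sets round_space" for i
    by (intro sets.sets_Collect_imp le idx)
  then have "{r \<in> space round_space. \<forall>i. i \<in> {1..fst r} \<longrightarrow> g (snd (snd (fst (snd r) i))) \<le> fst (snd (fst (snd r) i))} \<in> sets round_space"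
    by (rule sets.sets_Collect_countable_All)
  then show ?thesis by (simp only: Ball_def)
qed

theorem mainTheorem4:
  fixes b :: "real \<Rightarrow> real" and x T K :: real
    and M :: "'a measure"
    and N :: "nat \<Rightarrow> 'a \<Rightarrow> nat"
    and t z Y :: "nat \<Rightarrow> nat \<Rightarrow> 'a \<Rightarrow> real"
    and E :: "nat \<Rightarrow> 'a \<Rightarrow> real"
    and P :: "'b measure"
    and F :: "real \<Rightarrow> 'b measure"
    and W X :: "real \<Rightarrow> 'b \<Rightarrow> real"
  assumes "0 < T"
    and "admissible_drift b"
    and "0 < K" and "\<And>y. phi_tilde b y \<le> K"
    and "rejection_rounds M b x T K N t z Y E"
    and "sde_solution P F T b x W X"
  shows "(AE \<omega> in M. \<exists>k. accepted b N z Y \<omega> k) \<and>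
         algorithm_output b N z Y E \<in> borel_measurable M \<and>
         distr M borel (algorithm_output b N z Y E) = distr P borel (X T)"
proof -
  obtain Mb where Mb: "\<And>y. \<bar>b y\<bar> \<le> Mb"
    using assms(2) unfolding admissible_drift_def bounded_iff by auto
  interpret d: drift b K Mb by (intro drift.intro assms(2,4) Mb)
  interpret s: sde P F T b x W X Mb
    by (intro sde.intro assms(1,6) Mb d.b_measurable)
  interpret drift_sde b K Mb P F T x W X ..
  define D where "D k = round_data (N k) (t k) (z k) (Y k) (E k)" for k
  define G where "G = {r \<in> space round_space. \<forall>i\<in>{1..fst r}. phi_tilde b (snd (snd (fst (snd r) i))) \<le> fst (snd (fst (snd r) i))}"
  \<comment> \<open>The acceptance probability of one round, read off from
    \<open>emeasure_accepted_round\<close>. It is positive because the normaliser is, and it is the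
    same for all rounds.\<close>
  define p where "p = exp (d.c * T - T * K) / d.normaliser x T"
  have p: "0 < p" unfolding p_def using d.normaliser_pos[OF assms(1), of x] by simp
  have m: "prob_space M" and sr: "sampling_round M b x T K (N k) (t k) (z k) (Y k) (E k)" for k
    using assms(5) unfolding rejection_rounds_def by blast+
  have iv: "prob_space.indep_vars M (\<lambda>_. round_space) D UNIV"
    using assms(5) unfolding rejection_rounds_def D_def[abs_def] by blast
  have Dm: "D k \<in> measurable M round_space" for k
    using sr unfolding sampling_round_def D_def by blast
  have DG: "D k \<omega> \<in> G \<longleftrightarrow> accepted b N z Y \<omega> k" if "\<omega> \<in> space M" for k \<omega>
    using measurable_space[OF Dm that, of k] by (auto simp: G_def D_def round_data_def accepted_def)
  have fD: "snd (snd (D k \<omega>)) = E k \<omega>" for k \<omega> by (simp add: D_def round_data_def)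
  have Gm: "G \<in> sets round_space"
    unfolding G_def by (rule accepting_data_measurable[OF d.phi_tilde_measurable])
  have fm: "(\<lambda>r. snd (snd r)) \<in> borel_measurable round_space"
    unfolding round_space_def by (rule measurable_compose[OF measurable_snd measurable_snd])
  have Pp: "prob_space P" using assms(6) by (simp add: sde_solution_def brownian_motion_def)
  have XT: "X T \<in> borel_measurable P"
    by (rule measurable_from_subalg[OF s.F_sub s.X_measurable]) (use assms(1) in auto)
  have law: "emeasure M {\<omega> \<in> space M. D k \<omega> \<in> G \<and> snd (snd (D k \<omega>)) \<in> C} = ennreal p * emeasure (distr P borel (X T)) C" if "C \<in> sets borel" for k C
  proof -
    have "{\<omega> \<in> space M. D k \<omega> \<in> G \<and> snd (snd (D k \<omega>)) \<in> C} = {\<omega> \<in> space M. (\<forall>i\<in>{1..N k \<omega>}. phi_tilde b (Y k i \<omega>) \<le> z k i \<omega>) \<and> E k \<omega> \<in> C}"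
      using DG unfolding fD accepted_def by blast
    then show ?thesis unfolding p_def using emeasure_accepted_round[OF m sr that] by (simp only:)
  qed
  note rs = rejection_sampling[OF m iv Gm fm prob_space.prob_space_distr[OF Pp XT] sets_distr p]
  have rs1: "AE \<omega> in M. \<exists>k. D k \<omega> \<in> G"
    and rs2: "(\<lambda>\<omega>. snd (snd (D (LEAST k. D k \<omega> \<in> G) \<omega>))) \<in> borel_measurable M"
    and rs3: "distr M borel (\<lambda>\<omega>. snd (snd (D (LEAST k. D k \<omega> \<in> G) \<omega>))) = distr P borel (X T)"
    by (rule rs, erule law)+
  have out: "snd (snd (D (LEAST k. D k \<omega> \<in> G) \<omega>)) = algorithm_output b N z Y E \<omega>" if "\<omega> \<in> space M" for \<omega>
    unfolding fD algorithm_output_def using DG[OF that] by simp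
  have "AE \<omega> in M. \<exists>k. accepted b N z Y \<omega> k"
    using rs1 AE_space by eventually_elim (use DG in blast)
  moreover have "algorithm_output b N z Y E \<in> borel_measurable M"
    using rs2 by (subst (asm) measurable_cong[OF out])
  moreover have "distr M borel (algorithm_output b N z Y E) = distr P borel (X T)"
    unfolding rs3[symmetric] by (rule distr_cong[OF refl refl out[symmetric]])
  ultimately show ?thesis by blast
qed

end
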